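(* Let $X$ be a (reduced, irreducible) smooth projective curve over an algebraically closed field $k$ of characteristic $p \ge 0$, and let $\varphi: X \to \mathbb{P}^2$ be a morphism that is birational onto its image, with $\deg \varphi(X) \ge 4$. Let $P_1, P_2 \in X$ be such that $\varphi(P_1)$ and $\varphi(P_2) \in \varphi(X) \subset \mathbb{P}^2$ are different inner Galois points for $\varphi(X)$, let $\sigma \in G_{\varphi(P_1)}$, and put $P_3=\sigma(P_2)$. Then there exists a linear transformation $\tilde{\sigma}$ of $\mathbb{P}^2$ such that $\varphi^{-1}\circ\tilde{\sigma}\circ\varphi=\sigma$ if and only if the following three conditions are satisfied: (a) $\sigma(P_1)=P_1$; (b) $\varphi(P_3)$ is an inner Galois point for $\varphi(X)$; and (c) $\sigma^*\bigl(P_3+\sum_{\gamma \in G_{\varphi(P_3)}}\gamma(P_3)\bigr)=P_2+\sum_{\tau \in G_{\varphi(P_2)}}\tau(P_2)$ as divisors on $X$.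
   Context: A point $P \in \mathbb{P}^2$ is called a Galois point for $\varphi(X)$ if the extension of function fields $k(\varphi(X))/\pi_P^*k(\mathbb{P}^1)$ induced by the projection $\pi_P: \varphi(X) \dashrightarrow \mathbb{P}^1$ from $P$ is a Galois extension. A Galois point $P$ is inner if $P \in \varphi(X)\setminus \mathrm{Sing}(\varphi(X))$. For a Galois point $P$, $G_P$ denotes the Galois group of this extension, regarded via $k(X)=k(\varphi(X))$ as a subgroup of $\mathrm{Aut}(X)$. Sums $\sum_{\gamma\in G}\gamma(P)$ are divisors on $X$ (points counted with multiplicity), and $\sigma^*$ is pullback of divisors under $\sigma: X\to X$. Condition (c) presupposes (b), so that $G_{\varphi(P_3)}$ is defined. A linear transformation of $\mathbb{P}^2$ is an element of $\mathrm{PGL}(3,k)$; the equality $\varphi^{-1}\circ\tilde{\sigma}\circ\varphi=\sigma$ (with $\varphi^{-1}$ the birational inverse $\varphi(X)\dashrightarrow X$) means that $\tilde\sigma$ preserves $\varphi(X)$ and $\tilde\sigma\circ\varphi=\varphi\circ\sigma$. *)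

theory Defs
  imports
    "HOL-Analysis.Analysis"
    "HOL-Library.Poly_Mapping"
    "HOL-Computational_Algebra.Polynomial"
    "HOL-Algebra.Embedded_Algebras"
    "HOL-Algebra.QuotRing"
    "HOL-Algebra.Bij"
begin

section \<open>Projective space and its Zariski topology\<close>

definition proj_rel :: "'a::field ^ 'n::finite \<Rightarrow> 'a ^ 'n \<Rightarrow> bool" where
  "proj_rel v w \<longleftrightarrow> v \<noteq> 0 \<and> w \<noteq> 0 \<and> (\<exists>c. c \<noteq> 0 \<and> w = c *s v)"

lemma part_equivp_proj_rel: "part_equivp (proj_rel :: 'a::field ^ 'n::finite \<Rightarrow> _)"
proof (rule part_equivpI)
  have "(1 :: 'a ^ 'n) \<noteq> 0"
    by (simp add: vec_eq_iff)
  then have "proj_rel (1 :: 'a ^ 'n) 1"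
    unfolding proj_rel_def by (intro conjI exI[of _ 1]) auto
  then show "\<exists>x :: 'a ^ 'n. proj_rel x x" ..
  show "symp (proj_rel :: 'a ^ 'n \<Rightarrow> _)"
  proof (rule sympI)
    fix v w :: "'a ^ 'n"
    assume "proj_rel v w"
    then obtain c where c: "v \<noteq> 0" "w \<noteq> 0" "c \<noteq> 0" "w = c *s v"
      unfolding proj_rel_def by blast
    have "inverse c *s w = v"
      unfolding c(4) using c(3) by (simp add: vector_smult_assoc)
    then show "proj_rel w v"
      unfolding proj_rel_def using c(1-3) by (intro conjI exI[of _ "inverse c"]) simp_all
  qed
  show "transp (proj_rel :: 'a ^ 'n \<Rightarrow> _)"
  proof (rule transpI)
    fix u v w :: "'a ^ 'n"
    assume "proj_rel u v" "proj_rel v w"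
    then obtain c d where c: "u \<noteq> 0" "w \<noteq> 0" "c \<noteq> 0" "d \<noteq> 0" "v = c *s u" "w = d *s v"
      unfolding proj_rel_def by blast
    have "w = (d * c) *s u"
      unfolding c(5,6) by (simp add: vector_smult_assoc)
    then show "proj_rel u w"
      unfolding proj_rel_def using c(1-4) by (intro conjI exI[of _ "d * c"]) simp_all
  qed
qed

text \<open>
  \<open>('a, 'n) proj\<close> is projective space of dimension \<open>CARD('n) - 1\<close> over the field \<open>'a\<close>.
\<close>

quotient_type (overloaded) ('a, 'n) proj = "'a::field ^ 'n::finite" / partial: proj_rel
  by (rule part_equivp_proj_rel)

type_synonym ('a, 'n) mpoly = "('n \<Rightarrow>\<^sub>0 nat) \<Rightarrow>\<^sub>0 'a"

definition peval :: "('a::field, 'n::finite) mpoly \<Rightarrow> 'a ^ 'n \<Rightarrow> 'a" where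
  "peval F v = (\<Sum>m\<in>Poly_Mapping.keys F. Poly_Mapping.lookup F m * (\<Prod>i\<in>UNIV. v $ i ^ Poly_Mapping.lookup m i))"

definition mpderiv :: "'n \<Rightarrow> ('a::field, 'n::finite) mpoly \<Rightarrow> ('a, 'n) mpoly" where
  "mpderiv i F = (\<Sum>m\<in>Poly_Mapping.keys F. Poly_Mapping.single (m - Poly_Mapping.single i 1)
                                 (of_nat (Poly_Mapping.lookup m i) * Poly_Mapping.lookup F m))"

definition is_form :: "nat \<Rightarrow> ('a::field, 'n::finite) mpoly \<Rightarrow> bool" where
  "is_form d F \<longleftrightarrow> (\<forall>m\<in>Poly_Mapping.keys F. (\<Sum>i\<in>UNIV. Poly_Mapping.lookup m i) = d)"

text \<open>
  The value of a form at a point depends on the representative \<open>rep_proj x\<close>; it is only used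
  in tests for zero, in quotients of forms of equal degree, and as a coordinate of a vector
  of forms of equal degree.
\<close>

definition form_at :: "('a::field, 'n::finite) mpoly \<Rightarrow> ('a, 'n) proj \<Rightarrow> 'a" where
  "form_at F x = peval F (rep_proj x)"

definition zariski :: "('a::field, 'n::finite) proj topology" where
  "zariski = topology_generated_by {{x. form_at F x \<noteq> 0} |F. \<exists>d. is_form d F}"

definition irreducible_set :: "('a::field, 'n::finite) proj set \<Rightarrow> bool" where
  "irreducible_set Z \<longleftrightarrow> Z \<noteq> {} \<and>
     (\<forall>A B. closedin zariski A \<and> closedin zariski B \<and> Z \<subseteq> A \<union> B \<longrightarrow> Z \<subseteq> A \<or> Z \<subseteq> B)"

definition krull_dim :: "('a::field, 'n::finite) proj set \<Rightarrow> enat" where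
  "krull_dim X = Sup {enat n |n. \<exists>Z :: nat \<Rightarrow> ('a, 'n) proj set.
     (\<forall>i\<le>n. Z i \<subseteq> X \<and> closedin (subtopology zariski X) (Z i) \<and> irreducible_set (Z i)) \<and>
     (\<forall>i<n. Z i \<subset> Z (Suc i))}"


section \<open>Curves\<close>

text \<open>
  The linear subspace of \<open>k^(n+1)\<close> whose projectivization is the embedded projective tangent
  space of \<open>X\<close> at \<open>x\<close>: the kernel of the Jacobian of all forms vanishing on \<open>X\<close>.
\<close>

definition tangent_space :: "('a::field, 'n::finite) proj set \<Rightarrow> ('a, 'n) proj \<Rightarrow> ('a ^ 'n) set" where
  "tangent_space X x = {v. \<forall>d F. is_form d F \<and> (\<forall>y\<in>X. form_at F y = 0) \<longrightarrow>
     (\<Sum>i\<in>UNIV. form_at (mpderiv i F) x * v $ i) = 0}"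

text \<open>
  For a curve, the Jacobian criterion says that \<open>x\<close> is nonsingular iff the projective tangent
  space is a line, i.e. has a linear space of dimension 2 above it.
\<close>

definition smooth_point :: "('a::field, 'n::finite) proj set \<Rightarrow> ('a, 'n) proj \<Rightarrow> bool" where
  "smooth_point X x \<longleftrightarrow> x \<in> X \<and> vec.dim (tangent_space X x) = 2"

definition smooth_projective_curve :: "('a::field, 'n::finite) proj set \<Rightarrow> bool" where
  "smooth_projective_curve X \<longleftrightarrow> closedin zariski X \<and> irreducible_set X \<and> krull_dim X = 1 \<and>
     (\<forall>x\<in>X. smooth_point X x)"

text \<open>An irreducible form is determined up to a scalar by the plane curve that it defines.\<close>

definition plane_curve_of_degree :: "('a::field, 3) proj set \<Rightarrow> nat \<Rightarrow> bool" where
  "plane_curve_of_degree C d \<longleftrightarrow> (\<exists>F. Factorial_Ring.irreducible F \<and> is_form d F \<and> C = {x. form_at F x = 0})"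


section \<open>Morphisms\<close>

definition morphism :: "('a::field, 'n::finite) proj set \<Rightarrow> ('a, 'm::finite) proj set \<Rightarrow>
    (('a, 'n) proj \<Rightarrow> ('a, 'm) proj) \<Rightarrow> bool" where
  "morphism X Y f \<longleftrightarrow> f ` X \<subseteq> Y \<and>
     (\<forall>x\<in>X. \<exists>U d F. openin zariski U \<and> x \<in> U \<and> (\<forall>i. is_form d (F i)) \<and>
        (\<forall>y\<in>X \<inter> U. (\<chi> i. form_at (F i) y) \<noteq> 0 \<and> f y = abs_proj (\<chi> i. form_at (F i) y)))"

definition birational_onto_image :: "('a::field, 'n::finite) proj set \<Rightarrow>
    (('a, 'n) proj \<Rightarrow> ('a, 'm::finite) proj) \<Rightarrow> bool" where
  "birational_onto_image X f \<longleftrightarrow>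
     (\<exists>V g. openin (subtopology zariski (f ` X)) V \<and> V \<noteq> {} \<and> morphism V X g \<and>
        (\<forall>y\<in>V. f (g y) = y) \<and> (\<forall>x\<in>X. f x \<in> V \<longrightarrow> g (f x) = x))"

definition curve_aut :: "('a::field, 'n::finite) proj set \<Rightarrow> (('a, 'n) proj \<Rightarrow> ('a, 'n) proj) set" where
  "curve_aut X = {\<sigma> \<in> Bij X. morphism X X \<sigma> \<and> morphism X X (inv_into X \<sigma>)}"

definition linear_proj_map :: "'a::field ^ 'n::finite ^ 'm::finite \<Rightarrow> ('a, 'n) proj \<Rightarrow> ('a, 'm) proj" where
  "linear_proj_map A x = abs_proj (A *v rep_proj x)"

definition PGL :: "(('a::field, 'n::finite) proj \<Rightarrow> ('a, 'n) proj) set" where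
  "PGL = {linear_proj_map A |A. invertible A}"

text \<open>
  The matrix is determined by \<open>P\<close> up to an automorphism of the projective line. The value of
  the projection at \<open>P\<close> itself is irrelevant.
\<close>

definition projection_from :: "('a::field, 3) proj \<Rightarrow> ('a, 3) proj \<Rightarrow> ('a, 2) proj" where
  "projection_from P =
     linear_proj_map (SOME A :: 'a ^ 3 ^ 2. {v. A *v v = 0} = vec.span {rep_proj P})"


section \<open>Function fields\<close>

definition regular_on :: "('a::field, 'n::finite) proj set \<Rightarrow> (('a, 'n) proj \<Rightarrow> 'a) \<Rightarrow> bool" where
  "regular_on U f \<longleftrightarrow> (\<forall>x\<in>U. \<exists>V d F G. openin zariski V \<and> x \<in> V \<and> is_form d F \<and> is_form d G \<and>
     (\<forall>y\<in>U \<inter> V. form_at G y \<noteq> 0 \<and> f y = form_at F y / form_at G y))"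

text \<open>
  A rational function on an irreducible \<open>X\<close> is encoded as the class of all total functions that
  agree, on some nonempty open subset of \<open>X\<close>, with a function regular there. Thus a pair
  \<open>(U, f)\<close> in the usual description corresponds to \<open>generic_class X f\<close>.
\<close>

definition generic_class :: "('a::field, 'n::finite) proj set \<Rightarrow> (('a, 'n) proj \<Rightarrow> 'a) \<Rightarrow>
    (('a, 'n) proj \<Rightarrow> 'a) set" where
  "generic_class X f =
     {g. \<exists>U. openin (subtopology zariski X) U \<and> U \<noteq> {} \<and> (\<forall>x\<in>U. g x = f x)}"

definition function_field :: "('a::field, 'n::finite) proj set \<Rightarrow> (('a, 'n) proj \<Rightarrow> 'a) set ring" where
  "function_field X =
     \<lparr>carrier = {generic_class X f |f. \<exists>U. openin (subtopology zariski X) U \<and> U \<noteq> {} \<and> regular_on U f},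
      mult = (\<lambda>a b. \<Union>f\<in>a. \<Union>g\<in>b. generic_class X (\<lambda>x. f x * g x)),
      one = generic_class X (\<lambda>_. 1),
      zero = generic_class X (\<lambda>_. 0),
      add = (\<lambda>a b. \<Union>f\<in>a. \<Union>g\<in>b. generic_class X (\<lambda>x. f x + g x))\<rparr>"

text \<open>
  Pullback along a dominant rational map out of \<open>X\<close>; \<open>f\<close> needs to be meaningful only on a
  nonempty open subset of \<open>X\<close>.
\<close>

definition rat_pullback :: "('a::field, 'n::finite) proj set \<Rightarrow> (('a, 'n) proj \<Rightarrow> ('a, 'm::finite) proj) \<Rightarrow>
    (('a, 'm) proj \<Rightarrow> 'a) set \<Rightarrow> (('a, 'n) proj \<Rightarrow> 'a) set" where
  "rat_pullback X f a = (\<Union>h\<in>a. generic_class X (h \<circ> f))"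


section \<open>Galois points\<close>

definition galois_group :: "('b, 'c) ring_scheme \<Rightarrow> 'b set \<Rightarrow> ('b \<Rightarrow> 'b) set" where
  "galois_group L K = {g \<in> ring_iso L L. \<forall>a\<in>K. g a = a}"

definition finite_galois_extension :: "('b, 'c) ring_scheme \<Rightarrow> 'b set \<Rightarrow> bool" where
  "finite_galois_extension L K \<longleftrightarrow> field L \<and> subfield K L \<and>
     ring.finite_dimension L K (carrier L) \<and>
     {a \<in> carrier L. \<forall>g\<in>galois_group L K. g a = a} = K"

definition projection_subfield :: "('a::field, 3) proj set \<Rightarrow> ('a, 3) proj \<Rightarrow>
    (('a, 3) proj \<Rightarrow> 'a) set set" where
  "projection_subfield C P =
     rat_pullback C (projection_from P) ` carrier (function_field (UNIV :: ('a, 2) proj set))"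

text \<open>
  For a plane curve \<open>C\<close> other than a line through \<open>P\<close>, the extension is always finite.
\<close>

definition galois_point :: "('a::field, 3) proj set \<Rightarrow> ('a, 3) proj \<Rightarrow> bool" where
  "galois_point C P \<longleftrightarrow> finite_galois_extension (function_field C) (projection_subfield C P)"

definition inner_galois_point :: "('a::field, 3) proj set \<Rightarrow> ('a, 3) proj \<Rightarrow> bool" where
  "inner_galois_point C P \<longleftrightarrow> smooth_point C P \<and> galois_point C P"

text \<open>
  The automorphisms of \<open>X\<close> which induce, under the identification of the function fields of \<open>X\<close>
  and \<open>\<phi> ` X\<close> by \<open>\<phi>\<close>, an element of the Galois group of the projection from \<open>P\<close>.
\<close>

definition galois_point_group :: "('a::field, 'n::finite) proj set \<Rightarrow>
    (('a, 'n) proj \<Rightarrow> ('a, 3) proj) \<Rightarrow> ('a, 3) proj \<Rightarrow> (('a, 'n) proj \<Rightarrow> ('a, 'n) proj) set" where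
  "galois_point_group X \<phi> P = {\<gamma> \<in> curve_aut X.
     \<exists>g\<in>galois_group (function_field (\<phi> ` X)) (projection_subfield (\<phi> ` X) P).
       \<forall>a\<in>carrier (function_field (\<phi> ` X)).
         rat_pullback X \<gamma> (rat_pullback X \<phi> a) = rat_pullback X \<phi> (g a)}"


section \<open>Divisors\<close>

definition local_ring :: "('a::field, 'n::finite) proj set \<Rightarrow> ('a, 'n) proj \<Rightarrow>
    (('a, 'n) proj \<Rightarrow> 'a) set set" where
  "local_ring X x = {a. \<exists>f U. openin (subtopology zariski X) U \<and> x \<in> U \<and> regular_on U f \<and>
     a = generic_class X f}"

definition local_max_ideal :: "('a::field, 'n::finite) proj set \<Rightarrow> ('a, 'n) proj \<Rightarrow>
    (('a, 'n) proj \<Rightarrow> 'a) set set" where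
  "local_max_ideal X x = {a. \<exists>f U. openin (subtopology zariski X) U \<and> x \<in> U \<and> regular_on U f \<and>
     a = generic_class X f \<and> f x = 0}"

definition uniformizer :: "('a::field, 'n::finite) proj set \<Rightarrow> ('a, 'n) proj \<Rightarrow>
    (('a, 'n) proj \<Rightarrow> 'a) set \<Rightarrow> bool" where
  "uniformizer X x t \<longleftrightarrow> local_max_ideal X x = (\<lambda>a. a \<otimes>\<^bsub>function_field X\<^esub> t) ` local_ring X x"

definition ramification_index :: "('a::field, 'n::finite) proj set \<Rightarrow> ('a, 'm::finite) proj set \<Rightarrow>
    (('a, 'n) proj \<Rightarrow> ('a, 'm) proj) \<Rightarrow> ('a, 'n) proj \<Rightarrow> nat" where
  "ramification_index X Y f x = (THE e. \<exists>t s u. uniformizer Y (f x) t \<and> uniformizer X x s \<and>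
     u \<in> local_ring X x - local_max_ideal X x \<and>
     rat_pullback X f t = u \<otimes>\<^bsub>function_field X\<^esub> (s [^]\<^bsub>function_field X\<^esub> e))"

text \<open>
  Divisors on a curve \<open>X\<close> are elements of the free abelian group \<open>('a, 'n) proj \<Rightarrow>\<^sub>0 int\<close>
  supported on \<open>X\<close>. The pullback below is for nonconstant morphisms of smooth projective curves,
  which have finite fibres.
\<close>

definition div_pullback :: "('a::field, 'n::finite) proj set \<Rightarrow> ('a, 'm::finite) proj set \<Rightarrow>
    (('a, 'n) proj \<Rightarrow> ('a, 'm) proj) \<Rightarrow> (('a, 'm) proj \<Rightarrow>\<^sub>0 int) \<Rightarrow> (('a, 'n) proj \<Rightarrow>\<^sub>0 int)" where
  "div_pullback X Y f D = (\<Sum>Q\<in>Poly_Mapping.keys D. \<Sum>R\<in>{R \<in> X. f R = Q}.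
     Poly_Mapping.single R (int (ramification_index X Y f R) * Poly_Mapping.lookup D Q))"

definition galois_divisor :: "('a::field, 'n::finite) proj set \<Rightarrow>
    (('a, 'n) proj \<Rightarrow> ('a, 3) proj) \<Rightarrow> ('a, 'n) proj \<Rightarrow> (('a, 'n) proj \<Rightarrow>\<^sub>0 int)" where
  "galois_divisor X \<phi> P = Poly_Mapping.single P 1 +
     (\<Sum>\<gamma>\<in>galois_point_group X \<phi> (\<phi> P). Poly_Mapping.single (\<gamma> P) 1)"

end

theory Submission
  imports Defs
begin

text \<open>
  Choose coordinates with \<open>\<phi>(P\<^sub>1) = (1:0:0)\<close> and \<open>\<phi>(P\<^sub>2) = (0:1:0)\<close>. The projection from the second
  point is \<open>x\<close>, and the equation of the curve is \<open>f(x, b) = L(x) \<Prod>(b - y\<circ>\<tau>)\<close> with \<open>\<tau>\<close> running over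
  the Galois group. Since \<open>d \<ge> 4\<close>, the line through the two points is tangent at neither of them; so
  \<open>L\<close> is not constant, and the zeros of \<open>L(x)\<close> form the divisor \<open>\<Sum>\<tau>(P\<^sub>2)\<close>.

  A linear map inducing \<open>\<sigma>\<close> preserves \<open>y\<close>, hence fixes \<open>\<phi>(P\<^sub>1)\<close>, and it conjugates the Galois group
  of \<open>\<phi>(P\<^sub>2)\<close> to that of its image. Conversely, if \<open>L\<^sub>3(x\<^sub>3)\<close> is the analogue of \<open>L(x)\<close> for \<open>P\<^sub>3\<close>, the
  equality of divisors makes \<open>L\<^sub>3(x\<^sub>3\<circ>\<sigma>) / L(x)\<close> regular everywhere, hence constant; together with
  \<open>y\<circ>\<sigma> = y\<close> this makes \<open>\<sigma>\<close> affine in \<open>x\<close> and \<open>y\<close>.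
\<close>

subsection \<open>Polynomials over an algebraically closed field\<close>

text \<open>Divisor arguments need every local ring of X to be a valuation ring. Smoothness gives a
  principal maximal ideal, but excluding functions divisible by all powers of its generator takes
  algebraicity of the function field over k(z) for some z vanishing at the point. Galois points
  supply it: every rational function is a root of its characteristic polynomial over k(x), and the
  projection centre yields a suitable z at every other point, so two Galois points cover X. The same
  valuation rings turn field automorphisms into automorphisms of X and identify X with its image
  near the Galois points. The divisor in (c) is cut out by the tangent line at the Galois point: the
  fibre of the projection through that point, plus the centre itself. As \<sigma> maps
  \<open>P2\<close> to \<open>P3\<close>, the added points correspond, and only orbit multiplicities
  are compared. Rational functions are functions modulo equality on nonempty open sets, with values
  attached by a separate relation. The bound d \<ge> 4 enters as d - 1 \<ge> 3, the degree of the
  projections.\<close>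

lemma infinite_UNIV_alg_closed: "infinite (UNIV :: 'a::alg_closed_field set)"
proof
  assume fin: "finite (UNIV :: 'a set)"
  \<comment> \<open>Euclid's trick: the product of all X - a, plus 1, would be a nonconstant
    polynomial without a root.\<close>
  define p :: "'a poly" where "p = (\<Prod>a\<in>UNIV. [:-a, 1:])"
  have "degree p = card (UNIV :: 'a set)"
    unfolding p_def by (subst degree_prod_sum_eq) auto
  then have "degree p > 0"
    using fin by (simp add: card_gt_0_iff)
  then have "degree (p + 1) > 0"
    by (metis degree_1 degree_add_eq_left)
  then obtain x where "poly (p + 1) x = 0"
    using alg_closed_imp_poly_has_root by blast
  moreover have "poly p x = 0"
    unfolding p_def using fin by (simp add: poly_prod)
  ultimately show False
    by simp
qed

lemma poly_eqI_cofinite: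
  fixes p q :: "'a::alg_closed_field poly"
  assumes "finite A" "\<And>x. x \<notin> A \<Longrightarrow> poly p x = poly q x"
  shows "p = q"
proof (rule ccontr)
  assume "p \<noteq> q"
  then have "finite {x. poly (p - q) x = 0}"
    using poly_roots_finite[of "p - q"] by simp
  moreover have "UNIV = A \<union> {x. poly (p - q) x = 0}"
    using assms(2) by auto
  ultimately show False
    using assms(1) infinite_UNIV_alg_closed by (metis finite_UnI)
qed

lemma poly_eqI_infinite:
  fixes p q :: "'a::alg_closed_field poly"
  assumes "\<And>x. poly p x = poly q x"
  shows "p = q"
  using poly_eqI_cofinite[of "{}" p q] assms by auto

lemma poly_nonroot_avoiding:
  fixes p :: "'a::alg_closed_field poly"
  assumes "p \<noteq> 0" "finite A"
  obtains x where "x \<notin> A" "poly p x \<noteq> 0"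
  using poly_eqI_cofinite[OF assms(2), of p 0] assms(1) by auto

subsection \<open>Evaluation of multivariate polynomials\<close>

definition mon :: "('n::finite \<Rightarrow>\<^sub>0 nat) \<Rightarrow> 'a::field ^ 'n \<Rightarrow> 'a" where
  "mon m v = (\<Prod>i\<in>UNIV. v $ i ^ Poly_Mapping.lookup m i)"

lemma mon_add: "mon (m + n) v = mon m v * mon n v"
  by (simp add: mon_def lookup_add power_add prod.distrib)

lemma mon_0 [simp]: "mon 0 v = 1"
  by (simp add: mon_def)

lemma mon_single: "mon (Poly_Mapping.single i k) v = v $ i ^ k"
proof -
  have "mon (Poly_Mapping.single i k) v = (\<Prod>j\<in>UNIV. if j = i then v $ i ^ k else 1)"
    unfolding mon_def by (rule prod.cong) (auto simp: lookup_single when_def)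
  then show ?thesis
    by (simp add: prod.delta)
qed

lemma peval_mon: "peval F v = (\<Sum>m\<in>Poly_Mapping.keys F. Poly_Mapping.lookup F m * mon m v)"
  by (simp add: peval_def mon_def)

lemma peval_superset:
  assumes "finite A" "Poly_Mapping.keys F \<subseteq> A"
  shows "peval F v = (\<Sum>m\<in>A. Poly_Mapping.lookup F m * mon m v)"
  unfolding peval_mon using assms
  by (intro sum.mono_neutral_left) (auto simp: in_keys_iff)

lemma peval_0 [simp]: "peval 0 v = 0"
  by (simp add: peval_def)

lemma peval_add [simp]: "peval (F + G) v = peval F v + peval G v"
proof -
  let ?A = "Poly_Mapping.keys F \<union> Poly_Mapping.keys G"
  have "peval (F + G) v = (\<Sum>m\<in>?A. Poly_Mapping.lookup (F + G) m * mon m v)"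
    by (rule peval_superset) (auto dest: subsetD[OF keys_add])
  then show ?thesis
    by (simp add: peval_superset[of ?A F] peval_superset[of ?A G] lookup_add
        distrib_right sum.distrib)
qed

lemma peval_sum [simp]: "peval (sum F A) v = (\<Sum>a\<in>A. peval (F a) v)"
  by (induction A rule: infinite_finite_induct) auto

lemma peval_single [simp]: "peval (Poly_Mapping.single m c) v = c * mon m v"
  by (subst peval_superset[of "{m}"]) (auto simp: keys_def lookup_single when_def)

lemma peval_1 [simp]: "peval 1 v = 1"
  using peval_single[of 0 1 v] by (simp del: peval_single)

lemma mpoly_sum_monomials:
  "F = (\<Sum>m\<in>Poly_Mapping.keys F. Poly_Mapping.single m (Poly_Mapping.lookup F m))"
proof (rule poly_mapping_eqI)
  fix k
  have "Poly_Mapping.lookup (\<Sum>m\<in>Poly_Mapping.keys F. Poly_Mapping.single m (Poly_Mapping.lookup F m)) k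
      = (\<Sum>m\<in>Poly_Mapping.keys F. if m = k then Poly_Mapping.lookup F k else 0)"
    unfolding lookup_sum by (rule sum.cong) (auto simp: lookup_single when_def)
  then show "Poly_Mapping.lookup F k = Poly_Mapping.lookup
      (\<Sum>m\<in>Poly_Mapping.keys F. Poly_Mapping.single m (Poly_Mapping.lookup F m)) k"
    by (simp add: sum.delta in_keys_iff)
qed

lemma peval_mult [simp]: "peval (F * G) v = peval F v * peval G v"
proof -
  let ?s = "\<lambda>F m. Poly_Mapping.single m (Poly_Mapping.lookup F m)"
  have "F * G = (\<Sum>m\<in>Poly_Mapping.keys F. \<Sum>n\<in>Poly_Mapping.keys G. ?s F m * ?s G n)"
    by (subst mpoly_sum_monomials[of F], subst mpoly_sum_monomials[of G]) (simp add: sum_product)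
  then have "peval (F * G) v = (\<Sum>m\<in>Poly_Mapping.keys F. \<Sum>n\<in>Poly_Mapping.keys G.
      (Poly_Mapping.lookup F m * mon m v) * (Poly_Mapping.lookup G n * mon n v))"
    by (simp add: mult_single mon_add mult_ac)
  then show ?thesis
    by (simp add: peval_mon sum_product)
qed

lemma peval_uminus [simp]: "peval (- F) v = - peval F v"
proof -
  have "peval (F + - F) v = 0" by simp
  then show ?thesis unfolding peval_add by (simp add: eq_neg_iff_add_eq_0 add.commute)
qed

lemma peval_diff [simp]: "peval (F - G) v = peval F v - peval G v"
  using peval_add[of F "- G" v] by simp

lemma peval_power [simp]: "peval (F ^ k) v = peval F v ^ k"
  by (induction k) auto

lemma peval_prod [simp]: "peval (prod F A) v = (\<Prod>a\<in>A. peval (F a) v)"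
  by (induction A rule: infinite_finite_induct) auto

section \<open>Closure properties of forms\<close>

lemma is_form_0 [simp]: "is_form d 0"
  by (simp add: is_form_def)

lemma is_form_single: "is_form (\<Sum>i\<in>UNIV. Poly_Mapping.lookup m i) (Poly_Mapping.single m c)"
  by (auto simp: is_form_def)

lemma is_form_const [simp]: "is_form 0 (Poly_Mapping.single 0 c)"
  using is_form_single[of 0 c] by simp

lemma is_form_one [simp]: "is_form 0 1"
  using is_form_const[of 1] by simp

lemma is_form_add: "is_form d F \<Longrightarrow> is_form d G \<Longrightarrow> is_form d (F + G)"
  unfolding is_form_def using keys_add[of F G] by blast

lemma is_form_uminus: "is_form d F \<Longrightarrow> is_form d (- F)"
  by (simp add: is_form_def)

lemma is_form_diff: "is_form d F \<Longrightarrow> is_form d G \<Longrightarrow> is_form d (F - G)"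
  using is_form_add[of d F "- G"] is_form_uminus[of d G] by simp

lemma is_form_sum: "(\<And>a. a \<in> A \<Longrightarrow> is_form d (F a)) \<Longrightarrow> is_form d (sum F A)"
  by (induction A rule: infinite_finite_induct) (auto simp: is_form_add)

lemma is_form_mult: "is_form d F \<Longrightarrow> is_form e G \<Longrightarrow> is_form (d + e) (F * G)"
  unfolding is_form_def using keys_mult[of F G]
  by (fastforce simp: lookup_add sum.distrib)

lemma is_form_power: "is_form d F \<Longrightarrow> is_form (d * k) (F ^ k)"
proof (induction k)
  case (Suc k)
  then show ?case using is_form_mult[of d F "d * k" "F ^ k"] by (simp add: add.commute)
qed auto

lemma is_form_prod: "(\<And>a. a \<in> A \<Longrightarrow> is_form (d a) (F a)) \<Longrightarrow> is_form (sum d A) (prod F A)"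
  by (induction A rule: infinite_finite_induct) (auto intro: is_form_mult)

lemma is_form_cmult: "is_form d F \<Longrightarrow> is_form d (Poly_Mapping.single 0 c * F)"
  using is_form_mult[of 0 "Poly_Mapping.single 0 c" d F] by simp

section \<open>Linear forms, substitution and restriction to lines\<close>

definition dotp :: "'a::field ^ 'n::finite \<Rightarrow> 'a ^ 'n \<Rightarrow> 'a" where
  "dotp l v = (\<Sum>i\<in>UNIV. l $ i * v $ i)"

lemma dotp_add [simp]: "dotp l (v + w) = dotp l v + dotp l w"
  by (simp add: dotp_def distrib_left sum.distrib)
lemma dotp_scale [simp]: "dotp l (c *s v) = c * dotp l v"
  by (simp add: dotp_def sum_distrib_left mult_ac)
lemma dotp_add_left [simp]: "dotp (l + l') v = dotp l v + dotp l' v"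
  by (simp add: dotp_def distrib_right sum.distrib)
lemma dotp_scale_left [simp]: "dotp (c *s l) v = c * dotp l v"
  by (simp add: dotp_def sum_distrib_left mult_ac)
lemma dotp_diff [simp]: "dotp l (v - w) = dotp l v - dotp l w"
  by (simp add: dotp_def right_diff_distrib sum_subtractf)
lemma dotp_diff_left [simp]: "dotp (l - l') v = dotp l v - dotp l' v"
  by (simp add: dotp_def left_diff_distrib sum_subtractf)
lemma dotp_0 [simp]: "dotp l 0 = 0" "dotp 0 v = 0"
  by (simp_all add: dotp_def)
lemma dotp_axis [simp]: "dotp (axis i 1) v = v $ i"
  by (simp add: dotp_def axis_def if_distrib[of "\<lambda>x. x * _"] cong: if_cong)
lemma dotp_axis_right [simp]: "dotp v (axis i 1) = v $ i"
  by (simp add: dotp_def axis_def if_distrib[of "\<lambda>x. _ * x"] cong: if_cong)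

definition lin :: "'a::field ^ 'n::finite \<Rightarrow> ('a, 'n) mpoly" where
  "lin l = (\<Sum>i\<in>UNIV. Poly_Mapping.single (Poly_Mapping.single i 1) (l $ i))"

lemma peval_lin [simp]: "peval (lin l) v = dotp l v"
  by (simp add: lin_def dotp_def mon_single)

lemma is_form_lin [simp]:
  fixes l :: "'a::field ^ 'n::finite"
  shows "is_form 1 (lin l)" "is_form (Suc 0) (lin l)"
proof -
  have "(\<Sum>j\<in>UNIV. Poly_Mapping.lookup (Poly_Mapping.single i (1::nat)) j) = 1" for i :: 'n
  proof -
    have "(\<Sum>j\<in>UNIV. Poly_Mapping.lookup (Poly_Mapping.single i (1::nat)) j)
      = (\<Sum>j\<in>UNIV. if j = i then 1 else (0::nat))"
      by (rule sum.cong) (auto simp: lookup_single when_def)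
    then show ?thesis by (simp add: sum.delta del: One_nat_def)
  qed
  then show "is_form 1 (lin l)"
    unfolding lin_def by (intro is_form_sum) (metis is_form_single)
  then show "is_form (Suc 0) (lin l)" by simp
qed

definition psubst :: "('a::field, 'n::finite) mpoly \<Rightarrow> ('n \<Rightarrow> ('a, 'm::finite) mpoly) \<Rightarrow> ('a, 'm) mpoly" where
  "psubst H F = (\<Sum>m\<in>Poly_Mapping.keys H. Poly_Mapping.single 0 (Poly_Mapping.lookup H m) *
     (\<Prod>i\<in>UNIV. F i ^ Poly_Mapping.lookup m i))"

lemma peval_psubst [simp]: "peval (psubst H F) v = peval H (\<chi> i. peval (F i) v)"
  by (simp add: psubst_def peval_def[of H])

lemma is_form_psubst:
  assumes "is_form e H" "\<And>i. is_form d (F i)"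
  shows "is_form (e * d) (psubst H F)"
  unfolding psubst_def
proof (intro is_form_sum is_form_cmult)
  fix m assume m: "m \<in> Poly_Mapping.keys H"
  have "is_form (\<Sum>i\<in>UNIV. d * Poly_Mapping.lookup m i) (\<Prod>i\<in>UNIV. F i ^ Poly_Mapping.lookup m i)"
    using assms(2) by (intro is_form_prod is_form_power)
  also have "(\<Sum>i\<in>UNIV. d * Poly_Mapping.lookup m i) = e * d"
    using assms(1) m by (simp add: is_form_def flip: sum_distrib_left)
  finally show "is_form (e * d) (\<Prod>i\<in>UNIV. F i ^ Poly_Mapping.lookup m i)" .
qed

lemma peval_scale:
  assumes "is_form d F"
  shows "peval F (c *s v) = c ^ d * peval F v"
proof -
  have "mon m (c *s v) = c ^ d * mon m v" if "m \<in> Poly_Mapping.keys F" for m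
    using assms that by (simp add: mon_def is_form_def power_mult_distrib prod.distrib flip: power_sum)
  then show ?thesis
    by (simp add: peval_mon sum_distrib_left mult_ac)
qed

text \<open>The restriction of F to the parametrized line a + t v, as a polynomial in t. Its two
  lowest coefficients are the value and the directional derivative at a, so differential statements
  reduce to one variable.\<close>

definition lp :: "('a::field, 'n::finite) mpoly \<Rightarrow> 'a ^ 'n \<Rightarrow> 'a ^ 'n \<Rightarrow> 'a poly" where
  "lp F a v = (\<Sum>m\<in>Poly_Mapping.keys F. Polynomial.smult (Poly_Mapping.lookup F m)
     (\<Prod>i\<in>UNIV. [:a $ i, v $ i:] ^ Poly_Mapping.lookup m i))"

lemma poly_lp [simp]: "poly (lp F a v) t = peval F (a + t *s v)"
  by (simp add: lp_def peval_def poly_sum poly_prod)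

lemma coeff_lp_0 [simp]: "Polynomial.coeff (lp F a v) 0 = peval F a"
  using poly_lp[of F a v 0] by (simp add: poly_0_coeff_0)

lemma coeff_lp_Suc_0: "Polynomial.coeff (lp F a v) (Suc 0) = (\<Sum>i\<in>UNIV. peval (mpderiv i F) a * v $ i)"
proof -
  have mon_minus: "of_nat (Poly_Mapping.lookup m i) * mon (m - Poly_Mapping.single i 1) a =
     of_nat (Poly_Mapping.lookup m i) * a $ i ^ (Poly_Mapping.lookup m i - 1) *
       (\<Prod>j\<in>UNIV - {i}. a $ j ^ Poly_Mapping.lookup m j)" for m i
  proof -
    have lk: "Poly_Mapping.lookup (m - Poly_Mapping.single i 1) j =
        Poly_Mapping.lookup m j - (if j = i then 1 else 0)" for j
      by (simp add: minus_poly_mapping.rep_eq lookup_single when_def)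
    have "mon (m - Poly_Mapping.single i 1) a =
      a $ i ^ (Poly_Mapping.lookup m i - 1) * (\<Prod>j\<in>UNIV - {i}. a $ j ^ Poly_Mapping.lookup m j)"
      unfolding mon_def lk by (subst prod.remove[of _ i]) (auto intro!: prod.cong)
    then show ?thesis by simp
  qed
  have "Polynomial.coeff (lp F a v) (Suc 0) = poly (pderiv (lp F a v)) 0"
    by (simp add: poly_0_coeff_0 coeff_pderiv)
  also have "\<dots> = (\<Sum>m\<in>Poly_Mapping.keys F. \<Sum>i\<in>UNIV. Poly_Mapping.lookup F m *
     ((\<Prod>j\<in>UNIV - {i}. a $ j ^ Poly_Mapping.lookup m j) *
        (of_nat (Poly_Mapping.lookup m i) * (a $ i ^ (Poly_Mapping.lookup m i - 1) * v $ i))))"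
    unfolding lp_def higher_pderiv_sum[of 1, simplified] pderiv_smult pderiv_prod pderiv_power
    by (simp add: poly_sum poly_prod pderiv_pCons sum_distrib_left mult_ac)
  also have "\<dots> = (\<Sum>i\<in>UNIV. \<Sum>m\<in>Poly_Mapping.keys F. Poly_Mapping.lookup F m *
     (of_nat (Poly_Mapping.lookup m i) * mon (m - Poly_Mapping.single i 1) a) * v $ i)"
    unfolding mon_minus by (subst sum.swap) (simp add: mult_ac)
  also have "\<dots> = (\<Sum>i\<in>UNIV. peval (mpderiv i F) a * v $ i)"
    unfolding mpderiv_def peval_sum peval_single sum_distrib_right
    by (intro sum.cong refl) (simp add: mult_ac)
  finally show ?thesis .
qed

lemma lp_eqI:
  fixes F G :: "('a::alg_closed_field, 'n::finite) mpoly"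
  assumes "\<And>t. peval F (a + t *s v) = poly p t"
  shows "lp F a v = p"
  by (rule poly_eqI_infinite) (simp add: assms)

text \<open>Uniqueness of digits in base N, with the lowest digit read off modulo N. It is the
  injectivity behind the Kronecker substitution.\<close>

lemma base_expansion_inj:
  fixes a b :: "nat \<Rightarrow> nat"
  assumes "\<And>i. i < n \<Longrightarrow> a i < N \<and> b i < N" "(\<Sum>i<n. a i * N ^ i) = (\<Sum>i<n. b i * N ^ i)" "i < n"
  shows "a i = b i"
  using assms
proof (induction n arbitrary: a b i)
  case (Suc n)
  have eq: "a 0 + N * (\<Sum>i<n. a (Suc i) * N ^ i) = b 0 + N * (\<Sum>i<n. b (Suc i) * N ^ i)"
    using Suc.prems(2) by (simp add: sum.lessThan_Suc_shift sum_distrib_left mult_ac del: sum.lessThan_Suc)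
  have lt: "a 0 < N" "b 0 < N" using Suc.prems(1) by auto
  have z: "a 0 = b 0"
    using arg_cong[OF eq, of "\<lambda>x. x mod N"] lt by simp
  have "N * (\<Sum>i<n. a (Suc i) * N ^ i) = N * (\<Sum>i<n. b (Suc i) * N ^ i)"
    using eq unfolding z by (rule add_left_imp_eq)
  then have "(\<Sum>i<n. a (Suc i) * N ^ i) = (\<Sum>i<n. b (Suc i) * N ^ i)"
    using lt(1) unfolding mult_cancel1 by (elim disjE) simp_all
  note S = this
  have "\<And>i. i < n \<Longrightarrow> a (Suc i) < N \<and> b (Suc i) < N" using Suc.prems(1) by blast
  from Suc.IH[OF this S] have "\<And>j. j < n \<Longrightarrow> a (Suc j) = b (Suc j)" .
  then show ?case using z Suc.prems(3) by (cases i) auto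
qed simp

text \<open>Kronecker substitution \<open>X\<^sub>i \<mapsto> t ^ (N ^ i)\<close> separates the monomials.\<close>

lemma peval_eq_0_imp:
  fixes F :: "('a::alg_closed_field, 'n::finite) mpoly"
  assumes "\<And>v. peval F v = 0"
  shows "F = 0"
proof -
  obtain idx :: "'n \<Rightarrow> nat" where idx: "bij_betw idx UNIV {..<CARD('n)}"
    using ex_bij_betw_finite_nat[OF finite[of "UNIV :: 'n set"]] by (auto simp: atLeast0LessThan)
  \<comment> \<open>Larger than every exponent in F, so that exponent vectors become digit strings
    in base N. The inserted 0 keeps the maximum meaningful for F = 0.\<close>
  define N where "N = Suc (Max (insert 0 ((\<lambda>(m, i). Poly_Mapping.lookup m i) ` (Poly_Mapping.keys F \<times> UNIV))))"
  have N: "Poly_Mapping.lookup m i < N" if "m \<in> Poly_Mapping.keys F" for m i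
    unfolding N_def less_Suc_eq_le using that by (intro Max_ge) force+
  define e where "e m = (\<Sum>i\<in>UNIV. Poly_Mapping.lookup m i * N ^ idx i)" for m :: "'n \<Rightarrow>\<^sub>0 nat"
  have e_alt: "e m = (\<Sum>j<CARD('n). Poly_Mapping.lookup m (inv_into UNIV idx j) * N ^ j)" for m
    unfolding e_def by (subst sum.reindex_bij_betw[OF idx, symmetric])
      (use idx in \<open>simp add: bij_betw_def\<close>)
  have inj: "inj_on e (Poly_Mapping.keys F)"
  proof (rule inj_onI)
    fix m m' assume m: "m \<in> Poly_Mapping.keys F" "m' \<in> Poly_Mapping.keys F" "e m = e m'"
    have "Poly_Mapping.lookup m i = Poly_Mapping.lookup m' i" for i
    proof -
      have "idx i < CARD('n)" using idx by (auto simp: bij_betw_def)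
      from base_expansion_inj[OF _ m(3)[unfolded e_alt] this] N m(1,2)
      have "Poly_Mapping.lookup m (inv_into UNIV idx (idx i)) = Poly_Mapping.lookup m' (inv_into UNIV idx (idx i))"
        by blast
      then show ?thesis using idx by (simp add: bij_betw_def)
    qed
    then show "m = m'" by (rule poly_mapping_eqI)
  qed
  define p :: "'a poly" where "p = (\<Sum>m\<in>Poly_Mapping.keys F. Polynomial.monom (Poly_Mapping.lookup F m) (e m))"
  have "poly p t = peval F (\<chi> i. t ^ (N ^ idx i))" for t
    by (simp add: p_def poly_sum poly_monom peval_def e_def power_sum mult.commute flip: power_mult)
  then have "p = 0"
    by (intro poly_eqI_infinite) (simp add: assms)
  have "Poly_Mapping.lookup F m = 0" if m: "m \<in> Poly_Mapping.keys F" for m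
  proof -
    have "Polynomial.coeff p (e m) = (\<Sum>m'\<in>Poly_Mapping.keys F. if m' = m then Poly_Mapping.lookup F m else 0)"
      unfolding p_def coeff_sum by (rule sum.cong) (use inj m in \<open>auto simp: inj_on_def\<close>)
    then show ?thesis using \<open>p = 0\<close> m by (simp add: sum.delta')
  qed
  then show ?thesis
    by (metis in_keys_iff keys_eq_empty equals0I)
qed

lemma mpoly_eqI:
  fixes F :: "('a::alg_closed_field, 'n::finite) mpoly"
  assumes "\<And>v. peval F v = peval G v"
  shows "F = G"
  using peval_eq_0_imp[of "F - G"] assms by simp

text \<open>Through every v runs a line that meets the hyperplane in at most one point; on it the
  two restrictions agree at almost all parameters, hence everywhere.\<close>

lemma peval_eq_off_hyperplane:
  fixes F :: "('a::alg_closed_field, 'n::finite) mpoly"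
  assumes "l \<noteq> 0" "\<And>v. dotp l v \<noteq> 0 \<Longrightarrow> peval F v = peval G v"
  shows "peval F v = peval G v"
proof -
  obtain i where i: "l $ i \<noteq> 0" using assms(1) by (metis vec_eq_iff zero_index)
  define p where "p = [:dotp l v, l $ i:]"
  have "p \<noteq> 0" using i by (simp add: p_def)
  have "lp F v (axis i 1) = lp G v (axis i 1)"
  proof (rule poly_eqI_cofinite)
    show "finite {t. poly p t = 0}" using \<open>p \<noteq> 0\<close> by (rule poly_roots_finite)
    fix t assume "t \<notin> {t. poly p t = 0}"
    then have "dotp l (v + t *s axis i 1) \<noteq> 0" by (simp add: p_def)
    then show "poly (lp F v (axis i 1)) t = poly (lp G v (axis i 1)) t"
      by (simp add: assms(2))
  qed
  then show ?thesis by (metis coeff_lp_0)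
qed

text \<open>On each line through 0 the restrictions of F and of its inverse multiply to 1, so both
  have degree 0 and F takes its value at 0 along the whole line.\<close>

lemma peval_unit_const:
  fixes F :: "('a::alg_closed_field, 'n::finite) mpoly"
  assumes "F dvd 1"
  obtains c where "c \<noteq> 0" "\<And>v. peval F v = c"
proof -
  obtain G where G: "1 = F * G" using assms by (auto elim: dvdE)
  have pv: "peval F v * peval G v = 1" for v
    using arg_cong[OF G, of "\<lambda>H. peval H v"] by simp
  have "peval F v = peval F 0" for v
  proof -
    have "lp F 0 v * lp G 0 v = 1"
      by (rule poly_eqI_infinite) (simp add: pv)
    then have "degree (lp F 0 v) = 0"
      by (metis degree_1 degree_mult_eq_0 one_neq_zero mult_eq_0_iff)
    then obtain c where "lp F 0 v = [:c:]" by (rule degree_eq_zeroE)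
    then have "poly (lp F 0 v) 1 = poly (lp F 0 v) 0" by simp
    then show ?thesis by simp
  qed
  then show ?thesis using that[of "peval F 0"] pv[of 0] by (metis mult_eq_0_iff one_neq_zero)
qed

subsection \<open>Projective space\<close>

lemma rep_proj_nonzero [simp]: "rep_proj x \<noteq> 0"
  using Quotient3_rep_reflp[OF Quotient3_proj, of x] by (simp add: proj_rel_def)

lemma abs_rep_proj [simp]: "abs_proj (rep_proj x) = x"
  using Quotient3_abs_rep[OF Quotient3_proj] .

lemma abs_proj_eq_iff:
  assumes "v \<noteq> 0" "w \<noteq> 0"
  shows "abs_proj v = abs_proj w \<longleftrightarrow> (\<exists>c. c \<noteq> 0 \<and> w = c *s v)"
proof -
  have "proj_rel v v" "proj_rel w w"
    using assms by (auto simp: proj_rel_def intro!: exI[of _ 1])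
  then have "abs_proj v = abs_proj w \<longleftrightarrow> proj_rel v w"
    using Quotient3_rel[OF Quotient3_proj, of v w] by auto
  then show ?thesis using assms by (simp add: proj_rel_def)
qed

lemma abs_proj_scale: "c \<noteq> 0 \<Longrightarrow> v \<noteq> 0 \<Longrightarrow> abs_proj (c *s v) = abs_proj v"
  by (subst abs_proj_eq_iff) (auto intro!: exI[of _ "inverse c"] simp: vector_smult_assoc)

lemma rep_abs_proj:
  assumes "v \<noteq> 0"
  obtains c where "c \<noteq> 0" "rep_proj (abs_proj v) = c *s v"
  using abs_proj_eq_iff[OF assms rep_proj_nonzero[of "abs_proj v"]] by auto

lemma form_at_abs_proj:
  assumes "v \<noteq> 0" "is_form d F"
  shows "form_at F (abs_proj v) = 0 \<longleftrightarrow> peval F v = 0"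
proof -
  obtain c where "c \<noteq> 0" "rep_proj (abs_proj v) = c *s v" using rep_abs_proj[OF assms(1)] .
  then show ?thesis using peval_scale[OF assms(2), of c v] by (simp add: form_at_def)
qed

lemma form_at_simps [simp]:
  "form_at (F + G) x = form_at F x + form_at G x" "form_at (F * G) x = form_at F x * form_at G x"
  "form_at (F - G) x = form_at F x - form_at G x" "form_at (- F) x = - form_at F x"
  "form_at (F ^ k) x = form_at F x ^ k" "form_at 1 x = 1" "form_at 0 x = 0"
  "form_at (Poly_Mapping.single 0 c) x = c" "form_at (sum H A) x = (\<Sum>a\<in>A. form_at (H a) x)"
  "form_at (prod H A) x = (\<Prod>a\<in>A. form_at (H a) x)"
  by (simp_all add: form_at_def)

lemma form_at_lin: "form_at (lin l) x = dotp l (rep_proj x)"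
  by (simp add: form_at_def)

lemma exists_coordinate_nonzero:
  obtains i where "form_at (lin (axis i 1)) x \<noteq> 0"
  using rep_proj_nonzero[of x] by (auto simp: form_at_lin vec_eq_iff)

lemma openin_zariski_basic: "is_form d F \<Longrightarrow> openin zariski {x. form_at F x \<noteq> 0}"
  unfolding zariski_def by (rule topology_generated_by_Basis) auto

lemma topspace_zariski [simp]: "topspace (zariski :: ('a::field, 'n::finite) proj topology) = UNIV"
proof -
  have [simp]: "{x :: ('a, 'n) proj. True} = UNIV" by blast
  have "openin (zariski :: ('a, 'n) proj topology) {x. form_at 1 x \<noteq> 0}"
    by (rule openin_zariski_basic[of 0]) simp
  then have "openin (zariski :: ('a, 'n) proj topology) UNIV" by simp
  from openin_subset[OF this] show ?thesis by blast
qed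

text \<open>Forms multiply, so nonvanishing loci are closed under finite intersection: the
  generating family is a base and not merely a subbase. Every later neighbourhood is taken of this
  shape.\<close>

lemma zariski_base:
  assumes "openin zariski U" "x \<in> U"
  obtains d F where "is_form d F" "form_at F x \<noteq> 0" "\<And>y. form_at F y \<noteq> 0 \<Longrightarrow> y \<in> U"
proof -
  have "generate_topology_on {{x. form_at F x \<noteq> 0} |F. \<exists>d. is_form d F} U"
    using assms(1) by (simp add: zariski_def openin_topology_generated_by_iff)
  then have "x \<in> U \<longrightarrow> (\<exists>d F. is_form d F \<and> form_at F x \<noteq> 0 \<and> (\<forall>y. form_at F y \<noteq> 0 \<longrightarrow> y \<in> U))"
  proof induction
    case (Int a b)
    show ?case
    proof
      assume "x \<in> a \<inter> b"
      then obtain d F d' F' where "is_form d F" "form_at F x \<noteq> 0" "\<forall>y. form_at F y \<noteq> 0 \<longrightarrow> y \<in> a"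
        "is_form d' F'" "form_at F' x \<noteq> 0" "\<forall>y. form_at F' y \<noteq> 0 \<longrightarrow> y \<in> b"
        using Int by blast
      then show "\<exists>d F. is_form d F \<and> form_at F x \<noteq> 0 \<and> (\<forall>y. form_at F y \<noteq> 0 \<longrightarrow> y \<in> a \<inter> b)"
        by (intro exI[of _ "d + d'"] exI[of _ "F * F'"]) (auto intro: is_form_mult)
    qed
  qed blast+
  then show ?thesis using assms(2) that by blast
qed

lemma closedin_zariski_iff:
  fixes Z :: "('a::field, 'n::finite) proj set"
  shows "closedin zariski Z \<longleftrightarrow>
    (\<forall>x. x \<notin> Z \<longrightarrow> (\<exists>d F. is_form d F \<and> form_at F x \<noteq> 0 \<and> (\<forall>y\<in>Z. form_at F y = 0)))"
    (is "?L \<longleftrightarrow> ?R")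
proof
  assume ?L
  then have "openin zariski (- Z)" by (simp add: closedin_def Compl_eq_Diff_UNIV)
  then show ?R by (metis ComplD ComplI zariski_base)
next
  assume ?R
  then have "\<exists>T. openin zariski T \<and> x \<in> T \<and> T \<subseteq> - Z" if x: "x \<in> - Z" for x
  proof -
    obtain d F where "is_form d F" "form_at F x \<noteq> 0" "\<forall>y\<in>Z. form_at F y = 0"
      using \<open>?R\<close> x by blast
    then show ?thesis
      by (intro exI[of _ "{x. form_at F x \<noteq> 0}"]) (auto intro: openin_zariski_basic)
  qed
  then have "openin zariski (- Z)" by (subst openin_subopen) blast
  then show ?L by (simp add: closedin_def Compl_eq_Diff_UNIV)
qed

subsection \<open>Germs of functions at the generic point\<close>

lemma proportional_vectors:
  fixes v w :: "'a::field ^ 'n::finite"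
  assumes "v \<noteq> 0" "w \<noteq> 0" "\<And>i j. v $ i * w $ j = v $ j * w $ i"
  obtains c where "c \<noteq> 0" "w = c *s v"
proof -
  obtain i where i: "v $ i \<noteq> 0" using assms(1) by (auto simp: vec_eq_iff)
  have w: "w = (w $ i / v $ i) *s v"
    using i assms(3)[of i] by (auto simp: vec_eq_iff field_simps)
  then have "w $ i / v $ i \<noteq> 0" using assms(2) by (metis vector_smult_lzero)
  then show ?thesis using that w by blast
qed

text \<open>For irreducible X this is the filter of the generic point: a property holds eventually
  iff it holds on a nonempty open subset. Finite conjunctions and elimination rules for filters then
  replace explicit intersections of open sets.\<close>

definition genf :: "('a::field, 'n::finite) proj set \<Rightarrow> ('a, 'n) proj filter" where
  "genf X = (INF U\<in>{U. openin (subtopology zariski X) U \<and> U \<noteq> {}}. principal U)"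

lemma irreducible_open_Int:
  assumes irr: "irreducible_set X"
    and "openin (subtopology zariski X) U" "U \<noteq> {}" "openin (subtopology zariski X) V" "V \<noteq> {}"
  shows "U \<inter> V \<noteq> {}"
proof
  assume "U \<inter> V = {}"
  obtain U' V' where UV: "openin zariski U'" "U = U' \<inter> X" "openin zariski V'" "V = V' \<inter> X"
    using assms by (auto simp: openin_subtopology)
  have "closedin zariski (- U')" "closedin zariski (- V')"
    using UV by (auto simp: closedin_def Compl_eq_Diff_UNIV double_diff)
  moreover have "X \<subseteq> - U' \<union> - V'" using \<open>U \<inter> V = {}\<close> UV by blast
  ultimately have "X \<subseteq> - U' \<or> X \<subseteq> - V'"
    using irr by (auto simp: irreducible_set_def)
  then show False using assms UV by blast
qed

lemma eventually_genf:
  assumes irr: "irreducible_set X"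
  shows "eventually P (genf X) \<longleftrightarrow> (\<exists>U. openin (subtopology zariski X) U \<and> U \<noteq> {} \<and> (\<forall>x\<in>U. P x))"
proof -
  let ?B = "{U. openin (subtopology zariski X) U \<and> U \<noteq> {}}"
  have "eventually P (genf X) \<longleftrightarrow> (\<exists>U\<in>?B. eventually P (principal U))"
    unfolding genf_def
  proof (rule eventually_INF_base)
    have "X \<noteq> {}" using irr by (simp add: irreducible_set_def)
    then show "?B \<noteq> {}" using openin_topspace[of "subtopology zariski X"] by auto
    fix U V assume "U \<in> ?B" "V \<in> ?B"
    then show "\<exists>W\<in>?B. principal W \<le> inf (principal U) (principal V)"
      using irreducible_open_Int[OF irr, of U V] by (intro bexI[of _ "U \<inter> V"]) auto
  qed
  then show ?thesis by (auto simp: eventually_principal)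
qed

lemma openin_subtopology_form:
  "is_form d F \<Longrightarrow> openin (subtopology zariski X) {x \<in> X. form_at F x \<noteq> 0}"
  unfolding openin_subtopology
  by (intro exI[of _ "{x. form_at F x \<noteq> 0}"]) (auto intro: openin_zariski_basic)

lemma subtopology_base:
  assumes "openin (subtopology zariski X) U" "x \<in> U"
  obtains d F where "is_form d F" "form_at F x \<noteq> 0" "\<And>y. y \<in> X \<Longrightarrow> form_at F y \<noteq> 0 \<Longrightarrow> y \<in> U"
proof -
  obtain U' where "openin zariski U'" "U = U' \<inter> X"
    using assms by (auto simp: openin_subtopology)
  then show ?thesis using zariski_base[of U' x] assms(2) that by (metis IntE IntI)
qed

lemma eventually_genf_openI:
  assumes "irreducible_set X" "openin (subtopology zariski X) U" "x \<in> U" "\<And>y. y \<in> U \<Longrightarrow> P y"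
  shows "eventually P (genf X)"
  unfolding eventually_genf[OF assms(1)] using assms by blast

lemma eventually_genfI:
  assumes "irreducible_set X" "is_form d F" "x \<in> X" "form_at F x \<noteq> 0"
    "\<And>y. y \<in> X \<Longrightarrow> form_at F y \<noteq> 0 \<Longrightarrow> P y"
  shows "eventually P (genf X)"
  by (rule eventually_genf_openI[OF assms(1) openin_subtopology_form[OF assms(2)]])
    (use assms in auto)

lemma eventually_genfE:
  assumes "irreducible_set X" "eventually P (genf X)"
  obtains d F x where "is_form d F" "x \<in> X" "form_at F x \<noteq> 0"
    "\<And>y. y \<in> X \<Longrightarrow> form_at F y \<noteq> 0 \<Longrightarrow> P y"
proof -
  obtain U x where U: "openin (subtopology zariski X) U" "x \<in> U" "\<forall>x\<in>U. P x"
    using assms(2) unfolding eventually_genf[OF assms(1)] by blast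
  have "x \<in> X" using U openin_subset by fastforce
  then show ?thesis using subtopology_base[OF U(1,2)] U(3) that by metis
qed

lemma eventually_genf_form_nonzero:
  "irreducible_set X \<Longrightarrow> is_form d F \<Longrightarrow> x \<in> X \<Longrightarrow> form_at F x \<noteq> 0 \<Longrightarrow>
    \<forall>\<^sub>F y in genf X. form_at F y \<noteq> 0"
  by (rule eventually_genfI)

lemma eventually_genf_in: "irreducible_set X \<Longrightarrow> \<forall>\<^sub>F x in genf X. x \<in> X"
  using openin_topspace[of "subtopology zariski X"]
  by (auto simp: eventually_genf irreducible_set_def)

lemma genf_neq_bot: "irreducible_set X \<Longrightarrow> genf X \<noteq> bot"
  by (auto simp: trivial_limit_def eventually_genf)

lemma eventually_genf_ex:
  "irreducible_set X \<Longrightarrow> eventually P (genf X) \<Longrightarrow> \<exists>x\<in>X. P x"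
  using eventually_happens'[OF genf_neq_bot eventually_conj[OF eventually_genf_in]] by blast

lemma eventually_genf_form_zero:
  assumes "irreducible_set X" "is_form d F" "\<forall>\<^sub>F x in genf X. form_at F x = 0" "x \<in> X"
  shows "form_at F x = 0"
proof (rule ccontr)
  assume "form_at F x \<noteq> 0"
  from eventually_conj[OF assms(3) eventually_genf_form_nonzero[OF assms(1,2,4) this]]
  show False using eventually_genf_ex[OF assms(1)] by fastforce
qed

lemma generic_class_alt: "irreducible_set X \<Longrightarrow> generic_class X f = {g. \<forall>\<^sub>F x in genf X. g x = f x}"
  by (simp add: generic_class_def eventually_genf)

lemma generic_class_eq_iff:
  assumes "irreducible_set X"
  shows "generic_class X f = generic_class X g \<longleftrightarrow> (\<forall>\<^sub>F x in genf X. f x = g x)"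
proof
  assume "generic_class X f = generic_class X g"
  moreover have "f \<in> generic_class X f" by (simp add: generic_class_alt[OF assms])
  ultimately show "\<forall>\<^sub>F x in genf X. f x = g x" by (simp add: generic_class_alt[OF assms])
next
  assume *: "\<forall>\<^sub>F x in genf X. f x = g x"
  have "(\<forall>\<^sub>F x in genf X. h x = f x) \<longleftrightarrow> (\<forall>\<^sub>F x in genf X. h x = g x)" for h
    by (rule eventually_cong[OF *]) simp
  then show "generic_class X f = generic_class X g" by (simp add: generic_class_alt[OF assms])
qed

lemma generic_class_self: "irreducible_set X \<Longrightarrow> f \<in> generic_class X f"
  by (simp add: generic_class_alt)

text \<open>Operations of the function field and pullbacks are defined as unions over all
  representatives. If an operation respects generic equality, all members of the union coincide and
  one representative suffices.\<close>

lemma generic_class_UN: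
  assumes "irreducible_set X"
    "\<And>g. \<forall>\<^sub>F x in genf X. g x = f x \<Longrightarrow> \<forall>\<^sub>F x in genf Y. T g x = T f x" "irreducible_set Y"
  shows "(\<Union>g\<in>generic_class X f. generic_class Y (T g)) = generic_class Y (T f)"
proof -
  have "generic_class Y (T g) = generic_class Y (T f)" if "g \<in> generic_class X f" for g
    using that assms by (simp add: generic_class_alt[OF assms(1)] generic_class_eq_iff[OF assms(3)])
  note eq = this
  show ?thesis
  proof (rule Set.set_eqI)
    fix h show "h \<in> (\<Union>g\<in>generic_class X f. generic_class Y (T g)) \<longleftrightarrow> h \<in> generic_class Y (T f)"
      unfolding UN_iff using eq generic_class_self[OF assms(1), of f] by metis
  qed
qed

subsection \<open>Rational functions and their values\<close>

definition ratf :: "('a::field, 'n::finite) proj set \<Rightarrow> (('a, 'n) proj \<Rightarrow> 'a) \<Rightarrow> bool" where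
  "ratf X f \<longleftrightarrow> (\<exists>d F G. is_form d F \<and> is_form d G \<and>
     (\<forall>\<^sub>F x in genf X. form_at G x \<noteq> 0 \<and> f x = form_at F x / form_at G x))"

text \<open>\<open>locv X Q f a\<close>: the germ \<open>f\<close> is regular at \<open>Q\<close> and takes the value \<open>a\<close> there. The value
  \<open>f Q\<close> of the representing function is irrelevant.\<close>

definition locv :: "('a::field, 'n::finite) proj set \<Rightarrow> ('a, 'n) proj \<Rightarrow> (('a, 'n) proj \<Rightarrow> 'a) \<Rightarrow> 'a \<Rightarrow> bool" where
  "locv X Q f a \<longleftrightarrow> Q \<in> X \<and> (\<exists>d F G. is_form d F \<and> is_form d G \<and> form_at G Q \<noteq> 0 \<and>
     a = form_at F Q / form_at G Q \<and> (\<forall>\<^sub>F x in genf X. f x = form_at F x / form_at G x))"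

lemma ratf_cong: "ratf X f \<Longrightarrow> \<forall>\<^sub>F x in genf X. f x = g x \<Longrightarrow> ratf X g"
  unfolding ratf_def by (elim exE conjE, intro exI conjI, assumption+) (auto elim: eventually_elim2)

lemma locv_cong: "locv X Q f a \<Longrightarrow> \<forall>\<^sub>F x in genf X. f x = g x \<Longrightarrow> locv X Q g a"
  unfolding locv_def by (elim exE conjE, intro exI conjI, assumption+) (auto elim: eventually_elim2)

lemma locv_in: "locv X Q f a \<Longrightarrow> Q \<in> X"
  by (simp add: locv_def)

context
  fixes X :: "('a::field, 'n::finite) proj set"
  assumes irr: "irreducible_set X"
begin

lemma ratf_form_quotient:
  assumes "is_form d F" "is_form d G" "x \<in> X" "form_at G x \<noteq> 0"
  shows "ratf X (\<lambda>x. form_at F x / form_at G x)"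
  unfolding ratf_def using eventually_genf_form_nonzero[OF irr assms(2-4)]
  by (intro exI[of _ d] exI[of _ F] exI[of _ G]) (simp add: assms)

lemma locv_form_quotient:
  assumes "is_form d F" "is_form d G" "Q \<in> X" "form_at G Q \<noteq> 0"
  shows "locv X Q (\<lambda>x. form_at F x / form_at G x) (form_at F Q / form_at G Q)"
  unfolding locv_def using assms by (intro conjI exI[of _ d] exI[of _ F] exI[of _ G]) auto

lemma locvE:
  assumes "locv X Q f a"
  obtains d F G where "is_form d F" "is_form d G" "form_at G Q \<noteq> 0" "a = form_at F Q / form_at G Q"
    "\<forall>\<^sub>F x in genf X. form_at G x \<noteq> 0 \<and> f x = form_at F x / form_at G x"
proof -
  obtain d F G where *: "is_form d F" "is_form d G" "form_at G Q \<noteq> 0" "a = form_at F Q / form_at G Q"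
    "\<forall>\<^sub>F x in genf X. f x = form_at F x / form_at G x" "Q \<in> X"
    using assms unfolding locv_def by blast
  then show ?thesis using that eventually_conj[OF eventually_genf_form_nonzero[OF irr *(2,6,3)] *(5)] by blast
qed

lemma locv_ratf: "locv X Q f a \<Longrightarrow> ratf X f"
  by (erule locvE) (auto simp: ratf_def)

lemma ratfE:
  assumes "ratf X f"
  obtains d F G where "is_form d F" "is_form d G"
    "\<forall>\<^sub>F x in genf X. form_at G x \<noteq> 0 \<and> f x = form_at F x / form_at G x"
  using assms unfolding ratf_def by blast

lemma ratf_const: "ratf X (\<lambda>_. c)"
  unfolding ratf_def by (intro exI[of _ 0] exI[of _ "Poly_Mapping.single 0 c"] exI[of _ 1]) auto

lemma locv_const: "Q \<in> X \<Longrightarrow> locv X Q (\<lambda>_. c) c"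
  unfolding locv_def by (intro conjI exI[of _ 0] exI[of _ "Poly_Mapping.single 0 c"] exI[of _ 1]) auto

lemma ratf_add: "ratf X f \<Longrightarrow> ratf X g \<Longrightarrow> ratf X (\<lambda>x. f x + g x)"
proof (elim ratfE)
  fix d F G d' F' G'
  assume *: "is_form d F" "is_form d G" "is_form d' F'" "is_form d' G'"
    "\<forall>\<^sub>F x in genf X. form_at G x \<noteq> 0 \<and> f x = form_at F x / form_at G x"
    "\<forall>\<^sub>F x in genf X. form_at G' x \<noteq> 0 \<and> g x = form_at F' x / form_at G' x"
  show ?thesis unfolding ratf_def
  proof (intro exI conjI)
    show "is_form (d + d') (F * G' + G * F')" "is_form (d + d') (G * G')"
      using * by (auto intro: is_form_add is_form_mult)
    show "\<forall>\<^sub>F x in genf X. form_at (G * G') x \<noteq> 0 \<and>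
      f x + g x = form_at (F * G' + G * F') x / form_at (G * G') x"
      using *(5,6) by eventually_elim (auto simp: add_frac_eq mult.commute)
  qed
qed

lemma ratf_mult: "ratf X f \<Longrightarrow> ratf X g \<Longrightarrow> ratf X (\<lambda>x. f x * g x)"
proof (elim ratfE)
  fix d F G d' F' G'
  assume *: "is_form d F" "is_form d G" "is_form d' F'" "is_form d' G'"
    "\<forall>\<^sub>F x in genf X. form_at G x \<noteq> 0 \<and> f x = form_at F x / form_at G x"
    "\<forall>\<^sub>F x in genf X. form_at G' x \<noteq> 0 \<and> g x = form_at F' x / form_at G' x"
  show ?thesis unfolding ratf_def
  proof (intro exI conjI)
    show "is_form (d + d') (F * F')" "is_form (d + d') (G * G')"
      using * by (auto intro: is_form_mult)
    show "\<forall>\<^sub>F x in genf X. form_at (G * G') x \<noteq> 0 \<and>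
      f x * g x = form_at (F * F') x / form_at (G * G') x"
      using *(5,6) by eventually_elim auto
  qed
qed

text \<open>The numerator either vanishes on all of X or has a nonempty nonvanishing locus. This
  dichotomy is what makes germs of rational functions a field.\<close>

lemma ratf_0_or_nonzero:
  assumes "ratf X f"
  shows "(\<forall>\<^sub>F x in genf X. f x = 0) \<or> (\<forall>\<^sub>F x in genf X. f x \<noteq> 0)"
proof -
  obtain d F G where *: "is_form d F"
    "\<forall>\<^sub>F x in genf X. form_at G x \<noteq> 0 \<and> f x = form_at F x / form_at G x"
    using assms by (elim ratfE)
  show ?thesis
  proof (cases "\<exists>x\<in>X. form_at F x \<noteq> 0")
    case True
    then have "\<forall>\<^sub>F x in genf X. form_at F x \<noteq> 0"
      using eventually_genf_form_nonzero[OF irr *(1)] by blast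
    then have "\<forall>\<^sub>F x in genf X. f x \<noteq> 0" using *(2) by eventually_elim auto
    then show ?thesis ..
  next
    case False
    have "\<forall>\<^sub>F x in genf X. f x = 0"
      using *(2) eventually_genf_in[OF irr] by eventually_elim (use False in auto)
    then show ?thesis ..
  qed
qed

lemma ratf_inverse:
  assumes "ratf X f"
  shows "ratf X (\<lambda>x. 1 / f x)"
proof -
  obtain d F G where *: "is_form d F" "is_form d G"
    "\<forall>\<^sub>F x in genf X. form_at G x \<noteq> 0 \<and> f x = form_at F x / form_at G x"
    using assms by (elim ratfE)
  show ?thesis using ratf_0_or_nonzero[OF assms]
  proof
    assume "\<forall>\<^sub>F x in genf X. f x = 0"
    then have "\<forall>\<^sub>F x in genf X. 0 = 1 / f x" by eventually_elim auto
    then show ?thesis by (rule ratf_cong[OF ratf_const])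
  next
    assume "\<forall>\<^sub>F x in genf X. f x \<noteq> 0"
    then show ?thesis unfolding ratf_def
      using * by (intro exI[of _ d] exI[of _ G] exI[of _ F] conjI) (auto elim: eventually_elim2)
  qed
qed

lemma ratf_divide: "ratf X f \<Longrightarrow> ratf X g \<Longrightarrow> ratf X (\<lambda>x. f x / g x)"
  using ratf_mult[OF _ ratf_inverse] by (simp add: divide_inverse)

lemma ratf_uminus: "ratf X f \<Longrightarrow> ratf X (\<lambda>x. - f x)"
  using ratf_mult[OF ratf_const[of "-1"]] by simp

lemma ratf_diff: "ratf X f \<Longrightarrow> ratf X g \<Longrightarrow> ratf X (\<lambda>x. f x - g x)"
  using ratf_add[OF _ ratf_uminus] by simp

lemma ratf_sum: "(\<And>a. a \<in> A \<Longrightarrow> ratf X (f a)) \<Longrightarrow> ratf X (\<lambda>x. \<Sum>a\<in>A. f a x)"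
  by (induction A rule: infinite_finite_induct) (auto intro: ratf_const ratf_add)

lemma ratf_prod: "(\<And>a. a \<in> A \<Longrightarrow> ratf X (f a)) \<Longrightarrow> ratf X (\<lambda>x. \<Prod>a\<in>A. f a x)"
  by (induction A rule: infinite_finite_induct) (auto intro: ratf_const ratf_mult)

lemma ratf_power: "ratf X f \<Longrightarrow> ratf X (\<lambda>x. f x ^ k)"
  by (induction k) (auto intro: ratf_const ratf_mult)

lemma ratf_peval:
  assumes "\<And>i. ratf X (f i)"
  shows "ratf X (\<lambda>x. peval F (\<chi> i. f i x))"
  unfolding peval_def by (intro ratf_sum ratf_mult ratf_const ratf_prod) (simp add: assms ratf_power)

lemma ratf_poly: "ratf X f \<Longrightarrow> ratf X (\<lambda>x. poly p (f x))"
  unfolding poly_altdef by (intro ratf_sum ratf_mult ratf_const ratf_power)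

lemma locv_add:
  assumes "locv X Q f a" "locv X Q g b"
  shows "locv X Q (\<lambda>x. f x + g x) (a + b)"
proof -
  obtain d F G where 1: "is_form d F" "is_form d G" "form_at G Q \<noteq> 0" "a = form_at F Q / form_at G Q"
    "\<forall>\<^sub>F x in genf X. form_at G x \<noteq> 0 \<and> f x = form_at F x / form_at G x"
    using assms(1) by (rule locvE)
  obtain d' F' G' where 2: "is_form d' F'" "is_form d' G'" "form_at G' Q \<noteq> 0" "b = form_at F' Q / form_at G' Q"
    "\<forall>\<^sub>F x in genf X. form_at G' x \<noteq> 0 \<and> g x = form_at F' x / form_at G' x"
    using assms(2) by (rule locvE)
  note * = 1(1,2) 2(1,2) 1(3) 2(3) 1(4) 2(4) 1(5) 2(5)
  show ?thesis unfolding locv_def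
  proof (intro exI conjI)
    show "Q \<in> X" using assms(1) by (rule locv_in)
    show "is_form (d + d') (F * G' + G * F')" "is_form (d + d') (G * G')"
      using * by (auto intro: is_form_add is_form_mult)
    show "form_at (G * G') Q \<noteq> 0" using * by simp
    show "a + b = form_at (F * G' + G * F') Q / form_at (G * G') Q"
      using * by (simp add: add_frac_eq mult.commute)
    show "\<forall>\<^sub>F x in genf X. f x + g x = form_at (F * G' + G * F') x / form_at (G * G') x"
      using *(9,10) by eventually_elim (auto simp: add_frac_eq mult.commute)
  qed
qed

lemma locv_mult:
  assumes "locv X Q f a" "locv X Q g b"
  shows "locv X Q (\<lambda>x. f x * g x) (a * b)"
proof -
  obtain d F G where 1: "is_form d F" "is_form d G" "form_at G Q \<noteq> 0" "a = form_at F Q / form_at G Q"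
    "\<forall>\<^sub>F x in genf X. form_at G x \<noteq> 0 \<and> f x = form_at F x / form_at G x"
    using assms(1) by (rule locvE)
  obtain d' F' G' where 2: "is_form d' F'" "is_form d' G'" "form_at G' Q \<noteq> 0" "b = form_at F' Q / form_at G' Q"
    "\<forall>\<^sub>F x in genf X. form_at G' x \<noteq> 0 \<and> g x = form_at F' x / form_at G' x"
    using assms(2) by (rule locvE)
  note * = 1(1,2) 2(1,2) 1(3) 2(3) 1(4) 2(4) 1(5) 2(5)
  show ?thesis unfolding locv_def
  proof (intro exI conjI)
    show "Q \<in> X" using assms(1) by (rule locv_in)
    show "is_form (d + d') (F * F')" "is_form (d + d') (G * G')"
      using * by (auto intro: is_form_mult)
    show "form_at (G * G') Q \<noteq> 0" using * by simp
    show "a * b = form_at (F * F') Q / form_at (G * G') Q"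
      using * by simp
    show "\<forall>\<^sub>F x in genf X. f x * g x = form_at (F * F') x / form_at (G * G') x"
      using *(9,10) by eventually_elim auto
  qed
qed

lemma locv_uminus: "locv X Q f a \<Longrightarrow> locv X Q (\<lambda>x. - f x) (- a)"
  using locv_mult[OF locv_const[of Q "-1"], of f a] locv_in by fastforce

lemma locv_diff: "locv X Q f a \<Longrightarrow> locv X Q g b \<Longrightarrow> locv X Q (\<lambda>x. f x - g x) (a - b)"
  using locv_add[OF _ locv_uminus, of Q f a g b] by simp

lemma locv_inverse:
  assumes "locv X Q f a" "a \<noteq> 0"
  shows "locv X Q (\<lambda>x. 1 / f x) (1 / a)"
  using assms(1)
proof (rule locvE)
  fix d F G
  assume *: "is_form d F" "is_form d G" "form_at G Q \<noteq> 0" "a = form_at F Q / form_at G Q"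
    "\<forall>\<^sub>F x in genf X. form_at G x \<noteq> 0 \<and> f x = form_at F x / form_at G x"
  show ?thesis unfolding locv_def
    using * assms locv_in[OF assms(1)]
    by (intro conjI exI[of _ d] exI[of _ G] exI[of _ F]) (auto elim: eventually_mono)
qed

lemma locv_divide: "locv X Q f a \<Longrightarrow> locv X Q g b \<Longrightarrow> b \<noteq> 0 \<Longrightarrow> locv X Q (\<lambda>x. f x / g x) (a / b)"
  using locv_mult[OF _ locv_inverse, of Q f a g b] by simp

lemma locv_sum: "Q \<in> X \<Longrightarrow> (\<And>i. i \<in> A \<Longrightarrow> locv X Q (f i) (a i)) \<Longrightarrow> locv X Q (\<lambda>x. \<Sum>i\<in>A. f i x) (\<Sum>i\<in>A. a i)"
  by (induction A rule: infinite_finite_induct) (auto intro: locv_const locv_add)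

lemma locv_prod: "Q \<in> X \<Longrightarrow> (\<And>i. i \<in> A \<Longrightarrow> locv X Q (f i) (a i)) \<Longrightarrow> locv X Q (\<lambda>x. \<Prod>i\<in>A. f i x) (\<Prod>i\<in>A. a i)"
  by (induction A rule: infinite_finite_induct) (auto intro: locv_const locv_mult)

lemma locv_power: "locv X Q f a \<Longrightarrow> locv X Q (\<lambda>x. f x ^ k) (a ^ k)"
  by (induction k) (auto intro: locv_const locv_mult dest: locv_in)

lemma locv_peval:
  assumes "\<And>i. locv X Q (f i) (a $ i)"
  shows "locv X Q (\<lambda>x. peval F (\<chi> i. f i x)) (peval F a)"
  unfolding peval_def
  using locv_in[OF assms] by (intro locv_sum locv_mult locv_const locv_prod) (simp_all add: assms locv_power)

lemma locv_poly: "locv X Q f a \<Longrightarrow> locv X Q (\<lambda>x. poly p (f x)) (poly p a)"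
  unfolding poly_altdef by (intro locv_sum locv_mult locv_const locv_power) (auto dest: locv_in)

text \<open>The cross-multiplied difference of two representing fractions is a form that vanishes
  generically on X, hence on all of X, in particular at Q.\<close>

lemma locv_unique:
  assumes "locv X Q f a" "locv X Q f b"
  shows "a = b"
  using assms
proof (elim locvE)
  fix d F G d' F' G'
  assume *: "is_form d F" "is_form d G" "is_form d' F'" "is_form d' G'"
    "form_at G Q \<noteq> 0" "form_at G' Q \<noteq> 0" "a = form_at F Q / form_at G Q" "b = form_at F' Q / form_at G' Q"
    "\<forall>\<^sub>F x in genf X. form_at G x \<noteq> 0 \<and> f x = form_at F x / form_at G x"
    "\<forall>\<^sub>F x in genf X. form_at G' x \<noteq> 0 \<and> f x = form_at F' x / form_at G' x"
  have "\<forall>\<^sub>F x in genf X. form_at (F * G' - G * F') x = 0"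
    using *(9,10) by eventually_elim (auto simp: frac_eq_eq mult.commute)
  moreover have "is_form (d + d') (F * G' - G * F')"
    using * by (auto intro: is_form_diff is_form_mult)
  ultimately have "form_at (F * G' - G * F') Q = 0"
    using eventually_genf_form_zero[OF irr] locv_in[OF assms(1)] by blast
  then show "a = b" using * by (simp add: frac_eq_eq mult.commute)
qed

lemma locv_nonzero: 
  assumes "locv X Q f a" "a \<noteq> 0"
  shows "\<forall>\<^sub>F x in genf X. f x \<noteq> 0"
  using ratf_0_or_nonzero[OF locv_ratf[OF assms(1)]]
proof
  assume "\<forall>\<^sub>F x in genf X. f x = 0"
  then have "locv X Q (\<lambda>_. 0) a" by (rule locv_cong[OF assms(1)])
  then show ?thesis using locv_unique[OF locv_const[of Q 0]] assms locv_in by blast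
qed

text \<open>The function field is the quotient field of each local ring: numerator and denominator
  are both divided by the same power of a coordinate that does not vanish at Q.\<close>

lemma ratf_quotient_locv:
  assumes "ratf X f" "Q \<in> X"
  obtains g h a b where "locv X Q g a" "locv X Q h b" "\<forall>\<^sub>F x in genf X. h x \<noteq> 0"
    "\<forall>\<^sub>F x in genf X. f x = g x / h x"
proof -
  obtain d F G where *: "is_form d F" "is_form d G"
    "\<forall>\<^sub>F x in genf X. form_at G x \<noteq> 0 \<and> f x = form_at F x / form_at G x"
    using assms(1) by (elim ratfE)
  obtain i where i: "form_at (lin (axis i 1)) Q \<noteq> 0" using exists_coordinate_nonzero .
  let ?H = "lin (axis i 1) ^ d"
  have H: "is_form d ?H" "form_at ?H Q \<noteq> 0"
    using i is_form_power[OF is_form_lin(1)[of "axis i 1"], of d] by auto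
  have HX: "\<forall>\<^sub>F x in genf X. form_at ?H x \<noteq> 0"
    using eventually_genf_form_nonzero[OF irr H(1) assms(2) H(2)] .
  show ?thesis
  proof (rule that)
    show "locv X Q (\<lambda>x. form_at F x / form_at ?H x) (form_at F Q / form_at ?H Q)"
      "locv X Q (\<lambda>x. form_at G x / form_at ?H x) (form_at G Q / form_at ?H Q)"
      using locv_form_quotient * H assms(2) by blast+
    show "\<forall>\<^sub>F x in genf X. form_at G x / form_at ?H x \<noteq> 0"
      using *(3) HX by eventually_elim (auto simp del: form_at_simps)
    show "\<forall>\<^sub>F x in genf X. f x = form_at F x / form_at ?H x / (form_at G x / form_at ?H x)"
      using *(3) HX by eventually_elim (auto simp del: form_at_simps)
  qed
qed

subsection \<open>Comparison with the function field and the local rings\<close>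

lemma regular_on_locv:
  assumes "openin (subtopology zariski X) U" "Q \<in> U" "regular_on U f"
  shows "locv X Q f (f Q)"
proof -
  obtain V d F G where V: "openin zariski V" "Q \<in> V" "is_form d F" "is_form d G"
    "\<forall>y\<in>U \<inter> V. form_at G y \<noteq> 0 \<and> f y = form_at F y / form_at G y"
    using assms(3)[unfolded regular_on_def, THEN bspec, OF assms(2)] by (elim exE conjE) (rule that)
  have "openin (subtopology zariski X) (U \<inter> V)"
  proof -
    obtain U' where "openin zariski U'" "U = U' \<inter> X"
      using assms(1) by (auto simp: openin_subtopology)
    then have "openin zariski (U' \<inter> V)" "U \<inter> V = (U' \<inter> V) \<inter> X" using V(1) by auto
    then show ?thesis unfolding openin_subtopology by blast
  qed
  then have "\<forall>\<^sub>F x in genf X. f x = form_at F x / form_at G x"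
    by (rule eventually_genf_openI[OF irr, of _ Q]) (use assms V in auto)
  moreover have "Q \<in> X" using assms openin_subset by fastforce
  ultimately show ?thesis unfolding locv_def using V assms(2) by blast
qed

lemma locv_regular:
  assumes "locv X Q f a"
  obtains U g where "openin (subtopology zariski X) U" "Q \<in> U" "regular_on U g" "g Q = a"
    "\<forall>\<^sub>F x in genf X. f x = g x"
  using assms
proof (rule locvE)
  fix d F G
  assume *: "is_form d F" "is_form d G" "form_at G Q \<noteq> 0" "a = form_at F Q / form_at G Q"
    "\<forall>\<^sub>F x in genf X. form_at G x \<noteq> 0 \<and> f x = form_at F x / form_at G x"
  show ?thesis
  proof (rule that)
    show "openin (subtopology zariski X) {x \<in> X. form_at G x \<noteq> 0}"
      by (rule openin_subtopology_form[OF *(2)])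
    show "Q \<in> {x \<in> X. form_at G x \<noteq> 0}" using * locv_in[OF assms] by simp
    show "regular_on {x \<in> X. form_at G x \<noteq> 0} (\<lambda>x. form_at F x / form_at G x)"
      unfolding regular_on_def
      using * by (intro ballI exI[of _ UNIV] exI[of _ d] exI[of _ F] exI[of _ G])
        (use openin_topspace[of zariski] in auto)
    show "form_at F Q / form_at G Q = a" using * by simp
    show "\<forall>\<^sub>F x in genf X. f x = form_at F x / form_at G x"
      using *(5) by eventually_elim simp
  qed
qed

lemma local_ring_alt: "local_ring X Q = {generic_class X f |f. \<exists>a. locv X Q f a}"
proof (intro Set.set_eqI iffI)
  fix c assume "c \<in> local_ring X Q"
  then show "c \<in> {generic_class X f |f. \<exists>a. locv X Q f a}"
    unfolding local_ring_def using regular_on_locv by blast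
next
  fix c assume "c \<in> {generic_class X f |f. \<exists>a. locv X Q f a}"
  then obtain f a where f: "c = generic_class X f" "locv X Q f a" by blast
  obtain U g where "openin (subtopology zariski X) U" "Q \<in> U" "regular_on U g"
    "\<forall>\<^sub>F x in genf X. f x = g x" using locv_regular[OF f(2)] by metis
  then show "c \<in> local_ring X Q"
    unfolding local_ring_def f using generic_class_eq_iff[OF irr, of f g] by blast
qed

lemma local_max_ideal_alt: "local_max_ideal X Q = {generic_class X f |f. locv X Q f 0}"
proof (intro Set.set_eqI iffI)
  fix c assume "c \<in> local_max_ideal X Q"
  then obtain f U where "openin (subtopology zariski X) U" "Q \<in> U" "regular_on U f"
    "c = generic_class X f" "f Q = 0"
    unfolding local_max_ideal_def by blast
  then show "c \<in> {generic_class X f |f. locv X Q f 0}"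
    using regular_on_locv[of U Q f] by auto
next
  fix c assume "c \<in> {generic_class X f |f. locv X Q f 0}"
  then obtain f where f: "c = generic_class X f" "locv X Q f 0" by blast
  obtain U g where "openin (subtopology zariski X) U" "Q \<in> U" "regular_on U g" "g Q = 0"
    "\<forall>\<^sub>F x in genf X. f x = g x" using locv_regular[OF f(2)] by metis
  then show "c \<in> local_max_ideal X Q"
    unfolding local_max_ideal_def f using generic_class_eq_iff[OF irr, of f g] by blast
qed

lemma carrier_function_field: "carrier (function_field X) = {generic_class X f |f. ratf X f}"
proof (intro Set.set_eqI iffI)
  fix c assume "c \<in> carrier (function_field X)"
  then obtain f U where U: "c = generic_class X f" "openin (subtopology zariski X) U" "U \<noteq> {}" "regular_on U f"
    unfolding function_field_def by auto
  then obtain Q where "Q \<in> U" by blast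
  then have "ratf X f" using regular_on_locv[of U Q f] U locv_ratf by blast
  then show "c \<in> {generic_class X f |f. ratf X f}" using U by blast
next
  fix c assume "c \<in> {generic_class X f |f. ratf X f}"
  then obtain f where f: "c = generic_class X f" "ratf X f" by blast
  obtain d F G where *: "is_form d F" "is_form d G"
    "\<forall>\<^sub>F x in genf X. form_at G x \<noteq> 0 \<and> f x = form_at F x / form_at G x"
    using f(2) by (elim ratfE)
  obtain Q where Q: "Q \<in> X" "form_at G Q \<noteq> 0" using eventually_genf_ex[OF irr *(3)] by blast
  have "locv X Q f (form_at F Q / form_at G Q)"
    unfolding locv_def using * Q by (blast intro: eventually_mono)
  then obtain U g where "openin (subtopology zariski X) U" "Q \<in> U" "regular_on U g"
    "\<forall>\<^sub>F x in genf X. f x = g x" using locv_regular by metis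
  then show "c \<in> carrier (function_field X)"
    unfolding function_field_def using generic_class_eq_iff[OF irr, of f g] f(1) by auto
qed

lemma mult_function_field:
  "generic_class X f \<otimes>\<^bsub>function_field X\<^esub> generic_class X g = generic_class X (\<lambda>x. f x * g x)"
proof -
  have "(\<Union>g'\<in>generic_class X g. generic_class X (\<lambda>x. f' x * g' x)) = generic_class X (\<lambda>x. f' x * g x)" for f'
    by (rule generic_class_UN[OF irr _ irr]) (auto elim: eventually_mono)
  moreover have "(\<Union>f'\<in>generic_class X f. generic_class X (\<lambda>x. f' x * g x)) = generic_class X (\<lambda>x. f x * g x)"
    by (rule generic_class_UN[OF irr _ irr]) (auto elim: eventually_mono)
  ultimately show ?thesis by (simp add: function_field_def)
qed

lemma add_function_field:
  "generic_class X f \<oplus>\<^bsub>function_field X\<^esub> generic_class X g = generic_class X (\<lambda>x. f x + g x)"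
proof -
  have "(\<Union>g'\<in>generic_class X g. generic_class X (\<lambda>x. f' x + g' x)) = generic_class X (\<lambda>x. f' x + g x)" for f'
    by (rule generic_class_UN[OF irr _ irr]) (auto elim: eventually_mono)
  moreover have "(\<Union>f'\<in>generic_class X f. generic_class X (\<lambda>x. f' x + g x)) = generic_class X (\<lambda>x. f x + g x)"
    by (rule generic_class_UN[OF irr _ irr]) (auto elim: eventually_mono)
  ultimately show ?thesis by (simp add: function_field_def)
qed

lemma one_function_field: "\<one>\<^bsub>function_field X\<^esub> = generic_class X (\<lambda>_. 1)"
  by (simp add: function_field_def)

end

lemma rat_pullback_generic_class:
  assumes "irreducible_set X" "irreducible_set Y" "filterlim f (genf Y) (genf X)"
  shows "rat_pullback X f (generic_class Y h) = generic_class X (h \<circ> f)"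
  unfolding rat_pullback_def
  by (rule generic_class_UN[OF assms(2) _ assms(1)])
    (use assms(3) in \<open>auto simp: filterlim_iff\<close>)

subsection \<open>Morphisms and rational maps\<close>

lemma form_at_psubst [simp]: "form_at (psubst H F) x = peval H (\<chi> i. form_at (F i) x)"
  by (simp add: form_at_def)

lemma form_quotient_abs_proj:
  assumes "w \<noteq> 0" "is_form e A" "is_form e B"
  shows "form_at A (abs_proj w) / form_at B (abs_proj w) = peval A w / peval B w"
proof -
  obtain c where "c \<noteq> 0" "rep_proj (abs_proj w) = c *s w" using rep_abs_proj[OF assms(1)] .
  then show ?thesis by (simp add: form_at_def peval_scale[OF assms(2)] peval_scale[OF assms(3)])
qed

lemma morphism_local:
  assumes "morphism X Y f" "x \<in> X"
  obtains e N d F where "is_form e N" "form_at N x \<noteq> 0" "\<And>i. is_form d (F i)"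
    "\<And>y. y \<in> X \<Longrightarrow> form_at N y \<noteq> 0 \<Longrightarrow>
       (\<chi> i. form_at (F i) y) \<noteq> 0 \<and> f y = abs_proj (\<chi> i. form_at (F i) y)"
proof -
  obtain U d F where U: "openin zariski U" "x \<in> U" "\<forall>i. is_form d (F i)"
    "\<forall>y\<in>X \<inter> U. (\<chi> i. form_at (F i) y) \<noteq> 0 \<and> f y = abs_proj (\<chi> i. form_at (F i) y)"
    using assms(1)[unfolded morphism_def, THEN conjunct2, THEN bspec, OF assms(2)]
    by (elim exE conjE) (rule that)
  obtain e N where "is_form e N" "form_at N x \<noteq> 0" "\<And>y. form_at N y \<noteq> 0 \<Longrightarrow> y \<in> U"
    using zariski_base[OF U(1,2)] by metis
  then show ?thesis using that[of e N d F] U by blast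
qed

lemma morphismI:
  assumes "f ` X \<subseteq> Y"
    "\<And>x. x \<in> X \<Longrightarrow> \<exists>e N d F. is_form e N \<and> form_at N x \<noteq> 0 \<and> (\<forall>i. is_form d (F i)) \<and>
      (\<forall>y\<in>X. form_at N y \<noteq> 0 \<longrightarrow> (\<chi> i. form_at (F i) y) \<noteq> 0 \<and> f y = abs_proj (\<chi> i. form_at (F i) y))"
  shows "morphism X Y f"
  unfolding morphism_def
proof (intro conjI ballI assms(1))
  fix x assume "x \<in> X"
  from assms(2)[OF this] obtain e N d F where *: "is_form e N" "form_at N x \<noteq> 0" "\<forall>i. is_form d (F i)"
    "\<forall>y\<in>X. form_at N y \<noteq> 0 \<longrightarrow> (\<chi> i. form_at (F i) y) \<noteq> 0 \<and> f y = abs_proj (\<chi> i. form_at (F i) y)"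
    by (elim exE conjE)
  show "\<exists>U d F. openin zariski U \<and> x \<in> U \<and> (\<forall>i. is_form d (F i)) \<and>
        (\<forall>y\<in>X \<inter> U. (\<chi> i. form_at (F i) y) \<noteq> 0 \<and> f y = abs_proj (\<chi> i. form_at (F i) y))"
    by (rule exI[of _ "{y. form_at N y \<noteq> 0}"], rule exI[of _ d], rule exI[of _ F])
      (use * openin_zariski_basic[OF *(1)] in blast)
qed

lemma morphism_codomain: "morphism X Y f \<Longrightarrow> x \<in> X \<Longrightarrow> f x \<in> Y"
  by (auto simp: morphism_def)

lemma morphism_mono: "morphism X Y f \<Longrightarrow> f ` X \<subseteq> Z \<Longrightarrow> morphism X Z f"
  by (simp add: morphism_def)

lemma morphism_cong:
  assumes "morphism X Y f" "\<And>x. x \<in> X \<Longrightarrow> f x = g x"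
  shows "morphism X Y g"
proof -
  have "f ` X = g ` X" using assms(2) by (intro image_cong) auto
  then show ?thesis using assms by (simp add: morphism_def)
qed

text \<open>Continuity of a morphism in terms of forms: composing H with the local coordinate forms
  of f gives a form again, and a factor N confines it to where these coordinates describe f.\<close>

lemma morphism_pullback_form:
  assumes "morphism X Y f" "x \<in> X" "is_form e H" "form_at H (f x) \<noteq> 0"
  obtains k M where "is_form k M" "form_at M x \<noteq> 0"
    "\<And>y. y \<in> X \<Longrightarrow> form_at M y \<noteq> 0 \<Longrightarrow> form_at H (f y) \<noteq> 0"
proof -
  obtain e' N d F where *: "is_form e' N" "form_at N x \<noteq> 0" "\<And>i. is_form d (F i)"
    "\<And>y. y \<in> X \<Longrightarrow> form_at N y \<noteq> 0 \<Longrightarrow>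
       (\<chi> i. form_at (F i) y) \<noteq> 0 \<and> f y = abs_proj (\<chi> i. form_at (F i) y)"
    using morphism_local[OF assms(1,2)] by metis
  have eq: "form_at H (f y) \<noteq> 0 \<longleftrightarrow> form_at (psubst H F) y \<noteq> 0" if "y \<in> X" "form_at N y \<noteq> 0" for y
    using form_at_abs_proj[OF _ assms(3)] *(4)[OF that] by simp
  show ?thesis
  proof (rule that)
    show "is_form (e' + e * d) (N * psubst H F)"
      using * assms(3) by (intro is_form_mult is_form_psubst) auto
    show "form_at (N * psubst H F) x \<noteq> 0" using eq[OF assms(2) *(2)] * assms by simp
    show "form_at H (f y) \<noteq> 0" if "y \<in> X" "form_at (N * psubst H F) y \<noteq> 0" for y
      using that eq[of y] by simp
  qed
qed

lemma morphism_compose: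
  assumes "morphism X Y f" "morphism Y Z g"
  shows "morphism X Z (\<lambda>x. g (f x))"
proof (rule morphismI)
  show "(\<lambda>x. g (f x)) ` X \<subseteq> Z"
    using morphism_codomain[OF assms(1)] morphism_codomain[OF assms(2)] by blast
  fix x assume x: "x \<in> X"
  then have fx: "f x \<in> Y" using assms by (auto simp: morphism_def)
  obtain e N d F where 1: "is_form e N" "form_at N x \<noteq> 0" "\<And>i. is_form d (F i)"
    "\<And>y. y \<in> X \<Longrightarrow> form_at N y \<noteq> 0 \<Longrightarrow>
       (\<chi> i. form_at (F i) y) \<noteq> 0 \<and> f y = abs_proj (\<chi> i. form_at (F i) y)"
    using morphism_local[OF assms(1) x] by metis
  obtain e' N' d' F' where 2: "is_form e' N'" "form_at N' (f x) \<noteq> 0" "\<And>i. is_form d' (F' i)"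
    "\<And>y. y \<in> Y \<Longrightarrow> form_at N' y \<noteq> 0 \<Longrightarrow>
       (\<chi> i. form_at (F' i) y) \<noteq> 0 \<and> g y = abs_proj (\<chi> i. form_at (F' i) y)"
    using morphism_local[OF assms(2) fx] by metis
  obtain k M where M: "is_form k M" "form_at M x \<noteq> 0"
    "\<And>y. y \<in> X \<Longrightarrow> form_at M y \<noteq> 0 \<Longrightarrow> form_at N' (f y) \<noteq> 0"
    using morphism_pullback_form[OF assms(1) x 2(1,2)] by metis
  show "\<exists>e N d F. is_form e N \<and> form_at N x \<noteq> 0 \<and> (\<forall>i. is_form d (F i)) \<and>
      (\<forall>y\<in>X. form_at N y \<noteq> 0 \<longrightarrow> (\<chi> i. form_at (F i) y) \<noteq> 0 \<and> g (f y) = abs_proj (\<chi> i. form_at (F i) y))"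
  proof (rule exI[of _ "e + k"], rule exI[of _ "N * M"], rule exI[of _ "d' * d"],
      rule exI[of _ "\<lambda>i. psubst (F' i) F"], intro conjI allI ballI impI)
    show "is_form (e + k) (N * M)" using 1 M by (intro is_form_mult) auto
    show "form_at (N * M) x \<noteq> 0" using 1 M by simp
    show "is_form (d' * d) (psubst (F' i) F)" for i by (intro is_form_psubst 2 1)
    fix y assume y: "y \<in> X" "form_at (N * M) y \<noteq> 0"
    then have N: "form_at N y \<noteq> 0" "form_at M y \<noteq> 0" by auto
    define w where "w = (\<chi> i. form_at (F i) y)"
    have w: "w \<noteq> 0" "f y = abs_proj w" using 1(4)[OF y(1) N(1)] by (auto simp: w_def)
    have "f y \<in> Y" using y(1) assms(1) by (auto simp: morphism_def)
    from 2(4)[OF this M(3)[OF y(1) N(2)]]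
    have g: "(\<chi> i. form_at (F' i) (f y)) \<noteq> 0" "g (f y) = abs_proj (\<chi> i. form_at (F' i) (f y))" by auto
    obtain c where c: "c \<noteq> 0" "rep_proj (f y) = c *s w" using rep_abs_proj[OF w(1)] w(2) by metis
    have eq: "(\<chi> i. form_at (F' i) (f y)) = c ^ d' *s (\<chi> i. form_at (psubst (F' i) F) y)"
      by (simp add: vec_eq_iff form_at_def[of _ "f y"] c peval_scale[OF 2(3)] w_def)
    then show nz: "(\<chi> i. form_at (psubst (F' i) F) y) \<noteq> 0" using g(1) by (metis vector_smult_rzero)
    show "g (f y) = abs_proj (\<chi> i. form_at (psubst (F' i) F) y)"
      unfolding g(2) eq by (rule abs_proj_scale) (use c nz in auto)
  qed
qed

text \<open>Projective space is separated: the two-by-two minors of the coordinate vectors of f and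
  g are forms, so they vanish at every point once they vanish generically.\<close>

lemma morphism_eqI:
  assumes irr: "irreducible_set X" and "morphism X Y f" "morphism X Z g"
    "\<forall>\<^sub>F x in genf X. f x = g x" "x \<in> X"
  shows "f x = g x"
proof -
  obtain e N d F where 1: "is_form e N" "form_at N x \<noteq> 0" "\<And>i. is_form d (F i)"
    "\<And>y. y \<in> X \<Longrightarrow> form_at N y \<noteq> 0 \<Longrightarrow>
       (\<chi> i. form_at (F i) y) \<noteq> 0 \<and> f y = abs_proj (\<chi> i. form_at (F i) y)"
    using morphism_local[OF assms(2,5)] by metis
  obtain e' N' d' F' where 2: "is_form e' N'" "form_at N' x \<noteq> 0" "\<And>i. is_form d' (F' i)"
    "\<And>y. y \<in> X \<Longrightarrow> form_at N' y \<noteq> 0 \<Longrightarrow>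
       (\<chi> i. form_at (F' i) y) \<noteq> 0 \<and> g y = abs_proj (\<chi> i. form_at (F' i) y)"
    using morphism_local[OF assms(3,5)] by metis
  let ?v = "\<lambda>y. \<chi> i. form_at (F i) y" and ?w = "\<lambda>y. \<chi> i. form_at (F' i) y"
  have "?v x $ i * ?w x $ j = ?v x $ j * ?w x $ i" for i j
  proof -
    have "\<forall>\<^sub>F y in genf X. form_at (F i * F' j - F j * F' i) y = 0"
      using assms(4) eventually_genf_in[OF irr] eventually_genf_form_nonzero[OF irr 1(1) assms(5) 1(2)]
        eventually_genf_form_nonzero[OF irr 2(1) assms(5) 2(2)]
    proof eventually_elim
      case (elim y)
      have "?v y \<noteq> 0" "?w y \<noteq> 0" "abs_proj (?v y) = abs_proj (?w y)"
        using 1(4)[OF elim(2,3)] 2(4)[OF elim(2,4)] elim(1) by auto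
      then obtain c where "?w y = c *s ?v y" by (auto simp: abs_proj_eq_iff)
      then have "form_at (F' k) y = c * form_at (F k) y" for k by (simp add: vec_eq_iff)
      then show ?case by simp
    qed
    moreover have "is_form (d + d') (F i * F' j - F j * F' i)"
      by (intro is_form_diff is_form_mult 1 2)
    ultimately have "form_at (F i * F' j - F j * F' i) x = 0"
      using eventually_genf_form_zero[OF irr] assms(5) by blast
    then show ?thesis by simp
  qed
  moreover have nz: "?v x \<noteq> 0" "?w x \<noteq> 0" using 1(4) 1(2) 2(4) 2(2) assms(5) by blast+
  ultimately obtain c where "c \<noteq> 0" "?w x = c *s ?v x" using proportional_vectors[of "?v x" "?w x"] by metis
  then have "abs_proj (?v x) = abs_proj (?w x)" using nz by (auto simp: abs_proj_eq_iff)
  then show ?thesis using 1(4) 1(2) 2(4) 2(2) assms(5) by auto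
qed

lemma irreducible_image:
  assumes irr: "irreducible_set X" and f: "morphism X Y f"
  shows "irreducible_set (f ` X)"
  unfolding irreducible_set_def
proof (intro conjI allI impI)
  show "f ` X \<noteq> {}" using irr by (simp add: irreducible_set_def)
  fix A B assume AB: "closedin zariski A \<and> closedin zariski B \<and> f ` X \<subseteq> A \<union> B"
  have *: "\<forall>\<^sub>F x in genf X. f x \<notin> A" if A: "closedin zariski A" "x \<in> X" "f x \<notin> A" for x A
  proof -
    obtain d H where H: "is_form d H" "form_at H (f x) \<noteq> 0" "\<forall>y\<in>A. form_at H y = 0"
      using A(1)[unfolded closedin_zariski_iff, rule_format, OF A(3)] by blast
    obtain k M where "is_form k M" "form_at M x \<noteq> 0"
      "\<And>y. y \<in> X \<Longrightarrow> form_at M y \<noteq> 0 \<Longrightarrow> form_at H (f y) \<noteq> 0"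
      using morphism_pullback_form[OF f A(2) H(1,2)] by metis
    then show ?thesis using H(3) A(2) by (intro eventually_genfI[OF irr]) auto
  qed
  show "f ` X \<subseteq> A \<or> f ` X \<subseteq> B"
  proof (rule ccontr)
    assume "\<not> ?thesis"
    then obtain x x' where "x \<in> X" "f x \<notin> A" "x' \<in> X" "f x' \<notin> B" by blast
    then have "\<forall>\<^sub>F x in genf X. f x \<notin> A \<and> f x \<notin> B" using * AB by (intro eventually_conj) auto
    then show False using eventually_genf_ex[OF irr] AB by blast
  qed
qed

lemma morphism_filterlim:
  assumes "irreducible_set X" "irreducible_set Y" "morphism X Z f" "f ` X = Y"
  shows "filterlim f (genf Y) (genf X)"
  unfolding filterlim_iff
proof (intro allI impI)
  fix P assume "eventually P (genf Y)"
  then obtain e H y where H: "is_form e H" "y \<in> Y" "form_at H y \<noteq> 0"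
    "\<And>y. y \<in> Y \<Longrightarrow> form_at H y \<noteq> 0 \<Longrightarrow> P y"
    using eventually_genfE[OF assms(2)] by metis
  obtain x where x: "x \<in> X" "y = f x" using H(2) assms(4) by blast
  obtain k M where "is_form k M" "form_at M x \<noteq> 0"
      "\<And>y. y \<in> X \<Longrightarrow> form_at M y \<noteq> 0 \<Longrightarrow> form_at H (f y) \<noteq> 0"
    using morphism_pullback_form[OF assms(3) x(1) H(1)] H(3) x(2) by metis
  then show "\<forall>\<^sub>F x in genf X. P (f x)"
    using x H(4) assms(4) by (intro eventually_genfI[OF assms(1)]) auto
qed

text \<open>A dominant rational map. The filter condition is dominance, namely that the preimage of
  a nonempty open set contains one; the coordinate forms are required only generically.\<close>

definition ratmap :: "('a::field, 'n::finite) proj set \<Rightarrow> ('a, 'm::finite) proj set \<Rightarrow>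
    (('a, 'n) proj \<Rightarrow> ('a, 'm) proj) \<Rightarrow> bool" where
  "ratmap X Y f \<longleftrightarrow> filterlim f (genf Y) (genf X) \<and> (\<exists>d F. (\<forall>i. is_form d (F i)) \<and>
     (\<forall>\<^sub>F x in genf X. (\<chi> i. form_at (F i) x) \<noteq> 0 \<and> f x = abs_proj (\<chi> i. form_at (F i) x)))"

lemma ratf_compose:
  assumes "ratmap X Y f" "ratf Y h"
  shows "ratf X (\<lambda>x. h (f x))"
proof -
  obtain d F where F: "\<forall>i. is_form d (F i)"
    "\<forall>\<^sub>F x in genf X. (\<chi> i. form_at (F i) x) \<noteq> 0 \<and> f x = abs_proj (\<chi> i. form_at (F i) x)"
    using assms(1) unfolding ratmap_def by blast
  obtain e A B where h: "is_form e A" "is_form e B"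
    "\<forall>\<^sub>F x in genf Y. form_at B x \<noteq> 0 \<and> h x = form_at A x / form_at B x"
    using assms(2) unfolding ratf_def by blast
  have "\<forall>\<^sub>F x in genf X. form_at B (f x) \<noteq> 0 \<and> h (f x) = form_at A (f x) / form_at B (f x)"
    using h(3) assms(1) by (auto simp: ratmap_def filterlim_iff)
  then have "\<forall>\<^sub>F x in genf X. form_at (psubst B F) x \<noteq> 0 \<and>
      h (f x) = form_at (psubst A F) x / form_at (psubst B F) x"
    using F(2)
  proof eventually_elim
    case (elim x)
    then show ?case
      using form_quotient_abs_proj[OF _ h(1,2), of "\<chi> i. form_at (F i) x"]
        form_at_abs_proj[OF _ h(2), of "\<chi> i. form_at (F i) x"] by simp
  qed
  moreover have "is_form (e * d) (psubst A F)" "is_form (e * d) (psubst B F)"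
    using F h by (auto intro: is_form_psubst)
  ultimately show ?thesis unfolding ratf_def by blast
qed

lemma morphism_ratmap:
  assumes irr: "irreducible_set X" and "morphism X Z f" "filterlim f (genf Y) (genf X)"
  shows "ratmap X Y f"
proof -
  obtain x where x: "x \<in> X" using irr by (auto simp: irreducible_set_def)
  obtain e N d F where 1: "is_form e N" "form_at N x \<noteq> 0" "\<And>i. is_form d (F i)"
    "\<And>y. y \<in> X \<Longrightarrow> form_at N y \<noteq> 0 \<Longrightarrow>
       (\<chi> i. form_at (F i) y) \<noteq> 0 \<and> f y = abs_proj (\<chi> i. form_at (F i) y)"
    using morphism_local[OF assms(2) x] by metis
  have "\<forall>\<^sub>F x in genf X. (\<chi> i. form_at (F i) x) \<noteq> 0 \<and> f x = abs_proj (\<chi> i. form_at (F i) x)"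
    by (rule eventually_genfI[OF irr 1(1) x 1(2) 1(4)])
  then show ?thesis unfolding ratmap_def using assms(3) 1(3) by blast
qed

lemma locv_compose:
  assumes irrX: "irreducible_set X" and irrY: "irreducible_set Y"
    and f: "morphism X Z f" "filterlim f (genf Y) (genf X)"
    and x: "x \<in> X" "locv Y (f x) h a"
  shows "locv X x (\<lambda>x. h (f x)) a"
proof -
  obtain e N d F where 1: "is_form e N" "form_at N x \<noteq> 0" "\<And>i. is_form d (F i)"
    "\<And>y. y \<in> X \<Longrightarrow> form_at N y \<noteq> 0 \<Longrightarrow>
       (\<chi> i. form_at (F i) y) \<noteq> 0 \<and> f y = abs_proj (\<chi> i. form_at (F i) y)"
    using morphism_local[OF f(1) x(1)] by metis
  obtain k A B where h: "is_form k A" "is_form k B" "form_at B (f x) \<noteq> 0"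
    "a = form_at A (f x) / form_at B (f x)"
    "\<forall>\<^sub>F x in genf Y. form_at B x \<noteq> 0 \<and> h x = form_at A x / form_at B x"
    by (rule locvE[OF irrY x(2)]) (rule that)
  have ev: "form_at A (f y) / form_at B (f y) = form_at (psubst A F) y / form_at (psubst B F) y"
    if "y \<in> X" "form_at N y \<noteq> 0" for y
    using form_quotient_abs_proj[OF _ h(1,2), of "\<chi> i. form_at (F i) y"] 1(4)[OF that] by simp
  have "\<forall>\<^sub>F x in genf X. form_at B (f x) \<noteq> 0 \<and> h (f x) = form_at A (f x) / form_at B (f x)"
    using h(5) f(2) by (auto simp: filterlim_iff)
  then have "\<forall>\<^sub>F y in genf X. h (f y) = form_at (psubst A F) y / form_at (psubst B F) y"
    using eventually_genf_form_nonzero[OF irrX 1(1) x(1) 1(2)] eventually_genf_in[OF irrX]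
    by eventually_elim (use ev in auto)
  moreover have "is_form (k * d) (psubst A F)" "is_form (k * d) (psubst B F)"
    using 1 h by (auto intro: is_form_psubst)
  moreover have "form_at (psubst B F) x \<noteq> 0"
    using form_at_abs_proj[OF _ h(2), of "\<chi> i. form_at (F i) x"] 1(4)[OF x(1) 1(2)] h(3) by simp
  moreover have "a = form_at (psubst A F) x / form_at (psubst B F) x"
    using ev[OF x(1) 1(2)] h(4) by simp
  ultimately show ?thesis unfolding locv_def using x(1) by blast
qed

subsection \<open>Linear maps\<close>

lemma matrix_vector_dotp: "(A *v v) $ i = dotp (A $ i) v"
  by (simp add: matrix_vector_mult_def dotp_def)

lemma invertible_mult_eq_0:
  fixes A :: "'a::field ^ 'n::finite ^ 'n"
  assumes "invertible A"
  shows "A *v v = 0 \<longleftrightarrow> v = 0"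
proof -
  obtain B where "B ** A = mat 1" using assms by (auto simp: invertible_def)
  then have "B *v (A *v v) = v" by (simp add: matrix_vector_mul_assoc)
  then show ?thesis by (metis vec.linear_0 matrix_vector_mult_0_right)
qed

lemma rep_linear_proj_map:
  assumes "A *v rep_proj x \<noteq> 0"
  obtains c where "c \<noteq> 0" "rep_proj (linear_proj_map A x) = c *s (A *v rep_proj x)"
  using rep_abs_proj[OF assms] by (metis linear_proj_map_def)

lemma linear_proj_map_abs_proj:
  assumes "v \<noteq> 0" "A *v v \<noteq> 0"
  shows "linear_proj_map A (abs_proj v) = abs_proj (A *v v)"
proof -
  obtain c where "c \<noteq> 0" "rep_proj (abs_proj v) = c *s v" using rep_abs_proj[OF assms(1)] .
  then show ?thesis
    unfolding linear_proj_map_def using abs_proj_scale[of c "A *v v"] assms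
    by (simp add: vec.scale)
qed

lemma linear_proj_map_morphism:
  fixes A :: "'a::field ^ 'n::finite ^ 'm::finite"
  assumes "\<And>x. x \<in> X \<Longrightarrow> A *v rep_proj x \<noteq> 0"
  shows "morphism X UNIV (linear_proj_map A)"
proof (rule morphismI)
  fix x assume x: "x \<in> X"
  have eq: "(\<chi> i. form_at (lin (A $ i)) y) = A *v rep_proj y" for y
    by (simp add: vec_eq_iff form_at_lin matrix_vector_dotp)
  show "\<exists>e N d F. is_form e N \<and> form_at N x \<noteq> 0 \<and> (\<forall>i. is_form d (F i)) \<and>
      (\<forall>y\<in>X. form_at N y \<noteq> 0 \<longrightarrow> (\<chi> i. form_at (F i) y) \<noteq> 0 \<and>
        linear_proj_map A y = abs_proj (\<chi> i. form_at (F i) y))"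
    by (rule exI[of _ 0], rule exI[of _ 1], rule exI[of _ 1], rule exI[of _ "\<lambda>i. lin (A $ i)"])
      (use assms in \<open>auto simp: eq linear_proj_map_def simp del: One_nat_def\<close>)
qed simp

subsection \<open>Smooth points have a principal maximal ideal\<close>

text \<open>Induction over ring generators, the shape in which first-order expansions can be built
  up by sums and products.\<close>

lemma mpoly_induct:
  fixes F :: "('a::alg_closed_field, 'n::finite) mpoly"
  assumes const: "\<And>c. P (Poly_Mapping.single 0 c)" and var: "\<And>i. P (lin (axis i 1))"
    and add: "\<And>F G. P F \<Longrightarrow> P G \<Longrightarrow> P (F + G)" and mult: "\<And>F G. P F \<Longrightarrow> P G \<Longrightarrow> P (F * G)"
  shows "P F"
proof -
  have P1: "P 1" using const[of 1] by simp
  have P0: "P 0" using const[of 0] by simp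
  have pow: "P (G ^ k)" if "P G" for G k by (induction k) (auto intro: P1 mult that)
  have prod: "P (prod G A)" if "\<And>a. P (G a)" for G and A :: "'n set"
    by (induction A rule: infinite_finite_induct) (auto intro: P1 mult that)
  have "Poly_Mapping.single m c =
      Poly_Mapping.single 0 c * (\<Prod>i\<in>UNIV. lin (axis i 1) ^ Poly_Mapping.lookup m i)" for m :: "'n \<Rightarrow>\<^sub>0 nat" and c :: 'a
    by (rule mpoly_eqI) (simp add: mon_def)
  note single_eq = this
  have single: "P (Poly_Mapping.single m c)" for m c
    by (subst single_eq) (intro mult const prod pow var)
  have "P (sum G A)" if "\<And>a. P (G a)" for G and A :: "('n \<Rightarrow>\<^sub>0 nat) set"
    by (induction A rule: infinite_finite_induct) (auto intro: P0 add that)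
  note sum = this
  show ?thesis by (subst mpoly_sum_monomials) (intro sum single)
qed

section \<open>Gradients and tangent spaces\<close>

definition grad :: "('a::field, 'n::finite) mpoly \<Rightarrow> 'a ^ 'n \<Rightarrow> 'a ^ 'n" where
  "grad F a = (\<chi> i. peval (mpderiv i F) a)"

lemma dotp_grad: "dotp (grad F a) v = Polynomial.coeff (lp F a v) (Suc 0)"
  by (simp add: coeff_lp_Suc_0 grad_def dotp_def)

lemma grad_component: "grad F a $ i = Polynomial.coeff (lp F a (axis i 1)) (Suc 0)"
  using dotp_grad[of F a "axis i 1"] by simp

lemma coeff_mult_Suc_0: "Polynomial.coeff (p * q) (Suc 0) =
    Polynomial.coeff p 0 * Polynomial.coeff q (Suc 0) + Polynomial.coeff p (Suc 0) * Polynomial.coeff q 0"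
  by (simp add: coeff_mult)

lemma grad_mult:
  fixes F G :: "('a::alg_closed_field, 'n::finite) mpoly"
  shows "grad (F * G) a = peval F a *s grad G a + peval G a *s grad F a"
proof -
  have "lp (F * G) a v = lp F a v * lp G a v" for v by (rule lp_eqI) simp
  then show ?thesis by (simp add: vec_eq_iff grad_component coeff_mult_Suc_0 mult.commute)
qed

lemma grad_add:
  fixes F G :: "('a::alg_closed_field, 'n::finite) mpoly"
  shows "grad (F + G) a = grad F a + grad G a"
proof -
  have "lp (F + G) a v = lp F a v + lp G a v" for v by (rule lp_eqI) simp
  then show ?thesis by (simp add: vec_eq_iff grad_component)
qed

lemma grad_const: "grad (Poly_Mapping.single 0 c) (a :: 'a::alg_closed_field ^ 'n::finite) = 0"
proof -
  have "lp (Poly_Mapping.single 0 c) a v = [:c:]" for v by (rule lp_eqI) simp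
  then show ?thesis by (simp add: vec_eq_iff grad_component)
qed

lemma grad_lin: "grad (lin l) (a :: 'a::alg_closed_field ^ 'n::finite) = l"
proof -
  have "lp (lin l) a v = [:dotp l a, dotp l v:]" for v by (rule lp_eqI) (simp add: mult.commute)
  then show ?thesis by (simp add: vec_eq_iff grad_component)
qed

text \<open>Euler's identity at a zero of F: the form vanishes on the whole line through 0 and a, so
  its derivative along that line is zero in every characteristic.\<close>

lemma dotp_grad_self:
  fixes F :: "('a::alg_closed_field, 'n::finite) mpoly"
  assumes "is_form d F" "peval F a = 0"
  shows "dotp (grad F a) a = 0"
proof -
  have "lp F a a = 0"
  proof (rule lp_eqI)
    fix t
    have "a + t *s a = (1 + t) *s a" by (simp add: vec_eq_iff distrib_right)
    show "peval F (a + t *s a) = poly 0 t"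
      unfolding \<open>a + t *s a = (1 + t) *s a\<close> peval_scale[OF assms(1)] by (simp add: assms(2))
  qed
  then show ?thesis by (simp add: dotp_grad)
qed

lemma tangent_space_grad:
  "tangent_space X x = {v. \<forall>d F. is_form d F \<and> (\<forall>y\<in>X. form_at F y = 0) \<longrightarrow> dotp (grad F (rep_proj x)) v = 0}"
  by (simp add: tangent_space_def form_at_def grad_def dotp_def)

lemma subspace_tangent_space: "vec.subspace (tangent_space X x)"
  unfolding tangent_space_grad by (auto simp: vec.subspace_def)

text \<open>Double annihilator in finite dimension: if l lay outside the span of N, a functional
  could vanish on N and not on l, and every functional is pairing with some vector v.\<close>

lemma span_annihilator:
  fixes N :: "('a::field ^ 'n::finite) set"
  assumes "\<And>v. (\<forall>w\<in>N. dotp w v = 0) \<Longrightarrow> dotp l v = 0"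
  shows "l \<in> vec.span N"
proof (rule ccontr)
  assume l: "l \<notin> vec.span N"
  obtain B where B: "B \<subseteq> N" "vec.independent B" "N \<subseteq> vec.span B"
    using vec.maximal_independent_subset[of N] by metis
  have "l \<notin> vec.span B" using l B(1) vec.span_mono by blast
  then have ind: "vec.independent (insert l B)" using B(2) by (rule vec.independent_insertI)
  \<comment> \<open>An arbitrary coordinate: the functional is obtained as the i-th component of a
    linear self-map.\<close>
  obtain i :: 'n where True by simp
  obtain g where g: "Vector_Spaces.linear (*s) (*s) g"
    "\<forall>x\<in>insert l B. g x = (if x = l then axis i 1 else (0 :: 'a ^ 'n))"
    using vec.linear_independent_extend[OF ind, of "\<lambda>x. if x = l then axis i 1 else 0"] by blast
  define v where "v = (\<chi> j. g (axis j 1) $ i)"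
  have gv: "g w $ i = dotp w v" for w
  proof -
    have "g w = g (\<Sum>j\<in>UNIV. w $ j *s axis j 1)" by (simp add: basis_expansion)
    also have "\<dots> = (\<Sum>j\<in>UNIV. w $ j *s g (axis j 1))"
      by (simp add: vec.linear_sum[OF g(1)] vec.linear_scale[OF g(1)])
    finally show ?thesis by (simp add: v_def dotp_def sum_component)
  qed
  have "dotp w v = 0" if "w \<in> N" for w
  proof -
    have "w \<in> vec.span B" using that B(3) by blast
    then show ?thesis
    proof (induction rule: vec.span_induct_alt)
      case (step c x y)
      have "x \<noteq> l" using step(1) \<open>l \<notin> vec.span B\<close> vec.span_base by blast
      then have "g x = 0" using g(2) step(1) by auto
      then show ?case using step gv[of x] by simp
    qed simp
  qed
  then have "dotp l v = 0" using assms by blast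
  then show False using gv[of l] g(2) by simp
qed

text \<open>A generator of the maximal ideal, stated for germs. The nonvanishing condition rules out
  the degenerate case of a zero maximal ideal.\<close>

definition unif :: "('a::field, 'n::finite) proj set \<Rightarrow> ('a, 'n) proj \<Rightarrow> (('a, 'n) proj \<Rightarrow> 'a) \<Rightarrow> bool" where
  "unif X Q t \<longleftrightarrow> locv X Q t 0 \<and> (\<forall>\<^sub>F x in genf X. t x \<noteq> 0) \<and>
     (\<forall>f. locv X Q f 0 \<longrightarrow> (\<exists>g b. locv X Q g b \<and> (\<forall>\<^sub>F x in genf X. f x = g x * t x)))"

context
  fixes X :: "('a::alg_closed_field, 'n::finite) proj set"
  assumes irr: "irreducible_set X"
begin

text \<open>A first-order Taylor expansion in local functions w that vanish at Q: \<delta> is the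
  linear part, and the coefficients c lie in the maximal ideal, so the remainder is of second
  order.\<close>

definition has_expansion where
  "has_expansion Q w f \<alpha> \<delta> \<longleftrightarrow> (\<exists>c. (\<forall>i. locv X Q (c i) 0) \<and>
     (\<forall>x. f x = \<alpha> + (\<Sum>i\<in>UNIV. \<delta> $ i * w i x) + (\<Sum>i\<in>UNIV. c i x * w i x)))"
  for Q :: "('a, 'n) proj" and w :: "'n \<Rightarrow> ('a, 'n) proj \<Rightarrow> 'a" and \<delta> :: "'a ^ 'n"

lemma has_expansion_add:
  assumes "has_expansion Q w f \<alpha> \<delta>" "has_expansion Q w g \<beta> \<epsilon>"
  shows "has_expansion Q w (\<lambda>x. f x + g x) (\<alpha> + \<beta>) (\<delta> + \<epsilon>)"
proof -
  obtain c where c: "\<And>i. locv X Q (c i) 0"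
    "\<And>x. f x = \<alpha> + (\<Sum>i\<in>UNIV. \<delta> $ i * w i x) + (\<Sum>i\<in>UNIV. c i x * w i x)"
    using assms(1) unfolding has_expansion_def by blast
  obtain c' where c': "\<And>i. locv X Q (c' i) 0"
    "\<And>x. g x = \<beta> + (\<Sum>i\<in>UNIV. \<epsilon> $ i * w i x) + (\<Sum>i\<in>UNIV. c' i x * w i x)"
    using assms(2) unfolding has_expansion_def by blast
  show ?thesis unfolding has_expansion_def
    using locv_add[OF irr c(1) c'(1)]
    by (intro exI[of _ "\<lambda>i x. c i x + c' i x"]) (simp add: c c' sum.distrib algebra_simps)
qed

lemma has_expansion_mult:
  assumes w: "\<And>i. locv X Q (w i) 0"
    and "has_expansion Q w f \<alpha> \<delta>" "has_expansion Q w g \<beta> \<epsilon>"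
  shows "has_expansion Q w (\<lambda>x. f x * g x) (\<alpha> * \<beta>) (\<alpha> *s \<epsilon> + \<beta> *s \<delta>)"
proof -
  have Q: "Q \<in> X" using w locv_in by blast
  obtain c where c: "\<And>i. locv X Q (c i) 0"
    "\<And>x. f x = \<alpha> + (\<Sum>i\<in>UNIV. \<delta> $ i * w i x) + (\<Sum>i\<in>UNIV. c i x * w i x)"
    using assms(2) unfolding has_expansion_def by blast
  obtain c' where c': "\<And>i. locv X Q (c' i) 0"
    "\<And>x. g x = \<beta> + (\<Sum>i\<in>UNIV. \<epsilon> $ i * w i x) + (\<Sum>i\<in>UNIV. c' i x * w i x)"
    using assms(3) unfolding has_expansion_def by blast
  define E where "E x = (\<Sum>i\<in>UNIV. (\<epsilon> $ i + c' i x) * w i x)" for x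
  define D where "D x = (\<Sum>i\<in>UNIV. (\<delta> $ i + c i x) * w i x)" for x
  have f: "f x = \<alpha> + D x" for x by (simp add: c(2) D_def distrib_right sum.distrib)
  have g: "g x = \<beta> + E x" for x by (simp add: c'(2) E_def distrib_right sum.distrib)
  have E: "locv X Q E 0"
  proof -
    have "locv X Q E (\<Sum>i\<in>UNIV. (\<epsilon> $ i + 0) * 0)"
      unfolding E_def by (intro locv_sum[OF irr] locv_mult[OF irr] locv_add[OF irr] locv_const[OF irr] Q w c')
    then show ?thesis by simp
  qed
  \<comment> \<open>In the product of the linear parts D and E, the factor E is absorbed into the
    coefficients of D; as it vanishes at Q, the product belongs to the remainder.\<close>
  define h where "h i x = \<alpha> * c' i x + \<beta> * c i x + (\<delta> $ i + c i x) * E x" for i x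
  have h: "locv X Q (h i) 0" for i
  proof -
    have "locv X Q (h i) (\<alpha> * 0 + \<beta> * 0 + (\<delta> $ i + 0) * 0)"
      unfolding h_def by (intro locv_mult[OF irr] locv_add[OF irr] locv_const[OF irr] Q c c' E)
    then show ?thesis by simp
  qed
  have "f x * g x = \<alpha> * \<beta> + (\<Sum>i\<in>UNIV. (\<alpha> *s \<epsilon> + \<beta> *s \<delta>) $ i * w i x) + (\<Sum>i\<in>UNIV. h i x * w i x)" for x
  proof -
    have DE: "D x * E x = (\<Sum>i\<in>UNIV. (\<delta> $ i + c i x) * w i x * E x)"
      by (simp add: D_def sum_distrib_right)
    have "f x * g x = \<alpha> * \<beta> + (\<alpha> * E x + \<beta> * D x + D x * E x)"
      by (simp add: f g algebra_simps)
    also have "\<alpha> * E x + \<beta> * D x + D x * E x = (\<Sum>i\<in>UNIV. \<alpha> * ((\<epsilon> $ i + c' i x) * w i x)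
      + \<beta> * ((\<delta> $ i + c i x) * w i x) + (\<delta> $ i + c i x) * w i x * E x)"
      unfolding sum.distrib DE[symmetric] by (simp add: E_def D_def sum_distrib_left)
    also have "\<dots> = (\<Sum>i\<in>UNIV. (\<alpha> *s \<epsilon> + \<beta> *s \<delta>) $ i * w i x + h i x * w i x)"
      by (rule sum.cong) (simp_all add: h_def algebra_simps)
    finally show ?thesis by (simp add: sum.distrib add.assoc)
  qed
  then show ?thesis unfolding has_expansion_def using h by blast
qed

lemma has_expansion_peval:
  assumes w: "\<And>i. locv X Q (w i) 0"
  shows "has_expansion Q w (\<lambda>x. peval F (\<chi> i. a $ i + w i x)) (peval F a) (grad F a)"
proof (induction F rule: mpoly_induct)
  have Q: "Q \<in> X" using w locv_in by blast
  show "has_expansion Q w (\<lambda>x. peval (Poly_Mapping.single 0 c) (\<chi> i. a $ i + w i x))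
      (peval (Poly_Mapping.single 0 c) a) (grad (Poly_Mapping.single 0 c) a)" for c
    unfolding has_expansion_def by (rule exI[of _ "\<lambda>_ _. 0"]) (simp add: grad_const locv_const[OF irr Q])
  show "has_expansion Q w (\<lambda>x. peval (lin (axis i 1)) (\<chi> i. a $ i + w i x))
      (peval (lin (axis i 1)) a) (grad (lin (axis i 1)) a)" for i
  proof -
    have "(\<Sum>j\<in>UNIV. axis i 1 $ j * w j x) = w i x" for x
      using dotp_axis[of i "\<chi> j. w j x"] by (simp add: dotp_def)
    then show ?thesis unfolding has_expansion_def
      by (intro exI[of _ "\<lambda>_ _. 0"]) (simp add: grad_lin locv_const[OF irr Q])
  qed
next
  case (3 F G)
  then show ?case using has_expansion_add[OF 3] by (simp add: grad_add)
next
  case (4 F G)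
  then show ?case using has_expansion_mult[OF w 4] by (simp add: grad_mult)
qed

text \<open>Nakayama's lemma as Gaussian elimination: the equation for \<open>w s\<close> is solved
  for \<open>w s\<close> by dividing by 1 - \<open>c0 s\<close>, a unit because \<open>c0 s\<close>
  vanishes at Q, and is substituted into the others.\<close>

lemma nakayama:
  assumes "finite S"
    and "\<And>i. \<exists>b \<beta> c. locv X Q b \<beta> \<and> (\<forall>j\<in>S. locv X Q (c j) 0) \<and>
      (\<forall>\<^sub>F x in genf X. w i x = b x * \<tau> x + (\<Sum>j\<in>S. c j x * w j x))"
  shows "\<exists>b \<beta>. locv X Q b \<beta> \<and> (\<forall>\<^sub>F x in genf X. w i x = b x * \<tau> x)"
  using assms
proof (induction S arbitrary: i)
  case empty
  from empty[of i] show ?case by simp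
next
  case (insert s S)
  obtain b0 \<beta>0 c0 where 0: "locv X Q b0 \<beta>0" "\<And>j. j \<in> insert s S \<Longrightarrow> locv X Q (c0 j) 0"
    "\<forall>\<^sub>F x in genf X. w s x = b0 x * \<tau> x + (\<Sum>j\<in>insert s S. c0 j x * w j x)"
    using insert.prems[of s] by blast
  have Q: "Q \<in> X" using 0 locv_in by blast
  have u1: "locv X Q (\<lambda>x. 1 - c0 s x) 1"
    using locv_diff[OF irr locv_const[OF irr Q, of 1] 0(2)[of s]] by simp
  have u2: "\<forall>\<^sub>F x in genf X. 1 - c0 s x \<noteq> 0" using locv_nonzero[OF irr u1] by simp
  have "\<exists>b \<beta> c. locv X Q b \<beta> \<and> (\<forall>j\<in>S. locv X Q (c j) 0) \<and>
      (\<forall>\<^sub>F x in genf X. w i x = b x * \<tau> x + (\<Sum>j\<in>S. c j x * w j x))" for i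
  proof -
    obtain b \<beta> c where 1: "locv X Q b \<beta>" "\<And>j. j \<in> insert s S \<Longrightarrow> locv X Q (c j) 0"
      "\<forall>\<^sub>F x in genf X. w i x = b x * \<tau> x + (\<Sum>j\<in>insert s S. c j x * w j x)"
      using insert.prems[of i] by blast
    define b' where "b' x = b x + c s x * b0 x / (1 - c0 s x)" for x
    define c' where "c' j x = c j x + c s x * c0 j x / (1 - c0 s x)" for j x
    have "locv X Q b' (\<beta> + 0 * \<beta>0 / 1)"
      unfolding b'_def using 0 1 u1
      by (intro locv_add[OF irr] locv_divide[OF irr] locv_mult[OF irr]) auto
    moreover have "locv X Q (c' j) (0 + 0 * 0 / 1)" if "j \<in> S" for j
      unfolding c'_def using 0 1 u1 that
      by (intro locv_add[OF irr] locv_divide[OF irr] locv_mult[OF irr]) auto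
    moreover have "\<forall>\<^sub>F x in genf X. w i x = b' x * \<tau> x + (\<Sum>j\<in>S. c' j x * w j x)"
      using 0(3) 1(3) u2
    proof eventually_elim
      case (elim x)
      define \<Sigma>0 where "\<Sigma>0 = (\<Sum>j\<in>S. c0 j x * w j x)"
      define \<Sigma> where "\<Sigma> = (\<Sum>j\<in>S. c j x * w j x)"
      have "(1 - c0 s x) * w s x = b0 x * \<tau> x + \<Sigma>0"
        using elim(1) insert.hyps by (simp add: \<Sigma>0_def algebra_simps)
      then have ws: "w s x = (b0 x * \<tau> x + \<Sigma>0) / (1 - c0 s x)"
        using elim(3) by (simp add: field_simps)
      have "(\<Sum>j\<in>S. c' j x * w j x) =
          (\<Sum>j\<in>S. c j x * w j x + c s x / (1 - c0 s x) * (c0 j x * w j x))"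
        by (intro sum.cong refl) (use elim(3) in \<open>simp add: c'_def field_simps\<close>)
      then have "(\<Sum>j\<in>S. c' j x * w j x) = \<Sigma> + c s x / (1 - c0 s x) * \<Sigma>0"
        by (simp add: \<Sigma>0_def \<Sigma>_def sum.distrib sum_distrib_left)
      moreover have "w i x = b x * \<tau> x + c s x * w s x + \<Sigma>"
        using elim(2) insert.hyps by (simp add: \<Sigma>_def algebra_simps)
      ultimately show ?case
        using elim(3) unfolding ws b'_def by (simp add: distrib_left distrib_right add_divide_distrib mult_ac add_ac)
    qed
    ultimately show ?thesis by auto
  qed
  then show ?case by (rule insert.IH)
qed

text \<open>Affine coordinates centred at Q generate the maximal ideal, and gradients of forms
  vanishing on X are linear relations between them up to second order. Tangent dimension 2, one of
  it spanned by Q itself, leaves a single generator modulo second order; Nakayama's lemma removes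
  the remainder.\<close>

theorem smooth_point_uniformizers:
  assumes smooth: "smooth_point X Q" and "Q' \<in> X" "Q' \<noteq> Q"
  obtains b where "tangent_space X Q = vec.span {rep_proj Q, b}" "b \<notin> vec.span {rep_proj Q}"
    "\<And>t H. dotp t (rep_proj Q) = 0 \<Longrightarrow> dotp t b \<noteq> 0 \<Longrightarrow> dotp H (rep_proj Q) \<noteq> 0 \<Longrightarrow>
       unif X Q (\<lambda>x. dotp t (rep_proj x) / dotp H (rep_proj x))"
proof -
  define a where "a = rep_proj Q"
  define T where "T = tangent_space X Q"
  have Q: "Q \<in> X" and dim: "vec.dim T = 2" using smooth by (auto simp: smooth_point_def T_def)
  have aT: "a \<in> T" unfolding T_def tangent_space_grad a_def
    using dotp_grad_self Q by (auto simp: form_at_def)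
  have a0: "a \<noteq> 0" by (simp add: a_def)
  have "\<not> T \<subseteq> vec.span {a}"
  proof
    assume "T \<subseteq> vec.span {a}"
    then have "vec.dim T \<le> vec.dim {a}" by (rule vec.dim_mono)
    then show False using dim a0 by simp
  qed
  then obtain b where b: "b \<in> T" "b \<notin> vec.span {a}" by blast
  have ind: "vec.independent {b, a}"
    using b(2) a0 by (intro vec.independent_insertI) (auto simp: vec.independent_empty)
  have "b \<noteq> a" using b(2) vec.span_base by blast
  then have "T \<subseteq> vec.span {b, a}"
    using b aT ind dim by (intro vec.card_ge_dim_independent) auto
  moreover have "vec.span {b, a} \<subseteq> T"
    using b aT subspace_tangent_space[of X Q] by (intro vec.span_minimal) (auto simp: T_def)
  ultimately have T: "T = vec.span {a, b}" by (simp add: insert_commute)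
  \<comment> \<open>The second point \<open>Q'\<close> provides a linear form that vanishes at Q but
    not identically on X, so the maximal ideal is not zero.\<close>
  have nontriv: "\<exists>f. locv X Q f 0 \<and> (\<forall>\<^sub>F x in genf X. f x \<noteq> 0)"
  proof -
    have "\<exists>l. dotp l a = 0 \<and> dotp l (rep_proj Q') \<noteq> 0"
    proof (rule ccontr)
      assume *: "\<nexists>l. dotp l a = 0 \<and> dotp l (rep_proj Q') \<noteq> 0"
      obtain c where "c \<noteq> 0" "rep_proj Q' = c *s a"
      proof (rule proportional_vectors[of a "rep_proj Q'"])
        fix i j
        have "dotp (a $ i *s axis j 1 - a $ j *s axis i 1) a = 0" by simp
        then have "dotp (a $ i *s axis j 1 - a $ j *s axis i 1) (rep_proj Q') = 0" using * by blast
        then show "a $ i * rep_proj Q' $ j = a $ j * rep_proj Q' $ i" by simp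
      qed (use a0 in auto)
      then have "Q' = Q" using abs_proj_scale[of c a] a0 by (metis a_def abs_rep_proj)
      then show False using assms(3) by simp
    qed
    then obtain l where l: "dotp l a = 0" "dotp l (rep_proj Q') \<noteq> 0" by blast
    obtain i where i: "form_at (lin (axis i 1)) Q \<noteq> 0" using exists_coordinate_nonzero .
    have "locv X Q (\<lambda>x. form_at (lin l) x / form_at (lin (axis i 1)) x) (form_at (lin l) Q / form_at (lin (axis i 1)) Q)"
      by (rule locv_form_quotient[OF irr is_form_lin(1) is_form_lin(1) Q i])
    moreover have "form_at (lin l) Q = 0" using l(1) by (simp add: form_at_lin a_def)
    moreover have "\<forall>\<^sub>F x in genf X. form_at (lin l) x / form_at (lin (axis i 1)) x \<noteq> 0"
      using eventually_genf_form_nonzero[OF irr is_form_lin(1) Q i]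
        eventually_genf_form_nonzero[OF irr is_form_lin(1) assms(2), of l] l(2)
      by (auto simp: form_at_lin eventually_conj_iff)
    ultimately show ?thesis by auto
  qed
  have "unif X Q (\<lambda>x. dotp t (rep_proj x) / dotp H (rep_proj x))"
    if t: "dotp t a = 0" "dotp t b \<noteq> 0" and H: "dotp H a \<noteq> 0" for t H
  proof -
    define \<tau> where "\<tau> x = dotp t (rep_proj x) / dotp H (rep_proj x)" for x :: "('a, 'n) proj"
    have HX: "\<forall>\<^sub>F x in genf X. dotp H (rep_proj x) \<noteq> 0"
      using eventually_genf_form_nonzero[OF irr is_form_lin(1) Q, of H] H by (simp add: form_at_lin a_def)
    \<comment> \<open>Coordinates centred at Q, normalized so that a + w is the multiple of the
      representative of x on which H takes the value H(a).\<close>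
    define w where "w i x = (dotp H a * rep_proj x $ i - a $ i * dotp H (rep_proj x)) / dotp H (rep_proj x)"
      for i and x :: "('a, 'n) proj"
    have locl: "locv X Q (\<lambda>x. dotp l (rep_proj x) / dotp H (rep_proj x)) (dotp l a / dotp H a)" for l
      using locv_form_quotient[OF irr is_form_lin(1) is_form_lin(1) Q, of H l] H by (simp add: form_at_lin a_def)
    define lf where "lf i = dotp H a *s axis i 1 - a $ i *s H" for i
    have w_alt: "w i = (\<lambda>x. dotp (lf i) (rep_proj x) / dotp H (rep_proj x))" for i
      by (auto simp: w_def lf_def)
    have w: "locv X Q (w i) 0" for i
      unfolding w_alt using locl[of "lf i"] by (simp add: lf_def mult.commute)
    have aw: "(\<chi> i. a $ i + w i x) = (dotp H a / dotp H (rep_proj x)) *s rep_proj x"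
      if "dotp H (rep_proj x) \<noteq> 0" for x
      using that by (simp add: vec_eq_iff w_def field_simps)
    have dotw: "(\<Sum>i\<in>UNIV. l $ i * w i x) = dotp H a * (dotp l (rep_proj x) / dotp H (rep_proj x)) - dotp l a"
      if "dotp H (rep_proj x) \<noteq> 0" for x l
    proof -
      have "(\<Sum>i\<in>UNIV. l $ i * w i x) = dotp l (\<chi> i. a $ i + w i x) - dotp l a"
        by (simp add: dotp_def distrib_left sum.distrib)
      then show ?thesis unfolding aw[OF that] by simp
    qed
    \<comment> \<open>The linear forms whose value on w is of second order at Q. Expanding F(a + w)
      = 0 puts the gradient of every form vanishing on X into M.\<close>
    define M where "M = {l. \<exists>c. (\<forall>i. locv X Q (c i) 0) \<and>
      (\<forall>\<^sub>F x in genf X. (\<Sum>i\<in>UNIV. l $ i * w i x) = (\<Sum>i\<in>UNIV. c i x * w i x))}"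
    have subM: "vec.subspace M"
      unfolding vec.subspace_def
    proof (intro conjI ballI allI)
      show "0 \<in> M" unfolding M_def using locv_const[OF irr Q, of 0]
        by (intro CollectI exI[of _ "\<lambda>_ _. 0"]) simp
      show "l + l' \<in> M" if "l \<in> M" "l' \<in> M" for l l'
      proof -
        obtain c c' where c: "\<And>i. locv X Q (c i) 0" "\<And>i. locv X Q (c' i) 0"
          "\<forall>\<^sub>F x in genf X. (\<Sum>i\<in>UNIV. l $ i * w i x) = (\<Sum>i\<in>UNIV. c i x * w i x)"
          "\<forall>\<^sub>F x in genf X. (\<Sum>i\<in>UNIV. l' $ i * w i x) = (\<Sum>i\<in>UNIV. c' i x * w i x)"
          using \<open>l \<in> M\<close> \<open>l' \<in> M\<close> unfolding M_def by blast
        have "\<forall>\<^sub>F x in genf X. (\<Sum>i\<in>UNIV. (l + l') $ i * w i x) = (\<Sum>i\<in>UNIV. (c i x + c' i x) * w i x)"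
          using c(3,4) by eventually_elim (simp add: distrib_right sum.distrib)
        moreover have "locv X Q (\<lambda>x. c i x + c' i x) 0" for i using locv_add[OF irr c(1)[of i] c(2)[of i]] by simp
        ultimately show ?thesis
          unfolding M_def by (intro CollectI exI[of _ "\<lambda>i x. c i x + c' i x"] conjI allI)
      qed
      show "k *s l \<in> M" if l: "l \<in> M" for k l
      proof -
        obtain c where c: "\<And>i. locv X Q (c i) 0"
          "\<forall>\<^sub>F x in genf X. (\<Sum>i\<in>UNIV. l $ i * w i x) = (\<Sum>i\<in>UNIV. c i x * w i x)"
          using l unfolding M_def by blast
        have "\<forall>\<^sub>F x in genf X. (\<Sum>i\<in>UNIV. (k *s l) $ i * w i x) = (\<Sum>i\<in>UNIV. (k * c i x) * w i x)"
          using c(2) by eventually_elim (simp add: mult.assoc flip: sum_distrib_left)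
        moreover have "locv X Q (\<lambda>x. k * c i x) 0" for i
          using locv_mult[OF irr locv_const[OF irr Q, of k] c(1)[of i]] by simp
        ultimately show ?thesis
          unfolding M_def by (intro CollectI exI[of _ "\<lambda>i x. k * c i x"] conjI allI)
      qed
    qed
    have gradM: "grad F a \<in> M" if F: "is_form d F" "\<forall>y\<in>X. form_at F y = 0" for d F
    proof -
      obtain c where c: "\<And>i. locv X Q (c i) 0"
        "\<And>x. peval F (\<chi> i. a $ i + w i x) = peval F a + (\<Sum>i\<in>UNIV. grad F a $ i * w i x) + (\<Sum>i\<in>UNIV. c i x * w i x)"
        using has_expansion_peval[where w = w and Q = Q and F = F and a = a, OF w] unfolding has_expansion_def by blast
      have "\<forall>\<^sub>F x in genf X. (\<Sum>i\<in>UNIV. grad F a $ i * w i x) = (\<Sum>i\<in>UNIV. - c i x * w i x)"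
        using HX eventually_genf_in[OF irr]
      proof eventually_elim
        case (elim x)
        have "peval F (\<chi> i. a $ i + w i x) = 0"
          unfolding aw[OF elim(1)] peval_scale[OF F(1)] using F(2) elim(2) by (simp add: form_at_def)
        moreover have "peval F a = 0" using F(2) Q by (simp add: form_at_def a_def)
        ultimately show ?case using c(2)[of x] by (simp add: sum_negf eq_neg_iff_add_eq_0)
      qed
      moreover have "locv X Q (\<lambda>x. - c i x) 0" for i using locv_uminus[OF irr c(1)[of i]] by simp
      ultimately show ?thesis unfolding M_def by (intro CollectI exI[of _ "\<lambda>i x. - c i x"]) simp
    qed
    have wexp: "\<exists>b \<beta> c. locv X Q b \<beta> \<and> (\<forall>j\<in>UNIV. locv X Q (c j) 0) \<and>
      (\<forall>\<^sub>F x in genf X. w i x = b x * \<tau> x + (\<Sum>j\<in>UNIV. c j x * w j x))" for i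
    proof -
      \<comment> \<open>Chosen so that \<open>l'\<close> kills b as well as a, hence the whole
        tangent space; by duality \<open>l'\<close> is then a combination of gradients and lies in
        M.\<close>
      define \<kappa> where "\<kappa> = dotp (lf i) b / dotp t b"
      define l' where "l' = lf i - \<kappa> *s t"
      have la: "dotp (lf i) a = 0" by (simp add: lf_def mult.commute)
      have l': "dotp l' a = 0" "dotp l' b = 0" using t la by (simp_all add: l'_def \<kappa>_def)
      have "l' \<in> vec.span {grad F a |F. \<exists>d. is_form d F \<and> (\<forall>y\<in>X. form_at F y = 0)}"
      proof (rule span_annihilator)
        fix v assume "\<forall>w\<in>{grad F a |F. \<exists>d. is_form d F \<and> (\<forall>y\<in>X. form_at F y = 0)}. dotp w v = 0"
        then have "v \<in> T" unfolding T_def tangent_space_grad a_def by blast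
        then show "dotp l' v = 0" unfolding T
        proof (induction rule: vec.span_induct_alt)
          case (step c x y)
          then show ?case using l' by auto
        qed simp
      qed
      moreover have "vec.span {grad F a |F. \<exists>d. is_form d F \<and> (\<forall>y\<in>X. form_at F y = 0)} \<subseteq> M"
        using gradM subM by (intro vec.span_minimal) auto
      ultimately have "l' \<in> M" by blast
      then obtain c where c: "\<And>i. locv X Q (c i) 0"
          "\<forall>\<^sub>F x in genf X. (\<Sum>i\<in>UNIV. l' $ i * w i x) = (\<Sum>i\<in>UNIV. c i x * w i x)"
        unfolding M_def by blast
      have "\<forall>\<^sub>F x in genf X. w i x = \<kappa> * \<tau> x + (\<Sum>j\<in>UNIV. (1 / dotp H a * c j x) * w j x)"
        using c(2) HX
      proof eventually_elim
        case (elim x)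
        have "(\<Sum>j\<in>UNIV. (1 / dotp H a * c j x) * w j x) = 1 / dotp H a * (\<Sum>j\<in>UNIV. l' $ j * w j x)"
          unfolding elim(1) by (simp add: sum_distrib_left mult.assoc)
        also have "\<dots> = dotp l' (rep_proj x) / dotp H (rep_proj x)"
          using dotw[OF elim(2), of l'] l'(1) H by simp
        also have "\<dots> = w i x - \<kappa> * \<tau> x"
          by (simp add: w_alt l'_def \<tau>_def diff_divide_distrib)
        finally show ?case by simp
      qed
      moreover have "locv X Q (\<lambda>x. 1 / dotp H a * c j x) 0" for j
        using locv_mult[OF irr locv_const[OF irr Q, of "1 / dotp H a"] c(1)[of j]] by simp
      ultimately show ?thesis
        using locv_const[OF irr Q, of \<kappa>]
        by (intro exI[of _ "\<lambda>_. \<kappa>"] exI[of _ \<kappa>] exI[of _ "\<lambda>j x. 1 / dotp H a * c j x"]) simp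
    qed
    have w\<tau>: "\<exists>b \<beta>. locv X Q b \<beta> \<and> (\<forall>\<^sub>F x in genf X. w i x = b x * \<tau> x)" for i
      by (rule nakayama[OF finite[of UNIV] wexp])
    then obtain bb \<beta>\<beta> where bb: "\<And>i. locv X Q (bb i) (\<beta>\<beta> i)" "\<And>i. \<forall>\<^sub>F x in genf X. w i x = bb i x * \<tau> x"
      by metis
    have prin: "\<exists>g b. locv X Q g b \<and> (\<forall>\<^sub>F x in genf X. f x = g x * \<tau> x)" if f: "locv X Q f 0" for f
    proof -
      obtain d F G where FG: "is_form d F" "is_form d G" "form_at G Q \<noteq> 0" "0 = form_at F Q / form_at G Q"
        "\<forall>\<^sub>F x in genf X. form_at G x \<noteq> 0 \<and> f x = form_at F x / form_at G x"
        by (rule locvE[OF irr f]) (rule that)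
      have Fa: "peval F a = 0" using FG by (simp add: form_at_def a_def)
      obtain c where c: "\<And>i. locv X Q (c i) 0"
        "\<And>x. peval F (\<chi> i. a $ i + w i x) = peval F a + (\<Sum>i\<in>UNIV. grad F a $ i * w i x) + (\<Sum>i\<in>UNIV. c i x * w i x)"
        using has_expansion_peval[where w = w and Q = Q and F = F and a = a, OF w] unfolding has_expansion_def by blast
      \<comment> \<open>Each \<open>w i\<close> in the expansion of F is replaced by its multiple of
        \<tau>; the last factor undoes the rescaling of homogeneous coordinates and divides by
        G.\<close>
      define g where "g x = (\<Sum>i\<in>UNIV. (grad F a $ i + c i x) * bb i x) *
        (1 / dotp H a ^ d * (form_at (lin H ^ d) x / form_at G x))" for x
      have "is_form d (lin H ^ d)" using is_form_power[OF is_form_lin(1)[of H], of d] by simp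
      then have "locv X Q g ((\<Sum>i\<in>UNIV. (grad F a $ i + 0) * \<beta>\<beta> i) * (1 / dotp H a ^ d * (form_at (lin H ^ d) Q / form_at G Q)))"
        unfolding g_def
        by (intro locv_mult[OF irr] locv_sum[OF irr] locv_add[OF irr] locv_const[OF irr] Q c bb
            locv_form_quotient[OF irr _ FG(2) Q FG(3)])
      moreover have "\<forall>\<^sub>F x in genf X. \<forall>i\<in>UNIV. w i x = bb i x * \<tau> x"
        using bb(2) by (intro eventually_ball_finite) auto
      then have "\<forall>\<^sub>F x in genf X. f x = g x * \<tau> x"
        using FG(5) HX
      proof eventually_elim
        case (elim x)
        have "(dotp H a / dotp H (rep_proj x)) ^ d * form_at F x = (\<Sum>i\<in>UNIV. (grad F a $ i + c i x) * w i x)"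
          using c(2)[of x] unfolding aw[OF elim(3)] peval_scale[OF FG(1)]
          by (simp add: Fa form_at_def distrib_right sum.distrib)
        also have "\<dots> = (\<Sum>i\<in>UNIV. (grad F a $ i + c i x) * bb i x) * \<tau> x"
          using elim(1) by (simp add: sum_distrib_right mult.assoc)
        finally have "form_at F x = (\<Sum>i\<in>UNIV. (grad F a $ i + c i x) * bb i x) * \<tau> x *
            (dotp H (rep_proj x) / dotp H a) ^ d"
          using elim(3) H by (simp add: field_simps)
        then show ?case
          using elim(2) by (simp add: g_def form_at_lin power_divide)
      qed
      ultimately show ?thesis by blast
    qed
    have "locv X Q \<tau> 0" using locl[of t] t by (simp add: \<tau>_def[abs_def])
    moreover have "\<forall>\<^sub>F x in genf X. \<tau> x \<noteq> 0"
    proof -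
      obtain f where f: "locv X Q f 0" "\<forall>\<^sub>F x in genf X. f x \<noteq> 0" using nontriv by blast
      obtain g where "\<forall>\<^sub>F x in genf X. f x = g x * \<tau> x" using prin[OF f(1)] by blast
      with f(2) show ?thesis by eventually_elim auto
    qed
    ultimately show ?thesis using prin unfolding unif_def \<tau>_def by blast
  qed
  then show ?thesis using that[of b] T b(2) by (simp add: T_def a_def)
qed

end

subsection \<open>Polynomials in two variables\<close>

text \<open>The coefficients are polynomials in the first variable and the outer polynomial is in
  the second. Hence degree and leading coefficient always refer to the second variable.\<close>

definition ev :: "'a::field poly poly \<Rightarrow> 'a \<Rightarrow> 'a \<Rightarrow> 'a" where
  "ev P a b = poly (poly P [:b:]) a"

lemma ev_simps [simp]:
  "ev 0 a b = 0" "ev 1 a b = 1" "ev (P + Q) a b = ev P a b + ev Q a b"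
  "ev (P * Q) a b = ev P a b * ev Q a b" "ev (P - Q) a b = ev P a b - ev Q a b"
  "ev (- P) a b = - ev P a b" "ev (P ^ k) a b = ev P a b ^ k"
  "ev (pCons p P) a b = poly p a + b * ev P a b"
  "ev (Polynomial.smult p P) a b = poly p a * ev P a b"
  by (simp_all add: ev_def)

lemma ev_sum [simp]: "ev (sum P A) a b = (\<Sum>i\<in>A. ev (P i) a b)"
  by (simp add: ev_def poly_sum)
lemma ev_prod [simp]: "ev (prod P A) a b = (\<Prod>i\<in>A. ev (P i) a b)"
  by (simp add: ev_def poly_prod)

definition sp :: "'a::field poly poly \<Rightarrow> 'a \<Rightarrow> 'a poly" where
  "sp P a = map_poly (\<lambda>p. poly p a) P"

lemma coeff_sp [simp]: "Polynomial.coeff (sp P a) i = poly (Polynomial.coeff P i) a"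
  by (simp add: sp_def coeff_map_poly)

lemma poly_sp [simp]: "poly (sp P a) b = ev P a b"
proof (induction P)
  case (pCons p P)
  have "sp (pCons p P) a = pCons (poly p a) (sp P a)"
    by (rule poly_eqI) (simp add: coeff_pCons split: nat.split)
  then show ?case using pCons by simp
qed (simp add: sp_def)

lemma degree_sp_le: "degree (sp P a) \<le> degree P"
  by (rule degree_le) (simp add: coeff_eq_0)

lemma ev_eqI:
  fixes P Q :: "'a::alg_closed_field poly poly"
  assumes "\<And>a b. ev P a b = ev Q a b"
  shows "P = Q"
proof (rule poly_eqI)
  fix i
  have "sp P a = sp Q a" for a by (rule poly_eqI_infinite) (simp add: assms)
  then have "poly (Polynomial.coeff P i) a = poly (Polynomial.coeff Q i) a" for a
    by (metis coeff_sp)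
  then show "Polynomial.coeff P i = Polynomial.coeff Q i" by (rule poly_eqI_infinite)
qed

lemma sp_mult:
  fixes P Q :: "'a::alg_closed_field poly poly"
  shows "sp (P * Q) a = sp P a * sp Q a"
  by (rule poly_eqI_infinite) simp

lemma sp_eq_0_imp_smult:
  assumes "sp P c = 0"
  obtains P' where "P = Polynomial.smult [:-c, 1:] P'"
proof (rule that)
  have "[:-c, 1:] dvd Polynomial.coeff P i" for i
    using assms coeff_sp[of P c i] by (simp add: poly_eq_0_iff_dvd)
  then show "P = Polynomial.smult [:-c, 1:] (map_poly (\<lambda>p. p div [:-c, 1:]) P)"
    by (intro poly_eqI) (simp add: coeff_map_poly del: mult_pCons_left)
qed

text \<open>Splitting off the content. Over an algebraically closed field a polynomial in the second
  variable is primitive iff no specialization of the first variable kills it; each linear factor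
  removed lowers the degree of the leading coefficient.\<close>

lemma primitive_decomposition:
  fixes P :: "'a::field poly poly"
  assumes "P \<noteq> 0"
  shows "\<exists>q P0. q \<noteq> 0 \<and> P = Polynomial.smult q P0 \<and> (\<forall>c. sp P0 c \<noteq> 0)"
  using assms
proof (induction "degree (lead_coeff P)" arbitrary: P rule: less_induct)
  case less
  show ?case
  proof (cases "\<exists>c. sp P c = 0")
    case True
    then obtain c P' where P': "P = Polynomial.smult [:-c, 1:] P'" using sp_eq_0_imp_smult by metis
    then have "P' \<noteq> 0" using less.prems by auto
    moreover have "lead_coeff P = [:-c, 1:] * lead_coeff P'" unfolding P' by (simp del: mult_pCons_left)
    then have "degree (lead_coeff P) = 1 + degree (lead_coeff P')"
      using \<open>P' \<noteq> 0\<close> by (simp add: degree_mult_eq del: mult_pCons_left)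
    ultimately obtain q P0 where "q \<noteq> 0" "P' = Polynomial.smult q P0" "\<forall>c. sp P0 c \<noteq> 0"
      using less.hyps[of P'] by auto
    then show ?thesis using P'
      by (intro exI[of _ "[:-c, 1:] * q"] exI[of _ P0]) (simp del: mult_pCons_left)
  next
    case False
    then show ?thesis by (intro exI[of _ 1] exI[of _ P]) auto
  qed
qed

text \<open>Gauss's lemma: at a root c of the scalar l the right side specializes to zero, and as M
  does not, the cofactor q is divisible by the linear factor, which cancels.\<close>

lemma strip_scalar:
  fixes h M q :: "'a::alg_closed_field poly poly"
  assumes "Polynomial.smult l h = M * q" "l \<noteq> 0" "\<forall>c. sp M c \<noteq> 0"
  shows "M dvd h"
  using assms
proof (induction "degree l" arbitrary: l q rule: less_induct)
  case less
  show ?case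
  proof (cases "degree l = 0")
    case True
    then obtain k where k: "l = [:k:]" by (rule degree_eq_zeroE)
    then have "k \<noteq> 0" using less by auto
    have "h = Polynomial.smult [:1/k:] (Polynomial.smult l h)" using \<open>k \<noteq> 0\<close> by (simp add: k one_pCons[symmetric])
    also have "\<dots> = M * Polynomial.smult [:1/k:] q" unfolding less.prems(1) by simp
    finally show ?thesis by (rule dvdI)
  next
    case False
    then obtain c where c: "poly l c = 0" using alg_closed_imp_poly_has_root[of l] by blast
    have "sp (M * q) c = 0" by (rule poly_eqI_infinite) (simp add: c flip: less.prems(1))
    then have "sp q c = 0" using less.prems(3) by (simp add: sp_mult)
    then obtain q' where q': "q = Polynomial.smult [:-c, 1:] q'" by (rule sp_eq_0_imp_smult)
    obtain l' where l': "l = [:-c, 1:] * l'" using c by (auto simp: poly_eq_0_iff_dvd elim: dvdE)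
    have "l' \<noteq> 0" using l' less.prems(2) by auto
    have "Polynomial.smult [:-c, 1:] (Polynomial.smult l' h) = Polynomial.smult [:-c, 1:] (M * q')"
      using less.prems(1) unfolding l' q' by (simp del: mult_pCons_left)
    then have "Polynomial.smult [:-c, 1:] (Polynomial.smult l' h - M * q') = 0"
      by (simp only: smult_diff_right diff_self)
    then have "Polynomial.smult l' h = M * q'" by (simp only: smult_eq_0_iff) simp
    moreover have "degree l' < degree l"
      unfolding l' using \<open>l' \<noteq> 0\<close> by (simp add: degree_mult_eq del: mult_pCons_left)
    ultimately show ?thesis using less.hyps \<open>l' \<noteq> 0\<close> less.prems(3) by blast
  qed
qed

text \<open>Pseudo-division by an element of minimal degree in the vanishing ideal of \<open>S\<close>; linear factors
  in the first variable can be cancelled because the ground field is algebraically closed.\<close>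

lemma irreducible_dvd_vanishing:
  fixes f :: "'a::alg_closed_field poly poly"
  assumes f: "Factorial_Ring.irreducible f" "degree f > 0"
    and S: "\<And>a b. (a, b) \<in> S \<Longrightarrow> ev f a b = 0" "infinite (fst ` S)"
    and g: "\<And>a b. (a, b) \<in> S \<Longrightarrow> ev g a b = 0"
  shows "f dvd g"
proof -
  define I where "I = {g. \<forall>a b. (a, b) \<in> S \<longrightarrow> ev g a b = 0}"
  have fI: "f \<in> I" "f \<noteq> 0" using S f by (auto simp: I_def)
  define M where "M = arg_min degree (\<lambda>M. M \<in> I \<and> M \<noteq> 0)"
  have M: "M \<in> I" "M \<noteq> 0" "\<And>N. N \<in> I \<Longrightarrow> N \<noteq> 0 \<Longrightarrow> degree M \<le> degree N"
    using arg_min_natI[of "\<lambda>M. M \<in> I \<and> M \<noteq> 0" f degree] arg_min_nat_le[of "\<lambda>M. M \<in> I \<and> M \<noteq> 0" _ degree] fI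
    unfolding M_def by blast+
  \<comment> \<open>A nonzero polynomial in the first variable alone has finitely many roots, but
    the first coordinates of S are infinite in number.\<close>
  have "degree M > 0"
  proof (rule ccontr)
    assume "\<not> ?thesis"
    then obtain m where m: "M = [:m:]" by (metis degree_eq_zeroE gr0I)
    then have "fst ` S \<subseteq> {a. poly m a = 0}" using M(1) by (auto simp: I_def)
    moreover have "finite {a. poly m a = 0}" using m M(2) by (intro poly_roots_finite) auto
    ultimately show False using S(2) finite_subset by blast
  qed
  obtain p M0 where M0: "p \<noteq> 0" "M = Polynomial.smult p M0" "\<forall>c. sp M0 c \<noteq> 0"
    using primitive_decomposition[OF M(2)] by blast
  have "degree M0 > 0" using \<open>degree M > 0\<close> M0 by simp
  have dvd: "M0 dvd h" if "h \<in> I" for h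
  proof -
    obtain q r where qr: "pseudo_divmod h M = (q, r)" by fastforce
    define l where "l = lead_coeff M ^ (Suc (degree h) - degree M)"
    from pseudo_divmod[OF M(2) qr] have eq: "Polynomial.smult l h = M * q + r" "r = 0 \<or> degree r < degree M"
      by (simp_all add: l_def)
    then have "r = Polynomial.smult l h - M * q" by simp
    then have "r \<in> I" using that M(1) by (auto simp: I_def)
    then have "r = 0" using eq(2) M(3) by fastforce
    then have "Polynomial.smult l h = M0 * Polynomial.smult p q" using eq(1) by (simp add: M0(2))
    moreover have "l \<noteq> 0" using M(2) by (simp add: l_def)
    ultimately show ?thesis using strip_scalar M0(3) by blast
  qed
  obtain k where k: "f = M0 * k" using dvd[OF fI(1)] by (auto elim: dvdE)
  \<comment> \<open>A nonunit divisor of the irreducible f is associated to f, so f divides whatever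
    \<open>M0\<close> divides.\<close>
  have "\<not> M0 dvd 1" using \<open>degree M0 > 0\<close> by (auto simp: is_unit_poly_iff)
  then have "k dvd 1" using f(1) k by (auto simp: irreducible_def)
  then have "f dvd M0" unfolding k by (metis dvd_refl mult_unit_dvd_iff)
  moreover have "g \<in> I" using g by (auto simp: I_def)
  ultimately show ?thesis using dvd dvd_trans by blast
qed

lemma irreducible_sp_nonzero:
  fixes f :: "'a::alg_closed_field poly poly"
  assumes "Factorial_Ring.irreducible f" "degree f > 0"
  shows "sp f c \<noteq> 0"
proof
  assume "sp f c = 0"
  then obtain f' where f': "f = Polynomial.smult [:-c, 1:] f'" by (rule sp_eq_0_imp_smult)
  then have "f = [:[:-c, 1:]:] * f'" by simp
  moreover have "\<not> [:[:-c, 1:]:] dvd (1 :: 'a poly poly)" by (auto simp: is_unit_poly_iff)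
  ultimately have "f' dvd 1" using assms(1) by (meson irreducibleD)
  then have "degree f' = 0" by (auto simp: is_unit_poly_iff)
  then show False using assms(2) f' by simp
qed

subsection \<open>Valuation rings\<close>

definition valring :: "('a::field, 'n::finite) proj set \<Rightarrow> ('a, 'n) proj \<Rightarrow> bool" where
  "valring X Q \<longleftrightarrow> (\<forall>f. ratf X f \<longrightarrow> (\<exists>a. locv X Q f a) \<or> locv X Q (\<lambda>x. 1 / f x) 0)"

context
  fixes X :: "('a::alg_closed_field, 'n::finite) proj set"
  assumes irr: "irreducible_set X"
begin

lemma ratf_ev: "ratf X f \<Longrightarrow> ratf X g \<Longrightarrow> ratf X (\<lambda>x. ev P (f x) (g x))"
  by (induction P) (auto intro!: ratf_const ratf_add ratf_mult ratf_poly irr)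

lemma locv_ev: "locv X Q f a \<Longrightarrow> locv X Q g b \<Longrightarrow> locv X Q (\<lambda>x. ev P (f x) (g x)) (ev P a b)"
  by (induction P) (auto intro!: locv_const locv_add locv_mult locv_poly irr dest: locv_in)

lemma unif_unit_mult:
  assumes "unif X Q t" "locv X Q u a" "a \<noteq> 0" "\<forall>\<^sub>F x in genf X. s x = u x * t x"
  shows "unif X Q s"
  unfolding unif_def
proof (intro conjI allI impI)
  have u0: "\<forall>\<^sub>F x in genf X. u x \<noteq> 0" using locv_nonzero[OF irr assms(2,3)] .
  have t: "locv X Q t 0" using assms(1) by (simp add: unif_def)
  have "\<forall>\<^sub>F x in genf X. u x * t x = s x" using assms(4) by eventually_elim simp
  from locv_cong[OF locv_mult[OF irr assms(2) t] this]
  show "locv X Q s 0" by simp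
  have "\<forall>\<^sub>F x in genf X. t x \<noteq> 0" using assms(1) by (simp add: unif_def)
  then show "\<forall>\<^sub>F x in genf X. s x \<noteq> 0"
    using assms(4) u0 by eventually_elim simp
  fix f assume "locv X Q f 0"
  then obtain g b where g: "locv X Q g b" "\<forall>\<^sub>F x in genf X. f x = g x * t x"
    using assms(1) unfolding unif_def by blast
  have "\<forall>\<^sub>F x in genf X. f x = g x / u x * s x"
    using g(2) assms(4) u0 by eventually_elim simp
  then show "\<exists>g b. locv X Q g b \<and> (\<forall>\<^sub>F x in genf X. f x = g x * s x)"
    using locv_divide[OF irr g(1) assms(2,3)] by blast
qed

lemma unif_quotient:
  assumes "unif X Q t" "unif X Q s"
  obtains u a where "locv X Q u a" "a \<noteq> 0" "\<forall>\<^sub>F x in genf X. s x = u x * t x"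
proof -
  obtain g a where g: "locv X Q g a" "\<forall>\<^sub>F x in genf X. s x = g x * t x"
    using assms unfolding unif_def by blast
  obtain h b where h: "locv X Q h b" "\<forall>\<^sub>F x in genf X. t x = h x * s x"
    using assms unfolding unif_def by blast
  have "\<forall>\<^sub>F x in genf X. s x \<noteq> 0" using assms unfolding unif_def by blast
  then have "\<forall>\<^sub>F x in genf X. g x * h x = 1"
    using g(2) h(2)
  proof eventually_elim
    case (elim x)
    have "s x = g x * h x * s x" using elim(2,3) by (metis mult.assoc)
    then show ?case using elim(1) by simp
  qed
  then have "locv X Q (\<lambda>_. 1) (a * b)"
    by (rule locv_cong[OF locv_mult[OF irr g(1) h(1)]])
  then have "a * b = 1" using locv_unique[OF irr _ locv_const[OF irr locv_in[OF g(1)]]] by blast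
  then show ?thesis using that g by force
qed

text \<open>Order of vanishing at least n along t. A condition for each n, instead of an order
  function, makes sense before orders are known to be finite.\<close>

definition divn where
  "divn Q t n f \<longleftrightarrow> (\<exists>g b. locv X Q g b \<and> (\<forall>\<^sub>F x in genf X. f x = g x * t x ^ n))"
  for Q t f and n :: nat

context
  fixes Q t
  assumes t: "unif X Q t"
begin

lemma unif_locv: "locv X Q t 0" and unif_nonzero: "\<forall>\<^sub>F x in genf X. t x \<noteq> 0" and unif_in: "Q \<in> X"
  using t locv_in by (auto simp: unif_def)

lemma divnI: "locv X Q g b \<Longrightarrow> \<forall>\<^sub>F x in genf X. f x = g x * t x ^ n \<Longrightarrow> divn Q t n f"
  unfolding divn_def by blast

lemma divn_add: "divn Q t n f \<Longrightarrow> divn Q t n g \<Longrightarrow> divn Q t n (\<lambda>x. f x + g x)"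
  unfolding divn_def
proof (elim exE conjE)
  fix f' a g' b
  assume *: "locv X Q f' a" "\<forall>\<^sub>F x in genf X. f x = f' x * t x ^ n"
    "locv X Q g' b" "\<forall>\<^sub>F x in genf X. g x = g' x * t x ^ n"
  have "\<forall>\<^sub>F x in genf X. f x + g x = (f' x + g' x) * t x ^ n"
    using *(2,4) by eventually_elim (simp add: distrib_right)
  then show "\<exists>h b. locv X Q h b \<and> (\<forall>\<^sub>F x in genf X. f x + g x = h x * t x ^ n)"
    using locv_add[OF irr *(1,3)] by blast
qed

lemma divn_mult: "divn Q t n f \<Longrightarrow> divn Q t m g \<Longrightarrow> divn Q t (n + m) (\<lambda>x. f x * g x)"
  unfolding divn_def
proof (elim exE conjE)
  fix f' a g' b
  assume *: "locv X Q f' a" "\<forall>\<^sub>F x in genf X. f x = f' x * t x ^ n"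
    "locv X Q g' b" "\<forall>\<^sub>F x in genf X. g x = g' x * t x ^ m"
  have "\<forall>\<^sub>F x in genf X. f x * g x = (f' x * g' x) * t x ^ (n + m)"
    using *(2,4) by eventually_elim (simp add: power_add)
  then show "\<exists>h b. locv X Q h b \<and> (\<forall>\<^sub>F x in genf X. f x * g x = h x * t x ^ (n + m))"
    using locv_mult[OF irr *(1,3)] by blast
qed

lemma divn_0: "locv X Q f a \<Longrightarrow> divn Q t 0 f"
  by (rule divnI) auto

lemma divn_sum: "finite A \<Longrightarrow> (\<And>i. i \<in> A \<Longrightarrow> divn Q t n (f i)) \<Longrightarrow> divn Q t n (\<lambda>x. \<Sum>i\<in>A. f i x)"
proof (induction A rule: finite_induct)
  case empty
  show ?case by (rule divnI[OF locv_const[OF irr unif_in, of 0]]) simp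
next
  case (insert a A)
  then show ?case using divn_add by simp
qed

lemma divn_mono: "divn Q t n f \<Longrightarrow> m \<le> n \<Longrightarrow> divn Q t m f"
  unfolding divn_def
proof (elim exE conjE)
  fix g b assume *: "locv X Q g b" "\<forall>\<^sub>F x in genf X. f x = g x * t x ^ n" and "m \<le> n"
  have "\<forall>\<^sub>F x in genf X. f x = g x * t x ^ (n - m) * t x ^ m"
    using *(2) by eventually_elim (use \<open>m \<le> n\<close> in \<open>simp add: mult.assoc flip: power_add\<close>)
  then show "\<exists>g b. locv X Q g b \<and> (\<forall>\<^sub>F x in genf X. f x = g x * t x ^ m)"
    using locv_mult[OF irr *(1) locv_power[OF irr unif_locv]] by blast
qed

lemma divn_cong: "divn Q t n f \<Longrightarrow> \<forall>\<^sub>F x in genf X. f x = g x \<Longrightarrow> divn Q t n g"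
  unfolding divn_def
proof (elim exE conjE)
  fix h b assume *: "locv X Q h b" "\<forall>\<^sub>F x in genf X. f x = h x * t x ^ n" "\<forall>\<^sub>F x in genf X. f x = g x"
  have "\<forall>\<^sub>F x in genf X. g x = h x * t x ^ n" using *(2,3) by eventually_elim simp
  then show "\<exists>h b. locv X Q h b \<and> (\<forall>\<^sub>F x in genf X. g x = h x * t x ^ n)" using *(1) by blast
qed

lemma not_divn_unit:
  assumes "locv X Q u a" "a \<noteq> 0"
  shows "\<not> divn Q t (Suc n) (\<lambda>x. u x * t x ^ n)"
proof
  assume "divn Q t (Suc n) (\<lambda>x. u x * t x ^ n)"
  then obtain g b where g: "locv X Q g b" "\<forall>\<^sub>F x in genf X. u x * t x ^ n = g x * t x ^ Suc n"
    unfolding divn_def by blast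
  have "\<forall>\<^sub>F x in genf X. g x * t x = u x"
    using g(2) unif_nonzero by eventually_elim auto
  from locv_cong[OF locv_mult[OF irr g(1) unif_locv] this] have "locv X Q u (b * 0)" .
  then show False using locv_unique[OF irr assms(1)] assms(2) by auto
qed

text \<open>Take the least exponent that fails. One step below it the cofactor must be a unit at Q,
  since otherwise the uniformizer would split off once more.\<close>

lemma finite_order:
  assumes "locv X Q f a" "\<not> divn Q t n f"
  obtains m u b where "locv X Q u b" "b \<noteq> 0" "\<forall>\<^sub>F x in genf X. f x = u x * t x ^ m"
proof -
  define k where "k = (LEAST n. \<not> divn Q t n f)"
  have k1: "\<not> divn Q t k f"
    unfolding k_def by (rule LeastI[of "\<lambda>n. \<not> divn Q t n f", OF assms(2)])
  have "divn Q t j f" if "j < k" for j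
    using not_less_Least[OF that[unfolded k_def]] by simp
  note k = k1 this
  then obtain m where m: "k = Suc m" using divn_0[OF assms(1)] by (cases k) auto
  then obtain u b where u: "locv X Q u b" "\<forall>\<^sub>F x in genf X. f x = u x * t x ^ m"
    using k(2)[of m] unfolding divn_def by auto
  have "b \<noteq> 0"
  proof
    assume "b = 0"
    then obtain h c where h: "locv X Q h c" "\<forall>\<^sub>F x in genf X. u x = h x * t x"
      using t u(1) unfolding unif_def by blast
    have "\<forall>\<^sub>F x in genf X. f x = h x * t x ^ k"
      using u(2) h(2) by eventually_elim (simp add: m)
    then show False using k(1) h(1) divnI by blast
  qed
  then show ?thesis using that u by blast
qed

lemma poly_locv_0:
  assumes "locv X Q z 0" "q \<noteq> 0"
  obtains m u b where "locv X Q u b" "b \<noteq> 0" "\<And>x. poly q (z x) = u x * z x ^ m"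
proof -
  obtain q' where q': "q = [:-0, 1:] ^ Polynomial.order 0 q * q'" "\<not> [:-0, 1:] dvd q'"
    using order_decomp[OF assms(2), of 0] by blast
  have "poly q' 0 \<noteq> 0" using q'(2) poly_eq_0_iff_dvd by blast
  moreover have "poly q (z x) = poly q' (z x) * z x ^ Polynomial.order 0 q" for x
    by (subst q'(1)) (simp add: poly_power mult.commute)
  ultimately show ?thesis using that locv_poly[OF irr assms(1), of q'] by blast
qed

text \<open>The Krull intersection property, from algebraicity of the function field over \<open>k(z)\<close>.\<close>

theorem valring_of_unif:
  assumes z: "locv X Q z 0" "\<forall>\<^sub>F x in genf X. z x \<noteq> 0"
    and alg: "\<And>h. ratf X h \<Longrightarrow> \<exists>P. P \<noteq> 0 \<and> (\<forall>\<^sub>F x in genf X. ev P (z x) (h x) = 0)"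
  shows "valring X Q"
proof -
  \<comment> \<open>If z were divisible by all powers of t, a primitive equation of t over k[z]
    would have exactly one term of lowest order in t, so its terms could not sum to zero.\<close>
  have z_finite: "\<exists>n. \<not> divn Q t n z"
  proof (rule ccontr)
    assume "\<nexists>n. \<not> divn Q t n z"
    then have zn: "divn Q t n z" for n by blast
    obtain P where P: "P \<noteq> 0" "\<forall>\<^sub>F x in genf X. ev P (z x) (t x) = 0"
      using alg[OF locv_ratf[OF irr unif_locv]] by blast
    obtain q P0 where q: "q \<noteq> 0" "P = Polynomial.smult q P0" "\<forall>c. sp P0 c \<noteq> 0"
      using primitive_decomposition[OF P(1)] by blast
    obtain m u b where u: "locv X Q u b" "b \<noteq> 0" "\<And>x. poly q (z x) = u x * z x ^ m"
      by (rule poly_locv_0[OF z(1) q(1)]) (rule that)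
    have P0: "\<forall>\<^sub>F x in genf X. ev P0 (z x) (t x) = 0"
      using P(2) z(2) locv_nonzero[OF irr u(1,2)] by eventually_elim (simp add: q(2) u(3))
    \<comment> \<open>The first coefficient of \<open>P0\<close> that is a unit at Q, which exists
      by primitivity at z = 0. Earlier coefficients are divisible by z and later terms by higher
      powers of t.\<close>
    define i0 where "i0 = (LEAST i. poly (Polynomial.coeff P0 i) 0 \<noteq> 0)"
    have ex: "\<exists>i. poly (Polynomial.coeff P0 i) 0 \<noteq> 0"
      using q(3) by (metis coeff_sp leading_coeff_0_iff)
    have i01: "poly (Polynomial.coeff P0 i0) 0 \<noteq> 0"
      unfolding i0_def by (rule LeastI_ex[OF ex])
    have "poly (Polynomial.coeff P0 i) 0 = 0" if "i < i0" for i
      using not_less_Least[OF that[unfolded i0_def]] by simp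
    note i0 = i01 this
    let ?c = "\<lambda>i x. poly (Polynomial.coeff P0 i) (z x)"
    have c: "locv X Q (?c i) (poly (Polynomial.coeff P0 i) 0)" for i
      by (rule locv_poly[OF irr z(1)])
    have other: "divn Q t (Suc i0) (\<lambda>x. ?c i x * t x ^ i)" if "i \<noteq> i0" for i
    proof (cases "i < i0")
      case True
      then obtain r where r: "Polynomial.coeff P0 i = [:0, 1:] * r"
        using i0(2)[OF True] by (auto simp: poly_eq_0_iff_dvd elim: dvdE)
      have "divn Q t (Suc i0 + 0) (\<lambda>x. z x * (poly r (z x) * t x ^ i))"
        by (rule divn_mult[OF zn divn_0[OF locv_mult[OF irr locv_poly[OF irr z(1)] locv_power[OF irr unif_locv]]]])
      then show ?thesis by (simp add: r mult.assoc)
    next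
      case False
      then have "Suc i0 \<le> i" using that by simp
      moreover have "divn Q t i (\<lambda>x. ?c i x * t x ^ i)" by (rule divnI[OF c[of i]]) simp
      ultimately show ?thesis by (rule divn_mono[rotated])
    qed
    have evP: "ev P0 a b = (\<Sum>i\<le>degree P0. poly (Polynomial.coeff P0 i) a * b ^ i)" for a b
      by (simp add: ev_def poly_altdef[of P0] poly_sum poly_power)
    have "i0 \<le> degree P0" using i0(1) by (metis coeff_eq_0 not_le poly_0)
    then have "ev P0 a b = poly (Polynomial.coeff P0 i0) a * b ^ i0 +
        (\<Sum>i\<in>{..degree P0} - {i0}. poly (Polynomial.coeff P0 i) a * b ^ i)" for a b
      unfolding evP by (intro sum.remove) auto
    note split = this
    have "divn Q t (Suc i0) (\<lambda>x. \<Sum>i\<in>{..degree P0} - {i0}. ?c i x * t x ^ i)"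
      by (rule divn_sum) (use other in auto)
    from divn_mult[OF divn_0[OF locv_const[OF irr unif_in, of "-1"]] this]
    have "divn Q t (Suc i0) (\<lambda>x. - (\<Sum>i\<in>{..degree P0} - {i0}. ?c i x * t x ^ i))" by simp
    moreover have "\<forall>\<^sub>F x in genf X. - (\<Sum>i\<in>{..degree P0} - {i0}. ?c i x * t x ^ i) = ?c i0 x * t x ^ i0"
      using P0 by eventually_elim (simp add: split neg_eq_iff_add_eq_0 add.commute)
    ultimately have "divn Q t (Suc i0) (\<lambda>x. ?c i0 x * t x ^ i0)" by (rule divn_cong)
    then show False using not_divn_unit[OF c[of i0] i0(1)] by blast
  qed
  then obtain n where n: "\<not> divn Q t n z" by blast
  obtain k v e where v: "locv X Q v e" "e \<noteq> 0" "\<forall>\<^sub>F x in genf X. z x = v x * t x ^ k"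
    using finite_order[OF z(1) n] .
  have expand: "\<exists>m u b. locv X Q u b \<and> b \<noteq> 0 \<and> (\<forall>\<^sub>F x in genf X. f x = u x * t x ^ m)"
    if f: "locv X Q f a" "\<forall>\<^sub>F x in genf X. f x \<noteq> 0" for f a
  proof -
    \<comment> \<open>Minimality forces a nonzero constant term q(z), since otherwise a factor f
      could be cancelled. Then f divides q(z), which has finite order at Q, and so f has finite
      order too.\<close>
    define P where "P = arg_min degree (\<lambda>P. P \<noteq> 0 \<and> (\<forall>\<^sub>F x in genf X. ev P (z x) (f x) = 0))"
    obtain P1 where P1: "P1 \<noteq> 0 \<and> (\<forall>\<^sub>F x in genf X. ev P1 (z x) (f x) = 0)"
      using alg[OF locv_ratf[OF irr f(1)]] by blast
    have P: "P \<noteq> 0" "\<forall>\<^sub>F x in genf X. ev P (z x) (f x) = 0"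
      using arg_min_natI[of "\<lambda>P. P \<noteq> 0 \<and> (\<forall>\<^sub>F x in genf X. ev P (z x) (f x) = 0)", OF P1, of degree]
      unfolding P_def by auto
    have Pmin: "degree P \<le> degree P'" if "P' \<noteq> 0" "\<forall>\<^sub>F x in genf X. ev P' (z x) (f x) = 0" for P'
      unfolding P_def using that by (intro arg_min_nat_le) auto
    obtain q P' where PP': "P = pCons q P'" by (cases P)
    have "q \<noteq> 0"
    proof
      assume "q = 0"
      then have "P' \<noteq> 0" using P(1) PP' by auto
      moreover have "\<forall>\<^sub>F x in genf X. ev P' (z x) (f x) = 0"
        using P(2) f(2) by eventually_elim (simp add: PP' \<open>q = 0\<close>)
      ultimately have "degree P \<le> degree P'" by (rule Pmin)
      then show False using PP' \<open>P' \<noteq> 0\<close> by simp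
    qed
    then obtain m u b where u: "locv X Q u b" "b \<noteq> 0" "\<And>x. poly q (z x) = u x * z x ^ m"
      using poly_locv_0[OF z(1)] by metis
    have "\<not> divn Q t (Suc (k * m)) f"
    proof
      assume "divn Q t (Suc (k * m)) f"
      from divn_mult[OF this divn_0[OF locv_mult[OF irr locv_const[OF irr unif_in, of "-1"] locv_ev[OF z(1) f(1), of P']]]]
      have "divn Q t (Suc (k * m)) (\<lambda>x. - (f x * ev P' (z x) (f x)))" by simp
      moreover have "\<forall>\<^sub>F x in genf X. - (f x * ev P' (z x) (f x)) = u x * v x ^ m * t x ^ (k * m)"
        using P(2) v(3)
      proof eventually_elim
        case (elim x)
        have "poly q (z x) = u x * z x ^ m" by (rule u(3))
        also have "z x ^ m = v x ^ m * t x ^ (k * m)"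
          unfolding elim(2) by (simp add: power_mult_distrib power_mult)
        finally have "poly q (z x) = u x * v x ^ m * t x ^ (k * m)" by (simp add: mult.assoc)
        then show ?case using elim(1) by (simp add: PP' neg_eq_iff_add_eq_0 add.commute)
      qed
      ultimately have "divn Q t (Suc (k * m)) (\<lambda>x. u x * v x ^ m * t x ^ (k * m))" by (rule divn_cong)
      then show False
        using not_divn_unit[OF locv_mult[OF irr u(1) locv_power[OF irr v(1), of m]]] u(2) v(2) by simp
    qed
    then show ?thesis using finite_order[OF f(1)] by metis
  qed
  show ?thesis unfolding valring_def
  proof (intro allI impI)
    fix f assume f: "ratf X f"
    show "(\<exists>a. locv X Q f a) \<or> locv X Q (\<lambda>x. 1 / f x) 0"
    proof (cases "\<forall>\<^sub>F x in genf X. f x = 0")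
      case True
      then have "\<forall>\<^sub>F x in genf X. 0 = f x" by eventually_elim simp
      then show ?thesis using locv_cong[OF locv_const[OF irr unif_in, of 0]] by blast
    next
      case False
      then have f0: "\<forall>\<^sub>F x in genf X. f x \<noteq> 0" using ratf_0_or_nonzero[OF irr f] by blast
      obtain g h a b where gh: "locv X Q g a" "locv X Q h b" "\<forall>\<^sub>F x in genf X. h x \<noteq> 0"
        "\<forall>\<^sub>F x in genf X. f x = g x / h x"
        using ratf_quotient_locv[OF irr f unif_in] .
      have g0: "\<forall>\<^sub>F x in genf X. g x \<noteq> 0" using f0 gh(4) by eventually_elim auto
      obtain i u c where u: "locv X Q u c" "c \<noteq> 0" "\<forall>\<^sub>F x in genf X. g x = u x * t x ^ i"
        using expand[OF gh(1) g0] by blast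
      obtain j w d where w: "locv X Q w d" "d \<noteq> 0" "\<forall>\<^sub>F x in genf X. h x = w x * t x ^ j"
        using expand[OF gh(2,3)] by blast
      show ?thesis
      proof (cases "j \<le> i")
        case True
        have "\<forall>\<^sub>F x in genf X. u x / w x * t x ^ (i - j) = f x"
          using gh(4) u(3) w(3) unif_nonzero gh(3)
          by eventually_elim (use True in \<open>simp add: power_diff field_simps\<close>)
        from locv_cong[OF locv_mult[OF irr locv_divide[OF irr u(1) w(1,2)] locv_power[OF irr unif_locv]] this]
        show ?thesis by blast
      next
        case False
        have "\<forall>\<^sub>F x in genf X. w x / u x * t x ^ (j - i) = 1 / f x"
          using gh(4) u(3) w(3) unif_nonzero g0
          by eventually_elim (use False in \<open>simp add: power_diff field_simps\<close>)
        from locv_cong[OF locv_mult[OF irr locv_divide[OF irr w(1) u(1,2)] locv_power[OF irr unif_locv]] this]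
        have "locv X Q (\<lambda>x. 1 / f x) (d / c * 0 ^ (j - i))" .
        moreover have "(0::'a) ^ (j - i) = 0" using False by (simp add: power_0_left)
        ultimately show ?thesis by simp
      qed
    qed
  qed
qed

end

subsection \<open>Extending rational maps\<close>

text \<open>In a valuation ring divisibility is a total preorder, so some coordinate divides all
  others; after division by it all coordinates are regular at Q and one of them equals 1.\<close>

lemma extend_rational_map_local:
  assumes val: "valring X Q" and Q: "Q \<in> X"
    and \<eta>: "\<And>i. ratf X (\<eta> i)" "\<forall>\<^sub>F x in genf X. \<eta> j0 x \<noteq> 0"
  shows "\<exists>d A. (\<forall>i::'m::finite. is_form d (A i)) \<and> (\<chi> i. form_at (A i) Q) \<noteq> 0 \<and>
    (\<forall>\<^sub>F x in genf X. \<forall>i k. form_at (A i) x * \<eta> k x = form_at (A k) x * \<eta> i x)"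
proof -
  \<comment> \<open>The dividing coordinate is updated one index at a time: if a new coordinate is
    not a multiple of the current one, the reverse quotient vanishes at Q and the new one takes
    over.\<close>
  have "\<exists>j. (\<forall>\<^sub>F x in genf X. \<eta> j x \<noteq> 0) \<and> (\<forall>i\<in>S. \<exists>a. locv X Q (\<lambda>x. \<eta> i x / \<eta> j x) a)" for S :: "'m set"
  proof (induction S rule: infinite_finite_induct)
    case (insert s S)
    then obtain j where j: "\<forall>\<^sub>F x in genf X. \<eta> j x \<noteq> 0" "\<forall>i\<in>S. \<exists>a. locv X Q (\<lambda>x. \<eta> i x / \<eta> j x) a" by blast
    show ?case
    proof (cases "\<exists>a. locv X Q (\<lambda>x. \<eta> s x / \<eta> j x) a")
      case True
      then show ?thesis using j by blast
    next
      case False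
      then have inv: "locv X Q (\<lambda>x. 1 / (\<eta> s x / \<eta> j x)) 0"
        using val ratf_divide[OF irr \<eta>(1)[of s] \<eta>(1)[of j]] unfolding valring_def by blast
      have s: "\<forall>\<^sub>F x in genf X. \<eta> s x \<noteq> 0"
      proof (rule ccontr)
        assume "\<not> ?thesis"
        then have "\<forall>\<^sub>F x in genf X. \<eta> s x = 0" using ratf_0_or_nonzero[OF irr \<eta>(1)[of s]] by blast
        then have "\<forall>\<^sub>F x in genf X. 0 = \<eta> s x / \<eta> j x" by eventually_elim simp
        then have "locv X Q (\<lambda>x. \<eta> s x / \<eta> j x) 0" by (rule locv_cong[OF locv_const[OF irr Q]])
        then show False using False by blast
      qed
      have "\<exists>a. locv X Q (\<lambda>x. \<eta> i x / \<eta> s x) a" if "i \<in> insert s S" for i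
      proof (cases "i = s")
        case True
        have "\<forall>\<^sub>F x in genf X. 1 = \<eta> i x / \<eta> s x" using s by eventually_elim (simp add: True)
        then have "locv X Q (\<lambda>x. \<eta> i x / \<eta> s x) 1" by (rule locv_cong[OF locv_const[OF irr Q]])
        then show ?thesis by blast
      next
        case False
        then obtain a where a: "locv X Q (\<lambda>x. \<eta> i x / \<eta> j x) a" using j(2) \<open>i \<in> insert s S\<close> by blast
        have "\<forall>\<^sub>F x in genf X. \<eta> i x / \<eta> j x * (1 / (\<eta> s x / \<eta> j x)) = \<eta> i x / \<eta> s x"
          using j(1) by eventually_elim simp
        from locv_cong[OF locv_mult[OF irr a inv] this] show ?thesis by blast
      qed
      then show ?thesis using s by blast
    qed
  qed (use \<eta>(2) in auto)
  from this[of UNIV] obtain j where j: "\<forall>\<^sub>F x in genf X. \<eta> j x \<noteq> 0" "\<forall>i. \<exists>a. locv X Q (\<lambda>x. \<eta> i x / \<eta> j x) a" by auto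
  have "\<forall>i. \<exists>d F G. is_form d F \<and> is_form d G \<and> form_at G Q \<noteq> 0 \<and>
      (\<forall>\<^sub>F x in genf X. form_at G x \<noteq> 0 \<and> \<eta> i x / \<eta> j x = form_at F x / form_at G x)"
  proof
    fix i
    obtain a where "locv X Q (\<lambda>x. \<eta> i x / \<eta> j x) a" using j(2) by blast
    then show "\<exists>d F G. is_form d F \<and> is_form d G \<and> form_at G Q \<noteq> 0 \<and>
      (\<forall>\<^sub>F x in genf X. form_at G x \<noteq> 0 \<and> \<eta> i x / \<eta> j x = form_at F x / form_at G x)"
      by (rule locvE[OF irr]) blast
  qed
  then obtain d where "\<forall>i. \<exists>F G. is_form (d i) F \<and> is_form (d i) G \<and> form_at G Q \<noteq> 0 \<and>
      (\<forall>\<^sub>F x in genf X. form_at G x \<noteq> 0 \<and> \<eta> i x / \<eta> j x = form_at F x / form_at G x)"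
    unfolding choice_iff ..
  then obtain F where "\<forall>i. \<exists>G. is_form (d i) (F i) \<and> is_form (d i) G \<and> form_at G Q \<noteq> 0 \<and>
      (\<forall>\<^sub>F x in genf X. form_at G x \<noteq> 0 \<and> \<eta> i x / \<eta> j x = form_at (F i) x / form_at G x)"
    unfolding choice_iff ..
  then obtain G where "\<forall>i. is_form (d i) (F i) \<and> is_form (d i) (G i) \<and> form_at (G i) Q \<noteq> 0 \<and>
      (\<forall>\<^sub>F x in genf X. form_at (G i) x \<noteq> 0 \<and> \<eta> i x / \<eta> j x = form_at (F i) x / form_at (G i) x)"
    unfolding choice_iff ..
  then have FG: "\<And>i. is_form (d i) (F i)" "\<And>i. is_form (d i) (G i)" "\<And>i. form_at (G i) Q \<noteq> 0"
    "\<And>i. \<forall>\<^sub>F x in genf X. form_at (G i) x \<noteq> 0 \<and> \<eta> i x / \<eta> j x = form_at (F i) x / form_at (G i) x"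
    by auto
  define D where "D = (\<Sum>i\<in>UNIV. d i)"
  define B where "B = (\<Prod>k\<in>UNIV. G k)"
  define A where "A i = F i * (\<Prod>k\<in>UNIV - {i}. G k)" for i
  have A: "is_form D (A i)" for i
  proof -
    have "is_form (d i + (\<Sum>k\<in>UNIV - {i}. d k)) (A i)"
      unfolding A_def by (intro is_form_mult is_form_prod FG)
    then show ?thesis unfolding D_def by (subst sum.remove[of _ i]) auto
  qed
  have B: "is_form D B" unfolding D_def B_def by (intro is_form_prod FG)
  have BQ: "form_at B Q \<noteq> 0" using FG(3) by (simp add: B_def)
  have AB: "\<forall>\<^sub>F x in genf X. \<forall>i\<in>UNIV. form_at (A i) x = form_at B x * (\<eta> i x / \<eta> j x)"
  proof (rule eventually_ball_finite, simp, rule ballI)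
    fix i
    show "\<forall>\<^sub>F x in genf X. form_at (A i) x = form_at B x * (\<eta> i x / \<eta> j x)"
      using FG(4)[of i]
    proof eventually_elim
      case (elim x)
      have "form_at B x = form_at (G i) x * (\<Prod>k\<in>UNIV - {i}. form_at (G k) x)"
        unfolding B_def by (subst prod.remove[of _ i]) auto
      moreover have "form_at (A i) x = form_at (F i) x * (\<Prod>k\<in>UNIV - {i}. form_at (G k) x)"
        by (simp add: A_def)
      ultimately show ?case using elim by simp
    qed
  qed
  have "\<forall>\<^sub>F x in genf X. form_at (A j - B) x = 0" using AB j(1) by eventually_elim simp
  \<comment> \<open>The coordinate \<open>A j\<close> agrees generically with the common denominator
    B, so they agree at Q, where B is nonzero; this keeps the coordinate vector nonzero at
    Q.\<close>
  then have "form_at (A j - B) Q = 0"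
    by (rule eventually_genf_form_zero[OF irr is_form_diff[OF A B] _ Q])
  then have "form_at (A j) Q \<noteq> 0" using BQ by simp
  then have "(\<chi> i. form_at (A i) Q) \<noteq> 0" by (auto simp: vec_eq_iff)
  moreover have "\<forall>\<^sub>F x in genf X. \<forall>i k. form_at (A i) x * \<eta> k x = form_at (A k) x * \<eta> i x"
    using AB by eventually_elim simp
  ultimately show ?thesis using A by blast
qed

text \<open>A rational map from a curve with valuation rings to projective space is defined
  everywhere. Each point carries its own coordinate forms, and the values fit together because the
  minors of any two such vectors vanish.\<close>

theorem extend_rational_map:
  assumes val: "\<And>Q. Q \<in> X \<Longrightarrow> valring X Q"
    and \<eta>: "\<And>i::'m::finite. ratf X (\<eta> i)" "\<forall>\<^sub>F x in genf X. \<eta> j0 x \<noteq> 0"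
  obtains \<gamma> where "morphism X UNIV \<gamma>"
    "\<forall>\<^sub>F x in genf X. \<gamma> x = abs_proj (\<chi> i. \<eta> i x)"
proof -
  have "\<forall>Q\<in>X. \<exists>d A. (\<forall>i. is_form d (A i)) \<and> (\<chi> i. form_at (A i) Q) \<noteq> 0 \<and>
    (\<forall>\<^sub>F x in genf X. \<forall>i k. form_at (A i) x * \<eta> k x = form_at (A k) x * \<eta> i x)"
  proof
    fix Q assume Q: "Q \<in> X"
    show "\<exists>d A. (\<forall>i. is_form d (A i)) \<and> (\<chi> i. form_at (A i) Q) \<noteq> 0 \<and>
      (\<forall>\<^sub>F x in genf X. \<forall>i k. form_at (A i) x * \<eta> k x = form_at (A k) x * \<eta> i x)"
      by (rule extend_rational_map_local[where \<eta> = \<eta>, OF val[OF Q] Q \<eta>])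
  qed
  then obtain d where "\<forall>Q\<in>X. \<exists>A. (\<forall>i. is_form (d Q) (A i)) \<and> (\<chi> i. form_at (A i) Q) \<noteq> 0 \<and>
    (\<forall>\<^sub>F x in genf X. \<forall>i k. form_at (A i) x * \<eta> k x = form_at (A k) x * \<eta> i x)"
    unfolding bchoice_iff ..
  then obtain A where A': "\<forall>Q\<in>X. (\<forall>i. is_form (d Q) (A Q i)) \<and> (\<chi> i. form_at (A Q i) Q) \<noteq> 0 \<and>
    (\<forall>\<^sub>F x in genf X. \<forall>i k. form_at (A Q i) x * \<eta> k x = form_at (A Q k) x * \<eta> i x)"
    unfolding bchoice_iff ..
  have A: "\<And>Q i. Q \<in> X \<Longrightarrow> is_form (d Q) (A Q i)" "\<And>Q. Q \<in> X \<Longrightarrow> (\<chi> i. form_at (A Q i) Q) \<noteq> 0"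
    "\<And>Q. Q \<in> X \<Longrightarrow> \<forall>\<^sub>F x in genf X. \<forall>i k. form_at (A Q i) x * \<eta> k x = form_at (A Q k) x * \<eta> i x"
    using A' by auto
  define \<gamma> where "\<gamma> Q = abs_proj (\<chi> i. form_at (A Q i) Q)" for Q
  \<comment> \<open>Both vectors are generically proportional to \<eta>; cancelling the square of
    the nonzero component \<open>j0\<close> makes them proportional to each other.\<close>
  have cross: "form_at (A Q i) R * form_at (A R k) R = form_at (A Q k) R * form_at (A R i) R"
    if "Q \<in> X" "R \<in> X" for Q R i k
  proof -
    have "\<forall>\<^sub>F x in genf X. form_at (A Q i * A R k - A Q k * A R i) x = 0"
      using A(3)[OF that(1)] A(3)[OF that(2)] \<eta>(2)
    proof eventually_elim
      case (elim x)
      have "(form_at (A Q i) x * \<eta> j0 x) * (form_at (A R k) x * \<eta> j0 x) =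
          (form_at (A Q k) x * \<eta> j0 x) * (form_at (A R i) x * \<eta> j0 x)"
        using elim(1)[rule_format, of _ j0] elim(2)[rule_format, of _ j0] by (simp add: mult_ac)
      then have "(form_at (A Q i) x * form_at (A R k) x) * (\<eta> j0 x * \<eta> j0 x) =
          (form_at (A Q k) x * form_at (A R i) x) * (\<eta> j0 x * \<eta> j0 x)"
        by (simp only: mult_ac)
      then show ?case using elim(3) by simp
    qed
    moreover have "is_form (d Q + d R) (A Q i * A R k - A Q k * A R i)"
      by (intro is_form_diff is_form_mult A(1) that)
    ultimately have "form_at (A Q i * A R k - A Q k * A R i) R = 0"
      using eventually_genf_form_zero[OF irr] that(2) by blast
    then show ?thesis by simp
  qed
  have \<gamma>eq: "\<gamma> R = abs_proj (\<chi> i. form_at (A Q i) R)"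
    if QR: "Q \<in> X" "R \<in> X" "(\<chi> i. form_at (A Q i) R) \<noteq> 0" for Q R
  proof -
    obtain c where "c \<noteq> 0" "(\<chi> i. form_at (A R i) R) = c *s (\<chi> i. form_at (A Q i) R)"
      using proportional_vectors[OF QR(3) A(2)[OF QR(2)]] cross[OF QR(1,2)] by auto
    then show ?thesis unfolding \<gamma>_def by (simp add: abs_proj_scale QR(3))
  qed
  have mor: "morphism X UNIV \<gamma>"
  proof (rule morphismI)
    fix Q assume Q: "Q \<in> X"
    obtain j where j: "form_at (A Q j) Q \<noteq> 0" using A(2)[OF Q] by (auto simp: vec_eq_iff)
    show "\<exists>e N d F. is_form e N \<and> form_at N Q \<noteq> 0 \<and> (\<forall>i. is_form d (F i)) \<and>
        (\<forall>y\<in>X. form_at N y \<noteq> 0 \<longrightarrow> (\<chi> i. form_at (F i) y) \<noteq> 0 \<and> \<gamma> y = abs_proj (\<chi> i. form_at (F i) y))"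
    proof (rule exI[of _ "d Q"], rule exI[of _ "A Q j"], rule exI[of _ "d Q"], rule exI[of _ "A Q"], intro conjI allI ballI impI)
      fix y assume y: "y \<in> X" "form_at (A Q j) y \<noteq> 0"
      then show nz: "(\<chi> i. form_at (A Q i) y) \<noteq> 0" by (auto simp: vec_eq_iff)
      show "\<gamma> y = abs_proj (\<chi> i. form_at (A Q i) y)" by (rule \<gamma>eq[OF Q y(1) nz])
    qed (use A Q j in auto)
  qed simp
  obtain Q where Q: "Q \<in> X" using irr by (auto simp: irreducible_set_def)
  obtain j where j: "form_at (A Q j) Q \<noteq> 0" using A(2)[OF Q] by (auto simp: vec_eq_iff)
  have "\<forall>\<^sub>F x in genf X. \<gamma> x = abs_proj (\<chi> i. \<eta> i x)"
    using eventually_genf_form_nonzero[OF irr A(1)[OF Q] Q j] A(3)[OF Q] \<eta>(2) eventually_genf_in[OF irr]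
  proof eventually_elim
    case (elim x)
    have nz: "(\<chi> i. form_at (A Q i) x) \<noteq> 0" "(\<chi> i. \<eta> i x) \<noteq> 0" using elim by (auto simp: vec_eq_iff)
    obtain c where "c \<noteq> 0" "(\<chi> i. \<eta> i x) = c *s (\<chi> i. form_at (A Q i) x)"
      by (rule proportional_vectors[OF nz]) (use elim(2) in auto)
    then show ?case using \<gamma>eq[OF Q elim(4) nz(1)] nz by (simp add: abs_proj_scale)
  qed
  then show ?thesis using that mor by blast
qed

end

subsection \<open>Coordinate frames of the plane\<close>

lemma dotp_commute: "dotp v w = dotp w v"
  by (simp add: dotp_def mult.commute)

text \<open>Dual bases of k^3. The affine chart is the complement of \<open>l3\<close> = 0, and the
  points of \<open>e1\<close> and \<open>e2\<close> lie at infinity, so projection from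
  \<open>e2\<close> is the first affine coordinate and projection from \<open>e1\<close> the
  second.\<close>

locale frame =
  fixes e1 e2 e3 l1 l2 l3 :: "'a::alg_closed_field ^ 3"
  assumes dual [simp]: "dotp l1 e1 = 1" "dotp l1 e2 = 0" "dotp l1 e3 = 0"
    "dotp l2 e1 = 0" "dotp l2 e2 = 1" "dotp l2 e3 = 0"
    "dotp l3 e1 = 0" "dotp l3 e2 = 0" "dotp l3 e3 = 1"
    and expand: "v = dotp l1 v *s e1 + dotp l2 v *s e2 + dotp l3 v *s e3"

lemma frame_exists:
  fixes e1 e2 e3 :: "'a::alg_closed_field ^ 3"
  assumes "e1 \<noteq> 0" "e2 \<notin> vec.span {e1}" "e3 \<notin> vec.span {e1, e2}"
  obtains l1 l2 l3 where "frame e1 e2 e3 l1 l2 l3"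
proof -
  have ind: "vec.independent {e3, e2, e1}"
    using assms by (intro vec.independent_insertI) (auto simp: vec.independent_empty insert_commute)
  have d: "e2 \<noteq> e1" "e3 \<noteq> e1" "e3 \<noteq> e2" using assms vec.span_base by blast+
  then have card: "card {e3, e2, e1} = 3" by simp
  have dim: "vec.dim (UNIV :: ('a ^ 3) set) = 3" by (simp add: vec.dim_UNIV card_cart_basis)
  have span: "UNIV \<subseteq> vec.span {e3, e2, e1}"
    by (rule vec.card_ge_dim_independent[OF _ ind]) (simp_all only: dim card, simp_all)
  have dualv: "\<exists>l. dotp l b = 1 \<and> (\<forall>w\<in>{e3, e2, e1} - {b}. dotp l w = 0)" if "b \<in> {e3, e2, e1}" for b
  proof -
    have "b \<notin> vec.span ({e3, e2, e1} - {b})" using ind that unfolding vec.dependent_def by blast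
    then obtain v where v: "\<forall>w\<in>{e3, e2, e1} - {b}. dotp w v = 0" "dotp b v \<noteq> 0"
      using span_annihilator[of "{e3, e2, e1} - {b}" b] by blast
    then show ?thesis
      by (intro exI[of _ "(1 / dotp b v) *s v"]) (simp add: dotp_commute[of v])
  qed
  obtain l1 where l1: "dotp l1 e1 = 1" "dotp l1 e2 = 0" "dotp l1 e3 = 0" using dualv[of e1] d by auto
  obtain l2 where l2: "dotp l2 e1 = 0" "dotp l2 e2 = 1" "dotp l2 e3 = 0" using dualv[of e2] d by auto
  obtain l3 where l3: "dotp l3 e1 = 0" "dotp l3 e2 = 0" "dotp l3 e3 = 1" using dualv[of e3] d by auto
  have "v = dotp l1 v *s e1 + dotp l2 v *s e2 + dotp l3 v *s e3" for v
  proof -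
    have "v \<in> vec.span {e3, e2, e1}" using span by blast
    then obtain a b c where "v - a *s e3 - b *s e2 = c *s e1"
      by (auto simp: vec.span_breakdown_eq vec.span_singleton)
    then have v: "v = c *s e1 + b *s e2 + a *s e3" by (simp add: algebra_simps)
    show ?thesis by (subst (1 2 3 4) v) (simp add: l1 l2 l3)
  qed
  then have "frame e1 e2 e3 l1 l2 l3" using l1 l2 l3 by unfold_locales auto
  then show ?thesis by (rule that)
qed

lemma frame_complete:
  fixes e1 e2 :: "'a::alg_closed_field ^ 3"
  assumes "e1 \<noteq> 0" "e2 \<notin> vec.span {e1}"
  obtains e3 l1 l2 l3 where "frame e1 e2 e3 l1 l2 l3"
proof -
  have "\<not> UNIV \<subseteq> vec.span {e1, e2}"
  proof
    assume "UNIV \<subseteq> vec.span {e1, e2}"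
    then have "vec.dim (UNIV :: ('a ^ 3) set) \<le> card {e1, e2}"
      by (rule vec.dim_le_card) simp
    moreover have "card {e1, e2} \<le> 2" by (simp add: card_insert_if)
    ultimately show False by (simp add: vec.dim_UNIV card_cart_basis)
  qed
  then obtain e3 where "e3 \<notin> vec.span {e1, e2}" by blast
  show ?thesis by (rule frame_exists[OF assms \<open>e3 \<notin> vec.span {e1, e2}\<close>]) (rule that)
qed

subsection \<open>Dehomogenization\<close>

text \<open>The form F at a u + b v + w, as a polynomial in b over polynomials in a. For a frame
  this is the dehomogenization of F.\<close>

definition bp :: "('a::field, 'n::finite) mpoly \<Rightarrow> 'a ^ 'n \<Rightarrow> 'a ^ 'n \<Rightarrow> 'a ^ 'n \<Rightarrow> 'a poly poly" where
  "bp F u v w = (\<Sum>m\<in>Poly_Mapping.keys F. Polynomial.smult [:Poly_Mapping.lookup F m:]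
     (\<Prod>i\<in>UNIV. [:[:w $ i, u $ i:], [:v $ i:]:] ^ Poly_Mapping.lookup m i))"

lemma ev_bp [simp]: "ev (bp F u v w) a b = peval F (a *s u + b *s v + w)"
  by (simp add: bp_def peval_def algebra_simps)

lemma ev_monomials: "ev P a b = (\<Sum>(j, i)\<in>(SIGMA j:{..degree P}. {..degree (Polynomial.coeff P j)}).
    Polynomial.coeff (Polynomial.coeff P j) i * a ^ i * b ^ j)"
proof -
  have "ev P a b = (\<Sum>j\<le>degree P. poly (Polynomial.coeff P j) a * b ^ j)"
    by (simp add: ev_def poly_altdef[of P] poly_sum poly_power)
  also have "\<dots> = (\<Sum>j\<le>degree P. \<Sum>i\<le>degree (Polynomial.coeff P j).
      Polynomial.coeff (Polynomial.coeff P j) i * a ^ i * b ^ j)"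
    by (simp add: poly_altdef sum_distrib_right)
  finally show ?thesis by (simp add: sum.Sigma)
qed

lemma degree_bp_le:
  fixes F :: "('a::alg_closed_field, 'n::finite) mpoly"
  assumes "is_form d F"
  shows "degree (bp F u v w) \<le> d"
proof -
  have "degree (\<Prod>i\<in>UNIV. [:[:w $ i, u $ i:], [:v $ i:]:] ^ Poly_Mapping.lookup m i) \<le> d"
    if "m \<in> Poly_Mapping.keys F" for m
  proof -
    have "degree (\<Prod>i\<in>UNIV. [:[:w $ i, u $ i:], [:v $ i:]:] ^ Poly_Mapping.lookup m i)
      \<le> (\<Sum>i\<in>UNIV. degree ([:[:w $ i, u $ i:], [:v $ i:]:] ^ Poly_Mapping.lookup m i))"
      by (rule order_trans[OF degree_prod_sum_le]) (simp_all add: o_def)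
    also have "\<dots> \<le> (\<Sum>i\<in>UNIV. Poly_Mapping.lookup m i)"
    proof (rule sum_mono)
      fix i
      have "degree ([:[:w $ i, u $ i:], [:v $ i:]:] ^ Poly_Mapping.lookup m i)
          \<le> degree [:[:w $ i, u $ i:], [:v $ i:]:] * Poly_Mapping.lookup m i"
        by (rule degree_power_le)
      also have "\<dots> \<le> 1 * Poly_Mapping.lookup m i" by (intro mult_right_mono) auto
      finally show "degree ([:[:w $ i, u $ i:], [:v $ i:]:] ^ Poly_Mapping.lookup m i) \<le> Poly_Mapping.lookup m i" by simp
    qed
    finally show ?thesis using assms that by (simp add: is_form_def)
  qed
  then show ?thesis unfolding bp_def
    by (intro degree_sum_le) (auto intro: order_trans[OF degree_smult_le])
qed

context frame
begin

lemma l3_nonzero: "l3 \<noteq> 0"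
  by (metis dotp_0(2) dual(9) zero_neq_one)

lemma scale_affine:
  assumes "dotp l3 v \<noteq> 0"
  shows "v = dotp l3 v *s ((dotp l1 v / dotp l3 v) *s e1 + (dotp l2 v / dotp l3 v) *s e2 + e3)"
  using assms by (subst expand) (simp add: vector_add_ldistrib vector_smult_assoc)

lemma peval_affine:
  assumes "is_form d F" "dotp l3 v \<noteq> 0"
  shows "peval F v = dotp l3 v ^ d * ev (bp F e1 e2 e3) (dotp l1 v / dotp l3 v) (dotp l2 v / dotp l3 v)"
  using arg_cong[OF scale_affine[OF assms(2)], of "peval F"]
  by (simp only: peval_scale[OF assms(1)] ev_bp)

text \<open>The degree n is the total degree of P, so on the line at infinity only the top
  homogeneous part survives. Its restriction p is nonzero, as distinct monomials of total degree n
  give distinct powers of b.\<close>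

lemma homogenization:
  assumes "P \<noteq> 0"
  obtains n G p where "is_form n G" "p \<noteq> 0"
    "\<And>v. dotp l3 v \<noteq> 0 \<Longrightarrow> peval G v = dotp l3 v ^ n * ev P (dotp l1 v / dotp l3 v) (dotp l2 v / dotp l3 v)"
    "\<And>b. peval G (e1 + b *s e2) = poly p b"
proof -
  define c where "c j i = Polynomial.coeff (Polynomial.coeff P j) i" for i j
  define K where "K = {(j, i) \<in> (SIGMA j:{..degree P}. {..degree (Polynomial.coeff P j)}). c j i \<noteq> 0}"
  have finK: "finite K"
    by (rule finite_subset[of _ "SIGMA j:{..degree P}. {..degree (Polynomial.coeff P j)}"]) (auto simp: K_def)
  have evK: "ev P a b = (\<Sum>(j, i)\<in>K. c j i * a ^ i * b ^ j)" for a b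
    unfolding ev_monomials c_def[symmetric]
    by (rule sum.mono_neutral_right) (auto simp: K_def)
  have memK: "(j, i) \<in> K" if "c j i \<noteq> 0" for i j
  proof -
    have "Polynomial.coeff P j \<noteq> 0" using that by (auto simp: c_def)
    then show ?thesis using that by (auto simp: K_def c_def le_degree)
  qed
  have "(degree P, degree (lead_coeff P)) \<in> K" by (rule memK) (use assms in \<open>simp add: c_def\<close>)
  then have K0: "K \<noteq> {}" by blast
  define n where "n = Max ((\<lambda>(j, i). i + j) ` K)"
  have n: "i + j \<le> n" if "(j, i) \<in> K" for i j
    unfolding n_def using that finK by (intro Max_ge) force+
  have "n \<in> (\<lambda>(j, i). i + j) ` K"
    unfolding n_def using finK K0 by (intro Max_in) auto
  then obtain i0 j0 where ij0: "(j0, i0) \<in> K" "i0 + j0 = n" by auto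
  define G where "G = (\<Sum>(j, i)\<in>K. Poly_Mapping.single 0 (c j i) * (lin l1 ^ i * lin l2 ^ j * lin l3 ^ (n - i - j)))"
  define p where "p = (\<Sum>(j, i)\<in>K. if i + j = n then Polynomial.monom (c j i) j else 0)"
  show ?thesis
  proof (rule that)
    show "is_form n G" unfolding G_def
    proof (rule is_form_sum, clarify)
      fix j i assume ji: "(j, i) \<in> K"
      have "is_form (1 * i + 1 * j + 1 * (n - i - j)) (lin l1 ^ i * lin l2 ^ j * lin l3 ^ (n - i - j))"
        by (intro is_form_mult is_form_power is_form_lin)
      then show "is_form n (Poly_Mapping.single 0 (c j i) * (lin l1 ^ i * lin l2 ^ j * lin l3 ^ (n - i - j)))"
        using n[OF ji] by (intro is_form_cmult) simp
    qed
    have "Polynomial.coeff p j0 = (\<Sum>(j, i)\<in>K. if (j, i) = (j0, i0) then c j0 i0 else 0)"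
      unfolding p_def coeff_sum using ij0 by (intro sum.cong) auto
    also have "\<dots> = (\<Sum>x\<in>K. if x = (j0, i0) then c j0 i0 else 0)"
      by (intro sum.cong) (auto split: if_splits)
    also have "\<dots> = c j0 i0" using ij0 finK by (simp add: sum.delta)
    finally show "p \<noteq> 0" using ij0 by (auto simp: K_def)
    show "peval G v = dotp l3 v ^ n * ev P (dotp l1 v / dotp l3 v) (dotp l2 v / dotp l3 v)"
      if v: "dotp l3 v \<noteq> 0" for v
    proof -
      have "dotp l3 v ^ n = dotp l3 v ^ (n - i - j) * dotp l3 v ^ i * dotp l3 v ^ j" if "(j, i) \<in> K" for i j
        using n[OF that] by (simp flip: power_add)
      then show ?thesis
        unfolding G_def evK sum_distrib_left peval_sum using v
        by (intro sum.cong) (auto simp: power_divide field_simps)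
    qed
    show "peval G (e1 + b *s e2) = poly p b" for b
    proof -
      show ?thesis unfolding G_def p_def poly_sum peval_sum
      proof (intro sum.cong refl, clarify)
        fix j i assume "(j, i) \<in> K"
        from n[OF this] have "n - i - j = 0 \<longleftrightarrow> i + j = n" by auto
        then show "peval (Poly_Mapping.single 0 (c j i) * (lin l1 ^ i * lin l2 ^ j * lin l3 ^ (n - i - j))) (e1 + b *s e2)
            = poly (if i + j = n then Polynomial.monom (c j i) j else 0) b"
          by (cases "i + j = n") (auto simp: poly_monom power_0_left)
      qed
    qed
  qed
qed

text \<open>A factorization of the dehomogenization is homogenized factor by factor; F is then the
  product of the two forms and a power of \<open>l3\<close>, and irreducibility of F makes one of
  them constant.\<close>

theorem irreducible_bp:
  assumes F: "Factorial_Ring.irreducible F" "is_form d F" and deg: "degree (bp F e1 e2 e3) > 0"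
  shows "Factorial_Ring.irreducible (bp F e1 e2 e3)"
proof (rule irreducibleI)
  let ?f = "bp F e1 e2 e3"
  show "?f \<noteq> 0" using deg by auto
  show "\<not> ?f dvd 1" using deg by (auto simp: is_unit_poly_iff)
  fix g h assume gh: "?f = g * h"
  then have "g \<noteq> 0" "h \<noteq> 0" using deg by auto
  obtain n1 G p where G: "is_form n1 G" "p \<noteq> 0"
    "\<And>v. dotp l3 v \<noteq> 0 \<Longrightarrow> peval G v = dotp l3 v ^ n1 * ev g (dotp l1 v / dotp l3 v) (dotp l2 v / dotp l3 v)"
    "\<And>b. peval G (e1 + b *s e2) = poly p b"
    by (rule homogenization[OF \<open>g \<noteq> 0\<close>]) (rule that)
  obtain n2 H q where H: "is_form n2 H" "q \<noteq> 0"
    "\<And>v. dotp l3 v \<noteq> 0 \<Longrightarrow> peval H v = dotp l3 v ^ n2 * ev h (dotp l1 v / dotp l3 v) (dotp l2 v / dotp l3 v)"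
    "\<And>b. peval H (e1 + b *s e2) = poly q b"
    by (rule homogenization[OF \<open>h \<noteq> 0\<close>]) (rule that)
  have Fgh: "peval F v = dotp l3 v ^ d * (ev g (dotp l1 v / dotp l3 v) (dotp l2 v / dotp l3 v) *
      ev h (dotp l1 v / dotp l3 v) (dotp l2 v / dotp l3 v))" if "dotp l3 v \<noteq> 0" for v
    unfolding peval_affine[OF F(2) that] gh by simp
  \<comment> \<open>Otherwise a positive power of \<open>l3\<close> would divide G H, although
    neither G nor H vanishes identically on the line at infinity.\<close>
  have "n1 + n2 \<le> d"
  proof (rule ccontr)
    assume "\<not> ?thesis"
    then have lt: "d < n1 + n2" by simp
    have "peval (lin l3 ^ (n1 + n2 - d) * F) v = peval (G * H) v" for v
    proof (rule peval_eq_off_hyperplane[OF l3_nonzero])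
      fix v assume v: "dotp l3 v \<noteq> 0"
      have "dotp l3 v ^ (n1 + n2 - d) * dotp l3 v ^ d = dotp l3 v ^ n1 * dotp l3 v ^ n2"
        using lt by (simp flip: power_add)
      then show "peval (lin l3 ^ (n1 + n2 - d) * F) v = peval (G * H) v"
        by (simp add: Fgh[OF v] G(3)[OF v] H(3)[OF v])
    qed
    from this[of "e1 + _ *s e2"] have "poly (p * q) b = 0" for b
      using lt by (simp add: G(4) H(4) power_0_left)
    then have "p * q = 0" by (intro poly_eqI_infinite) simp
    then show False using G(2) H(2) by simp
  qed
  have "F = lin l3 ^ (d - n1 - n2) * G * H"
  proof (rule mpoly_eqI, rule peval_eq_off_hyperplane[OF l3_nonzero])
    fix v assume v: "dotp l3 v \<noteq> 0"
    have "dotp l3 v ^ d = dotp l3 v ^ (d - n1 - n2) * dotp l3 v ^ n1 * dotp l3 v ^ n2"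
      using \<open>n1 + n2 \<le> d\<close> by (simp flip: power_add)
    then show "peval F v = peval (lin l3 ^ (d - n1 - n2) * G * H) v"
      by (simp add: Fgh[OF v] G(3)[OF v] H(3)[OF v] mult_ac)
  qed
  then have "lin l3 ^ (d - n1 - n2) * G dvd 1 \<or> H dvd 1" using F(1) by (auto simp: irreducible_def)
  then show "g dvd 1 \<or> h dvd 1"
  proof
    assume "lin l3 ^ (d - n1 - n2) * G dvd 1"
    then obtain c where c: "c \<noteq> 0" "\<And>v. peval (lin l3 ^ (d - n1 - n2) * G) v = c"
      by (rule peval_unit_const) (rule that)
    have "g = [:[:c:]:]"
    proof (rule ev_eqI)
      fix a b
      show "ev g a b = ev [:[:c:]:] a b"
        using c(2)[of "a *s e1 + b *s e2 + e3"] G(3)[of "a *s e1 + b *s e2 + e3"] by simp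
    qed
    then show ?thesis using c(1) by (auto simp: is_unit_poly_iff dvd_field_iff)
  next
    assume "H dvd 1"
    then obtain c where c: "c \<noteq> 0" "\<And>v. peval H v = c"
      by (rule peval_unit_const) (rule that)
    have "h = [:[:c:]:]"
    proof (rule ev_eqI)
      fix a b
      show "ev h a b = ev [:[:c:]:] a b"
        using c(2)[of "a *s e1 + b *s e2 + e3"] H(3)[of "a *s e1 + b *s e2 + e3"] by simp
    qed
    then show ?thesis using c(1) by (auto simp: is_unit_poly_iff dvd_field_iff)
  qed
qed

end

subsection \<open>Smooth points of plane curves\<close>

text \<open>Expansion of F at the centre v, seen from infinity: with b = 1/t, homogeneity turns the
  coefficient of b^(d - k) into the coefficient of t^k in F(v + t (a u + w)). So the top two
  coefficients are the value of F and its differential at v.\<close>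

lemma leading_coeff_bp:
  fixes F :: "('a::alg_closed_field, 'n::finite) mpoly"
  assumes "is_form d F"
  shows "Polynomial.coeff (bp F u v w) d = [:peval F v:]"
    and "d > 0 \<Longrightarrow> Polynomial.coeff (bp F u v w) (d - 1) = [:dotp (grad F v) w, dotp (grad F v) u:]"
proof -
  have r: "Polynomial.coeff (sp (bp F u v w) a) (d - k) = Polynomial.coeff (lp F v (a *s u + w)) k" if "k \<le> d" for a k
  proof -
    let ?p = "sp (bp F u v w) a"
    have dp: "degree ?p \<le> d" using degree_sp_le degree_bp_le[OF assms] order_trans by blast
    define q where "q = (\<Sum>i\<le>d. Polynomial.monom (Polynomial.coeff ?p (d - i)) i)"
    have "lp F v (a *s u + w) = q"
    proof (rule poly_eqI_cofinite)
      show "finite {0 :: 'a}" by simp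
      fix t :: 'a assume "t \<notin> {0}"
      then have t: "t \<noteq> 0" by simp
      have eq: "v + t *s (a *s u + w) = t *s (a *s u + (1 / t) *s v + w)"
        using t by (simp add: vector_add_ldistrib vector_smult_assoc add_ac)
      have "poly (lp F v (a *s u + w)) t = t ^ d * poly ?p (1 / t)"
        unfolding poly_lp eq peval_scale[OF assms] by simp
      also have "poly ?p (1 / t) = (\<Sum>i\<le>d. Polynomial.coeff ?p i * (1 / t) ^ i)"
        unfolding poly_altdef using dp by (intro sum.mono_neutral_left) (auto simp: coeff_eq_0 simp del: coeff_sp)
      also have "t ^ d * \<dots> = (\<Sum>i\<le>d. Polynomial.coeff ?p i * t ^ (d - i))"
        unfolding sum_distrib_left using t by (intro sum.cong) (auto simp: power_diff field_simps)
      also have "\<dots> = (\<Sum>i\<le>d. Polynomial.coeff ?p (d - i) * t ^ i)"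
        by (rule sum.reindex_bij_witness[of _ "\<lambda>i. d - i" "\<lambda>i. d - i"]) auto
      also have "\<dots> = poly q t" by (simp add: q_def poly_sum poly_monom)
      finally show "poly (lp F v (a *s u + w)) t = poly q t" .
    qed
    moreover have "Polynomial.coeff q k = (\<Sum>i\<le>d. if i = k then Polynomial.coeff ?p (d - k) else 0)"
      unfolding q_def coeff_sum by (rule sum.cong) auto
    then have "Polynomial.coeff q k = Polynomial.coeff ?p (d - k)" using that by simp
    ultimately show ?thesis by simp
  qed
  show "Polynomial.coeff (bp F u v w) d = [:peval F v:]"
  proof (rule poly_eqI_infinite)
    fix a show "poly (Polynomial.coeff (bp F u v w) d) a = poly [:peval F v:] a"
      using r[of 0 a] by simp
  qed
  assume "d > 0"
  show "Polynomial.coeff (bp F u v w) (d - 1) = [:dotp (grad F v) w, dotp (grad F v) u:]"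
  proof (rule poly_eqI_infinite)
    fix a show "poly (Polynomial.coeff (bp F u v w) (d - 1)) a = poly [:dotp (grad F v) w, dotp (grad F v) u:] a"
      using r[of 1 a] \<open>d > 0\<close> by (simp add: dotp_grad[symmetric])
  qed
qed

locale plane_curve =
  fixes C :: "('a::alg_closed_field, 3) proj set" and d :: nat and F :: "('a, 3) mpoly"
  assumes F_irr: "Factorial_Ring.irreducible F" and F_form: "is_form d F"
    and C_eq: "C = {x. form_at F x = 0}" and d2: "d \<ge> 2" and C_irr: "irreducible_set C"
begin

lemma F_nonzero: "F \<noteq> 0"
  using F_irr by auto

lemma mem_C_iff: "v \<noteq> 0 \<Longrightarrow> abs_proj v \<in> C \<longleftrightarrow> peval F v = 0"
  using form_at_abs_proj[OF _ F_form] by (simp add: C_eq)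

lemma mem_C_rep: "x \<in> C \<longleftrightarrow> peval F (rep_proj x) = 0"
  by (simp add: C_eq form_at_def)

lemma exists_not_on_C: obtains v where "peval F v \<noteq> 0"
  using peval_eq_0_imp F_nonzero by blast

end

text \<open>Positive degree in the second affine coordinate yields points of the curve over almost
  every value of the first, so that x is not constant.\<close>

locale framed_curve = plane_curve C d F + frame e1 e2 e3 l1 l2 l3
  for C :: "('a::alg_closed_field, 3) proj set" and d F e1 e2 e3 l1 l2 l3 +
  assumes deg_pos: "degree (bp F e1 e2 e3) > 0"
begin

abbreviation "f \<equiv> bp F e1 e2 e3"

lemma irreducible_f: "Factorial_Ring.irreducible f"
  by (rule irreducible_bp[OF F_irr F_form deg_pos])

lemma sp_f_nonzero: "sp f c \<noteq> 0"
  by (rule irreducible_sp_nonzero[OF irreducible_f deg_pos])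

lemma affine_nonzero: "a *s e1 + b *s e2 + e3 \<noteq> 0"
proof
  assume "a *s e1 + b *s e2 + e3 = 0"
  then have "dotp l3 (a *s e1 + b *s e2 + e3) = 0" by (simp del: dotp_add)
  then show False by simp
qed

lemma affine_in_C: "abs_proj (a *s e1 + b *s e2 + e3) \<in> C \<longleftrightarrow> ev f a b = 0"
  using mem_C_iff[OF affine_nonzero] by simp

definition x where "x Q = dotp l1 (rep_proj Q) / dotp l3 (rep_proj Q)"
definition y where "y Q = dotp l2 (rep_proj Q) / dotp l3 (rep_proj Q)"

lemma xy_affine: "x (abs_proj (a *s e1 + b *s e2 + e3)) = a" "y (abs_proj (a *s e1 + b *s e2 + e3)) = b"
proof -
  obtain c where "c \<noteq> 0" "rep_proj (abs_proj (a *s e1 + b *s e2 + e3)) = c *s (a *s e1 + b *s e2 + e3)"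
    using rep_abs_proj[OF affine_nonzero] .
  then show "x (abs_proj (a *s e1 + b *s e2 + e3)) = a" "y (abs_proj (a *s e1 + b *s e2 + e3)) = b"
    by (simp_all add: x_def y_def)
qed

lemma rep_affine:
  assumes "dotp l3 (rep_proj Q) \<noteq> 0"
  shows "rep_proj Q = dotp l3 (rep_proj Q) *s (x Q *s e1 + y Q *s e2 + e3)"
  unfolding x_def y_def by (rule scale_affine[OF assms])

lemma on_C_f:
  assumes "Q \<in> C" "dotp l3 (rep_proj Q) \<noteq> 0"
  shows "ev f (x Q) (y Q) = 0"
proof -
  have "peval F (rep_proj Q) = 0" using assms(1) by (simp add: mem_C_rep)
  then show ?thesis using assms(2) unfolding peval_affine[OF F_form assms(2)] x_def y_def by simp
qed

lemma root_over:
  assumes "poly (lead_coeff f) a \<noteq> 0"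
  shows "\<exists>b. ev f a b = 0"
proof -
  have "Polynomial.coeff (sp f a) (degree f) \<noteq> 0" using assms by simp
  then have "degree (sp f a) > 0" using deg_pos le_degree[of "sp f a" "degree f"] by simp
  then show ?thesis using alg_closed_imp_poly_has_root[of "sp f a"] by simp
qed

lemma exists_affine_point: "\<exists>Q\<in>C. dotp l3 (rep_proj Q) \<noteq> 0 \<and> x Q \<notin> A" if "finite A"
proof -
  have "lead_coeff f \<noteq> 0" using deg_pos by auto
  then obtain a where a: "a \<notin> A" "poly (lead_coeff f) a \<noteq> 0" using poly_nonroot_avoiding \<open>finite A\<close> by blast
  then obtain b where b: "ev f a b = 0" using root_over by blast
  let ?v = "a *s e1 + b *s e2 + e3"
  obtain c where "c \<noteq> 0" "rep_proj (abs_proj ?v) = c *s ?v" using rep_abs_proj[OF affine_nonzero] .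
  then have "dotp l3 (rep_proj (abs_proj ?v)) \<noteq> 0" by simp
  then show ?thesis using affine_in_C[of a b] b xy_affine[of a b] a(1) by (intro bexI[of _ "abs_proj ?v"]) auto
qed

lemma gen_affine: "\<forall>\<^sub>F Q in genf C. dotp l3 (rep_proj Q) \<noteq> 0"
proof -
  obtain Q where "Q \<in> C" "dotp l3 (rep_proj Q) \<noteq> 0" using exists_affine_point[of "{}"] by auto
  then show ?thesis
    using eventually_genf_form_nonzero[OF C_irr is_form_lin(1), of Q l3] by (simp add: form_at_lin)
qed

lemma gen_f: "\<forall>\<^sub>F Q in genf C. ev f (x Q) (y Q) = 0"
  using gen_affine eventually_genf_in[OF C_irr] by eventually_elim (rule on_C_f)

lemma gen_x_notin:
  assumes "finite A"
  shows "\<forall>\<^sub>F Q in genf C. x Q \<notin> A"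
proof -
  have "\<forall>\<^sub>F Q in genf C. x Q \<noteq> a" for a
  proof -
    obtain Q where Q: "Q \<in> C" "dotp l3 (rep_proj Q) \<noteq> 0" "x Q \<noteq> a"
      using exists_affine_point[of "{a}"] by auto
    then have "form_at (lin (l1 - a *s l3)) Q \<noteq> 0"
      by (auto simp: form_at_lin x_def field_simps)
    from eventually_genf_form_nonzero[OF C_irr is_form_lin(1) Q(1) this] gen_affine
    show ?thesis by eventually_elim (auto simp: form_at_lin x_def field_simps)
  qed
  then have "\<forall>\<^sub>F Q in genf C. \<forall>a\<in>A. x Q \<noteq> a" by (intro eventually_ball_finite assms) auto
  then show ?thesis by eventually_elim auto
qed

lemma gen_poly_x_nonzero: "q \<noteq> 0 \<Longrightarrow> \<forall>\<^sub>F Q in genf C. poly q (x Q) \<noteq> 0"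
  using gen_x_notin[OF poly_roots_finite[of q]] by (auto elim: eventually_mono)

text \<open>The Nullstellensatz for the curve: a generic point avoids any finite set of x-values, so
  the common zeros of f and g have infinitely many of them.\<close>

lemma f_dvd_vanishing:
  assumes "\<forall>\<^sub>F Q in genf C. ev g (x Q) (y Q) = 0"
  shows "f dvd g"
proof -
  have "\<forall>\<^sub>F Q in genf C. ev f (x Q) (y Q) = 0 \<and> ev g (x Q) (y Q) = 0"
    using gen_f assms by eventually_elim simp
  define S where "S = {(a, b). ev f a b = 0 \<and> ev g a b = 0}"
  show ?thesis
  proof (rule irreducible_dvd_vanishing[OF irreducible_f deg_pos])
    show "infinite (fst ` S)"
    proof
      assume "finite (fst ` S)"
      from gen_x_notin[OF this] gen_f assms have "\<forall>\<^sub>F Q in genf C. False"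
        by eventually_elim (auto simp: S_def image_iff)
      then show False using genf_neq_bot[OF C_irr] by simp
    qed
  qed (auto simp: S_def)
qed

end

context plane_curve
begin

lemma framed_curveI:
  assumes "frame e1 e2 e3 l1 l2 l3" "Polynomial.coeff (bp F e1 e2 e3) k \<noteq> 0" "k > 0"
  shows "framed_curve C d F e1 e2 e3 l1 l2 l3"
  using assms le_degree[OF assms(2)] plane_curve_axioms
  by (simp add: framed_curve_def framed_curve_axioms_def)

text \<open>A chart centred at a singular point in which \<open>F\<close> is monic: every form vanishing on \<open>C\<close> is
  there a multiple of \<open>F\<close>, so its gradient vanishes as well.\<close>

lemma grad_smooth_point:
  assumes "smooth_point C Q"
  shows "grad F (rep_proj Q) \<noteq> 0"
proof
  assume sing: "grad F (rep_proj Q) = 0"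
  define a where "a = rep_proj Q"
  have QC: "Q \<in> C" "vec.dim (tangent_space C Q) = 2" using assms by (auto simp: smooth_point_def)
  have Fa: "peval F a = 0" using QC(1) by (simp add: mem_C_rep a_def)
  \<comment> \<open>A point off C. As the second frame vector it makes the leading coefficient of
    the dehomogenization the nonzero constant F(\<open>e2\<close>).\<close>
  obtain e2 where e2: "peval F e2 \<noteq> 0" using exists_not_on_C .
  have "e2 \<notin> vec.span {a}"
  proof
    assume "e2 \<in> vec.span {a}"
    then obtain c where "e2 = c *s a" by (auto simp: vec.span_singleton)
    then show False using e2 Fa by (simp add: peval_scale[OF F_form])
  qed
  then obtain e1 where fr: "\<exists>l1 l2 l3. frame e1 e2 a l1 l2 l3"
  proof -
    obtain u m1 m2 m3 where "frame a e2 u m1 m2 m3"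
      by (rule frame_complete[of a e2]) (use \<open>e2 \<notin> vec.span {a}\<close> that in \<open>auto simp: a_def\<close>)
    then have "frame u e2 a m3 m2 m1" unfolding frame_def by (auto simp: add_ac)
    then show ?thesis using that by blast
  qed
  then obtain l1 l2 l3 where fr: "frame e1 e2 a l1 l2 l3" by blast
  interpret framed_curve C d F e1 e2 a l1 l2 l3
    by (rule framed_curveI[OF fr, of d]) (use leading_coeff_bp(1)[OF F_form] e2 d2 in auto)
  have "v \<in> tangent_space C Q" for v
    unfolding tangent_space_grad a_def[symmetric]
  proof (intro CollectI allI impI)
    fix k G assume G: "is_form k G \<and> (\<forall>y\<in>C. form_at G y = 0)"
    have "\<forall>\<^sub>F R in genf C. ev (bp G e1 e2 a) (x R) (y R) = 0"
      using gen_affine eventually_genf_in[OF C_irr]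
    proof eventually_elim
      case (elim R)
      have "peval G (rep_proj R) = 0" using G elim(2) by (simp add: form_at_def)
      then show ?case using elim(1) peval_affine[of k G "rep_proj R"] G by (simp add: x_def y_def)
    qed
    from f_dvd_vanishing[OF this] obtain q where q: "bp G e1 e2 a = f * q" by (rule dvdE)
    have "dotp (grad G a) (s *s e1 + t *s e2) = 0" for s t
    proof -
      define w where "w = s *s e1 + t *s e2"
      \<comment> \<open>The cofactor q restricted to the line through the origin in direction (s,
        t), rewritten as a polynomial in the single parameter \<epsilon>.\<close>
      define h where "h = map_poly (\<lambda>p. pcompose p [:0, s:]) q"
      define qq where "qq = poly h [:0, t:]"
      have qq: "poly qq \<epsilon> = ev q (\<epsilon> * s) (\<epsilon> * t)" for \<epsilon>
      proof -
        have "poly (poly (map_poly (\<lambda>p. pcompose p [:0, s:]) q) [:0, t:]) \<epsilon> = ev q (\<epsilon> * s) (\<epsilon> * t)"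
        proof (induction q)
          case (pCons c q)
          have "map_poly (\<lambda>p. pcompose p [:0, s:]) (pCons c q) = pCons (pcompose c [:0, s:]) (map_poly (\<lambda>p. pcompose p [:0, s:]) q)"
            by (rule poly_eqI) (simp add: coeff_map_poly coeff_pCons split: nat.split)
          then show ?case using pCons by (simp add: poly_pcompose mult.commute)
        qed simp
        then show ?thesis by (simp add: qq_def h_def)
      qed
      have "lp G a w = qq * lp F a w"
      proof (rule lp_eqI)
        fix \<epsilon>
        have eq: "a + \<epsilon> *s w = (\<epsilon> * s) *s e1 + (\<epsilon> * t) *s e2 + a"
          by (simp add: w_def vector_add_ldistrib vector_smult_assoc)
        have "peval G (a + \<epsilon> *s w) = ev (bp G e1 e2 a) (\<epsilon> * s) (\<epsilon> * t)" by (simp add: eq)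
        also have "\<dots> = peval F (a + \<epsilon> *s w) * ev q (\<epsilon> * s) (\<epsilon> * t)" unfolding q by (simp add: eq)
        finally show "peval G (a + \<epsilon> *s w) = poly (qq * lp F a w) \<epsilon>" by (simp add: qq)
      qed
      then have "dotp (grad G a) w = 0"
        using sing[folded a_def] dotp_grad[of F a w] by (simp add: dotp_grad coeff_mult_Suc_0 Fa)
      then show ?thesis by (simp add: w_def)
    qed
    moreover have "peval G a = 0" using G QC(1) by (auto simp: form_at_def a_def)
    then have "dotp (grad G a) a = 0" using dotp_grad_self G by blast
    ultimately show "dotp (grad G a) v = 0"
      by (subst expand[of v]) (simp only: dotp_add dotp_scale, simp)
  qed
  then have "tangent_space C Q = UNIV" by blast
  then show False using QC(2) by (simp add: vec.dim_UNIV card_cart_basis)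
qed

text \<open>The kernel of the nonzero gradient is at most two-dimensional and contains the tangent
  space, which has dimension 2 by smoothness.\<close>

lemma tangent_space_smooth:
  assumes "smooth_point C Q"
  shows "tangent_space C Q = {v. dotp (grad F (rep_proj Q)) v = 0}" (is "_ = ?K")
proof -
  have sub: "tangent_space C Q \<subseteq> ?K"
    unfolding tangent_space_grad using F_form by (auto simp: C_eq)
  have subsp: "vec.subspace ?K" by (auto simp: vec.subspace_def)
  obtain i where i: "grad F (rep_proj Q) $ i \<noteq> 0" using grad_smooth_point[OF assms] by (auto simp: vec_eq_iff)
  then have "axis i 1 \<notin> ?K" by simp
  then have "?K \<noteq> UNIV" by blast
  moreover have "vec.span ?K = ?K" using vec.span_eq_iff[of ?K] subsp by simp
  ultimately have "vec.span ?K \<subset> vec.span UNIV" unfolding vec.span_UNIV by blast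
  then have "vec.dim ?K < vec.dim (UNIV :: ('a ^ 3) set)" by (rule vec.dim_psubset)
  then have "vec.dim ?K \<le> vec.dim (tangent_space C Q)"
    using assms by (simp add: vec.dim_UNIV card_cart_basis smooth_point_def)
  from vec.subspace_dim_equal[OF subspace_tangent_space subsp sub this] show ?thesis .
qed

end

subsection \<open>Homomorphisms between rings of germs\<close>

text \<open>A homomorphism of k-algebras between function fields, described on representing
  functions: each law holds only up to generic equality. Composition maps and the Galois action both
  take this shape.\<close>

definition germ_hom :: "('a::field, 'n::finite) proj set \<Rightarrow> ('a, 'm::finite) proj set \<Rightarrow>
    ((('a, 'n) proj \<Rightarrow> 'a) \<Rightarrow> (('a, 'm) proj \<Rightarrow> 'a)) \<Rightarrow> bool" where
  "germ_hom X Y T \<longleftrightarrow> (\<forall>f. ratf X f \<longrightarrow> ratf Y (T f)) \<and>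
     (\<forall>f g. ratf X f \<longrightarrow> ratf X g \<longrightarrow> (\<forall>\<^sub>F x in genf X. f x = g x) \<longrightarrow> (\<forall>\<^sub>F x in genf Y. T f x = T g x)) \<and>
     (\<forall>f g. ratf X f \<longrightarrow> ratf X g \<longrightarrow> (\<forall>\<^sub>F x in genf Y. T (\<lambda>x. f x + g x) x = T f x + T g x)) \<and>
     (\<forall>f g. ratf X f \<longrightarrow> ratf X g \<longrightarrow> (\<forall>\<^sub>F x in genf Y. T (\<lambda>x. f x * g x) x = T f x * T g x)) \<and>
     (\<forall>c. \<forall>\<^sub>F x in genf Y. T (\<lambda>_. c) x = c)"

context
  fixes X :: "('a::field, 'n::finite) proj set" and Y :: "('a, 'm::finite) proj set" and T
  assumes irrX: "irreducible_set X" and irrY: "irreducible_set Y" and T: "germ_hom X Y T"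
begin

lemma germ_hom_ratf: "ratf X f \<Longrightarrow> ratf Y (T f)"
  and germ_hom_cong: "ratf X f \<Longrightarrow> \<forall>\<^sub>F x in genf X. f x = g x \<Longrightarrow> \<forall>\<^sub>F x in genf Y. T f x = T g x"
  and germ_hom_add: "ratf X f \<Longrightarrow> ratf X g \<Longrightarrow> \<forall>\<^sub>F x in genf Y. T (\<lambda>x. f x + g x) x = T f x + T g x"
  and germ_hom_mult: "ratf X f \<Longrightarrow> ratf X g \<Longrightarrow> \<forall>\<^sub>F x in genf Y. T (\<lambda>x. f x * g x) x = T f x * T g x"
  and germ_hom_const: "\<forall>\<^sub>F x in genf Y. T (\<lambda>_. c) x = c"
  using T ratf_cong[of X f g] unfolding germ_hom_def by blast+

lemma germ_hom_sum:
  "(\<And>a. a \<in> A \<Longrightarrow> ratf X (f a)) \<Longrightarrow> \<forall>\<^sub>F x in genf Y. T (\<lambda>x. \<Sum>a\<in>A. f a x) x = (\<Sum>a\<in>A. T (f a) x)"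
proof (induction A rule: infinite_finite_induct)
  case (insert a A)
  then have "\<forall>\<^sub>F x in genf Y. T (\<lambda>x. f a x + (\<Sum>a\<in>A. f a x)) x = T (f a) x + T (\<lambda>x. \<Sum>a\<in>A. f a x) x"
    by (intro germ_hom_add ratf_sum irrX) auto
  moreover have "\<forall>\<^sub>F x in genf Y. T (\<lambda>x. \<Sum>a\<in>A. f a x) x = (\<Sum>a\<in>A. T (f a) x)" using insert by blast
  ultimately show ?case by eventually_elim (simp add: insert.hyps)
qed (simp_all add: germ_hom_const)

lemma germ_hom_prod:
  "(\<And>a. a \<in> A \<Longrightarrow> ratf X (f a)) \<Longrightarrow> \<forall>\<^sub>F x in genf Y. T (\<lambda>x. \<Prod>a\<in>A. f a x) x = (\<Prod>a\<in>A. T (f a) x)"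
proof (induction A rule: infinite_finite_induct)
  case (insert a A)
  then have "\<forall>\<^sub>F x in genf Y. T (\<lambda>x. f a x * (\<Prod>a\<in>A. f a x)) x = T (f a) x * T (\<lambda>x. \<Prod>a\<in>A. f a x) x"
    by (intro germ_hom_mult ratf_prod irrX) auto
  moreover have "\<forall>\<^sub>F x in genf Y. T (\<lambda>x. \<Prod>a\<in>A. f a x) x = (\<Prod>a\<in>A. T (f a) x)" using insert by blast
  ultimately show ?case by eventually_elim (simp add: insert.hyps)
qed (simp_all add: germ_hom_const)

lemma germ_hom_power: "ratf X f \<Longrightarrow> \<forall>\<^sub>F x in genf Y. T (\<lambda>x. f x ^ k) x = T f x ^ k"
  using germ_hom_prod[of "{..<k}" "\<lambda>_. f"] by simp

lemma germ_hom_cmult: "ratf X f \<Longrightarrow> \<forall>\<^sub>F x in genf Y. T (\<lambda>x. c * f x) x = c * T f x"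
  using germ_hom_mult[OF ratf_const[OF irrX], of f c] germ_hom_const[of c]
  by (auto elim: eventually_elim2)

lemma germ_hom_nonzero:
  assumes "ratf X f" "\<forall>\<^sub>F x in genf X. f x \<noteq> 0"
  shows "\<forall>\<^sub>F x in genf Y. T f x \<noteq> 0"
proof -
  have "\<forall>\<^sub>F x in genf X. f x * (1 / f x) = 1" using assms(2) by eventually_elim simp
  then have "\<forall>\<^sub>F x in genf Y. T (\<lambda>x. f x * (1 / f x)) x = T (\<lambda>_. 1) x"
    by (intro germ_hom_cong ratf_mult ratf_inverse irrX assms(1))
  with germ_hom_mult[OF assms(1) ratf_inverse[OF irrX assms(1)]] germ_hom_const[of 1]
  show ?thesis by eventually_elim auto
qed

lemma germ_hom_inverse:
  assumes "ratf X f"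
  shows "\<forall>\<^sub>F x in genf Y. T (\<lambda>x. 1 / f x) x = 1 / T f x"
  using ratf_0_or_nonzero[OF irrX assms]
proof
  assume f0: "\<forall>\<^sub>F x in genf X. f x = 0"
  then have "\<forall>\<^sub>F x in genf X. 1 / f x = 0" by eventually_elim simp
  then have "\<forall>\<^sub>F x in genf Y. T (\<lambda>x. 1 / f x) x = T (\<lambda>_. 0) x"
    by (intro germ_hom_cong ratf_inverse irrX assms)
  with germ_hom_cong[OF assms f0] germ_hom_const[of 0] show ?thesis by eventually_elim simp
next
  assume f0: "\<forall>\<^sub>F x in genf X. f x \<noteq> 0"
  then have "\<forall>\<^sub>F x in genf X. f x * (1 / f x) = 1" by eventually_elim simp
  then have "\<forall>\<^sub>F x in genf Y. T (\<lambda>x. f x * (1 / f x)) x = T (\<lambda>_. 1) x"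
    by (intro germ_hom_cong ratf_mult ratf_inverse irrX assms)
  with germ_hom_mult[OF assms ratf_inverse[OF irrX assms]] germ_hom_const[of 1]
    germ_hom_nonzero[OF assms f0]
  show ?thesis by eventually_elim (simp add: field_simps)
qed

lemma germ_hom_divide:
  assumes "ratf X f" "ratf X g"
  shows "\<forall>\<^sub>F x in genf Y. T (\<lambda>x. f x / g x) x = T f x / T g x"
  using germ_hom_mult[OF assms(1) ratf_inverse[OF irrX assms(2)]] germ_hom_inverse[OF assms(2)]
  by eventually_elim simp

lemma germ_hom_peval:
  assumes "\<And>i. ratf X (f i)"
  shows "\<forall>\<^sub>F x in genf Y. T (\<lambda>x. peval F (\<chi> i. f i x)) x = peval F (\<chi> i. T (f i) x)"
proof -
  let ?m = "\<lambda>m x. \<Prod>i\<in>UNIV. f i x ^ Poly_Mapping.lookup m i"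
  have m: "ratf X (?m m)" for m by (intro ratf_prod ratf_power irrX assms)
  have Tm: "\<forall>\<^sub>F x in genf Y. T (?m m) x = (\<Prod>i\<in>UNIV. T (f i) x ^ Poly_Mapping.lookup m i)" for m
  proof -
    have "\<forall>\<^sub>F x in genf Y. \<forall>i\<in>UNIV. T (\<lambda>x. f i x ^ Poly_Mapping.lookup m i) x = T (f i) x ^ Poly_Mapping.lookup m i"
      by (intro eventually_ball_finite ballI germ_hom_power assms) simp
    with germ_hom_prod[of UNIV "\<lambda>i x. f i x ^ Poly_Mapping.lookup m i", OF ratf_power[OF irrX assms]]
    show ?thesis by eventually_elim simp
  qed
  have Tc: "\<forall>\<^sub>F x in genf Y. T (\<lambda>x. Poly_Mapping.lookup F m * ?m m x) x =
      Poly_Mapping.lookup F m * (\<Prod>i\<in>UNIV. T (f i) x ^ Poly_Mapping.lookup m i)" for m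
    using germ_hom_cmult[OF m, of "Poly_Mapping.lookup F m" m] Tm[of m] by eventually_elim simp
  have "\<forall>\<^sub>F x in genf Y. \<forall>m\<in>Poly_Mapping.keys F. T (\<lambda>x. Poly_Mapping.lookup F m * ?m m x) x =
      Poly_Mapping.lookup F m * (\<Prod>i\<in>UNIV. T (f i) x ^ Poly_Mapping.lookup m i)"
    by (intro eventually_ball_finite ballI Tc) simp
  moreover have "\<forall>\<^sub>F x in genf Y. T (\<lambda>x. \<Sum>m\<in>Poly_Mapping.keys F. Poly_Mapping.lookup F m * ?m m x) x =
      (\<Sum>m\<in>Poly_Mapping.keys F. T (\<lambda>x. Poly_Mapping.lookup F m * ?m m x) x)"
    by (intro germ_hom_sum ratf_mult ratf_const irrX m)
  ultimately show ?thesis unfolding peval_def by eventually_elim simp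
qed

text \<open>Up to sign these coefficients are the elementary symmetric functions of the h s. Working
  with the product polynomial avoids naming them.\<close>

lemma ratf_coeff_prod:
  assumes "finite S" "\<And>s. s \<in> S \<Longrightarrow> ratf X (h s)"
  shows "ratf X (\<lambda>x. Polynomial.coeff (\<Prod>s\<in>S. [:- h s x, 1:]) i)"
  using assms
proof (induction S arbitrary: i rule: finite_induct)
  case empty
  then show ?case by (simp add: ratf_const[OF irrX])
next
  case (insert a S)
  have "ratf X (\<lambda>x. - h a x * Polynomial.coeff (\<Prod>s\<in>S. [:- h s x, 1:]) i +
      (case i of 0 \<Rightarrow> 0 | Suc j \<Rightarrow> Polynomial.coeff (\<Prod>s\<in>S. [:- h s x, 1:]) j))"
    using insert by (cases i) (auto intro!: ratf_add ratf_diff ratf_mult ratf_uminus irrX ratf_const)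
  then show ?case by (simp add: insert.hyps coeff_pCons)
qed

lemma germ_hom_coeff_prod:
  assumes "finite S" "\<And>s. s \<in> S \<Longrightarrow> ratf X (h s)"
  shows "\<forall>\<^sub>F x in genf Y. T (\<lambda>x. Polynomial.coeff (\<Prod>s\<in>S. [:- h s x, 1:]) i) x =
    Polynomial.coeff (\<Prod>s\<in>S. [:- T (h s) x, 1:]) i"
  using assms
proof (induction S arbitrary: i rule: finite_induct)
  case empty
  then show ?case by (simp add: germ_hom_const)
next
  case (insert a S)
  let ?c = "\<lambda>i x. Polynomial.coeff (\<Prod>s\<in>S. [:- h s x, 1:]) i"
  have c: "ratf X (?c i)" for i by (rule ratf_coeff_prod) (use insert in auto)
  have a: "ratf X (\<lambda>x. - 1 * h a x)" using insert by (intro ratf_mult ratf_const irrX) auto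
  have ha: "\<forall>\<^sub>F x in genf Y. T (\<lambda>x. -1 * h a x) x = -1 * T (h a) x"
    using insert by (intro germ_hom_cmult) auto
  have IH: "\<forall>\<^sub>F x in genf Y. T (?c i) x = Polynomial.coeff (\<Prod>s\<in>S. [:- T (h s) x, 1:]) i" for i
    using insert by blast
  show ?case
  proof (cases i)
    case 0
    show ?thesis using germ_hom_mult[OF a c[of 0]] IH[of 0] ha
      by eventually_elim (simp add: insert.hyps 0)
  next
    case (Suc j)
    show ?thesis
      using germ_hom_add[OF ratf_mult[OF irrX a c[of i]] c[of j]] germ_hom_mult[OF a c[of i]] IH[of i] IH[of j] ha
      by eventually_elim (simp add: insert.hyps Suc)
  qed
qed

end

lemma germ_hom_pullback:
  assumes "ratmap X Y f"
  shows "germ_hom Y X (\<lambda>h x. h (f x))"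
  unfolding germ_hom_def using ratf_compose[OF assms] assms
  by (auto simp: ratmap_def filterlim_iff)

subsection \<open>The projection from a point\<close>

text \<open>Points outside the two closed sets are joined by a line. The forms excluding them
  restrict to nonzero polynomials on it, and a parameter avoiding the roots of both gives a point in
  neither set.\<close>

lemma irreducible_UNIV: "irreducible_set (UNIV :: ('a::alg_closed_field, 'n::finite) proj set)"
  unfolding irreducible_set_def
proof (intro conjI allI impI)
  fix A B :: "('a, 'n) proj set"
  assume AB: "closedin zariski A \<and> closedin zariski B \<and> UNIV \<subseteq> A \<union> B"
  show "UNIV \<subseteq> A \<or> UNIV \<subseteq> B"
  proof (rule ccontr)
    assume "\<not> ?thesis"
    then obtain a b where ab: "a \<notin> A" "b \<notin> B" by blast
    obtain d F where F: "is_form d F" "form_at F a \<noteq> 0" "\<forall>y\<in>A. form_at F y = 0"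
      using AB[THEN conjunct1, unfolded closedin_zariski_iff, rule_format, OF ab(1)] by blast
    obtain e G where G: "is_form e G" "form_at G b \<noteq> 0" "\<forall>y\<in>B. form_at G y = 0"
      using AB[THEN conjunct2, THEN conjunct1, unfolded closedin_zariski_iff, rule_format, OF ab(2)] by blast
    define v w where "v = rep_proj a" and "w = rep_proj b - rep_proj a"
    have "lp F v w \<noteq> 0"
    proof
      assume "lp F v w = 0"
      then have "peval F v = 0" by (metis coeff_0 coeff_lp_0)
      then show False using F(2) by (simp add: form_at_def v_def)
    qed
    moreover have "lp G v w \<noteq> 0"
    proof
      assume "lp G v w = 0"
      then have "peval G (v + 1 *s w) = 0" by (metis poly_0 poly_lp)
      then show False using G(2) by (simp add: form_at_def v_def w_def)
    qed
    ultimately have nz: "lp F v w * lp G v w \<noteq> 0" by simp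
    obtain i where i: "v $ i \<noteq> 0" using rep_proj_nonzero[of a] by (auto simp: v_def vec_eq_iff)
    \<comment> \<open>The additional linear factor is a coordinate along the line; its nonvanishing
      ensures that the chosen parameter gives a nonzero vector.\<close>
    have "lp F v w * lp G v w * [:v $ i, w $ i:] \<noteq> 0"
      using nz i by (metis mult_eq_0_iff pCons_eq_0_iff)
    then obtain t where t: "poly (lp F v w * lp G v w * [:v $ i, w $ i:]) t \<noteq> 0"
      using poly_nonroot_avoiding[of _ "{}"] by blast
    then have t': "poly [:v $ i, w $ i:] t \<noteq> 0" "poly (lp F v w) t \<noteq> 0" "poly (lp G v w) t \<noteq> 0"
      by (simp_all only: poly_mult mult_eq_0_iff de_Morgan_disj not_False_eq_True)
    then have "(v + t *s w) $ i \<noteq> 0" by simp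
    then have "v + t *s w \<noteq> 0" by (metis zero_index)
    then have "form_at F (abs_proj (v + t *s w)) \<noteq> 0" "form_at G (abs_proj (v + t *s w)) \<noteq> 0"
      using t' form_at_abs_proj F(1) G(1) by auto
    then show False using F(3) G(3) AB by blast
  qed
qed simp

context framed_curve
begin

definition rational_in_x where
  "rational_in_x h \<longleftrightarrow> (\<exists>p q. q \<noteq> 0 \<and> (\<forall>\<^sub>F Q in genf C. h Q = poly p (x Q) / poly q (x Q)))"

lemma ratf_x: "ratf C x" and ratf_y: "ratf C y"
proof -
  obtain Q where "Q \<in> C" "dotp l3 (rep_proj Q) \<noteq> 0" using exists_affine_point[of "{}"] by auto
  then show "ratf C x" "ratf C y"
    using ratf_form_quotient[OF C_irr is_form_lin(1) is_form_lin(1), of Q l3]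
    by (simp_all add: form_at_lin x_def[abs_def] y_def[abs_def])
qed

lemma two_dim_dual:
  fixes u w :: "'a ^ 2"
  assumes "\<And>a b. a *s u + b *s w = 0 \<Longrightarrow> a = 0 \<and> b = 0"
  obtains m1 m2 where "dotp m1 u = 1" "dotp m1 w = 0" "dotp m2 u = 0" "dotp m2 w = 1"
    "\<And>v. v = dotp m1 v *s u + dotp m2 v *s w"
proof -
  have D: "u $ 1 * w $ 2 - u $ 2 * w $ 1 \<noteq> 0" (is "?D \<noteq> 0")
  proof
    assume D0: "?D = 0"
    have "w $ 2 *s u + (- u $ 2) *s w = 0" "w $ 1 *s u + (- u $ 1) *s w = 0"
      using D0 by (auto simp: vec_eq_iff forall_2 algebra_simps)
    from assms[OF this(1)] assms[OF this(2)] have "u $ 2 = 0" "u $ 1 = 0" by simp_all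
    then have "1 *s u + 0 *s w = 0" by (simp add: vec_eq_iff forall_2)
    from assms[OF this] show False by simp
  qed
  define D where "D = ?D"
  have D0: "D \<noteq> 0" and D_eq: "u $ 1 * w $ 2 - u $ 2 * w $ 1 = D" using D by (simp_all add: D_def)
  define m1 :: "'a ^ 2" where "m1 = vector [w $ 2 / D, - w $ 1 / D]"
  define m2 :: "'a ^ 2" where "m2 = vector [- u $ 2 / D, u $ 1 / D]"
  have m1: "dotp m1 v = (w $ 2 * v $ 1 - w $ 1 * v $ 2) / D" for v
    by (simp add: m1_def dotp_def sum_2 diff_divide_distrib)
  have m2: "dotp m2 v = (u $ 1 * v $ 2 - u $ 2 * v $ 1) / D" for v
    by (simp add: m2_def dotp_def sum_2 diff_divide_distrib)
  have "v = dotp m1 v *s u + dotp m2 v *s w" for v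
  proof -
    have "(w $ 2 * v $ 1 - w $ 1 * v $ 2) * u $ i + (u $ 1 * v $ 2 - u $ 2 * v $ 1) * w $ i = v $ i * D"
      if "i = 1 \<or> i = 2" for i
      using that unfolding D_eq[symmetric] by (elim disjE) (simp_all add: algebra_simps)
    then have "((w $ 2 * v $ 1 - w $ 1 * v $ 2) * u $ i + (u $ 1 * v $ 2 - u $ 2 * v $ 1) * w $ i) / D = v $ i"
      if "i = 1 \<or> i = 2" for i using that D0 by simp
    then have "v $ i = dotp m1 v * u $ i + dotp m2 v * w $ i" if "i = 1 \<or> i = 2" for i
      unfolding m1 m2 using that by (simp add: add_divide_distrib)
    then show ?thesis by (simp add: vec_eq_iff forall_2)
  qed
  moreover have "dotp m1 u = 1" "dotp m1 w = 0" "dotp m2 u = 0" "dotp m2 w = 1"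
    unfolding m1 m2 using D0 D_eq by (simp_all add: mult.commute)
  ultimately show ?thesis using that[of m1 m2] by blast
qed

text \<open>The projection matrix is an arbitrary choice with kernel spanned by the centre. It kills
  \<open>e2\<close> and is injective on the span of \<open>e1\<close> and \<open>e3\<close>, so up
  to a change of basis of the target it is x.\<close>

lemma projection_from_frame:
  assumes P: "P = abs_proj e2"
  obtains u w :: "'a ^ 2" where "\<And>a b. a *s u + b *s w = 0 \<Longrightarrow> a = 0 \<and> b = 0"
    "\<forall>\<^sub>F Q in genf C. projection_from P Q = abs_proj (x Q *s u + w)"
proof -
  have e20: "e2 \<noteq> 0" using dual(5) by fastforce
  obtain c where c: "c \<noteq> 0" "rep_proj P = c *s e2" using rep_abs_proj[OF e20] P by metis
  have span: "v \<in> vec.span {rep_proj P} \<longleftrightarrow> dotp l1 v = 0 \<and> dotp l3 v = 0" for v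
  proof
    assume "dotp l1 v = 0 \<and> dotp l3 v = 0"
    then have "v = dotp l2 v *s e2" using expand[of v] by simp
    then have "v = (dotp l2 v / c) *s rep_proj P" using c by (simp add: vector_smult_assoc)
    then show "v \<in> vec.span {rep_proj P}" by (auto simp: vec.span_singleton)
  qed (auto simp: vec.span_singleton c)
  define A where "A = (SOME A :: 'a ^ 3 ^ 2. {v. A *v v = 0} = vec.span {rep_proj P})"
  have "\<exists>A :: 'a ^ 3 ^ 2. {v. A *v v = 0} = vec.span {rep_proj P}"
  proof (rule exI[of _ "vector [l1, l3]"], rule Set.set_eqI)
    fix v
    show "v \<in> {v. (vector [l1, l3] :: 'a ^ 3 ^ 2) *v v = 0} \<longleftrightarrow> v \<in> vec.span {rep_proj P}"
      by (simp add: span vec_eq_iff forall_2 matrix_vector_dotp)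
  qed
  from someI_ex[OF this] have A: "A *v v = 0 \<longleftrightarrow> dotp l1 v = 0 \<and> dotp l3 v = 0" for v
    unfolding A_def[symmetric] using span by blast
  define u w where "u = A *v e1" and "w = A *v e3"
  have Auw: "A *v v = dotp l1 v *s u + dotp l3 v *s w" for v
  proof -
    have "A *v v = A *v (dotp l1 v *s e1 + dotp l2 v *s e2 + dotp l3 v *s e3)" using expand[of v] by simp
    also have "\<dots> = dotp l1 v *s u + dotp l2 v *s (A *v e2) + dotp l3 v *s w"
      by (simp add: u_def w_def vec.add vec.scale)
    also have "A *v e2 = 0" by (simp add: A)
    finally show ?thesis by simp
  qed
  show ?thesis
  proof (rule that)
    fix a b assume "a *s u + b *s w = 0"
    then have "A *v (a *s e1 + b *s e3) = 0" by (simp add: Auw)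
    then show "a = 0 \<and> b = 0" unfolding A by simp
  next
    show "\<forall>\<^sub>F Q in genf C. projection_from P Q = abs_proj (x Q *s u + w)"
      using gen_affine
    proof eventually_elim
      case (elim Q)
      have eq: "A *v rep_proj Q = dotp l3 (rep_proj Q) *s (x Q *s u + w)"
        unfolding Auw using elim by (simp add: x_def vector_add_ldistrib vector_smult_assoc)
      have "A *v rep_proj Q \<noteq> 0" using elim by (simp add: A)
      then have nz: "x Q *s u + w \<noteq> 0" unfolding eq by (metis vector_smult_rzero)
      show ?case
        unfolding projection_from_def A_def[symmetric] linear_proj_map_def eq
        by (rule abs_proj_scale[OF elim nz])
    qed
  qed
qed

text \<open>The pulled back function field of the projective line is k(x), whatever projection
  matrix was chosen: in one direction forms are restricted to the affine line x u + w, in the other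
  a fraction in x is homogenized.\<close>

theorem projection_subfield_frame:
  assumes P: "P = abs_proj e2"
  shows "projection_subfield C P = {generic_class C h |h. rational_in_x h}"
proof -
  obtain u w :: "'a ^ 2" where uw: "\<And>a b. a *s u + b *s w = 0 \<Longrightarrow> a = 0 \<and> b = 0"
    and pr: "\<forall>\<^sub>F Q in genf C. projection_from P Q = abs_proj (x Q *s u + w)"
    by (rule projection_from_frame[OF P]) (rule that)
  obtain m1 m2 where m: "dotp m1 u = 1" "dotp m1 w = 0" "dotp m2 u = 0" "dotp m2 w = 1"
    "\<And>v. v = dotp m1 v *s u + dotp m2 v *s w"
    by (rule two_dim_dual[where u = u and w = w, OF uw]) (assumption, rule that)
  have xuw: "a *s u + w \<noteq> 0" for a using uw[of a 1] by auto
  have m20: "m2 \<noteq> 0" using m(4) by auto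
  \<comment> \<open>The affine line w + a u meets every scalar class off \<open>m2\<close> = 0, so a
    form vanishing on it vanishes identically.\<close>
  have nz: "lp H w u \<noteq> 0" if H: "is_form k H" "form_at H R \<noteq> 0" for k H R
  proof
    assume lp0: "lp H w u = 0"
    have "peval H v = peval 0 v" for v
    proof (rule peval_eq_off_hyperplane[OF m20])
      fix v assume v: "dotp m2 v \<noteq> 0"
      have "v = dotp m2 v *s (w + (dotp m1 v / dotp m2 v) *s u)"
        using m(5)[of v] v by (simp add: vector_add_ldistrib vector_smult_assoc add.commute)
      then have "peval H v = dotp m2 v ^ k * peval H (w + (dotp m1 v / dotp m2 v) *s u)"
        using peval_scale[OF H(1)] by metis
      also have "\<dots> = 0" by (simp add: lp0 flip: poly_lp)
      finally show "peval H v = peval 0 v" by simp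
    qed
    then show False using H(2) by (simp add: form_at_def)
  qed
  have filt: "filterlim (projection_from P) (genf UNIV) (genf C)"
    unfolding filterlim_iff
  proof (intro allI impI)
    fix Pr assume "eventually Pr (genf (UNIV :: ('a, 2) proj set))"
    then obtain k H R where H: "is_form k H" "form_at H R \<noteq> 0" "\<And>y. form_at H y \<noteq> 0 \<Longrightarrow> Pr y"
      by (rule eventually_genfE[OF irreducible_UNIV]) auto
    have "\<forall>\<^sub>F Q in genf C. poly (lp H w u) (x Q) \<noteq> 0" by (rule gen_poly_x_nonzero[OF nz[OF H(1,2)]])
    then show "\<forall>\<^sub>F Q in genf C. Pr (projection_from P Q)" using pr
      by eventually_elim (use H(3) form_at_abs_proj[OF xuw H(1)] in \<open>auto simp: add.commute\<close>)
  qed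
  have pull: "rat_pullback C (projection_from P) (generic_class UNIV h) = generic_class C (h \<circ> projection_from P)" for h
    by (rule rat_pullback_generic_class[OF C_irr irreducible_UNIV filt])
  show ?thesis
  proof (intro Set.set_eqI iffI)
    fix a assume "a \<in> projection_subfield C P"
    then obtain h where h: "ratf UNIV h" "a = generic_class C (h \<circ> projection_from P)"
      unfolding projection_subfield_def carrier_function_field[OF irreducible_UNIV] using pull by auto
    obtain k A B where AB: "is_form k A" "is_form k B"
      "\<forall>\<^sub>F x in genf UNIV. form_at B x \<noteq> 0 \<and> h x = form_at A x / form_at B x"
      using h(1) by (elim ratfE[OF irreducible_UNIV])
    obtain R where R: "form_at B R \<noteq> 0" using eventually_genf_ex[OF irreducible_UNIV AB(3)] by blast
    have "\<forall>\<^sub>F Q in genf C. form_at B (projection_from P Q) \<noteq> 0 \<and>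
        h (projection_from P Q) = form_at A (projection_from P Q) / form_at B (projection_from P Q)"
      using filt AB(3) by (auto simp: filterlim_iff)
    then have "\<forall>\<^sub>F Q in genf C. (h \<circ> projection_from P) Q = poly (lp A w u) (x Q) / poly (lp B w u) (x Q)"
      using pr
    proof eventually_elim
      case (elim Q)
      have "poly (lp H w u) (x Q) = peval H (x Q *s u + w)" for H by (simp add: add.commute)
      then show ?case
        using elim form_quotient_abs_proj[OF xuw AB(1,2), of "x Q"] by (simp del: poly_lp)
    qed
    then show "a \<in> {generic_class C h |h. rational_in_x h}"
      unfolding rational_in_x_def using nz[OF AB(2) R] h(2) by blast
  next
    fix a assume "a \<in> {generic_class C h |h. rational_in_x h}"
    then obtain h p q where h: "a = generic_class C h" "q \<noteq> 0"
      "\<forall>\<^sub>F Q in genf C. h Q = poly p (x Q) / poly q (x Q)"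
      unfolding rational_in_x_def by blast
    define n where "n = max (degree p) (degree q)"
    \<comment> \<open>Homogenization to the common degree n, so that numerator and denominator
      become forms of equal degree in the dual coordinates.\<close>
    define hom where "hom p = (\<Sum>i\<le>n. Poly_Mapping.single 0 (Polynomial.coeff p i) * (lin m1 ^ i * lin m2 ^ (n - i)))" for p
    have form: "is_form n (hom p)" for p unfolding hom_def
    proof (rule is_form_sum)
      fix i assume "i \<in> {..n}"
      have "is_form (1 * i + 1 * (n - i)) (lin m1 ^ i * lin m2 ^ (n - i))"
        by (intro is_form_mult is_form_power is_form_lin)
      then show "is_form n (Poly_Mapping.single 0 (Polynomial.coeff p i) * (lin m1 ^ i * lin m2 ^ (n - i)))"
        using \<open>i \<in> {..n}\<close> by (intro is_form_cmult) simp
    qed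
    have hom: "peval (hom p) (b *s u + w) = poly p b" if "degree p \<le> n" for p b
    proof -
      have "poly p b = (\<Sum>i\<le>n. Polynomial.coeff p i * b ^ i)"
        unfolding poly_altdef using that by (intro sum.mono_neutral_left) (auto simp: coeff_eq_0)
      then show ?thesis by (simp add: hom_def m)
    qed
    have dn: "degree p \<le> n" "degree q \<le> n" by (simp_all add: n_def)
    define k where "k R = form_at (hom p) R / form_at (hom q) R" for R
    obtain b where b: "poly q b \<noteq> 0" using poly_nonroot_avoiding[OF h(2), of "{}"] by blast
    have "form_at (hom q) (abs_proj (b *s u + w)) \<noteq> 0"
      using form_at_abs_proj[OF xuw form] hom[OF dn(2)] b by simp
    then have k: "ratf UNIV k"
      unfolding k_def by (intro ratf_form_quotient[OF irreducible_UNIV form form]) auto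
    have "\<forall>\<^sub>F Q in genf C. (k \<circ> projection_from P) Q = h Q"
      using pr h(3)
      by eventually_elim (simp add: k_def form_quotient_abs_proj[OF xuw form form] hom dn)
    then have "a = rat_pullback C (projection_from P) (generic_class UNIV k)"
      unfolding h(1) pull by (subst generic_class_eq_iff[OF C_irr]) (auto elim: eventually_mono)
    then show "a \<in> projection_subfield C P"
      unfolding projection_subfield_def carrier_function_field[OF irreducible_UNIV] using k by blast
  qed
qed

end

subsection \<open>The Galois group of a projection\<close>

locale galois_curve = framed_curve C d F e1 e2 e3 l1 l2 l3
  for C :: "('a::alg_closed_field, 3) proj set" and d F e1 e2 e3 l1 l2 l3 +
  assumes galois: "galois_point C (abs_proj e2)"
begin

abbreviation "L \<equiv> function_field C"
abbreviation "K \<equiv> projection_subfield C (abs_proj e2)"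

lemma K_eq: "K = {generic_class C h |h. rational_in_x h}"
  by (rule projection_subfield_frame[OF refl])

lemma K_fixed: "{a \<in> carrier L. \<forall>g\<in>galois_group L K. g a = a} = K"
  using galois by (simp add: galois_point_def finite_galois_extension_def)

text \<open>A representative of the image class. It lets the Galois action, which is given on
  classes, be compared with other functions generically.\<close>

definition act where "act g h = (SOME k. k \<in> g (generic_class C h))"

lemma act_class:
  assumes "g \<in> galois_group L K" "ratf C h"
  shows "generic_class C (act g h) = g (generic_class C h)" "ratf C (act g h)"
proof -
  have "generic_class C h \<in> carrier L" using assms(2) by (auto simp: carrier_function_field[OF C_irr])
  then have "g (generic_class C h) \<in> carrier L"
    using assms(1) by (auto simp: galois_group_def ring_iso_def ring_hom_def)
  then obtain k where k: "ratf C k" "g (generic_class C h) = generic_class C k"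
    by (auto simp: carrier_function_field[OF C_irr])
  have "act g h \<in> generic_class C k"
    unfolding act_def k(2)
    by (rule someI[of "\<lambda>k'. k' \<in> generic_class C k" k, OF generic_class_self[OF C_irr]])
  then have "\<forall>\<^sub>F x in genf C. k x = act g h x"
    by (auto simp: generic_class_alt[OF C_irr] elim: eventually_mono)
  then show "generic_class C (act g h) = g (generic_class C h)" "ratf C (act g h)"
    using k ratf_cong generic_class_eq_iff[OF C_irr, of k "act g h"] by auto
qed

lemma K_memI: "rational_in_x h \<Longrightarrow> generic_class C h \<in> K"
  unfolding K_eq by blast

lemma rational_in_x_x: "rational_in_x x" and rational_in_x_const: "rational_in_x (\<lambda>_. c)"
  unfolding rational_in_x_def
  by (rule exI[of _ "[:0, 1:]"], rule exI[of _ 1], simp)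
    (rule exI[of _ "[:c:]"], rule exI[of _ 1], simp)

lemma galois_group_fixes: "g \<in> galois_group L K \<Longrightarrow> a \<in> K \<Longrightarrow> g a = a"
  by (simp add: galois_group_def)

lemma act_fixes:
  assumes "g \<in> galois_group L K" "ratf C h" "rational_in_x h"
  shows "\<forall>\<^sub>F Q in genf C. act g h Q = h Q"
  using act_class(1)[OF assms(1,2)] galois_group_fixes[OF assms(1) K_memI[OF assms(3)]]
  by (simp add: generic_class_eq_iff[OF C_irr])

lemma germ_hom_act:
  assumes g: "g \<in> galois_group L K"
  shows "germ_hom C C (act g)"
  unfolding germ_hom_def
proof (intro conjI allI impI)
  have hom: "g \<in> ring_hom L L" using g by (simp add: galois_group_def ring_iso_def)
  have carr: "generic_class C h \<in> carrier L" if "ratf C h" for h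
    using that by (auto simp: carrier_function_field[OF C_irr])
  show "ratf C (act g h)" if "ratf C h" for h using act_class(2)[OF g that] .
  show "\<forall>\<^sub>F x in genf C. act g h x = act g k x" if hk: "ratf C h" "ratf C k" "\<forall>\<^sub>F x in genf C. h x = k x" for h k
  proof -
    have "generic_class C h = generic_class C k" using hk(3) generic_class_eq_iff[OF C_irr] by blast
    then show ?thesis using act_class(1)[OF g hk(1)] act_class(1)[OF g hk(2)] generic_class_eq_iff[OF C_irr] by metis
  qed
  show "\<forall>\<^sub>F x in genf C. act g (\<lambda>x. h x + k x) x = act g h x + act g k x" if hk: "ratf C h" "ratf C k" for h k
  proof -
    have "generic_class C (act g (\<lambda>x. h x + k x)) = g (generic_class C h \<oplus>\<^bsub>L\<^esub> generic_class C k)"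
      unfolding add_function_field[OF C_irr] by (rule act_class(1)[OF g ratf_add[OF C_irr hk]])
    also have "\<dots> = generic_class C (\<lambda>x. act g h x + act g k x)"
      unfolding ring_hom_add[OF hom carr[OF hk(1)] carr[OF hk(2)]]
      by (simp add: act_class(1)[OF g, symmetric] hk add_function_field[OF C_irr])
    finally show ?thesis by (simp add: generic_class_eq_iff[OF C_irr])
  qed
  show "\<forall>\<^sub>F x in genf C. act g (\<lambda>x. h x * k x) x = act g h x * act g k x" if hk: "ratf C h" "ratf C k" for h k
  proof -
    have "generic_class C (act g (\<lambda>x. h x * k x)) = g (generic_class C h \<otimes>\<^bsub>L\<^esub> generic_class C k)"
      unfolding mult_function_field[OF C_irr] by (rule act_class(1)[OF g ratf_mult[OF C_irr hk]])
    also have "\<dots> = generic_class C (\<lambda>x. act g h x * act g k x)"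
      unfolding ring_hom_mult[OF hom carr[OF hk(1)] carr[OF hk(2)]]
      by (simp add: act_class(1)[OF g, symmetric] hk mult_function_field[OF C_irr])
    finally show ?thesis by (simp add: generic_class_eq_iff[OF C_irr])
  qed
  show "\<forall>\<^sub>F x in genf C. act g (\<lambda>_. c) x = c" for c
    using act_fixes[OF g ratf_const[OF C_irr] rational_in_x_const] .
qed

lemma act_x: "g \<in> galois_group L K \<Longrightarrow> \<forall>\<^sub>F Q in genf C. act g x Q = x Q"
  using act_fixes[OF _ ratf_x rational_in_x_x] .

text \<open>The elements of \<open>galois_group\<close> are arbitrary outside the carrier; restricting them gives a
  finite set.\<close>

definition \<Gamma> where "\<Gamma> = (\<lambda>g. restrict g (carrier L)) ` galois_group L K"

lemma \<Gamma>_galois: "g \<in> \<Gamma> \<Longrightarrow> g \<in> galois_group L K"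
proof -
  assume "g \<in> \<Gamma>"
  then obtain g0 where g0: "g0 \<in> galois_group L K" "g = restrict g0 (carrier L)" by (auto simp: \<Gamma>_def)
  have "K \<subseteq> carrier L" using K_fixed by blast
  moreover have "g \<in> ring_hom L L"
  proof -
    have "field L" using galois by (simp add: galois_point_def finite_galois_extension_def)
    then interpret field L .
    show ?thesis using g0 by (auto simp: galois_group_def ring_iso_def ring_hom_def)
  qed
  moreover have "bij_betw g (carrier L) (carrier L)"
    using g0 by (auto simp: galois_group_def ring_iso_def bij_betw_def inj_on_def)
  ultimately show ?thesis
    using g0 by (auto simp: galois_group_def ring_iso_def)
qed

text \<open>The function field is generated by y over k(x), which g fixes, so g acts by replacing y
  with its conjugate. The same A and B serve all g at once; hence g is determined by its effect on
  y.\<close>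

lemma act_generator:
  assumes "ratf C h"
  obtains k A B where "is_form k A" "is_form k B"
    "\<And>g. g \<in> galois_group L K \<Longrightarrow> \<forall>\<^sub>F Q in genf C.
       act g h Q = peval A (x Q *s e1 + act g y Q *s e2 + e3) / peval B (x Q *s e1 + act g y Q *s e2 + e3)"
proof -
  obtain k A B where AB: "is_form k A" "is_form k B"
    "\<forall>\<^sub>F Q in genf C. form_at B Q \<noteq> 0 \<and> h Q = form_at A Q / form_at B Q"
    using assms by (elim ratfE[OF C_irr])
  define v where "v i Q = x Q * e1 $ i + y Q * e2 $ i + e3 $ i" for i Q
  have v_alt: "(\<chi> i. v i Q) = x Q *s e1 + y Q *s e2 + e3" for Q by (simp add: vec_eq_iff v_def)
  have v: "ratf C (v i)" for i unfolding v_def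
    by (intro ratf_add ratf_mult ratf_const ratf_x ratf_y C_irr)
  have h: "\<forall>\<^sub>F Q in genf C. h Q = peval A (\<chi> i. v i Q) / peval B (\<chi> i. v i Q)"
    using AB(3) gen_affine
  proof eventually_elim
    case (elim Q)
    then show ?case unfolding v_alt
      using peval_affine[OF AB(1) elim(2)] peval_affine[OF AB(2) elim(2)]
      by (simp add: form_at_def x_def y_def)
  qed
  show ?thesis
  proof (rule that[OF AB(1,2)])
    fix g assume g: "g \<in> galois_group L K"
    note T = C_irr C_irr germ_hom_act[OF g]
    have rA: "ratf C (\<lambda>Q. peval A (\<chi> i. v i Q))" for A by (intro ratf_peval C_irr v)
    have gv: "\<forall>\<^sub>F Q in genf C. act g (v i) Q = x Q * e1 $ i + act g y Q * e2 $ i + e3 $ i" for i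
    proof -
      have veq: "v i = (\<lambda>Q. e1 $ i * x Q + e2 $ i * y Q + e3 $ i)" by (auto simp: v_def mult.commute)
      have "\<forall>\<^sub>F Q in genf C. act g (\<lambda>Q. e1 $ i * x Q) Q = e1 $ i * act g x Q"
        "\<forall>\<^sub>F Q in genf C. act g (\<lambda>Q. e2 $ i * y Q) Q = e2 $ i * act g y Q"
        by (intro germ_hom_cmult[OF T] ratf_x ratf_y)+
      moreover have "\<forall>\<^sub>F Q in genf C. act g (\<lambda>Q. e1 $ i * x Q + e2 $ i * y Q) Q =
          act g (\<lambda>Q. e1 $ i * x Q) Q + act g (\<lambda>Q. e2 $ i * y Q) Q"
        "\<forall>\<^sub>F Q in genf C. act g (\<lambda>Q. e1 $ i * x Q + e2 $ i * y Q + e3 $ i) Q =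
          act g (\<lambda>Q. e1 $ i * x Q + e2 $ i * y Q) Q + act g (\<lambda>Q. e3 $ i) Q"
        by (intro germ_hom_add[OF T] ratf_add ratf_mult ratf_const ratf_x ratf_y C_irr)+
      ultimately show ?thesis using act_x[OF g] germ_hom_const[OF T, of "e3 $ i"]
        unfolding veq by eventually_elim (simp add: mult.commute)
    qed
    have "\<forall>\<^sub>F Q in genf C. \<forall>i\<in>UNIV. act g (v i) Q = x Q * e1 $ i + act g y Q * e2 $ i + e3 $ i"
      by (intro eventually_ball_finite ballI gv) simp
    then have vec: "\<forall>\<^sub>F Q in genf C. (\<chi> i. act g (v i) Q) = x Q *s e1 + act g y Q *s e2 + e3"
      by eventually_elim (simp add: vec_eq_iff)
    have "\<forall>\<^sub>F Q in genf C. act g h Q = act g (\<lambda>Q. peval A (\<chi> i. v i Q) / peval B (\<chi> i. v i Q)) Q"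
      by (rule germ_hom_cong[OF T assms h])
    with germ_hom_divide[OF T rA[of A] rA[of B]] germ_hom_peval[where f = v and F = A, OF T v] germ_hom_peval[where f = v and F = B, OF T v] vec
    show "\<forall>\<^sub>F Q in genf C. act g h Q =
        peval A (x Q *s e1 + act g y Q *s e2 + e3) / peval B (x Q *s e1 + act g y Q *s e2 + e3)"
      by eventually_elim simp
  qed
qed

lemma \<Gamma>_eqI:
  assumes "g \<in> \<Gamma>" "g' \<in> \<Gamma>" "\<forall>\<^sub>F Q in genf C. act g y Q = act g' y Q"
  shows "g = g'"
proof -
  have g: "g \<in> galois_group L K" "g' \<in> galois_group L K" using assms \<Gamma>_galois by auto
  have "g a = g' a" if a: "a \<in> carrier L" for a
  proof -
    obtain h where h: "ratf C h" "a = generic_class C h"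
      using a by (auto simp: carrier_function_field[OF C_irr])
    obtain k A B where "is_form k A" "is_form k B" and AB: "\<And>g. g \<in> galois_group L K \<Longrightarrow> \<forall>\<^sub>F Q in genf C.
       act g h Q = peval A (x Q *s e1 + act g y Q *s e2 + e3) / peval B (x Q *s e1 + act g y Q *s e2 + e3)"
      by (rule act_generator[OF h(1)]) (rule that)
    have "\<forall>\<^sub>F Q in genf C. act g h Q = act g' h Q"
      using AB[OF g(1)] AB[OF g(2)] assms(3) by eventually_elim simp
    then show ?thesis using act_class(1)[OF g(1) h(1)] act_class(1)[OF g(2) h(1)]
      by (simp add: h(2) generic_class_eq_iff[OF C_irr, symmetric])
  qed
  then show ?thesis using assms(1,2) by (auto simp: \<Gamma>_def fun_eq_iff restrict_def)
qed

lemma act_y_root: "g \<in> galois_group L K \<Longrightarrow> \<forall>\<^sub>F Q in genf C. ev f (x Q) (act g y Q) = 0"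
proof -
  assume g: "g \<in> galois_group L K"
  note T = C_irr C_irr germ_hom_act[OF g]
  have ev: "\<forall>\<^sub>F Q in genf C. act g (\<lambda>Q. ev P (x Q) (y Q)) Q = ev P (x Q) (act g y Q)" for P
  proof (induction P)
    case 0
    then show ?case using germ_hom_const[OF T, of 0] by simp
  next
    case (pCons p P)
    have rp: "ratf C (\<lambda>Q. poly p (x Q))" "ratf C (\<lambda>Q. ev P (x Q) (y Q))"
      by (intro ratf_poly ratf_ev C_irr ratf_x ratf_y)+
    have "rational_in_x (\<lambda>Q. poly p (x Q))"
      unfolding rational_in_x_def by (rule exI[of _ p], rule exI[of _ 1]) simp
    then have "\<forall>\<^sub>F Q in genf C. act g (\<lambda>Q. poly p (x Q)) Q = poly p (x Q)"
      using act_fixes[OF g rp(1)] by blast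
    with germ_hom_add[OF T rp(1) ratf_mult[OF C_irr ratf_y rp(2)]] germ_hom_mult[OF T ratf_y rp(2)] pCons(2)
    show ?case by eventually_elim simp
  qed
  have "\<forall>\<^sub>F Q in genf C. act g (\<lambda>Q. ev f (x Q) (y Q)) Q = act g (\<lambda>_. 0) Q"
    by (rule germ_hom_cong[OF T ratf_ev[OF C_irr ratf_x ratf_y] gen_f])
  with ev[of f] germ_hom_const[OF T, of 0] show ?thesis by eventually_elim simp
qed

lemma gen_distinct:
  assumes "finite S" "S \<subseteq> \<Gamma>"
  shows "\<forall>\<^sub>F Q in genf C. inj_on (\<lambda>g. act g y Q) S"
proof -
  have "\<forall>\<^sub>F Q in genf C. act g y Q \<noteq> act g' y Q" if "g \<in> S" "g' \<in> S" "g \<noteq> g'" for g g'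
  proof -
    have gg: "g \<in> \<Gamma>" "g' \<in> \<Gamma>" using that assms(2) by auto
    then have "ratf C (\<lambda>Q. act g y Q - act g' y Q)"
      by (intro ratf_diff C_irr act_class(2) \<Gamma>_galois ratf_y)
    from ratf_0_or_nonzero[OF C_irr this] show ?thesis
    proof
      assume "\<forall>\<^sub>F Q in genf C. act g y Q - act g' y Q = 0"
      then have "\<forall>\<^sub>F Q in genf C. act g y Q = act g' y Q" by eventually_elim simp
      then show ?thesis using \<Gamma>_eqI[OF gg] that(3) by blast
    qed (auto elim: eventually_mono)
  qed
  then have "\<forall>\<^sub>F Q in genf C. g \<noteq> g' \<longrightarrow> act g y Q \<noteq> act g' y Q" if "g \<in> S" "g' \<in> S" for g g'
    using that by (cases "g = g'") (auto elim: eventually_mono)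
  then have "\<forall>\<^sub>F Q in genf C. \<forall>g\<in>S. \<forall>g'\<in>S. g \<noteq> g' \<longrightarrow> act g y Q \<noteq> act g' y Q"
    by (intro eventually_ball_finite assms(1) ballI)
  then show ?thesis by eventually_elim (auto simp: inj_on_def)
qed

text \<open>At a generic point the conjugates of y take distinct values, all of them roots of the
  nonzero polynomial f(x, .).\<close>

lemma card_le_degree:
  assumes "finite S" "S \<subseteq> \<Gamma>"
  shows "card S \<le> degree f"
proof -
  have "\<forall>\<^sub>F Q in genf C. \<forall>g\<in>S. ev f (x Q) (act g y Q) = 0"
    using assms \<Gamma>_galois by (intro eventually_ball_finite ballI act_y_root) auto
  with gen_distinct[OF assms] have "\<forall>\<^sub>F Q in genf C. inj_on (\<lambda>g. act g y Q) S \<and> (\<forall>g\<in>S. ev f (x Q) (act g y Q) = 0)"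
    by eventually_elim simp
  then obtain Q where Q: "inj_on (\<lambda>g. act g y Q) S" "\<forall>g\<in>S. ev f (x Q) (act g y Q) = 0"
    using eventually_genf_ex[OF C_irr] by blast
  have "card S = card ((\<lambda>g. act g y Q) ` S)" using Q(1) by (simp add: card_image)
  also have "\<dots> \<le> card {b. poly (sp f (x Q)) b = 0}"
    using Q(2) by (intro card_mono poly_roots_finite sp_f_nonzero) auto
  also have "\<dots> \<le> degree (sp f (x Q))" by (rule card_poly_roots_bound[OF sp_f_nonzero])
  also have "\<dots> \<le> degree f" by (rule degree_sp_le)
  finally show ?thesis .
qed

lemma finite_\<Gamma>: "finite \<Gamma>"
proof (rule ccontr)
  assume "infinite \<Gamma>"
  then obtain S where "S \<subseteq> \<Gamma>" "finite S" "card S = Suc (degree f)"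
    using infinite_arbitrarily_large by blast
  then show False using card_le_degree[of S] by simp
qed

section \<open>Group structure and characteristic polynomials\<close>

definition idG where "idG = restrict id (carrier L)"

lemma idG: "idG \<in> \<Gamma>" "ratf C h \<Longrightarrow> \<forall>\<^sub>F Q in genf C. act idG h Q = h Q"
proof -
  have "id \<in> galois_group L K" by (auto simp: galois_group_def ring_iso_def ring_hom_def)
  then show id: "idG \<in> \<Gamma>" by (auto simp: idG_def \<Gamma>_def)
  assume h: "ratf C h"
  then have "generic_class C (act idG h) = generic_class C h"
    using act_class(1)[OF \<Gamma>_galois[OF id] h] by (auto simp: idG_def carrier_function_field[OF C_irr])
  then show "\<forall>\<^sub>F Q in genf C. act idG h Q = h Q" by (simp add: generic_class_eq_iff[OF C_irr])
qed

lemma act_compose: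
  assumes "g \<in> \<Gamma>" "g' \<in> \<Gamma>"
  shows "compose (carrier L) g g' \<in> \<Gamma>"
    "ratf C h \<Longrightarrow> \<forall>\<^sub>F Q in genf C. act (compose (carrier L) g g') h Q = act g (act g' h) Q"
proof -
  have g: "g \<in> galois_group L K" "g' \<in> galois_group L K" using assms \<Gamma>_galois by auto
  have "g \<circ> g' \<in> ring_iso L L"
    using g unfolding galois_group_def by (auto intro: ring_iso_set_trans)
  then have "g \<circ> g' \<in> galois_group L K" using g unfolding galois_group_def by auto
  then have "restrict (g \<circ> g') (carrier L) \<in> \<Gamma>" by (auto simp: \<Gamma>_def)
  moreover have "restrict (g \<circ> g') (carrier L) = compose (carrier L) g g'"
    by (auto simp: compose_def restrict_def o_def)
  ultimately show c: "compose (carrier L) g g' \<in> \<Gamma>" by simp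
  assume h: "ratf C h"
  have hc: "generic_class C h \<in> carrier L" using h by (auto simp: carrier_function_field[OF C_irr])
  have "generic_class C (act (compose (carrier L) g g') h) = generic_class C (act g (act g' h))"
    using act_class[OF g(2) h] act_class[OF g(1) act_class(2)[OF g(2) h]] act_class(1)[OF \<Gamma>_galois[OF c] h] hc
    by (simp add: compose_def)
  then show "\<forall>\<^sub>F Q in genf C. act (compose (carrier L) g g') h Q = act g (act g' h) Q"
    by (simp add: generic_class_eq_iff[OF C_irr])
qed

lemma compose_bij:
  assumes "g \<in> \<Gamma>"
  shows "bij_betw (compose (carrier L) g) \<Gamma> \<Gamma>"
proof -
  have inj: "inj_on (compose (carrier L) g) \<Gamma>"
  proof (rule inj_onI)
    fix a b assume ab: "a \<in> \<Gamma>" "b \<in> \<Gamma>" "compose (carrier L) g a = compose (carrier L) g b"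
    have inj_g: "inj_on g (carrier L)" and a: "a \<in> carrier L \<rightarrow> carrier L" and b: "b \<in> carrier L \<rightarrow> carrier L"
      using \<Gamma>_galois[OF assms] \<Gamma>_galois[OF ab(1)] \<Gamma>_galois[OF ab(2)]
      by (auto simp: galois_group_def ring_iso_def bij_betw_def)
    have "a z = b z" if "z \<in> carrier L" for z
    proof -
      have "g (a z) = g (b z)" using fun_cong[OF ab(3), of z] that by (simp add: compose_def)
      moreover have "a z \<in> carrier L" "b z \<in> carrier L" using a b that by blast+
      ultimately show ?thesis by (rule inj_onD[OF inj_g])
    qed
    then show "a = b" using ab(1,2) by (auto simp: \<Gamma>_def fun_eq_iff restrict_def)
  qed
  have "compose (carrier L) g ` \<Gamma> \<subseteq> \<Gamma>" using act_compose(1)[OF assms] by blast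
  then show ?thesis using endo_inj_surj[OF finite_\<Gamma> _ inj] inj by (simp add: bij_betw_def)
qed

text \<open>The coefficients of the product over all conjugates are permuted into themselves by
  composition in \<Gamma>, hence fixed by the Galois group and contained in k(x); clearing
  denominators gives P. At b = c its value is, up to the leading coefficient, the norm of c -
  h.\<close>

theorem char_poly:
  assumes h: "ratf C h"
  obtains P where "P \<noteq> 0" "degree P = card \<Gamma>"
    "\<forall>\<^sub>F Q in genf C. poly (lead_coeff P) (x Q) \<noteq> 0 \<and>
      (\<forall>b. ev P (x Q) b = poly (lead_coeff P) (x Q) * (\<Prod>g\<in>\<Gamma>. b - act g h Q))"
proof -
  define N where "N = card \<Gamma>"
  define E where "E Q = (\<Prod>g\<in>\<Gamma>. [:- act g h Q, 1:])" for Q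
  define e where "e i Q = Polynomial.coeff (E Q) i" for i Q
  have gh: "ratf C (act g h)" if "g \<in> \<Gamma>" for g using act_class(2)[OF \<Gamma>_galois[OF that] h] .
  have E1: "lead_coeff (E Q) = 1" for Q unfolding E_def lead_coeff_prod by simp
  have E: "degree (E Q) = N" for Q by (simp add: E_def N_def degree_prod_sum_eq)
  have re: "ratf C (e i)" for i
    unfolding e_def E_def by (rule ratf_coeff_prod[OF C_irr C_irr germ_hom_act[OF \<Gamma>_galois[OF idG(1)]] finite_\<Gamma> gh])
  have "rational_in_x (e i)" for i
  proof -
    have inv: "\<forall>\<^sub>F Q in genf C. act g' (e i) Q = e i Q" if g': "g' \<in> \<Gamma>" for g'
    proof -
      have "\<forall>\<^sub>F Q in genf C. act g' (e i) Q = Polynomial.coeff (\<Prod>g\<in>\<Gamma>. [:- act g' (act g h) Q, 1:]) i"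
        unfolding e_def E_def
        by (rule germ_hom_coeff_prod[OF C_irr C_irr germ_hom_act[OF \<Gamma>_galois[OF g']] finite_\<Gamma> gh])
      moreover have "\<forall>\<^sub>F Q in genf C. \<forall>g\<in>\<Gamma>. act (compose (carrier L) g' g) h Q = act g' (act g h) Q"
        by (intro eventually_ball_finite finite_\<Gamma> ballI act_compose(2) g' h)
      ultimately show ?thesis
      proof eventually_elim
        case (elim Q)
        have "E Q = (\<Prod>g\<in>\<Gamma>. [:- act (compose (carrier L) g' g) h Q, 1:])"
          unfolding E_def by (rule prod.reindex_bij_betw[OF compose_bij[OF g'], symmetric])
        also have "\<dots> = (\<Prod>g\<in>\<Gamma>. [:- act g' (act g h) Q, 1:])" using elim(2) by (intro prod.cong) auto
        finally show ?case using elim(1) by (simp add: e_def)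
      qed
    qed
    have "generic_class C (e i) \<in> carrier L" using re by (auto simp: carrier_function_field[OF C_irr])
    moreover have "g (generic_class C (e i)) = generic_class C (e i)" if g: "g \<in> galois_group L K" for g
    proof -
      let ?g = "restrict g (carrier L)"
      have "?g \<in> \<Gamma>" using g by (auto simp: \<Gamma>_def)
      from inv[OF this] act_class(1)[OF \<Gamma>_galois[OF this] re[of i]] calculation
      show ?thesis by (simp add: generic_class_eq_iff[OF C_irr, symmetric])
    qed
    ultimately have "generic_class C (e i) \<in> K" using K_fixed by blast
    then obtain k where "rational_in_x k" "generic_class C (e i) = generic_class C k" unfolding K_eq by blast
    then obtain p q where pq: "q \<noteq> 0" "\<forall>\<^sub>F Q in genf C. k Q = poly p (x Q) / poly q (x Q)" "\<forall>\<^sub>F Q in genf C. e i Q = k Q"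
      unfolding rational_in_x_def by (auto simp: generic_class_eq_iff[OF C_irr])
    have "\<forall>\<^sub>F Q in genf C. e i Q = poly p (x Q) / poly q (x Q)" using pq(2,3) by eventually_elim simp
    then show ?thesis unfolding rational_in_x_def using pq(1) by blast
  qed
  then obtain p q where pq: "\<And>i. q i \<noteq> 0" "\<And>i. \<forall>\<^sub>F Q in genf C. e i Q = poly (p i) (x Q) / poly (q i) (x Q)"
    unfolding rational_in_x_def by metis
  \<comment> \<open>A common denominator of the coefficients; as the product is monic, D becomes the
    leading coefficient of P.\<close>
  define D where "D = (\<Prod>i<N. q i)"
  define P where "P = (\<Sum>i<N. Polynomial.monom (p i * (\<Prod>j\<in>{..<N} - {i}. q j)) i) + Polynomial.monom D N"
  have D0: "D \<noteq> 0" using pq(1) by (simp add: D_def)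
  have cP: "Polynomial.coeff P N = D"
    by (simp add: P_def coeff_sum)
  have dP: "degree P = N"
  proof (rule antisym)
    show "degree P \<le> N"
    proof (rule degree_le, intro allI impI)
      fix i assume "N < i" then show "Polynomial.coeff P i = 0" by (simp add: P_def coeff_sum)
    qed
    show "N \<le> degree P" using cP D0 by (intro le_degree) simp
  qed
  have lP: "lead_coeff P = D" using cP dP by simp
  show ?thesis
  proof (rule that)
    show "P \<noteq> 0" using lP D0 by auto
    show "degree P = card \<Gamma>" using dP by (simp add: N_def)
    have "\<forall>\<^sub>F Q in genf C. \<forall>i\<in>{..<N}. e i Q = poly (p i) (x Q) / poly (q i) (x Q)"
      by (intro eventually_ball_finite ballI pq(2)) simp
    with gen_poly_x_nonzero[OF D0]
    show "\<forall>\<^sub>F Q in genf C. poly (lead_coeff P) (x Q) \<noteq> 0 \<and>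
      (\<forall>b. ev P (x Q) b = poly (lead_coeff P) (x Q) * (\<Prod>g\<in>\<Gamma>. b - act g h Q))"
    proof eventually_elim
      case (elim Q)
      have evmon: "ev (Polynomial.monom r i) a b = poly r a * b ^ i" for r i a b
        by (induction i) (simp_all add: monom_0 monom_Suc mult_ac)
      have "ev P (x Q) b = poly D (x Q) * (\<Prod>g\<in>\<Gamma>. b - act g h Q)" for b
      proof -
        have "(\<Prod>g\<in>\<Gamma>. b - act g h Q) = poly (E Q) b" by (simp add: E_def poly_prod)
        also have "\<dots> = (\<Sum>i\<le>N. e i Q * b ^ i)" by (simp add: poly_altdef E e_def)
        also have "\<dots> = (\<Sum>i<N. e i Q * b ^ i) + b ^ N"
          using E[of Q] E1[of Q] by (simp add: lessThan_Suc_atMost[symmetric] e_def)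
        finally have "poly D (x Q) * (\<Prod>g\<in>\<Gamma>. b - act g h Q) =
            (\<Sum>i<N. poly D (x Q) * (e i Q * b ^ i)) + poly D (x Q) * b ^ N"
          by (simp add: distrib_left sum_distrib_left)
        also have "(\<Sum>i<N. poly D (x Q) * (e i Q * b ^ i)) =
            (\<Sum>i<N. poly (p i * (\<Prod>j\<in>{..<N} - {i}. q j)) (x Q) * b ^ i)"
        proof (rule sum.cong[OF refl])
          fix i assume i: "i \<in> {..<N}"
          have "D = q i * (\<Prod>j\<in>{..<N} - {i}. q j)" unfolding D_def using i by (intro prod.remove) auto
          then show "poly D (x Q) * (e i Q * b ^ i) = poly (p i * (\<Prod>j\<in>{..<N} - {i}. q j)) (x Q) * b ^ i"
            using elim i by auto
        qed
        finally show ?thesis by (simp add: P_def evmon)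
      qed
      then show ?case using elim(1) lP by simp
    qed
  qed
qed

corollary algebraic_over_x:
  assumes h: "ratf C h"
  shows "\<exists>P. P \<noteq> 0 \<and> (\<forall>\<^sub>F Q in genf C. ev P (x Q) (h Q) = 0)"
proof -
  obtain P where P: "P \<noteq> 0" "degree P = card \<Gamma>" "\<forall>\<^sub>F Q in genf C. poly (lead_coeff P) (x Q) \<noteq> 0 \<and>
      (\<forall>b. ev P (x Q) b = poly (lead_coeff P) (x Q) * (\<Prod>g\<in>\<Gamma>. b - act g h Q))"
    by (rule char_poly[OF h]) (rule that)
  have "\<forall>\<^sub>F Q in genf C. ev P (x Q) (h Q) = 0"
    using P(3) idG(2)[OF h]
  proof eventually_elim
    case (elim Q)
    have "(\<Prod>g\<in>\<Gamma>. h Q - act g h Q) = 0"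
      using finite_\<Gamma> idG(1) elim(2) by (intro prod_zero) (auto intro!: bexI[of _ idG])
    then show ?case using elim(1) by simp
  qed
  then show ?thesis using P(1) by blast
qed

text \<open>The irreducible f divides the characteristic polynomial of y, and the conjugates of y
  are at most deg f in number. Equal degrees leave a cofactor in k[x] only, which cancels.\<close>

theorem f_factorization:
  shows "card \<Gamma> = degree f"
    "\<forall>\<^sub>F Q in genf C. \<forall>b. ev f (x Q) b = poly (lead_coeff f) (x Q) * (\<Prod>g\<in>\<Gamma>. b - act g y Q)"
proof -
  obtain P where P: "P \<noteq> 0" "degree P = card \<Gamma>" "\<forall>\<^sub>F Q in genf C. poly (lead_coeff P) (x Q) \<noteq> 0 \<and>
      (\<forall>b. ev P (x Q) b = poly (lead_coeff P) (x Q) * (\<Prod>g\<in>\<Gamma>. b - act g y Q))"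
    by (rule char_poly[OF ratf_y]) (rule that)
  have "\<forall>\<^sub>F Q in genf C. ev P (x Q) (y Q) = 0"
    using P(3) idG(2)[OF ratf_y]
  proof eventually_elim
    case (elim Q)
    have "(\<Prod>g\<in>\<Gamma>. y Q - act g y Q) = 0"
      using finite_\<Gamma> idG(1) elim(2) by (intro prod_zero) (auto intro!: bexI[of _ idG])
    then show ?case using elim(1) by simp
  qed
  then obtain k where k: "P = f * k" using f_dvd_vanishing by (auto elim: dvdE)
  have "k \<noteq> 0" "f \<noteq> 0" using P(1) k by auto
  then have "degree P = degree f + degree k" by (simp add: k degree_mult_eq)
  moreover have "card \<Gamma> \<le> degree f" by (rule card_le_degree[OF finite_\<Gamma> order_refl])
  ultimately have dk: "degree k = 0" and card: "card \<Gamma> = degree f" using P(2) by auto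
  then obtain k0 where k0: "k = [:k0:]" by (meson degree_eq_zeroE)
  have lc: "lead_coeff P = lead_coeff f * k0" by (simp add: k lead_coeff_mult k0)
  show "card \<Gamma> = degree f" by (rule card)
  show "\<forall>\<^sub>F Q in genf C. \<forall>b. ev f (x Q) b = poly (lead_coeff f) (x Q) * (\<Prod>g\<in>\<Gamma>. b - act g y Q)"
    using P(3)
  proof eventually_elim
    case (elim Q)
    show ?case
    proof
      fix b
      have "ev f (x Q) b * poly k0 (x Q) = poly (lead_coeff f) (x Q) * poly k0 (x Q) * (\<Prod>g\<in>\<Gamma>. b - act g y Q)"
        using elim[THEN conjunct2, rule_format, of b] unfolding lc poly_mult by (simp add: k k0 del: ev_bp)
      then have "ev f (x Q) b * poly k0 (x Q) =
          (poly (lead_coeff f) (x Q) * (\<Prod>g\<in>\<Gamma>. b - act g y Q)) * poly k0 (x Q)"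
        by (simp only: mult_ac)
      moreover have "poly k0 (x Q) \<noteq> 0" using elim unfolding lc by auto
      ultimately show "ev f (x Q) b = poly (lead_coeff f) (x Q) * (\<Prod>g\<in>\<Gamma>. b - act g y Q)"
        by (metis mult_right_cancel)
    qed
  qed
qed

end

subsection \<open>Lifting birational self-maps of a smooth curve\<close>

lemma exists_separating_form:
  fixes a b :: "'a::field ^ 'n::finite"
  assumes "b \<notin> vec.span {a}"
  obtains l where "dotp l a = 0" "dotp l b \<noteq> 0"
  using span_annihilator[of "{a}" b] assms by (auto simp: dotp_commute)

lemma rep_proj_notin_span:
  assumes "P \<noteq> Q"
  shows "rep_proj Q \<notin> vec.span {rep_proj P}"
proof
  assume "rep_proj Q \<in> vec.span {rep_proj P}"
  then obtain c where c: "rep_proj Q = c *s rep_proj P" by (auto simp: vec.span_singleton)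
  then have "c \<noteq> 0" by (metis rep_proj_nonzero vector_smult_lzero)
  then have "abs_proj (rep_proj Q) = abs_proj (rep_proj P)" unfolding c by (simp add: abs_proj_scale)
  then show False using assms by simp
qed

lemma exists_form_nonzero_at_both:
  obtains H where "dotp H (rep_proj P) \<noteq> 0" "dotp H (rep_proj Q) \<noteq> 0"
proof -
  obtain i j where ij: "rep_proj P $ i \<noteq> 0" "rep_proj Q $ j \<noteq> 0"
    using rep_proj_nonzero[of P] rep_proj_nonzero[of Q] by (auto simp: vec_eq_iff)
  show ?thesis
  proof (cases "rep_proj Q $ i = 0 \<and> rep_proj P $ j = 0")
    case True
    then show ?thesis using that[of "axis i 1 + axis j 1"] ij by simp
  next
    case False
    then show ?thesis using that[of "axis i 1"] that[of "axis j 1"] ij by auto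
  qed
qed

lemma locv_linear_quotient:
  assumes "irreducible_set X" "Q \<in> X" "dotp m (rep_proj Q) \<noteq> 0"
  shows "locv X Q (\<lambda>R. dotp l (rep_proj R) / dotp m (rep_proj R)) (dotp l (rep_proj Q) / dotp m (rep_proj Q))"
  using locv_form_quotient[OF assms(1) is_form_lin(1) is_form_lin(1) assms(2), of m l] assms(3)
  by (simp add: form_at_lin)

lemma unif_exists:
  fixes X :: "('a::alg_closed_field, 'n::finite) proj set"
  assumes "irreducible_set X" "smooth_point X Q" "Q' \<in> X" "Q' \<noteq> Q"
  obtains t where "unif X Q t"
proof -
  obtain b where b: "b \<notin> vec.span {rep_proj Q}"
    "\<And>t H. dotp t (rep_proj Q) = 0 \<Longrightarrow> dotp t b \<noteq> 0 \<Longrightarrow> dotp H (rep_proj Q) \<noteq> 0 \<Longrightarrow>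
       unif X Q (\<lambda>x. dotp t (rep_proj x) / dotp H (rep_proj x))"
    by (rule smooth_point_uniformizers[OF assms]) (rule that)
  obtain t where "dotp t (rep_proj Q) = 0" "dotp t b \<noteq> 0" by (rule exists_separating_form[OF b(1)])
  moreover obtain H where "dotp H (rep_proj Q) \<noteq> 0" using exists_form_nonzero_at_both by metis
  ultimately show ?thesis using that b(2) by blast
qed

context
  fixes X :: "('a::alg_closed_field, 'n::finite) proj set" and i0 :: 'n
  assumes irr: "irreducible_set X" and i0: "\<exists>x\<in>X. rep_proj x $ i0 \<noteq> 0"
begin

definition aff_coord where "aff_coord i R = rep_proj R $ i / rep_proj R $ i0" for i and R :: "('a, 'n) proj"

lemma gen_coord: "\<forall>\<^sub>F x in genf X. rep_proj x $ i0 \<noteq> 0"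
proof -
  obtain x where "x \<in> X" "form_at (lin (axis i0 1)) x \<noteq> 0" using i0 by (auto simp: form_at_lin)
  from eventually_genf_form_nonzero[OF irr is_form_lin(1) this] show ?thesis by (simp add: form_at_lin)
qed

lemma ratf_aff_coord: "ratf X (aff_coord i)"
proof -
  obtain x where "x \<in> X" "form_at (lin (axis i0 1)) x \<noteq> 0" using i0 by (auto simp: form_at_lin)
  from ratf_form_quotient[OF irr is_form_lin(1) is_form_lin(1) this, of "axis i 1"]
  show ?thesis by (simp add: form_at_lin aff_coord_def[abs_def])
qed

lemma aff_coord_vec: "rep_proj x $ i0 \<noteq> 0 \<Longrightarrow> (\<chi> i. aff_coord i x) = (1 / rep_proj x $ i0) *s rep_proj x"
  by (simp add: vec_eq_iff aff_coord_def)

lemma abs_proj_aff_coord: "rep_proj x $ i0 \<noteq> 0 \<Longrightarrow> abs_proj (\<chi> i. aff_coord i x) = x"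
  by (simp add: aff_coord_vec abs_proj_scale)

text \<open>The images of the affine coordinates under T define a rational map, extended by the
  valuation rings. T commutes with polynomials: forms vanishing on X still vanish on the image,
  which stays in the closed set X, and other forms remain generically nonzero, which is
  dominance.\<close>

lemma lift_germ_hom_aux:
  assumes closed: "closedin zariski X" and val: "\<And>Q. Q \<in> X \<Longrightarrow> valring X Q"
    and T: "germ_hom X X T"
  obtains \<gamma> where "morphism X X \<gamma>" "filterlim \<gamma> (genf X) (genf X)"
    "\<And>h. ratf X h \<Longrightarrow> \<forall>\<^sub>F x in genf X. h (\<gamma> x) = T h x"
proof -
  note TT = irr irr T
  define \<eta> where "\<eta> i = T (aff_coord i)" for i
  have r\<eta>: "ratf X (\<eta> i)" for i unfolding \<eta>_def by (rule germ_hom_ratf[OF TT ratf_aff_coord])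
  have "\<forall>\<^sub>F x in genf X. aff_coord i0 x \<noteq> 0" using gen_coord by eventually_elim (simp add: aff_coord_def)
  then have nz: "\<forall>\<^sub>F x in genf X. \<eta> i0 x \<noteq> 0"
    unfolding \<eta>_def by (rule germ_hom_nonzero[OF TT ratf_aff_coord])
  obtain \<gamma> where \<gamma>: "morphism X UNIV \<gamma>" "\<forall>\<^sub>F x in genf X. \<gamma> x = abs_proj (\<chi> i. \<eta> i x)"
    by (rule extend_rational_map[where \<eta> = \<eta> and X = X, OF irr val]) (assumption, rule r\<eta>, rule nz, rule that)
  have pe: "\<forall>\<^sub>F x in genf X. T (\<lambda>x. peval H (\<chi> i. aff_coord i x)) x = peval H (\<chi> i. \<eta> i x)" for H
    unfolding \<eta>_def by (rule germ_hom_peval[where f = aff_coord, OF TT ratf_aff_coord])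
  have rpe: "ratf X (\<lambda>x. peval H (\<chi> i. aff_coord i x))" for H
    by (intro ratf_peval irr ratf_aff_coord)
  have pc: "peval H (\<chi> i. aff_coord i x) = (1 / rep_proj x $ i0) ^ e * form_at H x"
    if "is_form e H" "rep_proj x $ i0 \<noteq> 0" for H e x
    unfolding aff_coord_vec[OF that(2)] peval_scale[OF that(1)] form_at_def ..
  have \<eta>0: "\<forall>\<^sub>F x in genf X. (\<chi> i. \<eta> i x) \<noteq> 0"
    using nz by eventually_elim (auto simp: vec_eq_iff)
  have sub: "\<gamma> ` X \<subseteq> X"
  proof
    fix z assume "z \<in> \<gamma> ` X"
    then obtain Q where Q: "Q \<in> X" "z = \<gamma> Q" by blast
    show "z \<in> X"
    proof (rule ccontr)
      assume "z \<notin> X"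
      then obtain e H where H: "is_form e H" "form_at H (\<gamma> Q) \<noteq> 0" "\<forall>y\<in>X. form_at H y = 0"
        using closed[unfolded closedin_zariski_iff, rule_format, of z] Q(2) by blast
      obtain k M where M: "is_form k M" "form_at M Q \<noteq> 0"
        "\<And>y. y \<in> X \<Longrightarrow> form_at M y \<noteq> 0 \<Longrightarrow> form_at H (\<gamma> y) \<noteq> 0"
        by (rule morphism_pullback_form[OF \<gamma>(1) Q(1) H(1,2)]) (rule that)
      have "\<forall>\<^sub>F x in genf X. form_at H (\<gamma> x) \<noteq> 0"
        by (rule eventually_genfI[OF irr M(1) Q(1) M(2) M(3)])
      moreover have "\<forall>\<^sub>F x in genf X. peval H (\<chi> i. aff_coord i x) = 0"
        using gen_coord eventually_genf_in[OF irr] by eventually_elim (simp add: pc[OF H(1)] H(3))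
      from germ_hom_cong[OF TT rpe this] pe[of H] germ_hom_const[OF TT, of 0] \<gamma>(2) \<eta>0
      have "\<forall>\<^sub>F x in genf X. form_at H (\<gamma> x) = 0"
        by eventually_elim (simp add: form_at_abs_proj[OF _ H(1)])
      ultimately have "\<forall>\<^sub>F x in genf X. False" by eventually_elim simp
      then show False using genf_neq_bot[OF irr] by simp
    qed
  qed
  have filt: "filterlim \<gamma> (genf X) (genf X)"
    unfolding filterlim_iff
  proof (intro allI impI)
    fix Pr assume "eventually Pr (genf X)"
    then obtain e H y where H: "is_form e H" "y \<in> X" "form_at H y \<noteq> 0"
      "\<And>y. y \<in> X \<Longrightarrow> form_at H y \<noteq> 0 \<Longrightarrow> Pr y"
      by (rule eventually_genfE[OF irr]) (rule that)
    have "\<forall>\<^sub>F x in genf X. peval H (\<chi> i. aff_coord i x) \<noteq> 0"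
      using gen_coord eventually_genf_form_nonzero[OF irr H(1-3)]
      by eventually_elim (simp add: pc[OF H(1)])
    from germ_hom_nonzero[OF TT rpe this] pe[of H] \<gamma>(2) \<eta>0 eventually_genf_in[OF irr]
    show "\<forall>\<^sub>F x in genf X. Pr (\<gamma> x)"
    proof eventually_elim
      case (elim x)
      have "\<gamma> x \<in> X" using elim(5) sub by blast
      moreover have "form_at H (\<gamma> x) \<noteq> 0" using elim(1-4) form_at_abs_proj[OF elim(4) H(1)] by simp
      ultimately show ?case using H(4) by blast
    qed
  qed
  have pull: "\<forall>\<^sub>F x in genf X. h (\<gamma> x) = T h x" if h: "ratf X h" for h
  proof -
    obtain e A B where AB: "is_form e A" "is_form e B"
      "\<forall>\<^sub>F x in genf X. form_at B x \<noteq> 0 \<and> h x = form_at A x / form_at B x"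
      using h by (elim ratfE[OF irr])
    have "\<forall>\<^sub>F x in genf X. h x = peval A (\<chi> i. aff_coord i x) / peval B (\<chi> i. aff_coord i x)"
      using AB(3) gen_coord by eventually_elim (simp add: pc[OF AB(1)] pc[OF AB(2)])
    note 1 = germ_hom_cong[OF TT h this]
    have "\<forall>\<^sub>F x in genf X. h x = form_at A x / form_at B x"
      using AB(3) by eventually_elim simp
    then have "\<forall>\<^sub>F x in genf X. h (\<gamma> x) = form_at A (\<gamma> x) / form_at B (\<gamma> x)"
      by (rule filt[unfolded filterlim_iff, rule_format])
    with 1 germ_hom_divide[OF TT rpe[of A] rpe[of B]] pe[of A] pe[of B] \<gamma>(2) \<eta>0
    show ?thesis by eventually_elim (simp add: form_quotient_abs_proj[OF _ AB(1,2)])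
  qed
  show ?thesis by (rule that[OF morphism_mono[OF \<gamma>(1) sub] filt pull])
qed

end

lemma lift_germ_hom:
  fixes X :: "('a::alg_closed_field, 'n::finite) proj set"
  assumes irr: "irreducible_set X" and "closedin zariski X" "\<And>Q. Q \<in> X \<Longrightarrow> valring X Q" "germ_hom X X T"
  obtains \<gamma> where "morphism X X \<gamma>" "filterlim \<gamma> (genf X) (genf X)"
    "\<And>h. ratf X h \<Longrightarrow> \<forall>\<^sub>F x in genf X. h (\<gamma> x) = T h x"
proof -
  obtain x where "x \<in> X" using irr by (auto simp: irreducible_set_def)
  moreover obtain i where "form_at (lin (axis i 1)) x \<noteq> 0" using exists_coordinate_nonzero .
  ultimately have i: "\<exists>x\<in>X. rep_proj x $ i \<noteq> 0" by (auto simp: form_at_lin)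
  show ?thesis by (rule lift_germ_hom_aux[OF irr i assms(2-4)]) (assumption, rule that)
qed

lemma morphism_eq_of_pullback:
  fixes X :: "('a::alg_closed_field, 'n::finite) proj set" and Y :: "('a, 'm::finite) proj set"
  assumes irr: "irreducible_set X" "irreducible_set Y"
    and f: "morphism X Z f" "filterlim f (genf Y) (genf X)" and g: "morphism X Z g" "filterlim g (genf Y) (genf X)"
    and eq: "\<And>h. ratf Y h \<Longrightarrow> \<forall>\<^sub>F x in genf X. h (f x) = h (g x)" and x: "x \<in> X"
  shows "f x = g x"
proof -
  obtain y where "y \<in> Y" using irr(2) by (auto simp: irreducible_set_def)
  moreover obtain i where "form_at (lin (axis i 1)) y \<noteq> 0" using exists_coordinate_nonzero .
  ultimately have i: "\<exists>y\<in>Y. rep_proj y $ i \<noteq> 0" by (auto simp: form_at_lin)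
  have "\<forall>\<^sub>F x in genf X. \<forall>j\<in>UNIV. aff_coord i j (f x) = aff_coord i j (g x)"
    by (intro eventually_ball_finite ballI eq ratf_aff_coord[OF irr(2) i]) simp
  moreover have "\<forall>\<^sub>F x in genf X. rep_proj (f x) $ i \<noteq> 0" "\<forall>\<^sub>F x in genf X. rep_proj (g x) $ i \<noteq> 0"
    using f(2) g(2) gen_coord[OF irr(2) i] by (auto simp: filterlim_iff)
  ultimately have "\<forall>\<^sub>F x in genf X. f x = g x"
  proof eventually_elim
    case (elim x)
    have "f x = abs_proj (\<chi> j. aff_coord i j (f x))" by (rule abs_proj_aff_coord[OF irr(2) i elim(2), symmetric])
    also have "(\<chi> j. aff_coord i j (f x)) = (\<chi> j. aff_coord i j (g x))"
      using elim(1) unfolding vec_eq_iff by simp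
    also have "abs_proj \<dots> = g x" by (rule abs_proj_aff_coord[OF irr(2) i elim(3)])
    finally show ?case .
  qed
  then show ?thesis by (rule morphism_eqI[OF irr(1) f(1) g(1) _ x])
qed

subsection \<open>Automorphisms and local rings\<close>

context
  fixes X :: "('a::alg_closed_field, 'n::finite) proj set" and \<sigma>
  assumes irr: "irreducible_set X" and \<sigma>: "\<sigma> \<in> curve_aut X"
begin

lemma aut_morphism: "morphism X X \<sigma>" and aut_inv_morphism: "morphism X X (inv_into X \<sigma>)"
  and aut_bij: "bij_betw \<sigma> X X"
  using \<sigma> by (auto simp: curve_aut_def Bij_def)

lemma aut_in: "Q \<in> X \<Longrightarrow> \<sigma> Q \<in> X" and aut_inv_in: "Q \<in> X \<Longrightarrow> inv_into X \<sigma> Q \<in> X"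
  using aut_morphism aut_inv_morphism by (auto simp: morphism_def)

lemma aut_inv_left: "Q \<in> X \<Longrightarrow> inv_into X \<sigma> (\<sigma> Q) = Q" and aut_inv_right: "Q \<in> X \<Longrightarrow> \<sigma> (inv_into X \<sigma> Q) = Q"
  using aut_bij by (auto simp: bij_betw_def f_inv_into_f)

lemma aut_inj: "Q \<in> X \<Longrightarrow> R \<in> X \<Longrightarrow> \<sigma> Q = \<sigma> R \<longleftrightarrow> Q = R"
  using aut_bij by (auto simp: bij_betw_def inj_on_def)

lemma aut_filterlim: "filterlim \<sigma> (genf X) (genf X)" "filterlim (inv_into X \<sigma>) (genf X) (genf X)"
  using aut_bij bij_betw_inv_into[OF aut_bij]
  by (auto intro!: morphism_filterlim[OF irr irr] aut_morphism aut_inv_morphism simp: bij_betw_def)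

lemma aut_gen: "eventually P (genf X) \<Longrightarrow> \<forall>\<^sub>F x in genf X. P (\<sigma> x)"
  using aut_filterlim(1) by (simp add: filterlim_iff)

lemma aut_ratf: "ratf X h \<Longrightarrow> ratf X (\<lambda>x. h (\<sigma> x))"
  by (rule ratf_compose[OF morphism_ratmap[OF irr aut_morphism aut_filterlim(1)]])

lemma aut_locv: "Q \<in> X \<Longrightarrow> locv X (\<sigma> Q) h a \<Longrightarrow> locv X Q (\<lambda>x. h (\<sigma> x)) a"
  by (rule locv_compose[OF irr irr aut_morphism aut_filterlim(1)])

lemma aut_locv_inv: "Q \<in> X \<Longrightarrow> locv X Q h a \<Longrightarrow> locv X (\<sigma> Q) (\<lambda>x. h (inv_into X \<sigma> x)) a"
  by (rule locv_compose[OF irr irr aut_inv_morphism aut_filterlim(2)]) (simp_all add: aut_in aut_inv_left)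

lemma aut_unif:
  assumes Q: "Q \<in> X" and t: "unif X (\<sigma> Q) t"
  shows "unif X Q (\<lambda>x. t (\<sigma> x))"
  unfolding unif_def
proof (intro conjI allI impI)
  show "locv X Q (\<lambda>x. t (\<sigma> x)) 0" using t by (intro aut_locv Q) (simp add: unif_def)
  show "\<forall>\<^sub>F x in genf X. t (\<sigma> x) \<noteq> 0" using t by (intro aut_gen) (simp add: unif_def)
  fix h assume "locv X Q h 0"
  then have "locv X (\<sigma> Q) (\<lambda>x. h (inv_into X \<sigma> x)) 0" by (rule aut_locv_inv[OF Q])
  then obtain g b where g: "locv X (\<sigma> Q) g b" "\<forall>\<^sub>F x in genf X. h (inv_into X \<sigma> x) = g x * t x"
    using t unfolding unif_def by blast
  have "\<forall>\<^sub>F x in genf X. h x = g (\<sigma> x) * t (\<sigma> x)"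
    using aut_gen[OF g(2)] eventually_genf_in[OF irr] by eventually_elim (simp add: aut_inv_left)
  then show "\<exists>g b. locv X Q g b \<and> (\<forall>\<^sub>F x in genf X. h x = g x * t (\<sigma> x))"
    using aut_locv[OF Q g(1)] by blast
qed

lemma uniformizer_unif:
  assumes "Q \<in> X" "unif X Q t"
  shows "uniformizer X Q (generic_class X t)"
  unfolding uniformizer_def local_max_ideal_alt[OF irr] local_ring_alt[OF irr]
proof (intro Set.set_eqI iffI)
  fix c assume "c \<in> {generic_class X f |f. locv X Q f 0}"
  then obtain f where f: "c = generic_class X f" "locv X Q f 0" by blast
  then obtain g b where g: "locv X Q g b" "\<forall>\<^sub>F x in genf X. f x = g x * t x"
    using assms(2) unfolding unif_def by blast
  then have "c = generic_class X g \<otimes>\<^bsub>function_field X\<^esub> generic_class X t"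
    unfolding f(1) mult_function_field[OF irr] generic_class_eq_iff[OF irr] by blast
  then show "c \<in> (\<lambda>a. a \<otimes>\<^bsub>function_field X\<^esub> generic_class X t) ` {generic_class X f |f. \<exists>a. locv X Q f a}"
    using g(1) by blast
next
  fix c assume "c \<in> (\<lambda>a. a \<otimes>\<^bsub>function_field X\<^esub> generic_class X t) ` {generic_class X f |f. \<exists>a. locv X Q f a}"
  then obtain g b where g: "locv X Q g b" "c = generic_class X (\<lambda>x. g x * t x)"
    by (auto simp: mult_function_field[OF irr])
  have "locv X Q (\<lambda>x. g x * t x) (b * 0)"
    using assms(2) g(1) by (intro locv_mult irr) (auto simp: unif_def)
  then show "c \<in> {generic_class X f |f. locv X Q f 0}" using g(2) by auto
qed

text \<open>A set with the property \<open>uniformizer\<close> need not be a full germ: it may be any nonempty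
  part of one.\<close>

lemma uniformizerE:
  assumes Q: "Q \<in> X" and T: "uniformizer X Q T" and ex: "unif X Q t0"
  obtains t where "unif X Q t" "T \<noteq> {}" "T \<subseteq> generic_class X t"
proof -
  have mult: "generic_class X g \<otimes>\<^bsub>function_field X\<^esub> T = (\<Union>k\<in>T. generic_class X (\<lambda>x. g x * k x))" for g
  proof -
    have "(\<Union>f\<in>generic_class X g. generic_class X (\<lambda>x. f x * k x)) = generic_class X (\<lambda>x. g x * k x)" for k
      by (rule generic_class_UN[OF irr _ irr]) (auto elim: eventually_mono)
    then show ?thesis by (simp add: function_field_def) blast
  qed
  have one: "generic_class X (\<lambda>_. 1) \<in> local_ring X Q"
    unfolding local_ring_alt[OF irr] using locv_const[OF irr Q] by blast
  have "generic_class X (\<lambda>_. 1) \<otimes>\<^bsub>function_field X\<^esub> T \<in> local_max_ideal X Q"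
    using T one unfolding uniformizer_def by blast
  then obtain t where t: "locv X Q t 0" "(\<Union>k\<in>T. generic_class X (\<lambda>x. 1 * k x)) = generic_class X t"
    unfolding local_max_ideal_alt[OF irr] mult by blast
  have sub: "T \<subseteq> generic_class X t"
  proof
    fix k assume "k \<in> T"
    then have "k \<in> (\<Union>k\<in>T. generic_class X (\<lambda>x. 1 * k x))" using generic_class_self[OF irr, of k] by auto
    then show "k \<in> generic_class X t" unfolding t(2) .
  qed
  have ne: "T \<noteq> {}" using t(2) generic_class_self[OF irr, of t] by auto
  have prin: "\<exists>g b. locv X Q g b \<and> (\<forall>\<^sub>F x in genf X. f x = g x * t x)" if f: "locv X Q f 0" for f
  proof -
    have "generic_class X f \<in> local_max_ideal X Q" unfolding local_max_ideal_alt[OF irr] using f by blast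
    then obtain g b where g: "locv X Q g b" "generic_class X f = (\<Union>k\<in>T. generic_class X (\<lambda>x. g x * k x))"
      using T unfolding uniformizer_def local_ring_alt[OF irr] mult by (auto simp: mult)
    obtain k where k: "k \<in> T" using ne by blast
    have "\<forall>\<^sub>F x in genf X. k x = t x" using k sub by (auto simp: generic_class_alt[OF irr])
    moreover have "(\<lambda>x. g x * k x) \<in> generic_class X f"
      unfolding g(2) using k generic_class_self[OF irr, of "\<lambda>x. g x * k x"] by blast
    then have "\<forall>\<^sub>F x in genf X. g x * k x = f x" by (simp add: generic_class_alt[OF irr])
    ultimately have "\<forall>\<^sub>F x in genf X. f x = g x * t x" by eventually_elim simp
    then show ?thesis using g(1) by blast
  qed
  have "\<forall>\<^sub>F x in genf X. t x \<noteq> 0"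
  proof -
    obtain g where "\<forall>\<^sub>F x in genf X. t0 x = g x * t x" using prin ex unfolding unif_def by blast
    moreover have "\<forall>\<^sub>F x in genf X. t0 x \<noteq> 0" using ex by (simp add: unif_def)
    ultimately show ?thesis by eventually_elim auto
  qed
  then have "unif X Q t" using t(1) prin by (simp add: unif_def)
  then show ?thesis using that ne sub by blast
qed

text \<open>An automorphism pulls uniformizers back to uniformizers, so e = 1 is possible. The
  definite description also requires that every admissible choice of the two uniformizers and the
  unit leads to the same e.\<close>

lemma ramification_index_aut:
  assumes Q: "Q \<in> X" and ex: "unif X (\<sigma> Q) t0"
  shows "ramification_index X X \<sigma> Q = 1"
  unfolding ramification_index_def
proof (rule the_equality)
  let ?t = "generic_class X t0" and ?s = "generic_class X (\<lambda>x. t0 (\<sigma> x))" and ?u = "generic_class X (\<lambda>_. 1)"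
  have s: "unif X Q (\<lambda>x. t0 (\<sigma> x))" by (rule aut_unif[OF Q ex])
  have "rat_pullback X \<sigma> ?t = ?s"
    using rat_pullback_generic_class[OF irr irr aut_filterlim(1), of t0] by (simp add: o_def)
  moreover have "?u \<otimes>\<^bsub>function_field X\<^esub> (?s [^]\<^bsub>function_field X\<^esub> (1::nat)) = ?s"
    by (simp add: nat_pow_def one_function_field[OF irr] mult_function_field[OF irr])
  moreover have "?u \<in> local_ring X Q - local_max_ideal X Q"
  proof -
    have "\<not> locv X Q f 0" if "generic_class X (\<lambda>_. 1) = generic_class X f" for f
    proof
      assume f: "locv X Q f 0"
      have "\<forall>\<^sub>F x in genf X. f x = 1" using that by (auto simp: generic_class_eq_iff[OF irr] elim: eventually_mono)
      from locv_unique[OF irr locv_cong[OF f this] locv_const[OF irr Q]] show False by simp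
    qed
    then show ?thesis unfolding local_ring_alt[OF irr] local_max_ideal_alt[OF irr]
      using locv_const[OF irr Q] by blast
  qed
  ultimately show "\<exists>t s u. uniformizer X (\<sigma> Q) t \<and> uniformizer X Q s \<and> u \<in> local_ring X Q - local_max_ideal X Q \<and>
     rat_pullback X \<sigma> t = u \<otimes>\<^bsub>function_field X\<^esub> (s [^]\<^bsub>function_field X\<^esub> (1::nat))"
    using uniformizer_unif[OF aut_in[OF Q] ex] uniformizer_unif[OF Q s] by metis
next
  fix e
  assume "\<exists>t s u. uniformizer X (\<sigma> Q) t \<and> uniformizer X Q s \<and> u \<in> local_ring X Q - local_max_ideal X Q \<and>
     rat_pullback X \<sigma> t = u \<otimes>\<^bsub>function_field X\<^esub> (s [^]\<^bsub>function_field X\<^esub> (e::nat))"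
  then obtain T S U where *: "uniformizer X (\<sigma> Q) T" "uniformizer X Q S" "U \<in> local_ring X Q - local_max_ideal X Q"
     "rat_pullback X \<sigma> T = U \<otimes>\<^bsub>function_field X\<^esub> (S [^]\<^bsub>function_field X\<^esub> e)" by blast
  obtain t where t: "unif X (\<sigma> Q) t" "T \<noteq> {}" "T \<subseteq> generic_class X t"
    by (rule uniformizerE[OF aut_in[OF Q] *(1) ex]) (rule that)
  obtain s where s: "unif X Q s" "S \<noteq> {}" "S \<subseteq> generic_class X s"
    by (rule uniformizerE[OF Q *(2) aut_unif[OF Q ex]]) (rule that)
  obtain u a where u: "U = generic_class X u" "locv X Q u a"
    using *(3) unfolding local_ring_alt[OF irr] by blast
  have a: "a \<noteq> 0" using *(3) u unfolding local_max_ideal_alt[OF irr] by blast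
  obtain t' where t': "t' \<in> T" using t(2) by blast
  then have "\<forall>\<^sub>F x in genf X. t' x = t x" using t(3) by (auto simp: generic_class_alt[OF irr])
  then have t1: "\<forall>\<^sub>F x in genf X. t' (\<sigma> x) = t (\<sigma> x)" by (rule aut_gen)
  have "(\<lambda>x. t' (\<sigma> x)) \<in> rat_pullback X \<sigma> T"
    unfolding rat_pullback_def using t' generic_class_self[OF irr, of "t' \<circ> \<sigma>"] by (auto simp: o_def)
  \<comment> \<open>Products in the function field are unions over representatives, so for a
    possibly partial germ S only an inclusion is available, and it is enough.\<close>
  moreover have pow: "S [^]\<^bsub>function_field X\<^esub> n \<subseteq> generic_class X (\<lambda>x. s x ^ n)" for n
  proof (induction n)
    case 0
    then show ?case by (simp add: nat_pow_def one_function_field[OF irr])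
  next
    case (Suc n)
    have "S [^]\<^bsub>function_field X\<^esub> Suc n = (S [^]\<^bsub>function_field X\<^esub> n) \<otimes>\<^bsub>function_field X\<^esub> S"
      by (simp add: nat_pow_def)
    also have "\<dots> \<subseteq> generic_class X (\<lambda>x. s x ^ Suc n)"
    proof
      fix k assume "k \<in> (S [^]\<^bsub>function_field X\<^esub> n) \<otimes>\<^bsub>function_field X\<^esub> S"
      then obtain p q where pq: "p \<in> S [^]\<^bsub>function_field X\<^esub> n" "q \<in> S" "k \<in> generic_class X (\<lambda>x. p x * q x)"
        by (auto simp: function_field_def)
      have "\<forall>\<^sub>F x in genf X. p x = s x ^ n" "\<forall>\<^sub>F x in genf X. q x = s x" "\<forall>\<^sub>F x in genf X. k x = p x * q x"
        using pq Suc s(3) by (auto simp: generic_class_alt[OF irr])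
      then have "\<forall>\<^sub>F x in genf X. k x = s x ^ Suc n" by eventually_elim (simp add: mult.commute)
      then show "k \<in> generic_class X (\<lambda>x. s x ^ Suc n)" by (simp add: generic_class_alt[OF irr])
    qed
    finally show ?case .
  qed
  ultimately have "(\<lambda>x. t' (\<sigma> x)) \<in> U \<otimes>\<^bsub>function_field X\<^esub> (S [^]\<^bsub>function_field X\<^esub> e)" using *(4) by simp
  then obtain p q where pq: "p \<in> U" "q \<in> S [^]\<^bsub>function_field X\<^esub> e" "(\<lambda>x. t' (\<sigma> x)) \<in> generic_class X (\<lambda>x. p x * q x)"
    by (auto simp: function_field_def)
  have "\<forall>\<^sub>F x in genf X. p x = u x" "\<forall>\<^sub>F x in genf X. q x = s x ^ e" "\<forall>\<^sub>F x in genf X. t' (\<sigma> x) = p x * q x"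
    using pq pow[of e] u(1) by (auto simp: generic_class_alt[OF irr])
  with t1 have eq: "\<forall>\<^sub>F x in genf X. t (\<sigma> x) = u x * s x ^ e" by eventually_elim simp
  obtain v b where v: "locv X Q v b" "b \<noteq> 0" "\<forall>\<^sub>F x in genf X. t (\<sigma> x) = v x * s x"
    by (rule unif_quotient[OF irr s(1) aut_unif[OF Q t(1)]]) (rule that)
  have s0: "locv X Q s 0" "\<forall>\<^sub>F x in genf X. s x \<noteq> 0" using s(1) by (auto simp: unif_def)
  show "e = 1"
  proof (rule ccontr)
    assume "e \<noteq> 1"
    \<comment> \<open>For e = 0 a function vanishing at Q would be a unit there; for e \<ge> 2 the
      unit relating two uniformizers would vanish at Q.\<close>
    then consider "e = 0" | k where "e = Suc (Suc k)" by (metis One_nat_def not0_implies_Suc)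
    then show False
    proof cases
      case 1
      have "\<forall>\<^sub>F x in genf X. v x * s x = u x" using eq v(3) by eventually_elim (simp add: 1)
      from locv_unique[OF irr locv_cong[OF locv_mult[OF irr v(1) s0(1)] this] u(2)] a show False by simp
    next
      case 2
      have "\<forall>\<^sub>F x in genf X. u x * s x ^ Suc k = v x"
        using eq v(3) s0(2) by eventually_elim (simp add: 2)
      from locv_unique[OF irr locv_cong[OF locv_mult[OF irr u(2) locv_power[OF irr s0(1)]] this] v(1)] v(2)
      show False by simp
    qed
  qed
qed

text \<open>Fibres of an automorphism are single points with ramification index 1, so pullback just
  relabels coefficients. The hypothesis on keys reflects that a divisor is supported on X.\<close>

lemma lookup_div_pullback_aut:
  assumes unifs: "\<And>Q. Q \<in> X \<Longrightarrow> \<exists>t. unif X Q t" and D: "Poly_Mapping.keys D \<subseteq> X"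
  shows "Poly_Mapping.lookup (div_pullback X X \<sigma> D) R = (if R \<in> X then Poly_Mapping.lookup D (\<sigma> R) else 0)"
proof -
  have fib: "{S \<in> X. \<sigma> S = Q} = {inv_into X \<sigma> Q}" if "Q \<in> X" for Q
    using that aut_inv_left aut_inv_right aut_inv_in by auto
  have e: "ramification_index X X \<sigma> S = 1" if "S \<in> X" for S
    using unifs[OF aut_in[OF that]] ramification_index_aut[OF that] by blast
  have "div_pullback X X \<sigma> D = (\<Sum>Q\<in>Poly_Mapping.keys D. Poly_Mapping.single (inv_into X \<sigma> Q) (Poly_Mapping.lookup D Q))"
    unfolding div_pullback_def
  proof (rule sum.cong[OF refl])
    fix Q assume "Q \<in> Poly_Mapping.keys D"
    then have Q: "Q \<in> X" using D by blast
    show "(\<Sum>S\<in>{S \<in> X. \<sigma> S = Q}. Poly_Mapping.single S (int (ramification_index X X \<sigma> S) * Poly_Mapping.lookup D Q))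
      = Poly_Mapping.single (inv_into X \<sigma> Q) (Poly_Mapping.lookup D Q)"
      unfolding fib[OF Q] by (simp add: e[OF aut_inv_in[OF Q]])
  qed
  then have "Poly_Mapping.lookup (div_pullback X X \<sigma> D) R =
      (\<Sum>Q\<in>Poly_Mapping.keys D. if inv_into X \<sigma> Q = R then Poly_Mapping.lookup D Q else 0)"
    by (simp add: lookup_sum lookup_single when_def)
  also have "\<dots> = (\<Sum>Q\<in>Poly_Mapping.keys D. if R \<in> X \<and> Q = \<sigma> R then Poly_Mapping.lookup D (\<sigma> R) else 0)"
  proof (rule sum.cong[OF refl])
    fix Q assume "Q \<in> Poly_Mapping.keys D"
    then have "Q \<in> X" using D by blast
    then have "inv_into X \<sigma> Q = R \<longleftrightarrow> R \<in> X \<and> Q = \<sigma> R"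
      using aut_inv_left aut_inv_right aut_inv_in by auto
    then show "(if inv_into X \<sigma> Q = R then Poly_Mapping.lookup D Q else 0) =
        (if R \<in> X \<and> Q = \<sigma> R then Poly_Mapping.lookup D (\<sigma> R) else 0)" by auto
  qed
  also have "\<dots> = (if R \<in> X then Poly_Mapping.lookup D (\<sigma> R) else 0)"
    by (cases "R \<in> X") (simp_all add: sum.delta in_keys_iff)
  finally show ?thesis .
qed

end

subsection \<open>A smooth model of a plane curve\<close>

lemma germ_hom_compose:
  assumes "germ_hom X Y S" "germ_hom Y Z T" "irreducible_set Y" "irreducible_set Z"
  shows "germ_hom X Z (\<lambda>h. T (S h))"
  unfolding germ_hom_def
proof (intro conjI allI impI)
  note S = assms(1)[unfolded germ_hom_def]
  note T = assms(3,4,2)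
  fix f g assume fg: "ratf X f" "ratf X g"
  have Sfg: "ratf Y (S f)" "ratf Y (S g)" using S fg by blast+
  show "\<forall>\<^sub>F x in genf Z. T (S f) x = T (S g) x" if "\<forall>\<^sub>F x in genf X. f x = g x"
    using S fg that by (intro germ_hom_cong[OF T]) blast+
  have "\<forall>\<^sub>F x in genf Y. S f x + S g x = S (\<lambda>x. f x + g x) x"
    using S[THEN conjunct2, THEN conjunct2, THEN conjunct1, rule_format, OF fg] by eventually_elim simp
  from germ_hom_cong[OF T ratf_add[OF assms(3) Sfg] this] germ_hom_add[OF T Sfg]
  show "\<forall>\<^sub>F x in genf Z. T (S (\<lambda>x. f x + g x)) x = T (S f) x + T (S g) x" by eventually_elim simp
  have "\<forall>\<^sub>F x in genf Y. S f x * S g x = S (\<lambda>x. f x * g x) x"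
    using S[THEN conjunct2, THEN conjunct2, THEN conjunct2, THEN conjunct1, rule_format, OF fg] by eventually_elim simp
  from germ_hom_cong[OF T ratf_mult[OF assms(3) Sfg] this] germ_hom_mult[OF T Sfg]
  show "\<forall>\<^sub>F x in genf Z. T (S (\<lambda>x. f x * g x)) x = T (S f) x * T (S g) x" by eventually_elim simp
next
  fix f assume "ratf X f"
  then show "ratf Z (T (S f))" using assms(1,2) unfolding germ_hom_def by blast
next
  fix c
  have "\<forall>\<^sub>F x in genf Y. S (\<lambda>_. c) x = c" using assms(1) unfolding germ_hom_def by blast
  then have "\<forall>\<^sub>F x in genf Y. c = S (\<lambda>_. c) x" by eventually_elim simp
  from germ_hom_cong[OF assms(3,4,2) ratf_const[OF assms(3)] this] germ_hom_const[OF assms(3,4,2), of c]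
  show "\<forall>\<^sub>F x in genf Z. T (S (\<lambda>_. c)) x = c" by eventually_elim simp
qed

lemma morphism_ident:
  fixes X :: "('a::field, 'n::finite) proj set"
  shows "morphism X X (\<lambda>R. R)"
proof (rule morphismI)
  have eq: "(\<chi> i. form_at (lin (axis i 1)) y) = rep_proj y" for y :: "('a, 'n) proj"
    by (simp add: vec_eq_iff form_at_lin)
  fix R :: "('a, 'n) proj"
  show "\<exists>e N d F. is_form e N \<and> form_at N R \<noteq> 0 \<and> (\<forall>i. is_form d (F i)) \<and>
      (\<forall>y\<in>X. form_at N y \<noteq> 0 \<longrightarrow> (\<chi> i. form_at (F i) y) \<noteq> 0 \<and> y = abs_proj (\<chi> i. form_at (F i) y))"
    by (rule exI[of _ 0], rule exI[of _ 1], rule exI[of _ 1], rule exI[of _ "\<lambda>i. lin (axis i 1)"])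
      (auto simp: eq simp del: One_nat_def)
qed simp

lemma dotp_grad_scale:
  fixes F :: "('a::alg_closed_field, 'n::finite) mpoly"
  assumes "is_form d F" "c \<noteq> 0"
  shows "dotp (grad F (c *s a)) v = 0 \<longleftrightarrow> dotp (grad F a) v = 0"
proof -
  have "lp F (c *s a) (c *s v) = Polynomial.smult (c ^ d) (lp F a v)"
  proof (rule lp_eqI)
    fix t
    have "c *s a + t *s (c *s v) = c *s (a + t *s v)"
      by (simp add: vector_add_ldistrib vector_smult_assoc mult.commute)
    then show "peval F (c *s a + t *s (c *s v)) = poly (Polynomial.smult (c ^ d) (lp F a v)) t"
      by (simp only: peval_scale[OF assms(1)]) simp
  qed
  note eq = this
  have "dotp (grad F (c *s a)) (c *s v) = c ^ d * dotp (grad F a) v" unfolding dotp_grad eq coeff_smult ..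
  then show ?thesis using assms(2) by auto
qed

context plane_curve
begin

text \<open>At a point of the curve the coefficient of y^d is F(\<open>e2\<close>) = 0, and the next
  one is the equation of the tangent line, nonzero by smoothness. So projecting from a smooth point
  has degree d - 1, and the root of the leading coefficient is the tangent direction.\<close>

lemma smooth_frameI:
  assumes fr: "frame e1 e2 e3 l1 l2 l3" and smooth: "smooth_point C (abs_proj e2)"
  shows "framed_curve C d F e1 e2 e3 l1 l2 l3" "degree (bp F e1 e2 e3) = d - 1"
    "lead_coeff (bp F e1 e2 e3) = [:dotp (grad F e2) e3, dotp (grad F e2) e1:]"
    "dotp (grad F e2) e2 = 0" "lead_coeff (bp F e1 e2 e3) \<noteq> 0"
    "tangent_space C (abs_proj e2) = {v. dotp (grad F e2) v = 0}"
proof -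
  interpret frame e1 e2 e3 l1 l2 l3 by (rule fr)
  have e2: "e2 \<noteq> 0" using dual(5) by fastforce
  obtain c where c: "c \<noteq> 0" "rep_proj (abs_proj e2) = c *s e2" using rep_abs_proj[OF e2] .
  have "abs_proj e2 \<in> C" using smooth by (simp add: smooth_point_def)
  then have F0: "peval F e2 = 0" using mem_C_iff[OF e2] by simp
  show self: "dotp (grad F e2) e2 = 0" by (rule dotp_grad_self[OF F_form F0])
  show "tangent_space C (abs_proj e2) = {v. dotp (grad F e2) v = 0}"
    unfolding tangent_space_smooth[OF smooth] c(2) by (simp add: dotp_grad_scale[OF F_form c(1)])
  have nz: "dotp (grad F e2) e1 \<noteq> 0 \<or> dotp (grad F e2) e3 \<noteq> 0"
  proof (rule ccontr)
    assume "\<not> ?thesis"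
    then have "dotp (grad F e2) v = 0" for v
      by (subst expand[of v]) (simp only: dotp_add dotp_scale self, simp)
    then have "dotp (grad F (rep_proj (abs_proj e2))) v = 0" for v
      unfolding c(2) by (simp add: dotp_grad_scale[OF F_form c(1)])
    then have "grad F (rep_proj (abs_proj e2)) = 0"
      by (metis dotp_axis_right vec_eq_iff zero_index)
    then show False using grad_smooth_point[OF smooth] by simp
  qed
  have cd: "Polynomial.coeff (bp F e1 e2 e3) d = 0" using leading_coeff_bp(1)[OF F_form, of e1 e2 e3] F0 by simp
  have cd1: "Polynomial.coeff (bp F e1 e2 e3) (d - 1) = [:dotp (grad F e2) e3, dotp (grad F e2) e1:]"
    using leading_coeff_bp(2)[OF F_form, of e1 e2 e3] d2 by simp
  have cd1nz: "Polynomial.coeff (bp F e1 e2 e3) (d - 1) \<noteq> 0" using nz cd1 by auto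
  show deg: "degree (bp F e1 e2 e3) = d - 1"
  proof (rule antisym)
    show "degree (bp F e1 e2 e3) \<le> d - 1"
    proof (rule degree_le, intro allI impI)
      fix i assume "d - 1 < i"
      then have "i = d \<or> i > d" using d2 by auto
      then show "Polynomial.coeff (bp F e1 e2 e3) i = 0"
        using cd degree_bp_le[OF F_form, of e1 e2 e3] by (auto intro: coeff_eq_0)
    qed
    show "d - 1 \<le> degree (bp F e1 e2 e3)" by (rule le_degree[OF cd1nz])
  qed
  show "lead_coeff (bp F e1 e2 e3) = [:dotp (grad F e2) e3, dotp (grad F e2) e1:]" unfolding deg cd1 ..
  show "lead_coeff (bp F e1 e2 e3) \<noteq> 0" unfolding deg by (rule cd1nz)
  show "framed_curve C d F e1 e2 e3 l1 l2 l3"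
    by (rule framed_curveI[OF fr cd1nz]) (use d2 in simp)
qed

lemma galois_curveI:
  assumes "frame e1 e2 e3 l1 l2 l3" "inner_galois_point C (abs_proj e2)"
  shows "galois_curve C d F e1 e2 e3 l1 l2 l3"
  using smooth_frameI(1)[OF assms(1)] assms(2)
  by (simp add: galois_curve_def galois_curve_axioms_def inner_galois_point_def)

text \<open>In a frame with P as projection centre and R as origin, the coordinate x vanishes at R,
  and the Galois property of P makes the function field algebraic over k(x). The centre itself lies
  at infinity, hence R \<noteq> P.\<close>

lemma algebraic_coordinate:
  assumes P: "inner_galois_point C P" and R: "R \<in> C" "R \<noteq> P"
  obtains z where "locv C R z 0" "\<forall>\<^sub>F Q in genf C. z Q \<noteq> 0"
    "\<And>h. ratf C h \<Longrightarrow> \<exists>A. A \<noteq> 0 \<and> (\<forall>\<^sub>F Q in genf C. ev A (z Q) (h Q) = 0)"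
proof -
  have "rep_proj R \<notin> vec.span {rep_proj P}" using rep_proj_notin_span[of P R] R(2) by auto
  then obtain u m1 m2 m3 where "frame (rep_proj P) (rep_proj R) u m1 m2 m3"
    by (rule frame_complete[OF rep_proj_nonzero]) (rule that)
  then have fr: "frame u (rep_proj P) (rep_proj R) m3 m1 m2" unfolding frame_def by (auto simp: add_ac)
  interpret galois_curve C d F u "rep_proj P" "rep_proj R" m3 m1 m2
    by (rule galois_curveI[OF fr]) (use P in simp)
  show ?thesis
  proof (rule that)
    have "dotp m2 (rep_proj R) \<noteq> 0" by simp
    from locv_linear_quotient[OF C_irr R(1) this, of m3] show "locv C R x 0" by (simp add: x_def[abs_def])
    show "\<forall>\<^sub>F Q in genf C. x Q \<noteq> 0" using gen_x_notin[of "{0}"] by simp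
    show "\<exists>A. A \<noteq> 0 \<and> (\<forall>\<^sub>F Q in genf C. ev A (x Q) (h Q) = 0)" if "ratf C h" for h
      by (rule algebraic_over_x[OF that])
  qed
qed

end

locale plane_model =
  fixes X :: "('a::alg_closed_field, 'n::finite) proj set" and \<phi> :: "('a, 'n) proj \<Rightarrow> ('a, 3) proj"
    and d :: nat and F :: "('a, 3) mpoly"
  assumes X: "smooth_projective_curve X" and mor: "morphism X UNIV \<phi>" and bir: "birational_onto_image X \<phi>"
    and F0: "Factorial_Ring.irreducible F" "is_form d F" "\<phi> ` X = {x. form_at F x = 0}" and d4: "d \<ge> 4"
begin

abbreviation "C \<equiv> \<phi> ` X"

lemma X_irr: "irreducible_set X" and X_closed: "closedin zariski X" and X_smooth: "Q \<in> X \<Longrightarrow> smooth_point X Q"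
  using X by (auto simp: smooth_projective_curve_def)

lemma C_irr': "irreducible_set C"
  by (rule irreducible_image[OF X_irr mor])

sublocale plane_curve C d F
  using F0 d4 C_irr' by unfold_locales auto

lemma phi_filterlim: "filterlim \<phi> (genf C) (genf X)"
  by (rule morphism_filterlim[OF X_irr C_irr mor refl])

lemma phi_gen: "eventually P (genf C) \<Longrightarrow> \<forall>\<^sub>F R in genf X. P (\<phi> R)"
  using phi_filterlim by (simp add: filterlim_iff)

lemma phi_ratmap: "ratmap X C \<phi>"
  by (rule morphism_ratmap[OF X_irr mor phi_filterlim])

lemma phi_locv: "Q \<in> X \<Longrightarrow> locv C (\<phi> Q) h a \<Longrightarrow> locv X Q (\<lambda>R. h (\<phi> R)) a"
  by (rule locv_compose[OF X_irr C_irr mor phi_filterlim])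

text \<open>The inverse morphism lives on an open subset of C. For its dominance, a form
  nonvanishing somewhere on X is composed with the coordinate forms of the inverse; the result is
  generically nonzero after pullback by \<phi>, hence nonzero at some point of C.\<close>

lemma inverse_exists:
  "\<exists>\<psi>. ratmap C X \<psi> \<and> (\<forall>\<^sub>F y in genf C. \<phi> (\<psi> y) = y) \<and> (\<forall>\<^sub>F R in genf X. \<psi> (\<phi> R) = R)"
proof -
  obtain V g where V: "openin (subtopology zariski C) V" "V \<noteq> {}" "morphism V X g"
    "\<forall>y\<in>V. \<phi> (g y) = y" "\<forall>R\<in>X. \<phi> R \<in> V \<longrightarrow> g (\<phi> R) = R"
    using bir unfolding birational_onto_image_def by blast
  obtain y0 where y0: "y0 \<in> V" using V(2) by blast
  have genV: "\<forall>\<^sub>F y in genf C. y \<in> V" by (rule eventually_genf_openI[OF C_irr V(1) y0])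
  obtain e N k G where N: "is_form e N" "form_at N y0 \<noteq> 0" "\<And>i. is_form k (G i)"
    "\<And>y. y \<in> V \<Longrightarrow> form_at N y \<noteq> 0 \<Longrightarrow> (\<chi> i. form_at (G i) y) \<noteq> 0 \<and> g y = abs_proj (\<chi> i. form_at (G i) y)"
    by (rule morphism_local[OF V(3) y0]) (rule that)
  have "y0 \<in> C" using y0 openin_subset[OF V(1)] by auto
  then have genN: "\<forall>\<^sub>F y in genf C. form_at N y \<noteq> 0"
    using eventually_genf_form_nonzero[OF C_irr N(1) _ N(2)] by blast
  have gG: "\<forall>\<^sub>F y in genf C. (\<chi> i. form_at (G i) y) \<noteq> 0 \<and> g y = abs_proj (\<chi> i. form_at (G i) y)"
    using genV genN by eventually_elim (rule N(4))
  have gphi: "\<forall>\<^sub>F R in genf X. g (\<phi> R) = R"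
    using phi_gen[OF genV] eventually_genf_in[OF X_irr] by eventually_elim (use V(5) in blast)
  have "filterlim g (genf X) (genf C)"
    unfolding filterlim_iff
  proof (intro allI impI)
    fix Pr assume "eventually Pr (genf X)"
    then obtain m H R where H: "is_form m H" "R \<in> X" "form_at H R \<noteq> 0"
      "\<And>y. y \<in> X \<Longrightarrow> form_at H y \<noteq> 0 \<Longrightarrow> Pr y"
      by (rule eventually_genfE[OF X_irr]) (rule that)
    have "\<forall>\<^sub>F R in genf X. form_at (psubst H G) (\<phi> R) \<noteq> 0"
      using eventually_genf_form_nonzero[OF X_irr H(1-3)] gphi phi_gen[OF gG]
    proof eventually_elim
      case (elim R)
      then have "form_at H (abs_proj (\<chi> i. form_at (G i) (\<phi> R))) \<noteq> 0" by simp
      then show ?case using form_at_abs_proj[OF elim(3)[THEN conjunct1] H(1)] by simp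
    qed
    from eventually_genf_ex[OF X_irr this]
    obtain R0 where R0: "R0 \<in> X" "form_at (psubst H G) (\<phi> R0) \<noteq> 0" by (elim bexE) (rule that)
    have "\<forall>\<^sub>F y in genf C. form_at (psubst H G) y \<noteq> 0"
      by (rule eventually_genf_form_nonzero[OF C_irr is_form_psubst[OF H(1) N(3)] imageI[OF R0(1)] R0(2)])
    then show "\<forall>\<^sub>F y in genf C. Pr (g y)"
      using gG genV
    proof eventually_elim
      case (elim y)
      have "g y \<in> X" using V(3) elim(3) by (auto simp: morphism_def)
      moreover have "form_at H (g y) \<noteq> 0" using elim form_at_abs_proj[OF _ H(1)] by auto
      ultimately show ?case using H(4) by blast
    qed
  qed
  then have "ratmap C X g" unfolding ratmap_def using N(3) gG by blast
  moreover have "\<forall>\<^sub>F y in genf C. \<phi> (g y) = y" using genV by eventually_elim (use V(4) in blast)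
  ultimately show ?thesis using gphi by blast
qed

definition psi where "psi = (SOME \<psi>. ratmap C X \<psi> \<and> (\<forall>\<^sub>F y in genf C. \<phi> (\<psi> y) = y) \<and> (\<forall>\<^sub>F R in genf X. \<psi> (\<phi> R) = R))"

lemma psi_ratmap: "ratmap C X psi" and phi_psi: "\<forall>\<^sub>F y in genf C. \<phi> (psi y) = y"
  and psi_phi: "\<forall>\<^sub>F R in genf X. psi (\<phi> R) = R"
  using someI_ex[OF inverse_exists] unfolding psi_def[symmetric] by blast+

lemma psi_ratf: "ratf X h \<Longrightarrow> ratf C (\<lambda>y. h (psi y))"
  by (rule ratf_compose[OF psi_ratmap])

lemma phi_ratf: "ratf C h \<Longrightarrow> ratf X (\<lambda>R. h (\<phi> R))"
  by (rule ratf_compose[OF phi_ratmap])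

lemma psi_gen: "eventually P (genf X) \<Longrightarrow> \<forall>\<^sub>F y in genf C. P (psi y)"
  using psi_ratmap by (simp add: ratmap_def filterlim_iff)

lemma valring_C:
  assumes P: "inner_galois_point C P" and R: "smooth_point C R" "R \<noteq> P"
  shows "valring C R"
proof -
  have RC: "R \<in> C" "P \<in> C" using P R by (auto simp: smooth_point_def inner_galois_point_def)
  obtain t where t: "unif C R t" by (rule unif_exists[OF C_irr R(1) RC(2) R(2)[symmetric]]) (rule that)
  obtain z where "locv C R z 0" "\<forall>\<^sub>F Q in genf C. z Q \<noteq> 0"
    "\<And>h. ratf C h \<Longrightarrow> \<exists>A. A \<noteq> 0 \<and> (\<forall>\<^sub>F Q in genf C. ev A (z Q) (h Q) = 0)"
    by (rule algebraic_coordinate[OF P RC(1) R(2)]) (rule that)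
  then show ?thesis by (rule valring_of_unif[OF C_irr t])
qed

text \<open>The algebraic coordinate at \<phi>(Q) is pulled back to Q; equations over it transfer
  because functions on X and on C correspond through \<open>psi\<close>.\<close>

lemma valring_X:
  assumes P: "inner_galois_point C P" and Q: "Q \<in> X" "\<phi> Q \<noteq> P"
  shows "valring X Q"
proof -
  have "P \<in> C" using P by (auto simp: smooth_point_def inner_galois_point_def)
  then obtain Q' where Q': "Q' \<in> X" "P = \<phi> Q'" by blast
  then have ne: "Q' \<noteq> Q" using Q(2) by blast
  obtain t where t: "unif X Q t" by (rule unif_exists[OF X_irr X_smooth[OF Q(1)] Q'(1) ne]) (rule that)
  obtain z where z: "locv C (\<phi> Q) z 0" "\<forall>\<^sub>F Q in genf C. z Q \<noteq> 0"
    "\<And>h. ratf C h \<Longrightarrow> \<exists>A. A \<noteq> 0 \<and> (\<forall>\<^sub>F Q in genf C. ev A (z Q) (h Q) = 0)"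
    by (rule algebraic_coordinate[OF P _ Q(2)]) (use Q(1) in blast, rule that)
  show ?thesis
  proof (rule valring_of_unif[OF X_irr t])
    show "locv X Q (\<lambda>R. z (\<phi> R)) 0" by (rule phi_locv[OF Q(1) z(1)])
    show "\<forall>\<^sub>F R in genf X. z (\<phi> R) \<noteq> 0" by (rule phi_gen[OF z(2)])
    fix h assume "ratf X h"
    from z(3)[OF psi_ratf[OF this]] obtain A where A: "A \<noteq> 0" "\<forall>\<^sub>F y in genf C. ev A (z y) (h (psi y)) = 0" by blast
    have "\<forall>\<^sub>F R in genf X. ev A (z (\<phi> R)) (h R) = 0"
      using phi_gen[OF A(2)] psi_phi by eventually_elim simp
    then show "\<exists>A. A \<noteq> 0 \<and> (\<forall>\<^sub>F R in genf X. ev A (z (\<phi> R)) (h R) = 0)" using A(1) by blast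
  qed
qed

text \<open>A function separating the two points also lives on C through \<open>psi\<close>. The
  valuation ring at the common image gives it, or its inverse, a value there, and this value would
  be the same at both points.\<close>

lemma fibre_unique:
  assumes val: "valring C (\<phi> Q)" and Q: "Q \<in> X" "Q' \<in> X" "\<phi> Q' = \<phi> Q"
  shows "Q' = Q"
proof (rule ccontr)
  assume "Q' \<noteq> Q"
  then have "rep_proj Q' \<notin> vec.span {rep_proj Q}" using rep_proj_notin_span[of Q Q'] by auto
  then obtain l where l: "dotp l (rep_proj Q) = 0" "dotp l (rep_proj Q') \<noteq> 0" by (rule exists_separating_form)
  obtain H where H: "dotp H (rep_proj Q) \<noteq> 0" "dotp H (rep_proj Q') \<noteq> 0" by (rule exists_form_nonzero_at_both)
  define h where "h R = dotp l (rep_proj R) / dotp H (rep_proj R)" for R :: "('a, 'n) proj"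
  have h0: "locv X Q h 0" using locv_linear_quotient[OF X_irr Q(1) H(1), of l] l by (simp add: h_def[abs_def])
  obtain a where a: "locv X Q' h a" "a \<noteq> 0"
    using locv_linear_quotient[OF X_irr Q(2) H(2), of l] l H by (simp add: h_def[abs_def])
  have "ratf C (\<lambda>y. h (psi y))" by (rule psi_ratf[OF locv_ratf[OF X_irr h0]])
  with val consider c where "locv C (\<phi> Q) (\<lambda>y. h (psi y)) c" | "locv C (\<phi> Q) (\<lambda>y. 1 / h (psi y)) 0"
    unfolding valring_def by blast
  then show False
  proof cases
    case 1
    have eq: "\<forall>\<^sub>F R in genf X. h (psi (\<phi> R)) = h R" using psi_phi by eventually_elim simp
    have "locv X Q h c" "locv X Q' h c"
      using locv_cong[OF phi_locv[OF Q(1) 1] eq] locv_cong[OF phi_locv[OF Q(2), of "\<lambda>y. h (psi y)" c] eq] 1 Q(3) by auto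
    then show False using locv_unique[OF X_irr] h0 a by metis
  next
    case 2
    have eq: "\<forall>\<^sub>F R in genf X. 1 / h (psi (\<phi> R)) = 1 / h R" using psi_phi by eventually_elim simp
    have "locv X Q' (\<lambda>R. 1 / h R) 0"
      using locv_cong[OF phi_locv[OF Q(2), of "\<lambda>y. 1 / h (psi y)" 0] eq] 2 Q(3) by auto
    from locv_unique[OF X_irr this locv_inverse[OF X_irr a]] a(2) show False by simp
  qed
qed

text \<open>Valuation rings are maximal, so passing from C to X adds no functions to the local ring:
  one that vanishes at Q is already regular at \<phi>(Q), since a vanishing inverse would give 0 =
  1.\<close>

lemma unif_phi:
  assumes val: "valring C (\<phi> Q)" and Q: "Q \<in> X" and t: "unif C (\<phi> Q) t"
  shows "unif X Q (\<lambda>R. t (\<phi> R))"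
  unfolding unif_def
proof (intro conjI allI impI)
  show "locv X Q (\<lambda>R. t (\<phi> R)) 0" using t by (intro phi_locv Q) (simp add: unif_def)
  show "\<forall>\<^sub>F R in genf X. t (\<phi> R) \<noteq> 0" using t by (intro phi_gen) (simp add: unif_def)
  fix h assume h: "locv X Q h 0"
  have eq: "\<forall>\<^sub>F R in genf X. h (psi (\<phi> R)) = h R" using psi_phi by eventually_elim simp
  have "ratf C (\<lambda>y. h (psi y))" by (rule psi_ratf[OF locv_ratf[OF X_irr h]])
  with val consider c where "locv C (\<phi> Q) (\<lambda>y. h (psi y)) c" | "locv C (\<phi> Q) (\<lambda>y. 1 / h (psi y)) 0"
    unfolding valring_def by blast
  then show "\<exists>g b. locv X Q g b \<and> (\<forall>\<^sub>F R in genf X. h R = g R * t (\<phi> R))"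
  proof cases
    case 1
    have "c = 0" using locv_unique[OF X_irr locv_cong[OF phi_locv[OF Q 1] eq] h] .
    then obtain g b where g: "locv C (\<phi> Q) g b" "\<forall>\<^sub>F y in genf C. h (psi y) = g y * t y"
      using t 1 unfolding unif_def by blast
    have "\<forall>\<^sub>F R in genf X. h R = g (\<phi> R) * t (\<phi> R)" using phi_gen[OF g(2)] eq by eventually_elim simp
    then show ?thesis using phi_locv[OF Q g(1)] by blast
  next
    case 2
    show ?thesis
    proof (cases "\<forall>\<^sub>F R in genf X. h R = 0")
      case True
      then have "\<forall>\<^sub>F R in genf X. h R = 0 * t (\<phi> R)" by eventually_elim simp
      then show ?thesis using locv_const[OF X_irr Q, of 0] by blast
    next
      case False
      then have "\<forall>\<^sub>F R in genf X. h R \<noteq> 0" using ratf_0_or_nonzero[OF X_irr locv_ratf[OF X_irr h]] by blast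
      then have "\<forall>\<^sub>F R in genf X. h R * (1 / h (psi (\<phi> R))) = 1" using eq by eventually_elim simp
      from locv_unique[OF X_irr locv_cong[OF locv_mult[OF X_irr h phi_locv[OF Q 2]] this] locv_const[OF X_irr Q]]
      show ?thesis by simp
    qed
  qed
qed

lemma compose_aut:
  assumes "\<sigma> \<in> curve_aut X" "\<tau> \<in> curve_aut X"
  shows "compose X \<sigma> \<tau> \<in> curve_aut X"
proof -
  note s = aut_morphism[OF X_irr assms(1)] aut_inv_morphism[OF X_irr assms(1)] aut_bij[OF X_irr assms(1)]
  note t = aut_morphism[OF X_irr assms(2)] aut_inv_morphism[OF X_irr assms(2)] aut_bij[OF X_irr assms(2)]
  have bij: "compose X \<sigma> \<tau> \<in> Bij X"
    using assms by (intro compose_Bij) (auto simp: curve_aut_def)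
  have "morphism X X (compose X \<sigma> \<tau>)"
    by (rule morphism_cong[OF morphism_compose[OF t(1) s(1)]]) (simp add: compose_def)
  moreover have "inv_into X (compose X \<sigma> \<tau>) R = inv_into X \<tau> (inv_into X \<sigma> R)" if R: "R \<in> X" for R
  proof -
    have b: "bij_betw (compose X \<sigma> \<tau>) X X" using bij by (simp add: Bij_def)
    define S where "S = inv_into X \<tau> (inv_into X \<sigma> R)"
    have S: "S \<in> X" unfolding S_def by (intro aut_inv_in[OF X_irr assms(2)] aut_inv_in[OF X_irr assms(1)] R)
    have "compose X \<sigma> \<tau> S = R"
      using S R unfolding compose_def S_def
      by (simp add: aut_inv_right[OF X_irr assms(2)] aut_inv_right[OF X_irr assms(1)] aut_inv_in[OF X_irr assms(1)])
    then show ?thesis using b S by (metis S_def bij_betw_inv_into_left)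
  qed
  then have "morphism X X (inv_into X (compose X \<sigma> \<tau>))"
    by (intro morphism_cong[OF morphism_compose[OF s(2) t(2)]]) simp
  ultimately show ?thesis using bij by (simp add: curve_aut_def)
qed

lemma id_aut: "restrict (\<lambda>R. R) X \<in> curve_aut X"
proof -
  have b: "bij_betw (restrict (\<lambda>R. R) X) X X" by (simp add: bij_betw_def inj_on_def)
  have "inv_into X (restrict (\<lambda>R. R) X) R = R" if "R \<in> X" for R
    using bij_betw_inv_into_left[OF b that] that by simp
  then show ?thesis
    unfolding curve_aut_def Bij_def using b by (auto intro!: morphism_cong[OF morphism_ident])
qed

end

subsection \<open>A pair of inner Galois points\<close>

text \<open>Coordinates in which the two Galois points are \<open>(1:0:0)\<close> and \<open>(0:1:0)\<close>. The Galois group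
  under consideration is that of the second point, with projection \<open>x\<close>.\<close>

locale galois_pair = plane_model X \<phi> d F + frame e1 e2 e3 l1 l2 l3
  for X :: "('a::alg_closed_field, 'n::finite) proj set" and \<phi> :: "('a, 'n) proj \<Rightarrow> ('a, 3) proj"
    and d F e1 e2 e3 l1 l2 l3 +
  fixes P1 P2 :: "('a, 'n) proj"
  assumes P1: "P1 \<in> X" "\<phi> P1 = abs_proj e1" "inner_galois_point (\<phi> ` X) (abs_proj e1)"
    and P2: "P2 \<in> X" "\<phi> P2 = abs_proj e2" "inner_galois_point (\<phi> ` X) (abs_proj e2)"
begin

lemma e_nonzero: "e1 \<noteq> 0" "e2 \<noteq> 0"
  using dual(1,5) by (metis dotp_0(1) zero_neq_one)+

lemma phi_neq: "\<phi> P1 \<noteq> \<phi> P2"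
proof
  assume "\<phi> P1 = \<phi> P2"
  then obtain c where c: "e2 = c *s e1" using P1(2) P2(2) e_nonzero by (auto simp: abs_proj_eq_iff)
  have "dotp l2 (c *s e1) = 0" by simp
  then show False unfolding c[symmetric] by simp
qed

lemma P2_smooth: "smooth_point C (abs_proj e2)"
  using P2(3) by (simp add: inner_galois_point_def)

sublocale galois_curve C d F e1 e2 e3 l1 l2 l3
  by (rule galois_curveI[OF frame_axioms P2(3)])

text \<open>Each point of X has an image different from one of the two Galois points, and that one
  serves as the projection centre.\<close>

lemma valring_all: "Q \<in> X \<Longrightarrow> valring X Q"
  using valring_X[OF P1(3), of Q] valring_X[OF P2(3), of Q] phi_neq P1(2) P2(2) by metis

lemma valring_P: "valring C (\<phi> P1)" "valring C (\<phi> P2)"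
  using valring_C[OF P1(3), of "\<phi> P2"] valring_C[OF P2(3), of "\<phi> P1"] P1 P2 phi_neq
  by (auto simp: inner_galois_point_def)

lemma unif_X_exists: "Q \<in> X \<Longrightarrow> \<exists>t. unif X Q t"
proof -
  assume Q: "Q \<in> X"
  obtain Q' where "Q' \<in> X" "Q' \<noteq> Q" using P1(1) P2(1) phi_neq by metis
  then show ?thesis using unif_exists[OF X_irr X_smooth[OF Q]] by metis
qed

section \<open>Automorphisms of X lifting the Galois group\<close>

definition G where "G = galois_point_group X \<phi> (abs_proj e2)"

text \<open>Replaces the condition on sets of representatives by generic equality of functions, and
  the possibly infinite set \<open>galois_group\<close> by the finite \<Gamma>.\<close>

lemma mem_G_iff: "\<gamma> \<in> G \<longleftrightarrow> \<gamma> \<in> curve_aut X \<and>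
    (\<exists>g\<in>\<Gamma>. \<forall>h. ratf C h \<longrightarrow> (\<forall>\<^sub>F R in genf X. h (\<phi> (\<gamma> R)) = act g h (\<phi> R)))"
proof (cases "\<gamma> \<in> curve_aut X")
  case True
  have pull: "rat_pullback X \<gamma> (rat_pullback X \<phi> (generic_class C h)) = generic_class X (\<lambda>R. h (\<phi> (\<gamma> R)))" for h
    using rat_pullback_generic_class[OF X_irr C_irr phi_filterlim, of h]
      rat_pullback_generic_class[OF X_irr X_irr aut_filterlim(1)[OF X_irr True], of "h \<circ> \<phi>"]
    by (simp add: o_def)
  have pull2: "rat_pullback X \<phi> (generic_class C h) = generic_class X (\<lambda>R. h (\<phi> R))" for h
    using rat_pullback_generic_class[OF X_irr C_irr phi_filterlim, of h] by (simp add: o_def)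
  have carr: "generic_class C h \<in> carrier L" if "ratf C h" for h
    using that by (auto simp: carrier_function_field[OF C_irr])
  have eq: "rat_pullback X \<gamma> (rat_pullback X \<phi> (generic_class C h)) = rat_pullback X \<phi> (g (generic_class C h)) \<longleftrightarrow>
      (\<forall>\<^sub>F R in genf X. h (\<phi> (\<gamma> R)) = act g h (\<phi> R))" if "g \<in> galois_group L K" "ratf C h" for g h
    by (simp only: pull act_class(1)[OF that, symmetric] pull2[of "act g h"] generic_class_eq_iff[OF X_irr])
  show ?thesis
  proof
    assume "\<gamma> \<in> G"
    then obtain g where g: "g \<in> galois_group L K"
      "\<forall>a\<in>carrier L. rat_pullback X \<gamma> (rat_pullback X \<phi> a) = rat_pullback X \<phi> (g a)"
      unfolding G_def galois_point_group_def by blast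
    let ?g = "restrict g (carrier L)"
    have "?g \<in> \<Gamma>" using g(1) by (auto simp: \<Gamma>_def)
    moreover have "\<forall>\<^sub>F R in genf X. h (\<phi> (\<gamma> R)) = act ?g h (\<phi> R)" if "ratf C h" for h
      using eq[OF \<Gamma>_galois[OF calculation] that] g(2) carr[OF that] by simp
    ultimately show "\<gamma> \<in> curve_aut X \<and>
      (\<exists>g\<in>\<Gamma>. \<forall>h. ratf C h \<longrightarrow> (\<forall>\<^sub>F R in genf X. h (\<phi> (\<gamma> R)) = act g h (\<phi> R)))" using True by blast
  next
    assume "\<gamma> \<in> curve_aut X \<and>
      (\<exists>g\<in>\<Gamma>. \<forall>h. ratf C h \<longrightarrow> (\<forall>\<^sub>F R in genf X. h (\<phi> (\<gamma> R)) = act g h (\<phi> R)))"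
    then obtain g where g: "g \<in> \<Gamma>" "\<And>h. ratf C h \<Longrightarrow> \<forall>\<^sub>F R in genf X. h (\<phi> (\<gamma> R)) = act g h (\<phi> R)" by blast
    have "rat_pullback X \<gamma> (rat_pullback X \<phi> a) = rat_pullback X \<phi> (g a)" if "a \<in> carrier L" for a
      using that eq[OF \<Gamma>_galois[OF g(1)]] g(2) by (auto simp: carrier_function_field[OF C_irr])
    then show "\<gamma> \<in> G" unfolding G_def galois_point_group_def using True \<Gamma>_galois[OF g(1)] by blast
  qed
qed (simp add: G_def galois_point_group_def)

lemma G_aut: "\<tau> \<in> G \<Longrightarrow> \<tau> \<in> curve_aut X"
  using mem_G_iff by blast

definition rep_map where
  "rep_map g \<gamma> \<longleftrightarrow> \<gamma> \<in> G \<and> (\<forall>h. ratf C h \<longrightarrow> (\<forall>\<^sub>F R in genf X. h (\<phi> (\<gamma> R)) = act g h (\<phi> R)))"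

lemma rep_map_X:
  assumes "rep_map g \<gamma>" "ratf X u"
  shows "\<forall>\<^sub>F R in genf X. u (\<gamma> R) = act g (\<lambda>y. u (psi y)) (\<phi> R)"
proof -
  have \<gamma>: "\<gamma> \<in> curve_aut X" using assms(1) G_aut by (simp add: rep_map_def)
  have "\<forall>\<^sub>F R in genf X. u (psi (\<phi> (\<gamma> R))) = act g (\<lambda>y. u (psi y)) (\<phi> R)"
    using assms psi_ratf unfolding rep_map_def by blast
  then show ?thesis using aut_gen[OF X_irr \<gamma> psi_phi] by eventually_elim simp
qed

text \<open>The Galois action carried over from C to X through the birational identification by
  \<phi> and \<open>psi\<close>.\<close>

definition pull_act where "pull_act g h = (\<lambda>R. act g (\<lambda>y. h (psi y)) (\<phi> R))"

lemma pull_act_hom: "g \<in> \<Gamma> \<Longrightarrow> germ_hom X X (pull_act g)"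
  unfolding pull_act_def
  using germ_hom_compose[OF germ_hom_compose[OF germ_hom_pullback[OF psi_ratmap] germ_hom_act[OF \<Gamma>_galois] C_irr C_irr]
    germ_hom_pullback[OF phi_ratmap] C_irr X_irr] .

lemma ex_left_inverse:
  assumes "g \<in> \<Gamma>"
  obtains g' where "g' \<in> \<Gamma>" "\<And>h. ratf C h \<Longrightarrow> \<forall>\<^sub>F Q in genf C. act g (act g' h) Q = h Q"
proof -
  have "idG \<in> compose (carrier L) g ` \<Gamma>" using compose_bij[OF assms] idG(1) by (simp add: bij_betw_def)
  then obtain g' where g': "g' \<in> \<Gamma>" "idG = compose (carrier L) g g'" by blast
  have "\<forall>\<^sub>F Q in genf C. act g (act g' h) Q = h Q" if "ratf C h" for h
    using act_compose(2)[OF assms g'(1) that] idG(2)[OF that] unfolding g'(2)[symmetric] by eventually_elim simp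
  then show ?thesis using that g'(1) by blast
qed

lemma pre_lift:
  assumes "g \<in> \<Gamma>"
  obtains \<gamma> where "morphism X X \<gamma>" "filterlim \<gamma> (genf X) (genf X)"
    "\<And>h. ratf X h \<Longrightarrow> \<forall>\<^sub>F R in genf X. h (\<gamma> R) = pull_act g h R"
  by (rule lift_germ_hom[OF X_irr X_closed valring_all pull_act_hom[OF assms]]) (assumption, rule that)

text \<open>The action on germs is realized by a morphism because all local rings of X are valuation
  rings. Invertibility comes from lifting inverses as well, since a morphism is determined by its
  pullback.\<close>

lemma lift_exists:
  assumes g: "g \<in> \<Gamma>"
  shows "\<exists>\<gamma>. rep_map g \<gamma>"
proof -
  have inv: "\<gamma>' (\<gamma> R) = R"
    if gg': "g \<in> \<Gamma>" "g' \<in> \<Gamma>" "\<And>h. ratf C h \<Longrightarrow> \<forall>\<^sub>F Q in genf C. act g (act g' h) Q = h Q"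
      and \<gamma>: "morphism X X \<gamma>" "filterlim \<gamma> (genf X) (genf X)" "\<And>h. ratf X h \<Longrightarrow> \<forall>\<^sub>F R in genf X. h (\<gamma> R) = pull_act g h R"
      and \<gamma>': "morphism X X \<gamma>'" "filterlim \<gamma>' (genf X) (genf X)" "\<And>h. ratf X h \<Longrightarrow> \<forall>\<^sub>F R in genf X. h (\<gamma>' R) = pull_act g' h R"
      and R: "R \<in> X" for g g' \<gamma> \<gamma>' R
  proof (rule morphism_eq_of_pullback[OF X_irr X_irr _ _ _ _ _ R, where Z = X])
    show "morphism X X (\<lambda>R. \<gamma>' (\<gamma> R))" by (rule morphism_compose[OF \<gamma>(1) \<gamma>'(1)])
    show "filterlim (\<lambda>R. \<gamma>' (\<gamma> R)) (genf X) (genf X)" by (rule filterlim_compose[OF \<gamma>'(2) \<gamma>(2)])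
    show "morphism X X (\<lambda>R. R)" by (rule morphism_ident)
    show "filterlim (\<lambda>R. R) (genf X) (genf X)" by (rule filterlim_ident)
    fix h assume h: "ratf X h"
    have h': "ratf C (\<lambda>y. h (psi y))" by (rule psi_ratf[OF h])
    have r': "ratf C (act g' (\<lambda>y. h (psi y)))" by (rule act_class(2)[OF \<Gamma>_galois[OF gg'(2)] h'])
    have "\<forall>\<^sub>F R in genf X. h (\<gamma>' (\<gamma> R)) = pull_act g' h (\<gamma> R)"
      using \<gamma>'(3)[OF h] \<gamma>(2) by (auto simp: filterlim_iff)
    moreover have "\<forall>\<^sub>F R in genf X. pull_act g' h (\<gamma> R) = pull_act g (pull_act g' h) R"
      using \<gamma>(3)[of "pull_act g' h"] phi_ratf[OF r'] by (simp add: pull_act_def)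
    moreover have "\<forall>\<^sub>F R in genf X. pull_act g (pull_act g' h) R = h R"
    proof -
      have "\<forall>\<^sub>F y in genf C. act g' (\<lambda>y. h (psi y)) (\<phi> (psi y)) = act g' (\<lambda>y. h (psi y)) y"
        using phi_psi by eventually_elim simp
      from germ_hom_cong[OF C_irr C_irr germ_hom_act[OF \<Gamma>_galois[OF gg'(1)]] psi_ratf[OF phi_ratf[OF r']] this]
        gg'(3)[OF h']
      have "\<forall>\<^sub>F y in genf C. act g (\<lambda>y. act g' (\<lambda>y. h (psi y)) (\<phi> (psi y))) y = h (psi y)"
        by eventually_elim simp
      from phi_gen[OF this] psi_phi show ?thesis unfolding pull_act_def by eventually_elim simp
    qed
    ultimately show "\<forall>\<^sub>F R in genf X. h (\<gamma>' (\<gamma> R)) = h R" by eventually_elim simp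
  qed
  \<comment> \<open>Only one-sided inverses are at hand. Lifting g, an inverse of g and an inverse
    of that inverse gives left inverses for two successive maps, which forces the middle one to be a
    two-sided inverse.\<close>
  obtain g' where g': "g' \<in> \<Gamma>" "\<And>h. ratf C h \<Longrightarrow> \<forall>\<^sub>F Q in genf C. act g (act g' h) Q = h Q"
    by (rule ex_left_inverse[OF g]) (rule that)
  obtain g'' where g'': "g'' \<in> \<Gamma>" "\<And>h. ratf C h \<Longrightarrow> \<forall>\<^sub>F Q in genf C. act g' (act g'' h) Q = h Q"
    by (rule ex_left_inverse[OF g'(1)]) (rule that)
  obtain \<gamma> where \<gamma>: "morphism X X \<gamma>" "filterlim \<gamma> (genf X) (genf X)"
    "\<And>h. ratf X h \<Longrightarrow> \<forall>\<^sub>F R in genf X. h (\<gamma> R) = pull_act g h R" by (rule pre_lift[OF g]) (rule that)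
  obtain \<gamma>' where \<gamma>': "morphism X X \<gamma>'" "filterlim \<gamma>' (genf X) (genf X)"
    "\<And>h. ratf X h \<Longrightarrow> \<forall>\<^sub>F R in genf X. h (\<gamma>' R) = pull_act g' h R" by (rule pre_lift[OF g'(1)]) (rule that)
  obtain \<gamma>'' where \<gamma>'': "morphism X X \<gamma>''" "filterlim \<gamma>'' (genf X) (genf X)"
    "\<And>h. ratf X h \<Longrightarrow> \<forall>\<^sub>F R in genf X. h (\<gamma>'' R) = pull_act g'' h R" by (rule pre_lift[OF g''(1)]) (rule that)
  have inv1: "R \<in> X \<Longrightarrow> \<gamma>' (\<gamma> R) = R" for R by (rule inv[OF g g' \<gamma> \<gamma>'])
  have inv2: "R \<in> X \<Longrightarrow> \<gamma>'' (\<gamma>' R) = R" for R by (rule inv[OF g'(1) g'' \<gamma>' \<gamma>''])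
  have in1: "R \<in> X \<Longrightarrow> \<gamma> R \<in> X" "R \<in> X \<Longrightarrow> \<gamma>' R \<in> X" for R
    using \<gamma>(1) \<gamma>'(1) by (auto simp: morphism_def)
  have inv3: "\<gamma> (\<gamma>' R) = R" if "R \<in> X" for R
    using inv1[of "\<gamma>' R"] inv2[of "\<gamma> (\<gamma>' R)"] inv2[of R] in1 that by metis
  define \<gamma>r where "\<gamma>r = restrict \<gamma> X"
  have bij: "bij_betw \<gamma>r X X"
    by (rule bij_betw_byWitness[of _ \<gamma>']) (use inv1 inv3 in1 in \<open>auto simp: \<gamma>r_def\<close>)
  have invr: "inv_into X \<gamma>r R = \<gamma>' R" if "R \<in> X" for R
  proof -
    have "\<gamma>r (\<gamma>' R) = R" using inv3 in1 that by (simp add: \<gamma>r_def)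
    then show ?thesis using bij in1(2)[OF that] by (metis bij_betw_inv_into_left)
  qed
  have "morphism X X \<gamma>r" by (rule morphism_cong[OF \<gamma>(1)]) (simp add: \<gamma>r_def)
  moreover have "morphism X X (inv_into X \<gamma>r)" by (rule morphism_cong[OF \<gamma>'(1)]) (simp add: invr)
  moreover have "\<gamma>r \<in> extensional X" by (simp add: \<gamma>r_def)
  ultimately have "\<gamma>r \<in> curve_aut X" using bij by (simp add: curve_aut_def Bij_def)
  moreover have ev: "\<forall>\<^sub>F R in genf X. h (\<phi> (\<gamma>r R)) = act g h (\<phi> R)" if h: "ratf C h" for h
  proof -
    have "\<forall>\<^sub>F y in genf C. h (\<phi> (psi y)) = h y" using phi_psi by eventually_elim simp
    from germ_hom_cong[OF C_irr C_irr germ_hom_act[OF \<Gamma>_galois[OF g]] psi_ratf[OF phi_ratf[OF h]] this]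
    have "\<forall>\<^sub>F y in genf C. act g (\<lambda>y. h (\<phi> (psi y))) y = act g h y" .
    from phi_gen[OF this] \<gamma>(3)[OF phi_ratf[OF h]] eventually_genf_in[OF X_irr]
    show ?thesis by eventually_elim (simp add: \<gamma>r_def pull_act_def)
  qed
  ultimately have "\<gamma>r \<in> G" using mem_G_iff g by blast
  then show ?thesis using ev unfolding rep_map_def by blast
qed

lemma aut_eqI:
  assumes "\<gamma> \<in> curve_aut X" "\<gamma>' \<in> curve_aut X"
    and "\<And>u. ratf X u \<Longrightarrow> \<forall>\<^sub>F R in genf X. u (\<gamma> R) = u (\<gamma>' R)"
  shows "\<gamma> = \<gamma>'"
proof (rule extensionalityI)
  show "\<gamma> \<in> extensional X" "\<gamma>' \<in> extensional X" using assms(1,2) by (auto simp: curve_aut_def Bij_def)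
  fix R assume "R \<in> X"
  then show "\<gamma> R = \<gamma>' R"
    using morphism_eq_of_pullback[OF X_irr X_irr aut_morphism aut_filterlim(1) aut_morphism aut_filterlim(1)]
      X_irr assms by blast
qed

lemma rep_map_unique: "rep_map g \<gamma> \<Longrightarrow> rep_map g \<gamma>' \<Longrightarrow> \<gamma> = \<gamma>'"
proof (rule aut_eqI)
  assume *: "rep_map g \<gamma>" "rep_map g \<gamma>'"
  then show "\<gamma> \<in> curve_aut X" "\<gamma>' \<in> curve_aut X" using G_aut by (auto simp: rep_map_def)
  fix u assume "ratf X u"
  from rep_map_X[OF *(1) this] rep_map_X[OF *(2) this]
  show "\<forall>\<^sub>F R in genf X. u (\<gamma> R) = u (\<gamma>' R)" by eventually_elim simp
qed

definition lift where "lift g = (THE \<gamma>. rep_map g \<gamma>)"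

lemma lift: "g \<in> \<Gamma> \<Longrightarrow> rep_map g (lift g)"
  unfolding lift_def using lift_exists rep_map_unique by (metis theI)

lemma lift_bij: "bij_betw lift \<Gamma> G"
  unfolding bij_betw_def
proof
  show "inj_on lift \<Gamma>"
  proof (rule inj_onI)
    fix g g' assume g: "g \<in> \<Gamma>" "g' \<in> \<Gamma>" "lift g = lift g'"
    have "\<forall>\<^sub>F R in genf X. act g y (\<phi> R) = act g' y (\<phi> R)"
      using lift[OF g(1), unfolded rep_map_def, THEN conjunct2, rule_format, OF ratf_y]
        lift[OF g(2), unfolded rep_map_def, THEN conjunct2, rule_format, OF ratf_y] g(3)
      by (auto elim: eventually_elim2)
    from psi_gen[OF this] phi_psi have "\<forall>\<^sub>F Q in genf C. act g y Q = act g' y Q" by eventually_elim simp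
    then show "g = g'" by (rule \<Gamma>_eqI[OF g(1,2)])
  qed
  show "lift ` \<Gamma> = G"
  proof
    show "lift ` \<Gamma> \<subseteq> G" using lift by (auto simp: rep_map_def)
    show "G \<subseteq> lift ` \<Gamma>"
    proof
      fix \<gamma> assume \<gamma>: "\<gamma> \<in> G"
      then obtain g where g: "g \<in> \<Gamma>" "rep_map g \<gamma>" using mem_G_iff unfolding rep_map_def by blast
      then show "\<gamma> \<in> lift ` \<Gamma>" using rep_map_unique lift by blast
    qed
  qed
qed

lemma finite_G: "finite G"
  using finite_\<Gamma> lift_bij bij_betw_finite by blast

lemma card_G: "card G = d - 1"
  using bij_betw_same_card[OF lift_bij] f_factorization(1) smooth_frameI(2)[OF frame_axioms P2_smooth] by simp

lemma prod_G:
  assumes "ratf X u"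
  shows "\<forall>\<^sub>F R in genf X. \<forall>b. (\<Prod>g\<in>\<Gamma>. b - act g (\<lambda>y. u (psi y)) (\<phi> R)) = (\<Prod>\<tau>\<in>G. b - u (\<tau> R))"
proof -
  have "\<forall>\<^sub>F R in genf X. \<forall>g\<in>\<Gamma>. u (lift g R) = act g (\<lambda>y. u (psi y)) (\<phi> R)"
    by (intro eventually_ball_finite finite_\<Gamma> ballI rep_map_X lift assms)
  then show ?thesis
  proof eventually_elim
    case (elim R)
    have "(\<Prod>\<tau>\<in>G. b - u (\<tau> R)) = (\<Prod>g\<in>\<Gamma>. b - u (lift g R))" for b
      by (rule prod.reindex_bij_betw[OF lift_bij, symmetric])
    then show ?case using elim by simp
  qed
qed

abbreviation "xx R \<equiv> x (\<phi> R)"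
abbreviation "yy R \<equiv> y (\<phi> R)"

theorem char_poly_X:
  assumes "ratf X u"
  obtains P where "P \<noteq> 0"
    "\<forall>\<^sub>F R in genf X. poly (lead_coeff P) (xx R) \<noteq> 0 \<and>
      (\<forall>b. ev P (xx R) b = poly (lead_coeff P) (xx R) * (\<Prod>\<tau>\<in>G. b - u (\<tau> R)))"
proof -
  obtain P where P: "P \<noteq> 0" "degree P = card \<Gamma>"
    "\<forall>\<^sub>F Q in genf C. poly (lead_coeff P) (x Q) \<noteq> 0 \<and>
      (\<forall>b. ev P (x Q) b = poly (lead_coeff P) (x Q) * (\<Prod>g\<in>\<Gamma>. b - act g (\<lambda>y. u (psi y)) Q))"
    by (rule char_poly[OF psi_ratf[OF assms]]) (rule that)
  show ?thesis
    by (rule that[OF P(1)]) (use phi_gen[OF P(3)] prod_G[OF assms] in eventually_elim, simp)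
qed

theorem f_factor_X:
  "\<forall>\<^sub>F R in genf X. \<forall>b. ev f (xx R) b = poly (lead_coeff f) (xx R) * (\<Prod>\<tau>\<in>G. b - yy (\<tau> R))"
proof -
  have "\<forall>\<^sub>F R in genf X. \<forall>g\<in>\<Gamma>. yy (lift g R) = act g y (\<phi> R)"
    using lift ratf_y unfolding rep_map_def by (intro eventually_ball_finite finite_\<Gamma>) blast
  with phi_gen[OF f_factorization(2)] show ?thesis
  proof eventually_elim
    case (elim R)
    have "(\<Prod>\<tau>\<in>G. b - yy (\<tau> R)) = (\<Prod>g\<in>\<Gamma>. b - yy (lift g R))" for b
      by (rule prod.reindex_bij_betw[OF lift_bij, symmetric])
    also have "\<dots> b = (\<Prod>g\<in>\<Gamma>. b - act g y (\<phi> R))" for b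
      using elim(2) by (intro prod.cong) auto
    finally show ?case using elim(1) by (simp del: ev_bp)
  qed
qed

section \<open>Invariance of x, group operations and orbit counts\<close>

lemma G_xx: "\<tau> \<in> G \<Longrightarrow> \<forall>\<^sub>F R in genf X. xx (\<tau> R) = xx R"
proof -
  assume "\<tau> \<in> G"
  then obtain g where g: "g \<in> \<Gamma>" "\<forall>\<^sub>F R in genf X. x (\<phi> (\<tau> R)) = act g x (\<phi> R)"
    using mem_G_iff ratf_x by blast
  from g(2) phi_gen[OF act_x[OF \<Gamma>_galois[OF g(1)]]] show ?thesis by eventually_elim simp
qed

text \<open>Pullback reverses composition, so the corresponding field automorphisms are composed in
  the opposite order.\<close>

lemma G_compose: "\<sigma> \<in> G \<Longrightarrow> \<tau> \<in> G \<Longrightarrow> compose X \<sigma> \<tau> \<in> G"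
proof -
  assume st: "\<sigma> \<in> G" "\<tau> \<in> G"
  obtain g where g: "g \<in> \<Gamma>" "\<And>h. ratf C h \<Longrightarrow> \<forall>\<^sub>F R in genf X. h (\<phi> (\<sigma> R)) = act g h (\<phi> R)"
    using st(1) mem_G_iff by blast
  obtain g' where g': "g' \<in> \<Gamma>" "\<And>h. ratf C h \<Longrightarrow> \<forall>\<^sub>F R in genf X. h (\<phi> (\<tau> R)) = act g' h (\<phi> R)"
    using st(2) mem_G_iff by blast
  have "\<forall>\<^sub>F R in genf X. h (\<phi> (compose X \<sigma> \<tau> R)) = act (compose (carrier L) g' g) h (\<phi> R)" if h: "ratf C h" for h
    using aut_gen[OF X_irr G_aut[OF st(2)] g(2)[OF h]] g'(2)[OF act_class(2)[OF \<Gamma>_galois[OF g(1)] h]]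
      phi_gen[OF act_compose(2)[OF g'(1) g(1) h]] eventually_genf_in[OF X_irr]
    by eventually_elim (simp add: compose_def)
  then show ?thesis
    using mem_G_iff compose_aut[OF G_aut[OF st(1)] G_aut[OF st(2)]] act_compose(1)[OF g'(1) g(1)] by blast
qed

lemma id_G: "restrict (\<lambda>R. R) X \<in> G"
proof -
  have "\<forall>\<^sub>F R in genf X. h (\<phi> (restrict (\<lambda>R. R) X R)) = act idG h (\<phi> R)" if h: "ratf C h" for h
    using phi_gen[OF idG(2)[OF h]] eventually_genf_in[OF X_irr] by eventually_elim simp
  then show ?thesis using mem_G_iff id_aut idG(1) by blast
qed

lemma compose_inj: "\<sigma> \<in> curve_aut X \<Longrightarrow> inj_on (compose X \<sigma>) G"
proof (rule inj_onI)
  fix \<tau> \<tau>' assume *: "\<sigma> \<in> curve_aut X" "\<tau> \<in> G" "\<tau>' \<in> G" "compose X \<sigma> \<tau> = compose X \<sigma> \<tau>'"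
  show "\<tau> = \<tau>'"
  proof (rule extensionalityI)
    show "\<tau> \<in> extensional X" "\<tau>' \<in> extensional X"
      using G_aut[OF *(2)] G_aut[OF *(3)] by (auto simp: curve_aut_def Bij_def)
    fix R assume R: "R \<in> X"
    have "\<sigma> (\<tau> R) = \<sigma> (\<tau>' R)" using fun_cong[OF *(4), of R] R by (simp add: compose_def)
    then show "\<tau> R = \<tau>' R"
      using aut_inj[OF X_irr *(1) aut_in[OF X_irr G_aut[OF *(2)] R] aut_in[OF X_irr G_aut[OF *(3)] R]] by simp
  qed
qed

lemma compose_G_bij: "\<sigma> \<in> G \<Longrightarrow> bij_betw (compose X \<sigma>) G G"
  using compose_inj[OF G_aut] endo_inj_surj[OF finite_G _ compose_inj[OF G_aut]] G_compose
  by (auto simp: bij_betw_def image_subset_iff)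

lemma G_inverse:
  assumes "\<sigma> \<in> G"
  obtains \<tau> where "\<tau> \<in> G" "\<And>R. R \<in> X \<Longrightarrow> \<sigma> (\<tau> R) = R" "\<And>R. R \<in> X \<Longrightarrow> \<tau> (\<sigma> R) = R"
proof -
  have "restrict (\<lambda>R. R) X \<in> compose X \<sigma> ` G"
    using compose_G_bij[OF assms] id_G by (simp add: bij_betw_def)
  then obtain \<tau> where \<tau>: "\<tau> \<in> G" "restrict (\<lambda>R. R) X = compose X \<sigma> \<tau>" by blast
  have r: "\<sigma> (\<tau> R) = R" if "R \<in> X" for R using fun_cong[OF \<tau>(2), of R] that by (simp add: compose_def)
  have "\<tau> (\<sigma> R) = R" if "R \<in> X" for R
    using r[of "\<sigma> R"] aut_in[OF X_irr G_aut[OF assms]] aut_in[OF X_irr G_aut[OF \<tau>(1)]]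
      aut_inj[OF X_irr G_aut[OF assms]] that by metis
  then show ?thesis using that \<tau>(1) r by blast
qed

text \<open>A nonempty transporter is a coset of the stabilizer: composition with \<sigma> and with
  its inverse embeds each set into the other.\<close>

lemma card_transporter:
  assumes Q: "Q \<in> X" "Q' \<in> X" and \<sigma>: "\<sigma> \<in> G" "\<sigma> Q = Q'"
  shows "card {\<tau> \<in> G. \<tau> Q = Q'} = card {\<tau> \<in> G. \<tau> Q = Q}"
proof -
  obtain \<sigma>' where s: "\<sigma>' \<in> G" "\<And>R. R \<in> X \<Longrightarrow> \<sigma> (\<sigma>' R) = R" "\<And>R. R \<in> X \<Longrightarrow> \<sigma>' (\<sigma> R) = R"
    by (rule G_inverse[OF \<sigma>(1)]) (rule that)
  have fwd: "compose X \<sigma> ` {\<tau> \<in> G. \<tau> Q = Q} \<subseteq> {\<tau> \<in> G. \<tau> Q = Q'}"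
    using G_compose[OF \<sigma>(1)] Q \<sigma>(2) by (auto simp: compose_def)
  have bwd: "compose X \<sigma>' ` {\<tau> \<in> G. \<tau> Q = Q'} \<subseteq> {\<tau> \<in> G. \<tau> Q = Q}"
    using G_compose[OF s(1)] Q \<sigma>(2) s(3)[of Q] by (auto simp: compose_def)
  show ?thesis
  proof (rule antisym)
    show "card {\<tau> \<in> G. \<tau> Q = Q'} \<le> card {\<tau> \<in> G. \<tau> Q = Q}"
      by (rule card_inj_on_le[OF inj_on_subset[OF compose_inj[OF G_aut[OF s(1)]]] bwd]) (use finite_G in auto)
    show "card {\<tau> \<in> G. \<tau> Q = Q} \<le> card {\<tau> \<in> G. \<tau> Q = Q'}"
      by (rule card_inj_on_le[OF inj_on_subset[OF compose_inj[OF G_aut[OF \<sigma>(1)]]] fwd]) (use finite_G in auto)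
  qed
qed

text \<open>Inversion in the group exchanges the two sets. It is needed because divisors count
  images of a fixed point, whereas orders of functions count who is sent to that point.\<close>

lemma card_transporter_swap:
  assumes Q: "Q \<in> X" "Q' \<in> X"
  shows "card {\<tau> \<in> G. \<tau> Q = Q'} = card {\<tau> \<in> G. \<tau> Q' = Q}"
proof -
  have le: "card {\<tau> \<in> G. \<tau> Q = Q'} \<le> card {\<tau> \<in> G. \<tau> Q' = Q}" if Q: "Q \<in> X" "Q' \<in> X" for Q Q'
  proof (rule card_inj_on_le)
    define iv where "iv \<tau> = (SOME \<tau>'. \<tau>' \<in> G \<and> (\<forall>R\<in>X. \<tau> (\<tau>' R) = R) \<and> (\<forall>R\<in>X. \<tau>' (\<tau> R) = R))" for \<tau>
    have iv: "iv \<tau> \<in> G \<and> (\<forall>R\<in>X. \<tau> (iv \<tau> R) = R) \<and> (\<forall>R\<in>X. iv \<tau> (\<tau> R) = R)" if "\<tau> \<in> G" for \<tau>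
    proof -
      obtain \<tau>' where "\<tau>' \<in> G" "\<And>R. R \<in> X \<Longrightarrow> \<tau> (\<tau>' R) = R" "\<And>R. R \<in> X \<Longrightarrow> \<tau>' (\<tau> R) = R"
        by (rule G_inverse[OF \<open>\<tau> \<in> G\<close>]) (rule that)
      then have "\<exists>\<tau>'. \<tau>' \<in> G \<and> (\<forall>R\<in>X. \<tau> (\<tau>' R) = R) \<and> (\<forall>R\<in>X. \<tau>' (\<tau> R) = R)" by blast
      then show ?thesis unfolding iv_def by (rule someI_ex)
    qed
    show "inj_on iv {\<tau> \<in> G. \<tau> Q = Q'}"
    proof (rule inj_onI)
      fix a b assume ab: "a \<in> {\<tau> \<in> G. \<tau> Q = Q'}" "b \<in> {\<tau> \<in> G. \<tau> Q = Q'}" "iv a = iv b"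
      show "a = b"
      proof (rule extensionalityI)
        show "a \<in> extensional X" "b \<in> extensional X"
          using G_aut ab(1,2) by (auto simp: curve_aut_def Bij_def)
        fix R assume R: "R \<in> X"
        have aR: "a R \<in> X" using aut_in[OF X_irr G_aut R] ab(1) by simp
        have "b (iv b (a R)) = a R" using iv[of b] ab(2) aR by simp
        moreover have "iv b (a R) = R" using iv[of a] ab(1) R unfolding ab(3)[symmetric] by simp
        ultimately show "a R = b R" by simp
      qed
    qed
    show "iv ` {\<tau> \<in> G. \<tau> Q = Q'} \<subseteq> {\<tau> \<in> G. \<tau> Q' = Q}" using iv Q by fastforce
  qed (use finite_G in simp)
  show ?thesis using le[OF Q] le[OF Q(2,1)] by simp
qed

end

subsection \<open>The line through the two Galois points\<close>

context framed_curve
begin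

text \<open>The line at infinity is not contained in the curve. Otherwise the total degree of f
  would drop below d and \<open>l3\<close> would split off from the irreducible F.\<close>

lemma lp_line_nonzero: "lp F e1 e2 \<noteq> 0"
proof -
  have "f \<noteq> 0" using deg_pos by auto
  then obtain n H p where H: "is_form n H" "p \<noteq> 0"
    "\<And>v. dotp l3 v \<noteq> 0 \<Longrightarrow> peval H v = dotp l3 v ^ n * ev f (dotp l1 v / dotp l3 v) (dotp l2 v / dotp l3 v)"
    "\<And>b. peval H (e1 + b *s e2) = poly p b"
    by (rule homogenization) (rule that)
  have Ff: "peval F v = dotp l3 v ^ d * ev f (dotp l1 v / dotp l3 v) (dotp l2 v / dotp l3 v)" if "dotp l3 v \<noteq> 0" for v
    by (rule peval_affine[OF F_form that])
  \<comment> \<open>If f had total degree below d, F would be a positive power of \<open>l3\<close>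
    times the homogenization of f. Neither factor is a unit: the power vanishes at
    \<open>e1\<close>, and f has positive degree.\<close>
  have "d \<le> n"
  proof (rule ccontr)
    assume "\<not> d \<le> n"
    then have n: "n < d" by simp
    have "F = lin l3 ^ (d - n) * H"
    proof (rule mpoly_eqI, rule peval_eq_off_hyperplane[OF l3_nonzero])
      fix v assume v: "dotp l3 v \<noteq> 0"
      have "dotp l3 v ^ d = dotp l3 v ^ (d - n) * dotp l3 v ^ n" using n by (simp flip: power_add)
      then show "peval F v = peval (lin l3 ^ (d - n) * H) v" by (simp add: Ff[OF v] H(3)[OF v] del: ev_bp)
    qed
    then have "lin l3 ^ (d - n) dvd 1 \<or> H dvd 1" using F_irr by (auto simp: irreducible_def)
    then show False
    proof
      assume "lin l3 ^ (d - n) dvd 1"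
      then obtain c where c: "c \<noteq> 0" "\<And>v. peval (lin l3 ^ (d - n)) v = c" by (rule peval_unit_const) (rule that)
      then show False using c(2)[of e1] n by (simp add: power_0_left)
    next
      assume "H dvd 1"
      then obtain c where c: "c \<noteq> 0" "\<And>v. peval H v = c" by (rule peval_unit_const) (rule that)
      have "f = [:[:c:]:]"
      proof (rule ev_eqI)
        fix a b
        show "ev f a b = ev [:[:c:]:] a b"
          using c(2)[of "a *s e1 + b *s e2 + e3"] H(3)[of "a *s e1 + b *s e2 + e3"] by simp
      qed
      then show False using deg_pos by simp
    qed
  qed
  have eq: "peval (lin l3 ^ (n - d) * F) v = peval H v" for v
  proof (rule peval_eq_off_hyperplane[OF l3_nonzero])
    fix v assume v: "dotp l3 v \<noteq> 0"
    have "dotp l3 v ^ n = dotp l3 v ^ (n - d) * dotp l3 v ^ d" using \<open>d \<le> n\<close> by (simp flip: power_add)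
    then show "peval (lin l3 ^ (n - d) * F) v = peval H v" by (simp add: Ff[OF v] H(3)[OF v] del: ev_bp)
  qed
  show ?thesis
  proof
    assume 0: "lp F e1 e2 = 0"
    have "poly p b = 0" for b
      using eq[of "e1 + b *s e2"] H(4)[of b] arg_cong[OF 0, of "\<lambda>q. poly q b"] by simp
    then have "p = 0" by (intro poly_eqI_infinite) simp
    then show False using H(2) by simp
  qed
qed

end

lemma degree_lp_le:
  fixes F :: "('a::alg_closed_field, 'n::finite) mpoly"
  assumes "is_form d F"
  shows "degree (lp F a v) \<le> d"
proof -
  have "lp F a v = sp (bp F 0 v a) 0" by (rule lp_eqI) (simp add: add.commute)
  then show ?thesis using degree_sp_le[of "bp F 0 v a" 0] degree_bp_le[OF assms, of 0 v a] by simp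
qed

lemma order_prod_linear:
  fixes c :: "'i \<Rightarrow> 'a::field"
  assumes "finite A"
  shows "Polynomial.order z (\<Prod>i\<in>A. [:- c i, 1:]) = card {i \<in> A. c i = z}" "degree (\<Prod>i\<in>A. [:- c i, 1:]) = card A"
proof -
  have o1: "Polynomial.order z [:- w, 1:] = (if w = z then 1 else 0)" for w :: 'a
    using order_power_n_n[of z 1] by (auto simp: order_0I)
  show "Polynomial.order z (\<Prod>i\<in>A. [:- c i, 1:]) = card {i \<in> A. c i = z}"
    using assms
  proof (induction A rule: finite_induct)
    case empty
    then show ?case by (simp add: order_0I)
  next
    case (insert i A)
    have "(\<Prod>i\<in>insert i A. [:- c i, 1:]) \<noteq> 0" using insert(1) by simp
    then have "Polynomial.order z (\<Prod>i\<in>insert i A. [:- c i, 1:]) = (if c i = z then 1 else 0) + card {i \<in> A. c i = z}"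
      using insert by (simp add: order_mult o1 del: mult_pCons_left mult_pCons_right)
    moreover have "{j \<in> insert i A. c j = z} = (if c i = z then insert i {j \<in> A. c j = z} else {j \<in> A. c j = z})" by auto
    ultimately show ?case using insert(1,2) by simp
  qed
  show "degree (\<Prod>i\<in>A. [:- c i, 1:]) = card A"
    using assms by (subst degree_prod_eq_sum_degree) auto
qed

text \<open>The two parametrizations of a line by its points \<open>a\<close> and \<open>b\<close> are related by reversal.\<close>

lemma lp_reverse:
  fixes F :: "('a::alg_closed_field, 'n::finite) mpoly"
  assumes F: "is_form d F" and nz: "lp F a b \<noteq> 0"
  shows "Polynomial.order 0 (lp F b a) = d - degree (lp F a b)"
proof -
  let ?p = "lp F a b"
  have eq: "lp F b a = Polynomial.monom 1 (d - degree ?p) * reflect_poly ?p"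
  proof (rule poly_eqI_cofinite[of "{0}"])
    fix t :: 'a assume "t \<notin> {0}"
    then have t: "t \<noteq> 0" by simp
    have "b + t *s a = t *s (a + (1 / t) *s b)" using t by (simp add: vector_smult_assoc)
    then have "poly (lp F b a) t = t ^ d * poly ?p (1 / t)"
      unfolding poly_lp by (simp only: peval_scale[OF F])
    also have "t ^ d = t ^ (d - degree ?p) * t ^ degree ?p"
      using degree_lp_le[OF F, of a b] by (simp flip: power_add)
    finally show "poly (lp F b a) t = poly (Polynomial.monom 1 (d - degree ?p) * reflect_poly ?p) t"
      using poly_reflect_poly_nz[OF t, of ?p] by (simp add: poly_monom inverse_eq_divide del: poly_lp)
  qed simp
  have "poly (reflect_poly ?p) 0 \<noteq> 0" using nz by simp
  then have "Polynomial.order 0 (reflect_poly ?p) = 0" by (rule order_0I)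
  moreover have "Polynomial.order 0 (Polynomial.monom (1::'a) k) = k" for k
    using order_power_n_n[of "0::'a" k] by (simp add: monom_altdef)
  moreover have "reflect_poly ?p \<noteq> 0" using nz by simp
  ultimately show ?thesis unfolding eq by (subst order_mult) auto
qed

context plane_model
begin

abbreviation "hc R \<equiv> rep_proj (\<phi> R)"

lemma locv_lin:
  "Q \<in> X \<Longrightarrow> dotp m (hc Q) \<noteq> 0 \<Longrightarrow> locv X Q (\<lambda>R. dotp l (hc R) / dotp m (hc R)) (dotp l (hc Q) / dotp m (hc Q))"
  by (rule phi_locv[OF _ locv_linear_quotient[OF C_irr]]) auto

lemma gen_lin: "Q \<in> X \<Longrightarrow> dotp m (hc Q) \<noteq> 0 \<Longrightarrow> \<forall>\<^sub>F R in genf X. dotp m (hc R) \<noteq> 0"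
  using phi_gen[OF eventually_genf_form_nonzero[OF C_irr is_form_lin(1)], of "\<phi> Q" m] by (simp add: form_at_lin)

end

lemma unif_cong:
  assumes "irreducible_set (X :: ('a::alg_closed_field, 'n::finite) proj set)" "unif X Q t" "\<forall>\<^sub>F R in genf X. s R = t R"
  shows "unif X Q s"
  by (rule unif_unit_mult[OF assms(1,2) locv_const[OF assms(1), of Q 1]])
    (use assms locv_in in \<open>auto simp: unif_def\<close>)

context galois_pair
begin

text \<open>The frame is symmetric in the two Galois points, so everything proved about the
  projection from \<open>P2\<close> holds for the projection from \<open>P1\<close>, with x and y
  exchanged.\<close>

lemma swap: "galois_pair X \<phi> d F e2 e1 e3 l2 l1 l3 P2 P1"
proof -
  have "frame e2 e1 e3 l2 l1 l3"
    using expand by unfold_locales (simp_all add: add_ac)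
  then show ?thesis
    using plane_model_axioms P1 P2 by (simp add: galois_pair_def galois_pair_axioms_def)
qed

lemma hc_P1: "dotp l1 (hc P1) \<noteq> 0" "dotp l2 (hc P1) = 0" "dotp l3 (hc P1) = 0"
proof -
  obtain c where "c \<noteq> 0" "rep_proj (abs_proj e1) = c *s e1" using rep_abs_proj[OF e_nonzero(1)] .
  then show "dotp l1 (hc P1) \<noteq> 0" "dotp l2 (hc P1) = 0" "dotp l3 (hc P1) = 0" by (simp_all add: P1(2))
qed

lemma hc_P2: "dotp l1 (hc P2) = 0" "dotp l2 (hc P2) \<noteq> 0" "dotp l3 (hc P2) = 0"
proof -
  obtain c where "c \<noteq> 0" "rep_proj (abs_proj e2) = c *s e2" using rep_abs_proj[OF e_nonzero(2)] .
  then show "dotp l1 (hc P2) = 0" "dotp l2 (hc P2) \<noteq> 0" "dotp l3 (hc P2) = 0" by (simp_all add: P2(2))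
qed

text \<open>The conditions say that \<phi>(R) is the point \<open>e2\<close>; as its local ring is a
  valuation ring, \<open>P2\<close> is the only point above it.\<close>

lemma eq_P2:
  assumes "R \<in> X" "dotp l1 (hc R) = 0" "dotp l3 (hc R) = 0"
  shows "R = P2"
proof -
  have eq: "hc R = dotp l2 (hc R) *s e2" by (subst expand) (simp add: assms)
  then have "dotp l2 (hc R) \<noteq> 0" using rep_proj_nonzero[of "\<phi> R"] by (metis vector_smult_lzero)
  then have "abs_proj (hc R) = abs_proj e2" by (subst eq) (simp add: abs_proj_scale e_nonzero)
  then have "\<phi> R = \<phi> P2" by (simp add: abs_rep_proj P2(2))
  then show ?thesis using fibre_unique[OF valring_P(2) P2(1) assms(1)] by simp
qed

lemma eq_P1: "R \<in> X \<Longrightarrow> dotp l2 (hc R) = 0 \<Longrightarrow> dotp l3 (hc R) = 0 \<Longrightarrow> R = P1"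
  by (rule galois_pair.eq_P2[OF swap])

lemma gen_l: "\<forall>\<^sub>F R in genf X. dotp l1 (hc R) \<noteq> 0" "\<forall>\<^sub>F R in genf X. dotp l2 (hc R) \<noteq> 0"
  "\<forall>\<^sub>F R in genf X. dotp l3 (hc R) \<noteq> 0"
  using gen_lin[OF P1(1) hc_P1(1)] gen_lin[OF P2(1) hc_P2(2)] phi_gen[OF gen_affine] by auto

section \<open>Poles of x and the orbits of \<open>G\<close>\<close>

lemma gen_xx: "\<forall>\<^sub>F R in genf X. xx R \<noteq> 0"
  using gen_l(1,3) by eventually_elim (simp add: x_def)

lemma inv_xx: "1 / xx R = dotp l3 (hc R) / dotp l1 (hc R)"
  by (simp add: x_def)

lemma pole_l3:
  assumes "locv X Q (\<lambda>R. 1 / xx R) 0"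
  shows "dotp l3 (hc Q) = 0"
proof (rule ccontr)
  assume nz: "dotp l3 (hc Q) \<noteq> 0"
  have Q: "Q \<in> X" using assms by (rule locv_in)
  have "\<forall>\<^sub>F R in genf X. dotp l1 (hc R) / dotp l3 (hc R) * (1 / xx R) = 1"
    using gen_xx by eventually_elim (simp add: x_def)
  from locv_cong[OF locv_mult[OF X_irr locv_lin[OF Q nz, of l1] assms] this] locv_const[OF X_irr Q, of 1]
  show False using locv_unique[OF X_irr] by fastforce
qed

lemma l3_pole: "Q \<in> X \<Longrightarrow> Q \<noteq> P2 \<Longrightarrow> dotp l3 (hc Q) = 0 \<Longrightarrow> locv X Q (\<lambda>R. 1 / xx R) 0"
  using locv_lin[of Q l1 l3] eq_P2[of Q] by (auto simp: inv_xx)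

lemma finite_l3:
  assumes "locv X Q xx c" "Q \<noteq> P2"
  shows "dotp l3 (hc Q) \<noteq> 0"
proof
  assume 0: "dotp l3 (hc Q) = 0"
  have Q: "Q \<in> X" using assms(1) by (rule locv_in)
  have "\<forall>\<^sub>F R in genf X. xx R * (1 / xx R) = 1" using gen_xx by eventually_elim simp
  from locv_cong[OF locv_mult[OF X_irr assms(1) l3_pole[OF Q assms(2) 0]] this] locv_const[OF X_irr Q, of 1]
  show False using locv_unique[OF X_irr] by fastforce
qed

text \<open>The elements of \<open>G\<close> preserve x, so a function of x has the same value along
  an orbit. Taking k as a parameter covers x itself, its inverse and similar expressions.\<close>

lemma locv_invariant:
  assumes \<tau>: "\<tau> \<in> G" and u: "locv X Q (\<lambda>R. k (xx R)) a"
  shows "locv X (\<tau> Q) (\<lambda>R. k (xx R)) a"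
proof -
  have Q: "Q \<in> X" using u by (rule locv_in)
  obtain \<tau>' where t: "\<tau>' \<in> G" "\<And>R. R \<in> X \<Longrightarrow> \<tau>' (\<tau> R) = R" by (rule G_inverse[OF \<tau>]) (rule that)
  have "locv X (\<tau>' (\<tau> Q)) (\<lambda>R. k (xx R)) a" using u t(2)[OF Q] by simp
  from aut_locv[OF X_irr G_aut[OF t(1)] aut_in[OF X_irr G_aut[OF \<tau>] Q] this]
  have *: "locv X (\<tau> Q) (\<lambda>R. k (xx (\<tau>' R))) a" .
  have "\<forall>\<^sub>F R in genf X. k (xx (\<tau>' R)) = k (xx R)" using G_xx[OF t(1)] by eventually_elim simp
  from locv_cong[OF * this] show ?thesis .
qed

lemma unif_invariant:
  assumes \<tau>: "\<tau> \<in> G" and Q: "Q \<in> X" and u: "unif X Q (\<lambda>R. k (xx R))"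
  shows "unif X (\<tau> Q) (\<lambda>R. k (xx R))"
proof -
  obtain \<tau>' where t: "\<tau>' \<in> G" "\<And>R. R \<in> X \<Longrightarrow> \<tau>' (\<tau> R) = R" by (rule G_inverse[OF \<tau>]) (rule that)
  have "unif X (\<tau>' (\<tau> Q)) (\<lambda>R. k (xx R))" using u t(2)[OF Q] by simp
  from aut_unif[OF X_irr G_aut[OF t(1)] aut_in[OF X_irr G_aut[OF \<tau>] Q] this]
  have *: "unif X (\<tau> Q) (\<lambda>R. k (xx (\<tau>' R)))" .
  have "\<forall>\<^sub>F R in genf X. k (xx R) = k (xx (\<tau>' R))" using G_xx[OF t(1)] by eventually_elim simp
  from unif_cong[OF X_irr * this] show ?thesis .
qed

abbreviation "ww R \<equiv> dotp l2 (hc R) / dotp l1 (hc R)"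

text \<open>The factorization of f(x, b x), divided by x^d, is evaluated at a pole Q of x: it
  becomes a factorization of F on the line at infinity, whose roots are the slopes y/x along the
  orbit of Q. Orbit elements hitting \<open>P2\<close> have infinite slope and lower the degree
  instead.\<close>

lemma line_factorization:
  assumes Q: "locv X Q (\<lambda>R. 1 / xx R) 0"
  obtains \<kappa> where "\<kappa> \<noteq> 0" "lp F e1 e2 = Polynomial.smult \<kappa> (\<Prod>\<tau>\<in>{\<tau> \<in> G. \<tau> Q \<noteq> P2}. [:- ww (\<tau> Q), 1:])"
proof -
  have QX: "Q \<in> X" using Q by (rule locv_in)
  define A where "A = {\<tau> \<in> G. \<tau> Q \<noteq> P2}"
  define B where "B = {\<tau> \<in> G. \<tau> Q = P2}"
  have fin: "finite A" "finite B" and AB: "G = A \<union> B" "A \<inter> B = {}"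
    using finite_G by (auto simp: A_def B_def)
  \<comment> \<open>For \<tau> with \<tau>(Q) = \<open>P2\<close> the slope has a pole, so it is
    factored out and b/w - 1, with value -1 at Q, is kept instead.\<close>
  define D where "D b R = (\<Prod>\<tau>\<in>A. b - ww (\<tau> R)) * (\<Prod>\<tau>\<in>B. b * (1 / ww (\<tau> R)) - 1)" for b R
  define E where "E b R = peval F (\<chi> i. e1 $ i + b * e2 $ i + 1 / xx R * e3 $ i)" for b R
  have E: "locv X Q (E b) (peval F (e1 + b *s e2))" for b
  proof -
    have "locv X Q (\<lambda>R. e1 $ i + b * e2 $ i + 1 / xx R * e3 $ i) (e1 $ i + b * e2 $ i + 0 * e3 $ i)" for i
      by (intro locv_add locv_mult locv_const X_irr QX Q)
    then have "locv X Q (\<lambda>R. e1 $ i + b * e2 $ i + 1 / xx R * e3 $ i) ((e1 + b *s e2) $ i)" for i by simp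
    from locv_peval[OF X_irr this] show ?thesis by (simp add: E_def[abs_def])
  qed
  have D: "locv X Q (D b) ((\<Prod>\<tau>\<in>A. b - ww (\<tau> Q)) * (- 1) ^ card B)" for b
  proof -
    have "locv X Q (\<lambda>R. ww (\<tau> R)) (ww (\<tau> Q))" if "\<tau> \<in> A" for \<tau>
    proof -
      have t: "\<tau> \<in> G" "\<tau> Q \<noteq> P2" "\<tau> Q \<in> X" using that aut_in[OF X_irr G_aut QX] by (auto simp: A_def)
      have "dotp l3 (hc (\<tau> Q)) = 0" using pole_l3 locv_invariant[OF t(1) Q] by blast
      then have "dotp l1 (hc (\<tau> Q)) \<noteq> 0" using eq_P2[OF t(3)] t(2) by blast
      from aut_locv[OF X_irr G_aut[OF t(1)] QX locv_lin[OF t(3) this]] show ?thesis .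
    qed
    moreover have "locv X Q (\<lambda>R. 1 / ww (\<tau> R)) 0" if "\<tau> \<in> B" for \<tau>
    proof -
      have t: "\<tau> \<in> G" "\<tau> Q = P2" using that by (auto simp: B_def)
      have "locv X (\<tau> Q) (\<lambda>R. 1 / ww R) 0" using locv_lin[OF P2(1) hc_P2(2), of l1] by (simp add: t hc_P2)
      from aut_locv[OF X_irr G_aut[OF t(1)] QX this] show ?thesis .
    qed
    ultimately have "locv X Q (D b) ((\<Prod>\<tau>\<in>A. b - ww (\<tau> Q)) * (\<Prod>\<tau>\<in>B. b * 0 - 1))"
      unfolding D_def[abs_def] by (intro locv_mult locv_prod locv_diff locv_const X_irr QX)
    then show ?thesis by simp
  qed
  \<comment> \<open>The factor g collects the leading coefficient, powers of x and infinite slopes.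
    It need not have a value at Q, but it does not depend on b.\<close>
  have gen: "\<forall>\<^sub>F R in genf X. \<exists>g. \<forall>b. E b R = g * D b R"
  proof -
    have tl: "\<forall>\<^sub>F R in genf X. \<forall>\<tau>\<in>G. dotp l1 (hc (\<tau> R)) \<noteq> 0 \<and> dotp l2 (hc (\<tau> R)) \<noteq> 0 \<and> dotp l3 (hc (\<tau> R)) \<noteq> 0 \<and>
        xx (\<tau> R) = xx R"
      using aut_gen[OF X_irr G_aut gen_l(1)] aut_gen[OF X_irr G_aut gen_l(2)] aut_gen[OF X_irr G_aut gen_l(3)] G_xx
      by (intro eventually_ball_finite[OF finite_G] ballI eventually_conj) auto
    show ?thesis using f_factor_X tl gen_xx
    proof eventually_elim
      case (elim R)
      let ?x = "xx R"
      have "E b R = poly (lead_coeff f) ?x * ?x ^ card G / ?x ^ d * (\<Prod>\<tau>\<in>B. ww (\<tau> R)) * D b R" for b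
      proof -
        have "?x *s (\<chi> i. e1 $ i + b * e2 $ i + 1 / xx R * e3 $ i) = ?x *s e1 + (b * ?x) *s e2 + e3"
          using elim(3) by (simp add: vec_eq_iff algebra_simps)
        then have "?x ^ d * E b R = ev f ?x (b * ?x)"
          by (simp add: E_def peval_scale[OF F_form, symmetric])
        also have "\<dots> = poly (lead_coeff f) ?x * (\<Prod>\<tau>\<in>G. b * ?x - yy (\<tau> R))" using elim(1) by blast
        also have "(\<Prod>\<tau>\<in>G. b * ?x - yy (\<tau> R)) = (\<Prod>\<tau>\<in>G. ?x * (b - ww (\<tau> R)))"
        proof (rule prod.cong[OF refl])
          fix \<tau> assume "\<tau> \<in> G"
          then have t: "dotp l1 (hc (\<tau> R)) \<noteq> 0" "dotp l3 (hc (\<tau> R)) \<noteq> 0" "?x = xx (\<tau> R)" using elim(2) by auto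
          have "yy (\<tau> R) = xx (\<tau> R) * ww (\<tau> R)" using t(1,2) by (simp add: x_def y_def)
          then show "b * ?x - yy (\<tau> R) = ?x * (b - ww (\<tau> R))" unfolding t(3)[symmetric] by (simp add: algebra_simps)
        qed
        also have "\<dots> = ?x ^ card G * (\<Prod>\<tau>\<in>G. b - ww (\<tau> R))" by (simp add: prod.distrib)
        also have "(\<Prod>\<tau>\<in>G. b - ww (\<tau> R)) = (\<Prod>\<tau>\<in>A. b - ww (\<tau> R)) * (\<Prod>\<tau>\<in>B. b - ww (\<tau> R))"
          unfolding AB(1) by (rule prod.union_disjoint[OF fin AB(2)])
        also have "(\<Prod>\<tau>\<in>B. b - ww (\<tau> R)) = (\<Prod>\<tau>\<in>B. ww (\<tau> R) * (b * (1 / ww (\<tau> R)) - 1))"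
          using elim(2) AB(1) by (intro prod.cong refl) (auto simp: field_simps)
        finally have "?x ^ d * E b R = poly (lead_coeff f) ?x * ?x ^ card G * (\<Prod>\<tau>\<in>B. ww (\<tau> R)) * D b R"
          unfolding prod.distrib D_def by (simp only: mult_ac)
        then show ?thesis using elim(3) by (simp add: field_simps)
      qed
      then show ?case by blast
    qed
  qed
  \<comment> \<open>Comparing two values of b eliminates g, and the resulting identity between
    regular functions can be evaluated at Q.\<close>
  have key: "peval F (e1 + b *s e2) * (\<Prod>\<tau>\<in>A. b0 - ww (\<tau> Q)) = peval F (e1 + b0 *s e2) * (\<Prod>\<tau>\<in>A. b - ww (\<tau> Q))" for b b0
  proof -
    have "\<forall>\<^sub>F R in genf X. E b R * D b0 R = E b0 R * D b R"
      using gen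
    proof eventually_elim
      case (elim R)
      then obtain g where "\<And>b. E b R = g * D b R" by blast
      then show ?case by (simp only: mult_ac)
    qed
    from locv_unique[OF X_irr locv_cong[OF locv_mult[OF X_irr E D] this] locv_mult[OF X_irr E D]]
    show ?thesis by simp
  qed
  obtain b0 where b0: "b0 \<notin> (\<lambda>\<tau>. ww (\<tau> Q)) ` A" "poly (lp F e1 e2) b0 \<noteq> 0"
    by (rule poly_nonroot_avoiding[OF lp_line_nonzero finite_imageI[OF fin(1)]]) (rule that)
  define \<kappa> where "\<kappa> = poly (lp F e1 e2) b0 / (\<Prod>\<tau>\<in>A. b0 - ww (\<tau> Q))"
  have nz: "(\<Prod>\<tau>\<in>A. b0 - ww (\<tau> Q)) \<noteq> 0" using b0(1) fin by auto
  show ?thesis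
  proof (rule that)
    show "\<kappa> \<noteq> 0" using b0(2) nz by (simp add: \<kappa>_def del: poly_lp)
    show "lp F e1 e2 = Polynomial.smult \<kappa> (\<Prod>\<tau>\<in>{\<tau> \<in> G. \<tau> Q \<noteq> P2}. [:- ww (\<tau> Q), 1:])"
      unfolding A_def[symmetric]
    proof (rule lp_eqI)
      fix b
      have "peval F (e1 + b *s e2) = \<kappa> * (\<Prod>\<tau>\<in>A. b - ww (\<tau> Q))"
        using key[of b b0] nz by (simp add: \<kappa>_def field_simps)
      then show "peval F (e1 + b *s e2) = poly (Polynomial.smult \<kappa> (\<Prod>\<tau>\<in>A. [:- ww (\<tau> Q), 1:])) b"
        by (simp add: poly_prod)
    qed
  qed
qed

text \<open>Multiplicities of the line at \<open>P1\<close> and \<open>P2\<close> as orbit counts.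
  At \<open>P1\<close> they count roots of slope 0. At \<open>P2\<close> they are the degree
  deficiency d - #{\<tau>. \<tau>(Q) \<noteq> \<open>P2\<close>}; since \<open>G\<close> has d - 1
  elements, the projection centre itself adds 1.\<close>

lemma line_order:
  assumes Q: "locv X Q (\<lambda>R. 1 / xx R) 0"
  shows "Polynomial.order 0 (lp F e1 e2) = card {\<tau> \<in> G. \<tau> Q = P1}"
    and "Polynomial.order 0 (lp F e2 e1) = Suc (card {\<tau> \<in> G. \<tau> Q = P2})"
proof -
  have QX: "Q \<in> X" using Q by (rule locv_in)
  obtain \<kappa> where k: "\<kappa> \<noteq> 0" "lp F e1 e2 = Polynomial.smult \<kappa> (\<Prod>\<tau>\<in>{\<tau> \<in> G. \<tau> Q \<noteq> P2}. [:- ww (\<tau> Q), 1:])"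
    by (rule line_factorization[OF Q]) (rule that)
  have fin: "finite {\<tau> \<in> G. \<tau> Q \<noteq> P2}" using finite_G by simp
  have "{\<tau> \<in> {\<tau> \<in> G. \<tau> Q \<noteq> P2}. ww (\<tau> Q) = 0} = {\<tau> \<in> G. \<tau> Q = P1}"
  proof (intro Set.set_eqI iffI)
    fix \<tau> assume "\<tau> \<in> {\<tau> \<in> {\<tau> \<in> G. \<tau> Q \<noteq> P2}. ww (\<tau> Q) = 0}"
    then have t: "\<tau> \<in> G" "\<tau> Q \<noteq> P2" "ww (\<tau> Q) = 0" "\<tau> Q \<in> X" using aut_in[OF X_irr G_aut QX] by auto
    have l: "dotp l3 (hc (\<tau> Q)) = 0" using pole_l3 locv_invariant[OF t(1) Q] by blast
    then have "dotp l2 (hc (\<tau> Q)) = 0" using eq_P2[OF t(4)] t(2,3) by auto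
    then show "\<tau> \<in> {\<tau> \<in> G. \<tau> Q = P1}" using eq_P1[OF t(4)] l t(1) by blast
  qed (use hc_P1 phi_neq in auto)
  then show "Polynomial.order 0 (lp F e1 e2) = card {\<tau> \<in> G. \<tau> Q = P1}"
    unfolding k(2) order_smult[OF k(1)] order_prod_linear(1)[OF fin] by simp
  have "G = {\<tau> \<in> G. \<tau> Q \<noteq> P2} \<union> {\<tau> \<in> G. \<tau> Q = P2}" by blast
  then have "card G = card {\<tau> \<in> G. \<tau> Q \<noteq> P2} + card {\<tau> \<in> G. \<tau> Q = P2}"
    using finite_G by (subst card_Un_disjoint[symmetric]) auto
  moreover have "degree (lp F e1 e2) = card {\<tau> \<in> G. \<tau> Q \<noteq> P2}"
    unfolding k(2) using k(1) order_prod_linear(2)[OF fin] by simp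
  ultimately show "Polynomial.order 0 (lp F e2 e1) = Suc (card {\<tau> \<in> G. \<tau> Q = P2})"
    using lp_reverse[OF F_form lp_line_nonzero] card_G d4 by simp
qed

end

context galois_pair
begin

text \<open>The vector w is a tangent direction at \<open>e2\<close>, so a linear form through
  \<open>e2\<close> that does not kill w is not tangent and vanishes to first order; the local rings
  on X and C agree there.\<close>

lemma unif_P2:
  assumes t: "dotp t e2 = 0" and w: "dotp (grad F e2) w = 0" "dotp t w \<noteq> 0"
  shows "unif X P2 (\<lambda>R. dotp t (hc R) / dotp l2 (hc R))"
proof -
  have sm: "smooth_point C (\<phi> P2)" using P2 by (simp add: inner_galois_point_def)
  obtain b where b: "tangent_space C (\<phi> P2) = vec.span {hc P2, b}"
    "\<And>t H. dotp t (hc P2) = 0 \<Longrightarrow> dotp t b \<noteq> 0 \<Longrightarrow> dotp H (hc P2) \<noteq> 0 \<Longrightarrow>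
       unif C (\<phi> P2) (\<lambda>x. dotp t (rep_proj x) / dotp H (rep_proj x))"
    by (rule smooth_point_uniformizers[OF C_irr sm imageI[OF P1(1)] phi_neq]) (rule that)
  have t0: "dotp t (hc P2) = 0"
  proof -
    obtain c where "rep_proj (abs_proj e2) = c *s e2" using rep_abs_proj[OF e_nonzero(2)] .
    then show ?thesis by (simp add: P2(2) t)
  qed
  have "w \<in> tangent_space C (\<phi> P2)" using w(1) smooth_frameI(6)[OF frame_axioms P2_smooth] by (simp add: P2(2))
  then have "w \<in> vec.span {hc P2, b}" unfolding b(1) .
  then obtain \<alpha> \<beta> where "w - \<alpha> *s hc P2 = \<beta> *s b"
    by (auto simp: vec.span_breakdown_eq vec.span_singleton)
  then have "w = \<alpha> *s hc P2 + \<beta> *s b" by (simp add: algebra_simps)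
  then have "dotp t w = \<beta> * dotp t b" by (simp add: t0)
  then have "dotp t b \<noteq> 0" using w(2) by auto
  from unif_phi[OF valring_P(2) P2(1) b(2)[OF t0 this hc_P2(2)]] show ?thesis .
qed

lemma unif_P2_transversal:
  assumes "dotp (grad F e2) e1 \<noteq> 0"
  shows "unif X P2 (\<lambda>R. dotp l3 (hc R) / dotp l2 (hc R))"
  by (rule unif_P2[of _ "dotp (grad F e2) e3 *s e1 - dotp (grad F e2) e1 *s e3"]) (use assms in auto)

text \<open>If the line is the tangent at \<open>P2\<close>, then \<open>l1\<close> and every
  \<open>l3\<close> - a \<open>l1\<close> with a \<noteq> 0 vanish to first order. Were
  \<open>l3\<close> also of first order, the a that cancels the leading terms would raise the order
  of such a combination.\<close>

lemma not_unif_P2_tangent: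
  assumes tan: "dotp (grad F e2) e1 = 0"
  shows "\<not> unif X P2 (\<lambda>R. dotp l3 (hc R) / dotp l2 (hc R))"
proof
  assume 3: "unif X P2 (\<lambda>R. dotp l3 (hc R) / dotp l2 (hc R))"
  have 1: "unif X P2 (\<lambda>R. dotp l1 (hc R) / dotp l2 (hc R))" by (rule unif_P2[OF _ tan]) auto
  obtain u a where u: "locv X P2 u a" "a \<noteq> 0"
    "\<forall>\<^sub>F R in genf X. dotp l3 (hc R) / dotp l2 (hc R) = u R * (dotp l1 (hc R) / dotp l2 (hc R))"
    by (rule unif_quotient[OF X_irr 1 3]) (rule that)
  \<comment> \<open>The form is subtracted with a the value at \<open>P2\<close> of the ratio of the
    two supposed uniformizers; the ratio of the difference to \<open>l1\<close> then vanishes at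
    \<open>P2\<close>, yet should be a unit.\<close>
  have "unif X P2 (\<lambda>R. dotp (l3 - a *s l1) (hc R) / dotp l2 (hc R))"
    by (rule unif_P2[OF _ tan]) (use u(2) in auto)
  then obtain v b where v: "locv X P2 v b" "b \<noteq> 0"
    "\<forall>\<^sub>F R in genf X. dotp (l3 - a *s l1) (hc R) / dotp l2 (hc R) = v R * (dotp l1 (hc R) / dotp l2 (hc R))"
    by (rule unif_quotient[OF X_irr 1]) (rule that)
  have "\<forall>\<^sub>F R in genf X. v R = u R - a"
    using u(3) v(3) gen_l(1,2)
  proof eventually_elim
    case (elim R)
    then have "(v R - (u R - a)) * dotp l1 (hc R) = 0" by (simp add: field_simps)
    then show ?case using elim(3) by simp
  qed
  from locv_unique[OF X_irr locv_cong[OF v(1) this] locv_diff[OF X_irr u(1) locv_const[OF X_irr P2(1)]]]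
  show False using v(2) by simp
qed

lemma pole_P1: "locv X P1 (\<lambda>R. 1 / xx R) 0"
  using l3_pole[OF P1(1)] hc_P1 phi_neq by auto

end

text \<open>If the line were tangent at \<open>P\<^sub>2\<close>, comparing its two orbits would show that it meets the
  curve in \<open>P\<^sub>1 + 2 P\<^sub>2\<close> only, against \<open>d \<ge> 4\<close>.\<close>

lemma (in galois_pair) transversal: "dotp (grad F e2) e1 \<noteq> 0"
proof
  assume tan: "dotp (grad F e2) e1 = 0"
  interpret B: galois_pair X \<phi> d F e2 e1 e3 l2 l1 l3 P2 P1 by (rule swap)
  note A = line_order[OF pole_P1] and B = B.line_order[OF B.pole_P1]
  have idA: "card {\<tau> \<in> G. \<tau> P1 = P1} > 0"
    using id_G finite_G P1(1) by (auto simp: card_gt_0_iff intro!: exI[of _ "restrict (\<lambda>R. R) X"])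
  have F12: "peval F e1 = 0" "peval F e2 = 0"
    using mem_C_iff[OF e_nonzero(1)] mem_C_iff[OF e_nonzero(2)] imageI[OF P1(1), of \<phi>] imageI[OF P2(1), of \<phi>] P1(2) P2(2) by auto
  have "[:0, 1:] ^ 2 dvd lp F e2 e1"
  proof -
    have "Polynomial.monom 1 2 dvd lp F e2 e1"
      unfolding monom_1_dvd_iff'
    proof (intro allI impI)
      fix k :: nat assume "k < 2"
      then have "k = 0 \<or> k = Suc 0" by auto
      then show "Polynomial.coeff (lp F e2 e1) k = 0"
        using F12(2) tan by (auto simp: dotp_grad)
    qed
    then show ?thesis by (simp add: monom_altdef)
  qed
  then have "Polynomial.order 0 (lp F e2 e1) \<ge> 2"
    using B.lp_line_nonzero order_divides[of 0 2 "lp F e2 e1"] by simp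
  then have a1: "card {\<tau> \<in> G. \<tau> P1 = P2} \<ge> 1" using A(2) by simp
  then obtain \<sigma> where \<sigma>: "\<sigma> \<in> G" "\<sigma> P1 = P2" by (auto simp: card_le_Suc_iff Suc_le_eq card_gt_0_iff)
  \<comment> \<open>Tangency makes some \<sigma> in \<open>G\<close> send \<open>P1\<close> to
    \<open>P2\<close>, so both points have equal counts: with multiplicities m1 and m2 of the line,
    m2 - 1 = m1.\<close>
  have aA: "card {\<tau> \<in> G. \<tau> P1 = P2} = card {\<tau> \<in> G. \<tau> P1 = P1}"
    by (rule card_transporter[OF P1(1) P2(1) \<sigma>])
  have B1: "card {\<tau> \<in> B.G. \<tau> P2 = P2} = Suc (card {\<tau> \<in> G. \<tau> P1 = P2})" using A(2) B(1) by simp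
  have B2: "Suc (card {\<tau> \<in> B.G. \<tau> P2 = P1}) = card {\<tau> \<in> G. \<tau> P1 = P1}" using A(1) B(2) by simp
  \<comment> \<open>In the other group the stabilizer of \<open>P2\<close> has m2 = m1 + 1 elements
    and the transporter to \<open>P1\<close> has m1 - 1; a nonempty transporter would make these
    equal. Hence m1 = 1 and m2 = 2.\<close>
  have "{\<tau> \<in> B.G. \<tau> P2 = P1} = {}"
  proof (rule ccontr)
    assume "\<not> ?thesis"
    then obtain \<gamma> where "\<gamma> \<in> B.G" "\<gamma> P2 = P1" by blast
    from B.card_transporter[OF P2(1) P1(1) this] show False using B1 B2 aA by simp
  qed
  from B2[unfolded this] have one: "card {\<tau> \<in> G. \<tau> P1 = P1} = 1" by (simp only: card.empty One_nat_def)
  \<comment> \<open>Only two elements of \<open>G\<close> keep \<open>P1\<close> among the two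
    Galois points, whereas \<open>G\<close> has d - 1 \<ge> 3 elements. So the line carries a third
    point of the orbit.\<close>
  have "card ({\<tau> \<in> G. \<tau> P1 = P1} \<union> {\<tau> \<in> G. \<tau> P1 = P2}) < card G"
    using card_Un_le[of "{\<tau> \<in> G. \<tau> P1 = P1}" "{\<tau> \<in> G. \<tau> P1 = P2}"] one aA card_G d4 by linarith
  moreover have "card G \<le> card ({\<tau> \<in> G. \<tau> P1 = P1} \<union> {\<tau> \<in> G. \<tau> P1 = P2})"
    if "G \<subseteq> {\<tau> \<in> G. \<tau> P1 = P1} \<union> {\<tau> \<in> G. \<tau> P1 = P2}"
    using finite_G by (intro card_mono[OF _ that]) auto
  ultimately obtain \<tau> where \<tau>: "\<tau> \<in> G" "\<tau> P1 \<noteq> P1" "\<tau> P1 \<noteq> P2" by fastforce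
  define Q where "Q = \<tau> P1"
  have Q: "Q \<in> X" "Q \<noteq> P1" "Q \<noteq> P2" using aut_in[OF X_irr G_aut[OF \<tau>(1)] P1(1)] \<tau> by (auto simp: Q_def)
  \<comment> \<open>Multiplicity m1 = 1 means that the line is not tangent at \<open>P1\<close>, so
    1/x is a uniformizer there and, by invariance under \<open>G\<close>, at Q.\<close>
  have "Polynomial.coeff (lp F e1 e2) 1 \<noteq> 0"
  proof
    assume 0: "Polynomial.coeff (lp F e1 e2) 1 = 0"
    have "Polynomial.monom 1 2 dvd lp F e1 e2"
      unfolding monom_1_dvd_iff'
    proof (intro allI impI)
      fix k :: nat assume "k < 2"
      then have "k = 0 \<or> k = 1" by auto
      then show "Polynomial.coeff (lp F e1 e2) k = 0" using F12(1) 0 by auto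
    qed
    then have "[:0, 1:] ^ 2 dvd lp F e1 e2" by (simp add: monom_altdef)
    then have "Polynomial.order 0 (lp F e1 e2) \<ge> 2"
      using lp_line_nonzero order_divides[of 0 2 "lp F e1 e2"] by simp
    then show False using A(1) one by simp
  qed
  then have "dotp (grad F e1) e2 \<noteq> 0" by (simp add: dotp_grad)
  from B.unif_P2_transversal[OF this] have "unif X P1 (\<lambda>R. 1 / xx R)" by (simp add: inv_xx)
  from unif_invariant[OF \<tau>(1) P1(1) this] have uQ: "unif X Q (\<lambda>R. 1 / xx R)" by (simp add: Q_def)
  have l3Q: "dotp l3 (hc Q) = 0" by (rule pole_l3) (use uQ in \<open>simp add: unif_def\<close>)
  \<comment> \<open>At Q the ratio of \<open>l1\<close> and \<open>l2\<close> is a unit, so 1/y is a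
    uniformizer at Q along with 1/x. The group of \<open>P1\<close> carries this from Q to
    \<open>P2\<close>, where tangency forbids it.\<close>
  then have l12: "dotp l1 (hc Q) \<noteq> 0" "dotp l2 (hc Q) \<noteq> 0" using eq_P1 eq_P2 Q by blast+
  have "\<forall>\<^sub>F R in genf X. 1 / B.xx R = dotp l1 (hc R) / dotp l2 (hc R) * (1 / xx R)"
    using gen_l(1,2) by eventually_elim (simp add: x_def B.x_def)
  from unif_unit_mult[OF X_irr uQ locv_lin[OF Q(1) l12(2)] _ this]
  have uB: "unif X Q (\<lambda>R. 1 / B.xx R)" using l12 by simp
  then have "Polynomial.order 0 (lp F e2 e1) = card {\<gamma> \<in> B.G. \<gamma> Q = P2}"
    by (intro B.line_order(1)) (simp add: unif_def)
  then have "card {\<gamma> \<in> B.G. \<gamma> Q = P2} > 0" using A(2) by simp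
  then obtain \<gamma> where \<gamma>: "\<gamma> \<in> B.G" "\<gamma> Q = P2" by (auto simp: card_gt_0_iff)
  from B.unif_invariant[OF \<gamma>(1) Q(1) uB] have "unif X P2 (\<lambda>R. dotp l3 (hc R) / dotp l2 (hc R))"
    by (simp add: \<gamma>(2) B.inv_xx)
  then show False using not_unif_P2_tangent[OF tan] by blast
qed

context galois_pair
begin

lemmas unif_P2_l3 = unif_P2_transversal[OF transversal]

text \<open>By transversality \<open>l3\<close>/\<open>l2\<close> generates the maximal ideal at
  \<open>P2\<close> and hence divides \<open>l1\<close>/\<open>l2\<close>; the quotient is x. So
  \<open>P2\<close> lies on the line at infinity without being a pole of x.\<close>

lemma finite_P2: "\<exists>c. locv X P2 xx c"
proof -
  have "locv X P2 (\<lambda>R. dotp l1 (hc R) / dotp l2 (hc R)) 0"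
    using locv_lin[OF P2(1) hc_P2(2), of l1] by (simp add: hc_P2)
  then obtain g b where g: "locv X P2 g b"
    "\<forall>\<^sub>F R in genf X. dotp l1 (hc R) / dotp l2 (hc R) = g R * (dotp l3 (hc R) / dotp l2 (hc R))"
    using unif_P2_l3 unfolding unif_def by blast
  have "\<forall>\<^sub>F R in genf X. g R = xx R"
    using g(2) gen_l(2,3) by eventually_elim (simp add: x_def field_simps)
  from locv_cong[OF g(1) this] show ?thesis by blast
qed

lemma unif_pole_P1: "unif X P1 (\<lambda>R. 1 / xx R)"
  using galois_pair.unif_P2_l3[OF swap] by (simp add: inv_xx)

text \<open>\<open>f(x, b) = L(x) \<Prod>(b - y\<circ>\<tau>)\<close>, where only the factors with \<open>\<tau>(Q) = P\<^sub>2\<close> have a pole at \<open>Q\<close>,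
  which is simple on the curve at \<open>P\<^sub>2\<close>.\<close>

lemma lead_coeff_order:
  assumes xc: "locv X Q xx c" and t: "unif X Q t"
  obtains u a where "locv X Q u a" "a \<noteq> 0"
    "\<forall>\<^sub>F R in genf X. poly (lead_coeff f) (xx R) = u R * t R ^ card {\<tau> \<in> G. \<tau> Q = P2}"
proof -
  have QX: "Q \<in> X" using xc by (rule locv_in)
  define A where "A = {\<tau> \<in> G. \<tau> Q \<noteq> P2}"
  define B where "B = {\<tau> \<in> G. \<tau> Q = P2}"
  have fin: "finite A" "finite B" and AB: "G = A \<union> B" "A \<inter> B = {}"
    using finite_G by (auto simp: A_def B_def)
  \<comment> \<open>A value of b that makes f(c, b) and all finite factors nonzero at Q, so that
    every zero or pole left comes from the leading coefficient and the factors with \<tau>(Q) =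
    \<open>P2\<close>.\<close>
  obtain b where b: "b \<notin> (\<lambda>\<tau>. yy (\<tau> Q)) ` A" "poly (sp f c) b \<noteq> 0"
    by (rule poly_nonroot_avoiding[OF sp_f_nonzero finite_imageI[OF fin(1)]]) (rule that)
  have loc: "locv X Q (\<lambda>R. ev f (xx R) b) (ev f c b)"
    by (intro locv_ev[OF X_irr] xc locv_const[OF X_irr QX])
  have lA: "locv X Q (\<lambda>R. \<Prod>\<tau>\<in>A. b - yy (\<tau> R)) (\<Prod>\<tau>\<in>A. b - yy (\<tau> Q))"
  proof (intro locv_prod locv_diff X_irr QX locv_const)
    fix \<tau> assume "\<tau> \<in> A"
    then have t: "\<tau> \<in> G" "\<tau> Q \<noteq> P2" "\<tau> Q \<in> X" using aut_in[OF X_irr G_aut QX] by (auto simp: A_def)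
    have "locv X (\<tau> Q) xx c" using locv_invariant[OF t(1), of Q "\<lambda>a. a"] xc by simp
    from locv_lin[OF t(3) finite_l3[OF this t(2)]] show "locv X Q (\<lambda>R. yy (\<tau> R)) (yy (\<tau> Q))"
      unfolding y_def by (rule aut_locv[OF X_irr G_aut[OF t(1)] QX])
  qed
  \<comment> \<open>The unit and its value are packed into one pair so that a single choice over
    \<tau> selects both.\<close>
  have "\<forall>\<tau>\<in>B. \<exists>p. locv X Q (fst p) (snd p) \<and> snd p \<noteq> 0 \<and> (\<forall>\<^sub>F R in genf X. 1 / (b - yy (\<tau> R)) = fst p R * t R)"
  proof
    fix \<tau> assume "\<tau> \<in> B"
    then have \<tau>: "\<tau> \<in> G" "\<tau> Q = P2" by (auto simp: B_def)
    have "locv X P2 (\<lambda>R. 1 / (b * (dotp l3 (hc R) / dotp l2 (hc R)) - 1)) (1 / (b * (dotp l3 (hc P2) / dotp l2 (hc P2)) - 1))"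
      by (intro locv_inverse locv_diff locv_mult locv_const locv_lin X_irr P2(1) hc_P2(2)) (simp add: hc_P2)
    then have l: "locv X P2 (\<lambda>R. 1 / (b * (dotp l3 (hc R) / dotp l2 (hc R)) - 1)) (- 1)" by (simp add: hc_P2)
    have "\<forall>\<^sub>F R in genf X. 1 / (b - yy R) =
        1 / (b * (dotp l3 (hc R) / dotp l2 (hc R)) - 1) * (dotp l3 (hc R) / dotp l2 (hc R))"
      using gen_l(2,3) by eventually_elim (simp add: y_def field_simps)
    from unif_unit_mult[OF X_irr unif_P2_l3 l _ this] have "unif X (\<tau> Q) (\<lambda>R. 1 / (b - yy R))" by (simp add: \<tau>)
    from aut_unif[OF X_irr G_aut[OF \<tau>(1)] QX this] obtain u a where "locv X Q u a" "a \<noteq> 0"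
      "\<forall>\<^sub>F R in genf X. 1 / (b - yy (\<tau> R)) = u R * t R"
      by (rule unif_quotient[OF X_irr t]) (rule that)
    then show "\<exists>p. locv X Q (fst p) (snd p) \<and> snd p \<noteq> 0 \<and> (\<forall>\<^sub>F R in genf X. 1 / (b - yy (\<tau> R)) = fst p R * t R)"
      by (intro exI[of _ "(u, a)"]) simp
  qed
  from bchoice[OF this] obtain p where p: "\<And>\<tau>. \<tau> \<in> B \<Longrightarrow> locv X Q (fst (p \<tau>)) (snd (p \<tau>)) \<and> snd (p \<tau>) \<noteq> 0 \<and>
      (\<forall>\<^sub>F R in genf X. 1 / (b - yy (\<tau> R)) = fst (p \<tau>) R * t R)"
    by blast
  define u a where "u \<tau> = fst (p \<tau>)" and "a \<tau> = snd (p \<tau>)" for \<tau>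
  have u: "\<And>\<tau>. \<tau> \<in> B \<Longrightarrow> locv X Q (u \<tau>) (a \<tau>) \<and> a \<tau> \<noteq> 0 \<and>
      (\<forall>\<^sub>F R in genf X. 1 / (b - yy (\<tau> R)) = u \<tau> R * t R)"
    using p by (simp add: u_def a_def)
  have uB: "\<forall>\<^sub>F R in genf X. \<forall>\<tau>\<in>B. 1 / (b - yy (\<tau> R)) = u \<tau> R * t R"
    using u by (intro eventually_ball_finite fin) blast
  have unz: "\<forall>\<^sub>F R in genf X. \<forall>\<tau>\<in>B. u \<tau> R \<noteq> 0"
    using u by (intro eventually_ball_finite fin ballI locv_nonzero[OF X_irr]) auto
  have nA: "(\<Prod>\<tau>\<in>A. b - yy (\<tau> Q)) \<noteq> 0" using b(1) fin by auto
  show ?thesis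
  proof (rule that)
    show "locv X Q (\<lambda>R. ev f (xx R) b / (\<Prod>\<tau>\<in>A. b - yy (\<tau> R)) * (\<Prod>\<tau>\<in>B. u \<tau> R))
        (ev f c b / (\<Prod>\<tau>\<in>A. b - yy (\<tau> Q)) * (\<Prod>\<tau>\<in>B. a \<tau>))"
      using u by (intro locv_mult locv_divide locv_prod X_irr QX loc lA nA) auto
    show "ev f c b / (\<Prod>\<tau>\<in>A. b - yy (\<tau> Q)) * (\<Prod>\<tau>\<in>B. a \<tau>) \<noteq> 0" using b(2) nA u fin by auto
    have "\<forall>\<^sub>F R in genf X. (\<Prod>\<tau>\<in>A. b - yy (\<tau> R)) \<noteq> 0" by (rule locv_nonzero[OF X_irr lA nA])
    moreover have "\<forall>\<^sub>F R in genf X. t R \<noteq> 0" using t by (simp add: unif_def)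
    ultimately show "\<forall>\<^sub>F R in genf X. poly (lead_coeff f) (xx R) =
        ev f (xx R) b / (\<Prod>\<tau>\<in>A. b - yy (\<tau> R)) * (\<Prod>\<tau>\<in>B. u \<tau> R) * t R ^ card {\<tau> \<in> G. \<tau> Q = P2}"
      using f_factor_X uB unz unfolding B_def[symmetric]
    proof eventually_elim
      case (elim R)
      have "(\<Prod>\<tau>\<in>B. b - yy (\<tau> R)) * ((\<Prod>\<tau>\<in>B. u \<tau> R) * t R ^ card B) = (\<Prod>\<tau>\<in>B. (b - yy (\<tau> R)) * (u \<tau> R * t R))"
        by (simp add: prod.distrib)
      also have "\<dots> = (\<Prod>\<tau>\<in>B. 1)"
      proof (rule prod.cong[OF refl])
        fix \<tau> assume \<tau>: "\<tau> \<in> B"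
        then have eq: "1 / (b - yy (\<tau> R)) = u \<tau> R * t R" and "u \<tau> R * t R \<noteq> 0" using elim by auto
        then have "b - yy (\<tau> R) \<noteq> 0" by auto
        then show "(b - yy (\<tau> R)) * (u \<tau> R * t R) = 1" unfolding eq[symmetric] by simp
      qed
      finally have 1: "(\<Prod>\<tau>\<in>B. b - yy (\<tau> R)) * ((\<Prod>\<tau>\<in>B. u \<tau> R) * t R ^ card B) = 1" by simp
      have "ev f (xx R) b = poly (lead_coeff f) (xx R) * ((\<Prod>\<tau>\<in>A. b - yy (\<tau> R)) * (\<Prod>\<tau>\<in>B. b - yy (\<tau> R)))"
        using elim(3) unfolding AB(1) prod.union_disjoint[OF fin AB(2)] by blast
      then have "ev f (xx R) b / (\<Prod>\<tau>\<in>A. b - yy (\<tau> R)) * (\<Prod>\<tau>\<in>B. u \<tau> R) * t R ^ card B =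
          poly (lead_coeff f) (xx R) * ((\<Prod>\<tau>\<in>B. b - yy (\<tau> R)) * ((\<Prod>\<tau>\<in>B. u \<tau> R) * t R ^ card B))"
        using elim(1) by (simp del: ev_bp)
      then show ?case unfolding 1 by simp
    qed
  qed
qed

lemma lead_f: "lead_coeff f = [:dotp (grad F e2) e3, dotp (grad F e2) e1:]"
  by (rule smooth_frameI(3)[OF frame_axioms P2_smooth])

text \<open>Where the leading coefficient is nonzero, f(c, .) has a root. It is linear in x with
  nonzero slope by transversality, so its only root is the value of x at \<open>P2\<close>, and
  \<open>P2\<close> itself is the missing point.\<close>

lemma point_over: "\<exists>Q\<in>X. locv X Q xx c"
proof (cases "poly (lead_coeff f) c = 0")
  case False
  then obtain b where b: "ev f c b = 0" using root_over by blast
  then have "abs_proj (c *s e1 + b *s e2 + e3) \<in> C" using affine_in_C by blast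
  then obtain Q where Q: "Q \<in> X" "\<phi> Q = abs_proj (c *s e1 + b *s e2 + e3)" by auto
  obtain k where "k \<noteq> 0" "rep_proj (abs_proj (c *s e1 + b *s e2 + e3)) = k *s (c *s e1 + b *s e2 + e3)"
    using rep_abs_proj[OF affine_nonzero] .
  then have "dotp l3 (hc Q) \<noteq> 0" "dotp l1 (hc Q) / dotp l3 (hc Q) = c" by (simp_all add: Q(2))
  from locv_lin[OF Q(1) this(1), of l1] this(2) show ?thesis using Q(1) by (auto simp: x_def[abs_def])
next
  case True
  obtain a where a: "locv X P2 xx a" using finite_P2 by blast
  obtain u b where u: "locv X P2 u b"
    "\<forall>\<^sub>F R in genf X. poly (lead_coeff f) (xx R) = u R * (dotp l3 (hc R) / dotp l2 (hc R)) ^ card {\<tau> \<in> G. \<tau> P2 = P2}"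
    by (rule lead_coeff_order[OF a unif_P2_l3]) (rule that)
  have "card {\<tau> \<in> G. \<tau> P2 = P2} > 0"
    using id_G finite_G P2(1) by (auto simp: card_gt_0_iff intro!: exI[of _ "restrict (\<lambda>R. R) X"])
  moreover have "poly (lead_coeff f) a = b * (dotp l3 (hc P2) / dotp l2 (hc P2)) ^ card {\<tau> \<in> G. \<tau> P2 = P2}"
    using locv_unique[OF X_irr locv_cong[OF locv_poly[OF X_irr a] u(2)]
      locv_mult[OF X_irr u(1) locv_power[OF X_irr locv_lin[OF P2(1) hc_P2(2)]]]] .
  ultimately have a0: "poly (lead_coeff f) a = 0" by (simp add: hc_P2 power_0_left)
  have "dotp (grad F e2) e1 * (a - c) = poly (lead_coeff f) a - poly (lead_coeff f) c"
    unfolding lead_f by (simp add: algebra_simps)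
  also have "\<dots> = 0" unfolding True a0 by (rule diff_self)
  finally have "dotp (grad F e2) e1 * (a - c) = 0" .
  then have "a = c" using transversal by simp
  then show ?thesis using a P2(1) by blast
qed

text \<open>The norm of \<open>c - u\<close> is a function of \<open>x\<close> without poles, hence a polynomial in \<open>x\<close>; it
  vanishes at \<open>P\<^sub>1\<close>, a pole of \<open>x\<close>.\<close>

theorem regular_constant:
  assumes reg: "\<And>Q. Q \<in> X \<Longrightarrow> \<exists>a. locv X Q u a"
  obtains c where "\<forall>\<^sub>F R in genf X. u R = c"
proof -
  obtain c where c: "locv X P1 u c" using reg P1(1) by blast
  have u: "ratf X u" by (rule locv_ratf[OF X_irr c])
  define h where "h R = (\<Prod>\<tau>\<in>G. c - u (\<tau> R))" for R
  have hreg: "\<exists>a. locv X Q h a" if Q: "Q \<in> X" for Q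
  proof -
    have "\<exists>a. locv X Q (\<lambda>R. u (\<tau> R)) a" if "\<tau> \<in> G" for \<tau>
      using reg[OF aut_in[OF X_irr G_aut[OF that] Q]] aut_locv[OF X_irr G_aut[OF that] Q] by blast
    then obtain a where "\<And>\<tau>. \<tau> \<in> G \<Longrightarrow> locv X Q (\<lambda>R. u (\<tau> R)) (a \<tau>)" by metis
    then have "locv X Q h (\<Prod>\<tau>\<in>G. c - a \<tau>)"
      unfolding h_def[abs_def] by (intro locv_prod locv_diff locv_const X_irr Q)
    then show ?thesis by blast
  qed
  obtain P where P: "P \<noteq> 0" "\<forall>\<^sub>F R in genf X. poly (lead_coeff P) (xx R) \<noteq> 0 \<and>
      (\<forall>b. ev P (xx R) b = poly (lead_coeff P) (xx R) * (\<Prod>\<tau>\<in>G. b - u (\<tau> R)))"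
    by (rule char_poly_X[OF u]) (rule that)
  \<comment> \<open>Denominators q for the norm h as a fraction in x, sorted by degree; the
    characteristic polynomial provides the first one.\<close>
  define Pr where "Pr n q \<longleftrightarrow> q \<noteq> 0 \<and> degree q = n \<and> (\<exists>p. \<forall>\<^sub>F R in genf X. poly q (xx R) * h R = poly p (xx R))" for n and q :: "'a poly"
  have "Pr (degree (lead_coeff P)) (lead_coeff P)"
    unfolding Pr_def
  proof (intro conjI exI)
    show "\<forall>\<^sub>F R in genf X. poly (lead_coeff P) (xx R) * h R = poly (poly P [:c:]) (xx R)"
      using P(2) by eventually_elim (simp add: h_def ev_def)
  qed (use P(1) in auto)
  then have "\<exists>n q. Pr n q" by blast
  define n where "n = (LEAST n. \<exists>q. Pr n q)"
  obtain q where "Pr n q" using LeastI_ex[OF \<open>\<exists>n q. Pr n q\<close>] unfolding n_def by blast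
  then obtain p where q: "q \<noteq> 0" "degree q = n" and p: "\<forall>\<^sub>F R in genf X. poly q (xx R) * h R = poly p (xx R)"
    unfolding Pr_def by blast
  \<comment> \<open>Over a root \<beta> of a minimal denominator lies a point of X where h is
    regular; evaluating there shows that the numerator vanishes at \<beta> too, and the linear
    factor cancels.\<close>
  have "n = 0"
  proof (rule ccontr)
    assume "n \<noteq> 0"
    then obtain \<beta> where \<beta>: "poly q \<beta> = 0" using alg_closed_imp_poly_has_root[of q] q by auto
    obtain Q where Q: "Q \<in> X" "locv X Q xx \<beta>" using point_over by blast
    obtain a where a: "locv X Q h a" using hreg[OF Q(1)] by blast
    have "poly p \<beta> = 0"
      using locv_unique[OF X_irr locv_cong[OF locv_mult[OF X_irr locv_poly[OF X_irr Q(2)] a] p] locv_poly[OF X_irr Q(2)]] \<beta> by simp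
    then obtain q' p' where qp: "q = [:- \<beta>, 1:] * q'" "p = [:- \<beta>, 1:] * p'"
      using \<beta> by (auto simp: poly_eq_0_iff_dvd elim!: dvdE)
    have q'0: "q' \<noteq> 0" using q(1) qp(1) by auto
    have "\<forall>\<^sub>F R in genf X. xx R \<noteq> \<beta>" using phi_gen[OF gen_x_notin[of "{\<beta>}"]] by simp
    with p have "\<forall>\<^sub>F R in genf X. poly q' (xx R) * h R = poly p' (xx R)"
    proof eventually_elim
      case (elim R)
      then have "(xx R - \<beta>) * (poly q' (xx R) * h R) = (xx R - \<beta>) * poly p' (xx R)"
        by (simp add: qp algebra_simps)
      then show ?case using elim(2) by simp
    qed
    then have "Pr (degree q') q'" unfolding Pr_def using q'0 by blast
    then have "n \<le> degree q'" unfolding n_def by (intro Least_le) blast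
    moreover have "n = Suc (degree q')" using q(2) q'0 unfolding qp(1) by (subst (asm) degree_mult_eq) auto
    ultimately show False by simp
  qed
  then obtain k where k: "q = [:k:]" "k \<noteq> 0" using q by (metis degree_eq_zeroE pCons_0_0)
  have kh: "\<forall>\<^sub>F R in genf X. k * h R = poly p (xx R)" using p by (simp add: k)
  \<comment> \<open>The constant c is the value of u at \<open>P1\<close>, so the factor of the
    identity vanishes there.\<close>
  have h0: "locv X P1 h 0"
  proof -
    obtain a where a: "\<And>\<tau>. \<tau> \<in> G \<Longrightarrow> locv X P1 (\<lambda>R. u (\<tau> R)) (a \<tau>)"
      using reg[OF aut_in[OF X_irr G_aut P1(1)]] aut_locv[OF X_irr G_aut P1(1)] by metis
    have "locv X P1 (\<lambda>R. u (restrict (\<lambda>R. R) X R)) c"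
      using aut_locv[OF X_irr id_aut P1(1), of u c] c P1(1) by simp
    then have "a (restrict (\<lambda>R. R) X) = c" using locv_unique[OF X_irr a[OF id_G]] by blast
    then have 0: "(\<Prod>\<tau>\<in>G. c - a \<tau>) = 0" using id_G finite_G by auto
    have "locv X P1 h (\<Prod>\<tau>\<in>G. c - a \<tau>)"
      unfolding h_def[abs_def] by (intro locv_prod locv_diff locv_const X_irr P1(1) a)
    then show ?thesis unfolding 0 .
  qed
  have "p = 0"
  proof (rule ccontr)
    assume "p \<noteq> 0"
    \<comment> \<open>Dividing by x^(deg p) moves the comparison to the pole \<open>P1\<close>: the
      left side vanishes there, while the reversed polynomial takes the leading coefficient of
      p.\<close>
    have eq: "\<forall>\<^sub>F R in genf X. k * h R * (1 / xx R) ^ degree p = poly (reflect_poly p) (1 / xx R)"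
      using kh gen_xx
    proof eventually_elim
      case (elim R)
      then have "1 / xx R \<noteq> 0" by simp
      from poly_reflect_poly_nz[OF this, of p] elim(1) show ?case by (simp add: inverse_eq_divide mult.commute)
    qed
    have "locv X P1 (\<lambda>R. k * h R * (1 / xx R) ^ degree p) (k * 0 * 0 ^ degree p)"
      by (intro locv_mult locv_power locv_const X_irr P1(1) h0 pole_P1)
    from locv_unique[OF X_irr locv_cong[OF this eq] locv_poly[OF X_irr pole_P1]]
    show False using \<open>p \<noteq> 0\<close> by simp
  qed
  then have "\<forall>\<^sub>F R in genf X. h R = 0" using kh k(2) by (auto elim: eventually_mono)
  \<comment> \<open>The norm is generically zero, so one of its factors is; composing with the
    inverse of \<tau> turns this into a statement about u.\<close>
  have "\<exists>\<tau>\<in>G. \<forall>\<^sub>F R in genf X. c - u (\<tau> R) = 0"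
  proof (rule ccontr)
    assume "\<not> ?thesis"
    then have "\<forall>\<^sub>F R in genf X. c - u (\<tau> R) \<noteq> 0" if "\<tau> \<in> G" for \<tau>
      using ratf_0_or_nonzero[OF X_irr ratf_diff[OF X_irr ratf_const[OF X_irr, of c] aut_ratf[OF X_irr G_aut[OF that] u]]] that
      by blast
    then have "\<forall>\<^sub>F R in genf X. \<forall>\<tau>\<in>G. c - u (\<tau> R) \<noteq> 0" by (intro eventually_ball_finite finite_G) blast
    with \<open>\<forall>\<^sub>F R in genf X. h R = 0\<close> have "\<forall>\<^sub>F R in genf X. False"
      by eventually_elim (use finite_G in \<open>auto simp: h_def\<close>)
    then show False using genf_neq_bot[OF X_irr] by simp
  qed
  then obtain \<tau> where \<tau>: "\<tau> \<in> G" "\<forall>\<^sub>F R in genf X. c - u (\<tau> R) = 0" by blast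
  obtain \<tau>' where t: "\<tau>' \<in> G" "\<And>R. R \<in> X \<Longrightarrow> \<tau> (\<tau>' R) = R" by (rule G_inverse[OF \<tau>(1)]) (rule that)
  have "\<forall>\<^sub>F R in genf X. u R = c"
    using aut_gen[OF X_irr G_aut[OF t(1)] \<tau>(2)] eventually_genf_in[OF X_irr]
    by eventually_elim (simp add: t(2))
  then show ?thesis by (rule that)
qed

end

subsection \<open>Linear symmetries of the curve\<close>

text \<open>Transport of structure along an automorphism of L. Conjugation by \<theta> carries
  automorphisms over K to automorphisms over the image of K, so the fixed field of the latter is the
  image of the former.\<close>

lemma finite_galois_extension_image:
  assumes gal: "finite_galois_extension L K" and \<theta>: "\<theta> \<in> ring_iso L L"
  shows "finite_galois_extension L (\<theta> ` K)"
proof -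
  have fld: "field L" and sub: "subfield K L" and fin: "ring.finite_dimension L K (carrier L)"
    and fixed: "{a \<in> carrier L. \<forall>g\<in>galois_group L K. g a = a} = K"
    using gal by (auto simp: finite_galois_extension_def)
  interpret field L by (rule fld)
  have hom: "\<theta> \<in> ring_hom L L" and bij: "bij_betw \<theta> (carrier L) (carrier L)" using \<theta> by (auto simp: ring_iso_def)
  have car: "\<theta> a \<in> carrier L" if "a \<in> carrier L" for a using bij that by (auto simp: bij_betw_def)
  have inj: "\<theta> a = \<theta> b \<longleftrightarrow> a = b" if "a \<in> carrier L" "b \<in> carrier L" for a b
    using bij that by (auto simp: bij_betw_def inj_on_def)
  have K: "K \<subseteq> carrier L" using fixed by blast
  have rh: "ring_hom_ring L L \<theta>" by (rule ring_hom_ringI2[OF ring_axioms ring_axioms hom])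
  have zero: "\<theta> \<zero>\<^bsub>L\<^esub> = \<zero>\<^bsub>L\<^esub>" 
  proof -
    interpret h: ring_hom_ring L L \<theta> by (rule rh)
    show ?thesis by (rule h.hom_zero)
  qed
  \<comment> \<open>Dimension is defined inductively by line extensions, so it is transported one
    extension at a time.\<close>
  have dim: "E \<subseteq> carrier L \<and> dimension n (\<theta> ` K) (\<theta> ` E)" if "dimension n K E" "K \<subseteq> carrier L" for n E
    using that
  proof (induction rule: dimension.induct)
    case (zero_dim K)
    then show ?case by (simp add: zero)
  next
    case (Suc_dim v E n K)
    then have IH: "E \<subseteq> carrier L" "dimension n (\<theta> ` K) (\<theta> ` E)" by auto
    have "\<theta> v \<notin> \<theta> ` E" using inj Suc_dim(1,2) IH(1) by auto
    then have "dimension (Suc n) (\<theta> ` K) (line_extension (\<theta> ` K) (\<theta> v) (\<theta> ` E))"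
      by (rule dimension.Suc_dim[OF car[OF Suc_dim(1)] _ IH(2)])
    moreover have "\<theta> (k \<otimes>\<^bsub>L\<^esub> v \<oplus>\<^bsub>L\<^esub> e) = \<theta> k \<otimes>\<^bsub>L\<^esub> \<theta> v \<oplus>\<^bsub>L\<^esub> \<theta> e" if "k \<in> K" "e \<in> E" for k e
      using that Suc_dim IH(1) hom by (simp add: ring_hom_add ring_hom_mult subset_iff)
    then have "\<theta> ` line_extension K v E = line_extension (\<theta> ` K) (\<theta> v) (\<theta> ` E)"
      by (force simp: line_extension_mem_iff image_iff)
    ultimately show ?case using line_extension_in_carrier[OF Suc_dim(5) Suc_dim(1) IH(1)] by simp
  qed
  have "finite_dimension (\<theta> ` K) (\<theta> ` carrier L)"
    using fin dim K unfolding finite_dimension_def by blast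
  then have fin': "finite_dimension (\<theta> ` K) (carrier L)" using bij by (simp add: bij_betw_def)
  have sub': "subfield (\<theta> ` K) L" by (rule ring_hom_ring.img_is_subfield(2)[OF rh sub]) simp
  have "{a \<in> carrier L. \<forall>g\<in>galois_group L (\<theta> ` K). g a = a} = \<theta> ` K"
  proof (intro Set.set_eqI iffI)
    fix a assume a: "a \<in> {a \<in> carrier L. \<forall>g\<in>galois_group L (\<theta> ` K). g a = a}"
    then obtain b where b: "b \<in> carrier L" "a = \<theta> b" using bij by (auto simp: bij_betw_def)
    have "g b = b" if g: "g \<in> galois_group L K" for g
    proof -
      have gi: "g \<in> ring_iso L L" and gK: "\<And>k. k \<in> K \<Longrightarrow> g k = k" using g by (auto simp: galois_group_def)
      let ?i = "inv_into (carrier L) \<theta>"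
      have i: "?i (\<theta> c) = c" if "c \<in> carrier L" for c using bij that by (auto simp: bij_betw_def)
      have "\<theta> \<circ> (g \<circ> ?i) \<in> ring_iso L L"
        using ring_iso_set_trans[OF ring_iso_set_trans[OF ring_iso_set_sym[OF ring_axioms \<theta>] gi] \<theta>] .
      moreover have "(\<theta> \<circ> (g \<circ> ?i)) (\<theta> k) = \<theta> k" if "k \<in> K" for k using that K i gK by auto
      ultimately have "\<theta> \<circ> (g \<circ> ?i) \<in> galois_group L (\<theta> ` K)" unfolding galois_group_def by blast
      then have "(\<theta> \<circ> (g \<circ> ?i)) a = a" using a by blast
      then have "\<theta> (g b) = \<theta> b" by (simp add: b i)
      moreover have "g b \<in> carrier L" using gi b(1) by (auto simp: ring_iso_def bij_betw_def)
      ultimately show ?thesis using inj b(1) by blast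
    qed
    then have "b \<in> K" using b(1) fixed by blast
    then show "a \<in> \<theta> ` K" using b(2) by blast
  qed (use K car in \<open>auto simp: galois_group_def\<close>)
  then show ?thesis unfolding finite_galois_extension_def using fld sub' fin' by blast
qed

lemma dotp_vector_matrix: "dotp (l v* M) v = dotp l (M *v v)" for l :: "'a::field ^ 'n::finite" and M :: "'a ^ 'm::finite ^ 'n"
  unfolding dotp_def vector_matrix_mult_def matrix_vector_mult_def
  by (simp add: sum_distrib_left sum_distrib_right mult_ac) (rule sum.swap)

text \<open>The inverse matrix N is a parameter, so that the situation is symmetric: the locale
  applies again with M and N exchanged and \<sigma> inverted.\<close>

locale linear_symmetry = plane_model X \<phi> d F
  for X :: "('a::alg_closed_field, 'n::finite) proj set" and \<phi> :: "('a, 'n) proj \<Rightarrow> ('a, 3) proj" and d F +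
  fixes M N :: "'a ^ 3 ^ 3" and \<sigma> :: "('a, 'n) proj \<Rightarrow> ('a, 'n) proj"
  assumes MN: "M ** N = mat 1" "N ** M = mat 1" and \<sigma>: "\<sigma> \<in> curve_aut X"
    and image: "linear_proj_map M ` (\<phi> ` X) = \<phi> ` X"
    and commutes: "\<And>R. R \<in> X \<Longrightarrow> linear_proj_map M (\<phi> R) = \<phi> (\<sigma> R)"
begin

abbreviation "\<alpha> \<equiv> linear_proj_map M :: ('a, 3) proj \<Rightarrow> ('a, 3) proj"
abbreviation "\<beta> \<equiv> linear_proj_map N :: ('a, 3) proj \<Rightarrow> ('a, 3) proj"
abbreviation "\<sigma>' \<equiv> restrict (inv_into X \<sigma>) X"

lemma MN_v [simp]: "M *v (N *v v) = v" "N *v (M *v v) = v"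
  using MN by (simp_all add: matrix_vector_mul_assoc)

lemma M_nonzero: "v \<noteq> 0 \<Longrightarrow> M *v v \<noteq> 0" and N_nonzero: "v \<noteq> 0 \<Longrightarrow> N *v v \<noteq> 0"
  by (metis MN_v(2) matrix_vector_mult_0_right) (metis MN_v(1) matrix_vector_mult_0_right)

lemma inverse_maps [simp]: "\<alpha> (\<beta> p) = p" "\<beta> (\<alpha> p) = p"
proof -
  have "\<alpha> (\<beta> p) = abs_proj (M *v (N *v rep_proj p))"
    unfolding linear_proj_map_def[of N] by (intro linear_proj_map_abs_proj M_nonzero N_nonzero rep_proj_nonzero)
  then show "\<alpha> (\<beta> p) = p" by (simp add: abs_rep_proj)
  have "\<beta> (\<alpha> p) = abs_proj (N *v (M *v rep_proj p))"
    unfolding linear_proj_map_def[of M] by (intro linear_proj_map_abs_proj M_nonzero N_nonzero rep_proj_nonzero)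
  then show "\<beta> (\<alpha> p) = p" by (simp add: abs_rep_proj)
qed

lemma \<sigma>'_aut: "\<sigma>' \<in> curve_aut X"
proof -
  have "\<sigma>' \<in> Bij X" using \<sigma> by (intro restrict_inv_into_Bij) (simp add: curve_aut_def)
  moreover have "morphism X X \<sigma>'"
    by (rule morphism_cong[OF aut_inv_morphism[OF X_irr \<sigma>]]) simp
  moreover have "inv_into X \<sigma>' R = \<sigma> R" if "R \<in> X" for R
  proof -
    have "\<sigma>' (\<sigma> R) = R" using that by (simp add: aut_in[OF X_irr \<sigma>] aut_inv_left[OF X_irr \<sigma>])
    moreover have "inj_on \<sigma>' X" using \<open>\<sigma>' \<in> Bij X\<close> by (simp add: Bij_def bij_betw_def)
    ultimately show ?thesis using aut_in[OF X_irr \<sigma> that] by (metis inv_into_f_f)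
  qed
  then have "morphism X X (inv_into X \<sigma>')"
    by (intro morphism_cong[OF aut_morphism[OF X_irr \<sigma>]]) simp
  ultimately show ?thesis by (simp add: curve_aut_def)
qed

lemma \<sigma>'_left: "R \<in> X \<Longrightarrow> \<sigma>' (\<sigma> R) = R" and \<sigma>'_right: "R \<in> X \<Longrightarrow> \<sigma> (\<sigma>' R) = R"
  by (simp_all add: aut_in[OF X_irr \<sigma>] aut_inv_left[OF X_irr \<sigma>] aut_inv_right[OF X_irr \<sigma>])

lemma commutes': "R \<in> X \<Longrightarrow> \<beta> (\<phi> R) = \<phi> (\<sigma>' R)"
  using commutes[of "\<sigma>' R"] \<sigma>'_right[of R] aut_in[OF X_irr \<sigma>'_aut, of R] inverse_maps(2)[of "\<phi> (\<sigma>' R)"] by simp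

text \<open>Lets every one-sided statement about \<alpha> (an inclusion of tangent spaces, an
  inequality of cardinalities) be reversed by applying it to the inverse.\<close>

lemma inverse_symmetry: "linear_symmetry X \<phi> d F N M \<sigma>'"
proof (unfold_locales)
  have "\<beta> ` C = \<beta> ` (\<alpha> ` C)" using image by simp
  also have "\<dots> = C" by (simp add: image_image)
  finally show "\<beta> ` C = C" .
qed (simp_all only: MN \<sigma>'_aut commutes')

lemma \<alpha>_filterlim: "filterlim \<alpha> (genf C) (genf C)" and \<alpha>_ratmap: "ratmap C C \<alpha>"
proof -
  have m: "morphism C UNIV \<alpha>" by (rule linear_proj_map_morphism) (rule M_nonzero[OF rep_proj_nonzero])
  show f: "filterlim \<alpha> (genf C) (genf C)" by (rule morphism_filterlim[OF C_irr C_irr m image])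
  show "ratmap C C \<alpha>" by (rule morphism_ratmap[OF C_irr m f])
qed

lemma \<alpha>_gen: "eventually P (genf C) \<Longrightarrow> \<forall>\<^sub>F R in genf C. P (\<alpha> R)"
  using \<alpha>_filterlim by (simp add: filterlim_iff)

section \<open>Action of the symmetry on function field, tangent spaces and Galois groups\<close>

abbreviation "\<Theta> \<equiv> rat_pullback C \<alpha>"
abbreviation "\<Theta>' \<equiv> rat_pullback C \<beta>"
abbreviation "L \<equiv> function_field C"

lemma \<Theta>_class: "\<Theta> (generic_class C h) = generic_class C (\<lambda>Q. h (\<alpha> Q))"
  using rat_pullback_generic_class[OF C_irr C_irr \<alpha>_filterlim, of h] by (simp add: o_def)

lemma \<Theta>'_class: "\<Theta>' (generic_class C h) = generic_class C (\<lambda>Q. h (\<beta> Q))"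
  by (rule linear_symmetry.\<Theta>_class[OF inverse_symmetry])

lemma L_carrierE:
  assumes "a \<in> carrier L" obtains h where "a = generic_class C h" "ratf C h"
  using assms by (auto simp: carrier_function_field[OF C_irr])

lemma \<Theta>_carrier: "a \<in> carrier L \<Longrightarrow> \<Theta> a \<in> carrier L"
  using ratf_compose[OF \<alpha>_ratmap] by (auto simp: carrier_function_field[OF C_irr] \<Theta>_class)

lemma \<Theta>_inverse: "a \<in> carrier L \<Longrightarrow> \<Theta>' (\<Theta> a) = a" "a \<in> carrier L \<Longrightarrow> \<Theta> (\<Theta>' a) = a"
  by (auto elim!: L_carrierE simp: \<Theta>_class \<Theta>'_class)

lemma \<Theta>_iso: "\<Theta> \<in> ring_iso L L"
proof (rule ring_iso_memI)
  show "bij_betw \<Theta> (carrier L) (carrier L)"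
    by (rule bij_betw_byWitness[of _ \<Theta>'])
      (use \<Theta>_inverse \<Theta>_carrier linear_symmetry.\<Theta>_carrier[OF inverse_symmetry] in auto)
  show "\<Theta> \<one>\<^bsub>L\<^esub> = \<one>\<^bsub>L\<^esub>" by (simp add: one_function_field[OF C_irr] \<Theta>_class)
  fix a b assume "a \<in> carrier L" "b \<in> carrier L"
  then obtain h k where "a = generic_class C h" "b = generic_class C k" by (metis L_carrierE)
  then show "\<Theta> (a \<otimes>\<^bsub>L\<^esub> b) = \<Theta> a \<otimes>\<^bsub>L\<^esub> \<Theta> b" "\<Theta> (a \<oplus>\<^bsub>L\<^esub> b) = \<Theta> a \<oplus>\<^bsub>L\<^esub> \<Theta> b"
    by (simp_all add: mult_function_field[OF C_irr] add_function_field[OF C_irr] \<Theta>_class)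
qed (rule \<Theta>_carrier)

lemma rep_\<alpha>: obtains c where "c \<noteq> 0" "rep_proj (\<alpha> p) = c *s (M *v rep_proj p)"
  using rep_linear_proj_map[OF M_nonzero[OF rep_proj_nonzero]] .

text \<open>The chain rule without derivatives: composing a form with M has the same restriction to
  a line as the form has to the image line, so linear coefficients agree.\<close>

lemma tangent_space_image:
  assumes w: "w \<in> tangent_space C p"
  shows "M *v w \<in> tangent_space C (\<alpha> p)"
  unfolding tangent_space_grad
proof (intro CollectI allI impI)
  fix k H assume H: "is_form k H \<and> (\<forall>y\<in>C. form_at H y = 0)"
  define H' where "H' = psubst H (\<lambda>i. lin (M $ i))"
  have ev: "peval H' v = peval H (M *v v)" for v
  proof -
    have "(\<chi> i. peval (lin (M $ i)) v) = M *v v" by (simp add: vec_eq_iff matrix_vector_dotp)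
    then show ?thesis by (simp add: H'_def)
  qed
  have "is_form (1 * k) H'" unfolding H'_def using H is_form_lin by (metis is_form_psubst mult.commute)
  moreover have "form_at H' y = 0" if "y \<in> C" for y
  proof -
    have "form_at H (\<alpha> y) = 0" using H image that by blast
    then show ?thesis
      using form_at_abs_proj[OF M_nonzero[OF rep_proj_nonzero], of k H y] H
      by (simp add: form_at_def[of H'] ev linear_proj_map_def)
  qed
  ultimately have 0: "dotp (grad H' (rep_proj p)) w = 0" using w unfolding tangent_space_grad by blast
  have "lp H' (rep_proj p) w = lp H (M *v rep_proj p) (M *v w)"
    by (rule lp_eqI) (simp add: ev matrix_vector_right_distrib vec.scale)
  then have "dotp (grad H (M *v rep_proj p)) (M *v w) = 0" using 0 by (simp add: dotp_grad)
  moreover obtain c where "c \<noteq> 0" "rep_proj (\<alpha> p) = c *s (M *v rep_proj p)" by (rule rep_\<alpha>)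
  ultimately show "dotp (grad H (rep_proj (\<alpha> p))) (M *v w) = 0" using H dotp_grad_scale by metis
qed

lemma smooth_image:
  assumes "smooth_point C p"
  shows "smooth_point C (\<alpha> p)"
proof -
  have "tangent_space C (\<alpha> p) = (\<lambda>v. M *v v) ` tangent_space C p"
  proof
    show "tangent_space C (\<alpha> p) \<subseteq> (\<lambda>v. M *v v) ` tangent_space C p"
    proof
      fix w assume "w \<in> tangent_space C (\<alpha> p)"
      from linear_symmetry.tangent_space_image[OF inverse_symmetry this]
      have "N *v w \<in> tangent_space C p" by simp
      then show "w \<in> (\<lambda>v. M *v v) ` tangent_space C p" by (rule image_eqI[rotated]) simp
    qed
  qed (use tangent_space_image in blast)
  moreover have "inj ((*v) M)" by (rule inj_on_inverseI[of _ "(*v) N"]) simp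
  then have "vec.dim ((*v) M ` tangent_space C p) = vec.dim (tangent_space C p)"
    by (intro vec.dim_image_eq matrix_vector_mul_linear_gen) (rule inj_on_subset, auto)
  ultimately show ?thesis using assms image by (auto simp: smooth_point_def)
qed

lemma frame_image:
  assumes "frame u1 u2 u3 m1 m2 m3"
  shows "frame (M *v u1) (M *v u2) (M *v u3) (m1 v* N) (m2 v* N) (m3 v* N)"
proof -
  interpret frame u1 u2 u3 m1 m2 m3 by (rule assms)
  have "v = M *v (dotp m1 (N *v v) *s u1 + dotp m2 (N *v v) *s u2 + dotp m3 (N *v v) *s u3)" for v
    using expand[of "N *v v"] MN_v(1)[of v] by simp
  then show ?thesis
    by unfold_locales (simp_all add: dotp_vector_matrix matrix_vector_right_distrib vec.scale)
qed

text \<open>M carries a frame centred at p to one centred at \<alpha>(p), and in these frames the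
  coordinate x corresponds exactly. The point q completes p to a frame.\<close>

lemma projection_subfield_image:
  assumes p: "smooth_point C p" "q \<noteq> p"
  shows "projection_subfield C (\<alpha> p) = \<Theta>' ` projection_subfield C p"
proof -
  have "rep_proj q \<notin> vec.span {rep_proj p}" using rep_proj_notin_span[of p q] p(2) by auto
  then obtain u m1 m2 m3 where "frame (rep_proj p) (rep_proj q) u m1 m2 m3"
    by (rule frame_complete[OF rep_proj_nonzero]) (rule that)
  then have fr: "frame u (rep_proj p) (rep_proj q) m3 m1 m2" unfolding frame_def by (auto simp: add_ac)
  have eq: "p = abs_proj (rep_proj p)" "\<alpha> p = abs_proj (M *v rep_proj p)"
    by (simp_all add: abs_rep_proj linear_proj_map_def)
  interpret a: framed_curve C d F u "rep_proj p" "rep_proj q" m3 m1 m2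
    by (rule smooth_frameI(1)[OF fr]) (use p eq in simp)
  interpret b: framed_curve C d F "M *v u" "M *v rep_proj p" "M *v rep_proj q" "m3 v* N" "m1 v* N" "m2 v* N"
    by (rule smooth_frameI(1)[OF frame_image[OF fr]]) (use smooth_image[OF p(1)] eq in simp)
  have xx: "b.x (\<alpha> Q) = a.x Q" for Q
  proof -
    obtain c where "c \<noteq> 0" "rep_proj (\<alpha> Q) = c *s (M *v rep_proj Q)" by (rule rep_\<alpha>)
    then show ?thesis by (simp add: a.x_def b.x_def dotp_vector_matrix)
  qed
  have xx': "a.x (\<beta> Q) = b.x Q" for Q using xx[of "\<beta> Q"] by simp
  show ?thesis
    unfolding a.projection_subfield_frame[OF eq(1)] b.projection_subfield_frame[OF eq(2)]
  proof (intro Set.set_eqI iffI)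
    fix a assume "a \<in> {generic_class C h |h. b.rational_in_x h}"
    then obtain h g k where h: "a = generic_class C h" "k \<noteq> 0"
      "\<forall>\<^sub>F Q in genf C. h Q = poly g (b.x Q) / poly k (b.x Q)"
      unfolding b.rational_in_x_def by blast
    have "\<forall>\<^sub>F Q in genf C. h (\<alpha> Q) = poly g (a.x Q) / poly k (a.x Q)"
      using \<alpha>_gen[OF h(3)] by (simp add: xx)
    then have "a.rational_in_x (\<lambda>Q. h (\<alpha> Q))" unfolding a.rational_in_x_def using h(2) by blast
    moreover have "a = \<Theta>' (generic_class C (\<lambda>Q. h (\<alpha> Q)))" by (simp add: \<Theta>'_class h(1))
    ultimately show "a \<in> \<Theta>' ` {generic_class C h |h. a.rational_in_x h}" by blast
  next
    fix a assume "a \<in> \<Theta>' ` {generic_class C h |h. a.rational_in_x h}"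
    then obtain h g k where h: "a = \<Theta>' (generic_class C h)" "k \<noteq> 0"
      "\<forall>\<^sub>F Q in genf C. h Q = poly g (a.x Q) / poly k (a.x Q)"
      unfolding a.rational_in_x_def by blast
    have "\<forall>\<^sub>F Q in genf C. h (\<beta> Q) = poly g (b.x Q) / poly k (b.x Q)"
      using linear_symmetry.\<alpha>_gen[OF inverse_symmetry h(3)] by (simp add: xx')
    then have "b.rational_in_x (\<lambda>Q. h (\<beta> Q))" unfolding b.rational_in_x_def using h(2) by blast
    then show "a \<in> {generic_class C h |h. b.rational_in_x h}" using h(1) by (auto simp: \<Theta>'_class)
  qed
qed

lemma inner_galois_image:
  assumes "inner_galois_point C p" "q \<noteq> p"
  shows "inner_galois_point C (\<alpha> p)"
  using assms smooth_image projection_subfield_image[OF _ assms(2)]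
    finite_galois_extension_image[OF _ linear_symmetry.\<Theta>_iso[OF inverse_symmetry]]
  by (simp add: inner_galois_point_def galois_point_def)

text \<open>Conjugation by \<sigma> on X corresponds to conjugation by the pullback along \<alpha>
  on the function field, which maps one projection subfield to the other.\<close>

lemma conjugate:
  assumes p: "inner_galois_point C p" "q \<noteq> p" and \<gamma>: "\<gamma> \<in> galois_point_group X \<phi> p"
  shows "compose X \<sigma> (compose X \<gamma> \<sigma>') \<in> galois_point_group X \<phi> (\<alpha> p)"
proof -
  let ?\<gamma> = "compose X \<sigma> (compose X \<gamma> \<sigma>')"
  obtain g where \<gamma>a: "\<gamma> \<in> curve_aut X" and g: "g \<in> galois_group L (projection_subfield C p)"
    "\<And>a. a \<in> carrier L \<Longrightarrow> rat_pullback X \<gamma> (rat_pullback X \<phi> a) = rat_pullback X \<phi> (g a)"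
    using \<gamma> unfolding galois_point_group_def by blast
  have \<gamma>': "?\<gamma> \<in> curve_aut X" by (intro compose_aut \<sigma> \<sigma>'_aut \<gamma>a)
  have gi: "g \<in> ring_iso L L" and gK: "\<And>k. k \<in> projection_subfield C p \<Longrightarrow> g k = k"
    using g(1) by (auto simp: galois_group_def)
  have K: "projection_subfield C p \<subseteq> carrier L"
    using p(1) unfolding inner_galois_point_def galois_point_def finite_galois_extension_def by blast
  have sm: "smooth_point C p" using p(1) by (simp add: inner_galois_point_def)
  \<comment> \<open>The outer map is pullback by the inverse of \<alpha>: an element of the new
    subfield is first moved to the old one, fixed there by g, and moved back.\<close>
  define g' where "g' = \<Theta>' \<circ> (g \<circ> \<Theta>)"
  have "g' \<in> ring_iso L L" unfolding g'_def
    by (rule ring_iso_set_trans[OF ring_iso_set_trans[OF \<Theta>_iso gi] linear_symmetry.\<Theta>_iso[OF inverse_symmetry]])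
  moreover have "g' a = a" if a: "a \<in> projection_subfield C (\<alpha> p)" for a
  proof -
    obtain b where b: "b \<in> projection_subfield C p" "a = \<Theta>' b"
      using a unfolding projection_subfield_image[OF sm p(2)] by blast
    have "\<Theta> (\<Theta>' b) = b" using \<Theta>_inverse(2) b(1) K by blast
    then show ?thesis by (simp add: g'_def b(2) gK[OF b(1)])
  qed
  ultimately have g': "g' \<in> galois_group L (projection_subfield C (\<alpha> p))" by (simp add: galois_group_def)
  have pull: "rat_pullback X \<phi> (generic_class C h) = generic_class X (\<lambda>R. h (\<phi> R))" for h
    using rat_pullback_generic_class[OF X_irr C_irr phi_filterlim, of h] by (simp add: o_def)
  have pull2: "rat_pullback X \<rho> (generic_class X h) = generic_class X (\<lambda>R. h (\<rho> R))" if "\<rho> \<in> curve_aut X" for \<rho> h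
    using rat_pullback_generic_class[OF X_irr X_irr aut_filterlim(1)[OF X_irr that], of h] by (simp add: o_def)
  have "rat_pullback X ?\<gamma> (rat_pullback X \<phi> a) = rat_pullback X \<phi> (g' a)" if a: "a \<in> carrier L" for a
  proof -
    obtain h where h: "a = generic_class C h" "ratf C h" by (rule L_carrierE[OF a])
    have "g (\<Theta> a) \<in> carrier L" using gi \<Theta>_carrier[OF a] by (auto simp: ring_iso_def bij_betw_def)
    then obtain k where k: "g (\<Theta> a) = generic_class C k" "ratf C k" by (rule L_carrierE)
    have "generic_class X (\<lambda>R. h (\<alpha> (\<phi> (\<gamma> R)))) = generic_class X (\<lambda>R. k (\<phi> R))"
      using g(2)[OF \<Theta>_carrier[OF a]] unfolding k(1) by (simp add: h(1) \<Theta>_class pull pull2[OF \<gamma>a])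
    then have "\<forall>\<^sub>F R in genf X. h (\<alpha> (\<phi> (\<gamma> R))) = k (\<phi> R)" by (simp add: generic_class_eq_iff[OF X_irr])
    from aut_gen[OF X_irr \<sigma>'_aut this] eventually_genf_in[OF X_irr]
    have "\<forall>\<^sub>F R in genf X. h (\<phi> (?\<gamma> R)) = k (\<beta> (\<phi> R))"
    proof eventually_elim
      case (elim R)
      have "\<sigma>' R \<in> X" "\<gamma> (\<sigma>' R) \<in> X" using elim(2) aut_in[OF X_irr \<sigma>'_aut] aut_in[OF X_irr \<gamma>a] by blast+
      then show ?case using elim commutes[of "\<gamma> (\<sigma>' R)"] commutes'[of R] by (simp add: compose_def)
    qed
    then have "generic_class X (\<lambda>R. h (\<phi> (?\<gamma> R))) = generic_class X (\<lambda>R. k (\<beta> (\<phi> R)))"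
      by (simp only: generic_class_eq_iff[OF X_irr])
    then show ?thesis by (simp only: g'_def o_apply k(1)[unfolded h(1)] \<Theta>'_class pull h(1) pull2[OF \<gamma>'])
  qed
  then show ?thesis unfolding galois_point_group_def using \<gamma>' g' by blast
qed

text \<open>Conjugation is injective and sends maps P to R onto maps from \<sigma>(P) to
  \<sigma>(R). The reverse inequality is this one for the inverse symmetry.\<close>

lemma card_conjugate_le:
  assumes p: "inner_galois_point C p" "q \<noteq> p" and fin: "finite (galois_point_group X \<phi> (\<alpha> p))"
    and P: "P \<in> X"
  shows "card {\<gamma> \<in> galois_point_group X \<phi> p. \<gamma> P = R} \<le> card {\<gamma> \<in> galois_point_group X \<phi> (\<alpha> p). \<gamma> (\<sigma> P) = \<sigma> R}"
proof (rule card_inj_on_le)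
  let ?c = "\<lambda>\<gamma>. compose X \<sigma> (compose X \<gamma> \<sigma>')"
  have aut: "\<gamma> \<in> curve_aut X" if "\<gamma> \<in> galois_point_group X \<phi> p" for \<gamma>
    using that by (simp add: galois_point_group_def)
  show "inj_on ?c {\<gamma> \<in> galois_point_group X \<phi> p. \<gamma> P = R}"
  proof (rule inj_onI)
    fix \<gamma> \<delta> assume *: "\<gamma> \<in> {\<gamma> \<in> galois_point_group X \<phi> p. \<gamma> P = R}" "\<delta> \<in> {\<gamma> \<in> galois_point_group X \<phi> p. \<gamma> P = R}"
      "?c \<gamma> = ?c \<delta>"
    then have a: "\<gamma> \<in> curve_aut X" "\<delta> \<in> curve_aut X" using aut by auto
    show "\<gamma> = \<delta>"
    proof (rule extensionalityI)
      show "\<gamma> \<in> extensional X" "\<delta> \<in> extensional X" using a by (auto simp: curve_aut_def Bij_def)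
      fix S assume S: "S \<in> X"
      have "\<sigma> (\<gamma> S) = \<sigma> (\<delta> S)"
        using fun_cong[OF *(3), of "\<sigma> S"] \<sigma>'_left[OF S] aut_in[OF X_irr \<sigma> S] by (simp add: compose_def)
      then show "\<gamma> S = \<delta> S" using aut_inj[OF X_irr \<sigma> aut_in[OF X_irr a(1) S] aut_in[OF X_irr a(2) S]] by blast
    qed
  qed
  show "?c ` {\<gamma> \<in> galois_point_group X \<phi> p. \<gamma> P = R} \<subseteq> {\<gamma> \<in> galois_point_group X \<phi> (\<alpha> p). \<gamma> (\<sigma> P) = \<sigma> R}"
    using conjugate[OF p] \<sigma>'_left[OF P] aut_in[OF X_irr \<sigma> P] by (auto simp: compose_def)
qed (use fin in simp)

theorem card_conjugate:
  assumes p: "inner_galois_point C p" "q \<noteq> p"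
    and fin: "finite (galois_point_group X \<phi> p)" "finite (galois_point_group X \<phi> (\<alpha> p))"
    and P: "P \<in> X" and R: "R \<in> X"
  shows "card {\<gamma> \<in> galois_point_group X \<phi> (\<alpha> p). \<gamma> (\<sigma> P) = \<sigma> R} = card {\<gamma> \<in> galois_point_group X \<phi> p. \<gamma> P = R}"
proof (rule antisym[OF _ card_conjugate_le[OF p fin(2) P]])
  have "\<alpha> q \<noteq> \<alpha> p" using p(2) by (metis inverse_maps(2))
  from linear_symmetry.card_conjugate_le[OF inverse_symmetry inner_galois_image[OF p] this _ aut_in[OF X_irr \<sigma> P], of "\<sigma> R"]
  show "card {\<gamma> \<in> galois_point_group X \<phi> (\<alpha> p). \<gamma> (\<sigma> P) = \<sigma> R} \<le> card {\<gamma> \<in> galois_point_group X \<phi> p. \<gamma> P = R}"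
    using fin(1) by (simp only: inverse_maps \<sigma>'_left[OF P] \<sigma>'_left[OF R])
qed

end

subsection \<open>Galois divisors and extension of automorphisms\<close>

lemma lookup_galois_divisor:
  assumes "finite (galois_point_group X \<phi> (\<phi> P))"
  shows "Poly_Mapping.lookup (galois_divisor X \<phi> P) R =
    (if P = R then 1 else 0) + int (card {\<gamma> \<in> galois_point_group X \<phi> (\<phi> P). \<gamma> P = R})"
proof -
  have *: "(\<Sum>\<gamma>\<in>galois_point_group X \<phi> (\<phi> P). if \<gamma> P = R then 1 else 0) =
      int (card {\<gamma> \<in> galois_point_group X \<phi> (\<phi> P). \<gamma> P = R})"
    using assms by (simp add: sum.If_cases Int_def)
  show ?thesis
    by (simp only: galois_divisor_def lookup_add lookup_sum lookup_single when_def *)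
qed

context plane_model
begin

lemma galois_pairI:
  assumes "P \<in> X" "Q \<in> X" "\<phi> P \<noteq> \<phi> Q" "inner_galois_point C (\<phi> P)" "inner_galois_point C (\<phi> Q)"
  obtains e3 l1 l2 l3 where "galois_pair X \<phi> d F (hc P) (hc Q) e3 l1 l2 l3 P Q"
proof -
  have "hc Q \<notin> vec.span {hc P}" using rep_proj_notin_span assms(3) by auto
  then obtain e3 l1 l2 l3 where "frame (hc P) (hc Q) e3 l1 l2 l3"
    by (rule frame_complete[OF rep_proj_nonzero]) (rule that)
  then show ?thesis
    using that assms plane_model_axioms by (simp add: galois_pair_def galois_pair_axioms_def abs_rep_proj)
qed

lemma finite_galois_point_group:
  assumes "P \<in> X" "Q \<in> X" "\<phi> P \<noteq> \<phi> Q" "inner_galois_point C (\<phi> P)" "inner_galois_point C (\<phi> Q)"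
  shows "finite (galois_point_group X \<phi> (\<phi> Q))"
proof -
  obtain e3 l1 l2 l3 where "galois_pair X \<phi> d F (hc P) (hc Q) e3 l1 l2 l3 P Q"
    by (rule galois_pairI[OF assms]) (rule that)
  then interpret galois_pair X \<phi> d F "hc P" "hc Q" e3 l1 l2 l3 P Q .
  show ?thesis using finite_G by (simp add: G_def abs_rep_proj)
qed

lemma keys_galois_divisor:
  assumes "P \<in> X" "finite (galois_point_group X \<phi> (\<phi> P))"
  shows "Poly_Mapping.keys (galois_divisor X \<phi> P) \<subseteq> X"
proof
  fix R assume "R \<in> Poly_Mapping.keys (galois_divisor X \<phi> P)"
  then have ne: "Poly_Mapping.lookup (galois_divisor X \<phi> P) R \<noteq> 0" by (simp add: in_keys_iff)
  show "R \<in> X"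
  proof (cases "P = R")
    case False
    then have "card {\<gamma> \<in> galois_point_group X \<phi> (\<phi> P). \<gamma> P = R} \<noteq> 0"
      using ne by (simp only: lookup_galois_divisor[OF assms(2)] if_False add_0 of_nat_eq_0_iff not_False_eq_True)
    then have "{\<gamma> \<in> galois_point_group X \<phi> (\<phi> P). \<gamma> P = R} \<noteq> {}" by (metis card.empty)
    then obtain \<gamma> where "\<gamma> \<in> curve_aut X" "\<gamma> P = R" by (auto simp: galois_point_group_def)
    then show ?thesis using aut_in[OF X_irr _ assms(1)] by blast
  qed (use assms in simp)
qed

text \<open>The additional summands P and \<sigma>(P) correspond under \<sigma> and cancel, so the
  equality of divisors says exactly that the orbit multiplicities match point by point.\<close>

lemma pullback_galois_divisor_iff:
  assumes \<sigma>: "\<sigma> \<in> curve_aut X" and unifs: "\<And>Q. Q \<in> X \<Longrightarrow> \<exists>t. unif X Q t"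
    and P: "P \<in> X" and fin: "finite (galois_point_group X \<phi> (\<phi> P))" "finite (galois_point_group X \<phi> (\<phi> (\<sigma> P)))"
  shows "div_pullback X X \<sigma> (galois_divisor X \<phi> (\<sigma> P)) = galois_divisor X \<phi> P \<longleftrightarrow>
    (\<forall>R\<in>X. card {\<gamma> \<in> galois_point_group X \<phi> (\<phi> (\<sigma> P)). \<gamma> (\<sigma> P) = \<sigma> R} = card {\<tau> \<in> galois_point_group X \<phi> (\<phi> P). \<tau> P = R})"
    (is "?l = ?r \<longleftrightarrow> (\<forall>R\<in>X. ?a R = ?b R)")
proof -
  have sP: "\<sigma> P \<in> X" by (rule aut_in[OF X_irr \<sigma> P])
  have l: "Poly_Mapping.lookup ?l R = (if R \<in> X then (if P = R then 1 else 0) + int (?a R) else 0)" for R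
    using lookup_div_pullback_aut[OF X_irr \<sigma> unifs keys_galois_divisor[OF sP fin(2)], of R]
      aut_inj[OF X_irr \<sigma> P, of R]
    by (simp add: lookup_galois_divisor[OF fin(2)])
  have r: "Poly_Mapping.lookup ?r R = (if R \<in> X then (if P = R then 1 else 0) + int (?b R) else 0)" for R
  proof (cases "R \<in> X")
    case False
    then have "R \<notin> Poly_Mapping.keys ?r" using keys_galois_divisor[OF P fin(1)] by blast
    then show ?thesis using False by (simp add: in_keys_iff)
  qed (simp add: lookup_galois_divisor[OF fin(1)])
  show ?thesis unfolding poly_mapping_eq_iff fun_eq_iff l r by auto
qed

end

context galois_pair
begin

text \<open>Invariance of y under \<sigma>, written with the matrix M, is an equation on the curve
  of degree at most 2 in y. As f has degree d - 1 \<ge> 3 in y, it must hold identically, and its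
  coefficients say that M maps \<open>e1\<close> to a multiple of itself.\<close>

lemma symmetry_fixes_P1:
  assumes \<sigma>: "\<sigma> \<in> galois_point_group X \<phi> (abs_proj e1)" and S: "linear_symmetry X \<phi> d F M N \<sigma>"
  shows "\<sigma> P1 = P1"
proof -
  interpret B: galois_pair X \<phi> d F e2 e1 e3 l2 l1 l3 P2 P1 by (rule swap)
  interpret S: linear_symmetry X \<phi> d F M N \<sigma> by (rule S)
  have sB: "\<sigma> \<in> B.G" using \<sigma> by (simp add: B.G_def)
  let ?m = "\<lambda>l e. dotp l (M *v e)"
  \<comment> \<open>With w = x \<open>e1\<close> + y \<open>e2\<close> + \<open>e3\<close> this is
    \<open>l2\<close>(M w) - y \<open>l3\<close>(M w), sorted by powers of y.\<close>
  define g where "g = [:[:?m l2 e3, ?m l2 e1:], [:?m l2 e2 - ?m l3 e3, - ?m l3 e1:], [:- ?m l3 e2:]:]"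
  have "\<forall>\<^sub>F R in genf X. ev g (xx R) (yy R) = 0"
    using B.G_xx[OF sB] gen_l(3) aut_gen[OF X_irr S.\<sigma> gen_l(3)] eventually_genf_in[OF X_irr]
  proof eventually_elim
    case (elim R)
    let ?w = "xx R *s e1 + yy R *s e2 + e3"
    obtain c where c: "c \<noteq> 0" "hc (\<sigma> R) = c *s (M *v hc R)"
      by (rule S.rep_\<alpha>[of "\<phi> R"]) (use S.commutes[OF elim(4)] that in simp)
    have w: "hc R = dotp l3 (hc R) *s ?w" by (rule rep_affine[OF elim(2)])
    have Mw: "hc (\<sigma> R) = (c * dotp l3 (hc R)) *s (M *v ?w)"
      unfolding c(2) by (subst w) (simp only: vec.scale vector_smult_assoc)
    have "yy (\<sigma> R) = yy R" using elim(1) by (simp add: B.x_def y_def)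
    moreover have "yy (\<sigma> R) = ?m l2 ?w / ?m l3 ?w" "?m l3 ?w \<noteq> 0"
      using elim(3) c(1) elim(2) unfolding y_def Mw by simp_all
    ultimately have "?m l2 ?w = yy R * ?m l3 ?w" by (simp add: field_simps)
    then show ?case by (simp add: g_def matrix_vector_right_distrib vec.scale algebra_simps)
  qed
  from psi_gen[OF this] phi_psi have "\<forall>\<^sub>F Q in genf C. ev g (x Q) (y Q) = 0" by eventually_elim simp
  then have dvd: "f dvd g" by (rule f_dvd_vanishing)
  have "degree g \<le> 2" unfolding g_def by (intro degree_pCons_le[THEN order_trans]) simp
  then have "g = 0" using dvd_imp_degree_le[OF dvd] smooth_frameI(2)[OF frame_axioms P2_smooth] d4 by fastforce
  then have "?m l2 e1 = 0" "?m l3 e1 = 0" by (auto simp: g_def)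
  then have M1: "M *v e1 = ?m l1 e1 *s e1" by (subst expand) simp
  have "M *v e1 \<noteq> 0" by (rule S.M_nonzero[OF e_nonzero(1)])
  then have nz: "?m l1 e1 \<noteq> 0" using M1 by (metis vector_smult_lzero)
  have "\<phi> (\<sigma> P1) = abs_proj (M *v e1)"
    unfolding S.commutes[OF P1(1), symmetric] P1(2)
    by (rule linear_proj_map_abs_proj[OF e_nonzero(1) \<open>M *v e1 \<noteq> 0\<close>])
  also have "\<dots> = \<phi> P1" unfolding P1(2) by (subst M1) (rule abs_proj_scale[OF nz e_nonzero(1)])
  finally show ?thesis using fibre_unique[OF valring_P(1) P1(1) aut_in[OF X_irr S.\<sigma> P1(1)]] by simp
qed

text \<open>In affine coordinates the map (x, y) to (a x + s y + k, y): the linear maps that fix the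
  point \<open>e1\<close> and every line through it.\<close>

definition homology :: "'a \<Rightarrow> 'a \<Rightarrow> 'a \<Rightarrow> 'a ^ 3 ^ 3" where
  "homology a s k = (\<chi> i. e1 $ i *s (a *s l1 + s *s l2 + k *s l3) + e2 $ i *s l2 + e3 $ i *s l3)"

lemma homology_mult:
  "homology a s k *v v = (a * dotp l1 v + s * dotp l2 v + k * dotp l3 v) *s e1 + dotp l2 v *s e2 + dotp l3 v *s e3"
  by (simp add: vec_eq_iff matrix_vector_dotp homology_def algebra_simps)

lemma homology_inverse:
  assumes "a \<noteq> 0"
  shows "homology a s k ** homology (1 / a) (- s / a) (- k / a) = mat 1"
    "homology (1 / a) (- s / a) (- k / a) ** homology a s k = mat 1"
proof -
  have e: "dotp l1 v *s e1 + (dotp l2 v *s e2 + dotp l3 v *s e3) = v" for v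
    using expand[of v, symmetric] by (simp only: add.assoc)
  show "homology a s k ** homology (1 / a) (- s / a) (- k / a) = mat 1"
    using assms by (simp add: matrix_eq matrix_vector_mul_assoc[symmetric] homology_mult field_simps e)
  show "homology (1 / a) (- s / a) (- k / a) ** homology a s k = mat 1"
    using assms by (simp add: matrix_eq matrix_vector_mul_assoc[symmetric] homology_mult field_simps e)
qed

text \<open>The leading coefficients of \<open>f\<close> in the frames of \<open>P\<^sub>2\<close> and \<open>P\<^sub>3\<close> have, by the equality of
  divisors, zeros corresponding under \<open>\<sigma>\<close>, so their quotient is constant and \<open>\<sigma>\<close> is affine.\<close>

lemma linear_extension_exists:
  assumes \<sigma>: "\<sigma> \<in> galois_point_group X \<phi> (abs_proj e1)" and fixed_P1: "\<sigma> P1 = P1"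
    and P3: "inner_galois_point C (\<phi> (\<sigma> P2))"
    and cards: "\<And>R. R \<in> X \<Longrightarrow> card {\<gamma> \<in> galois_point_group X \<phi> (\<phi> (\<sigma> P2)). \<gamma> (\<sigma> P2) = \<sigma> R} = card {\<tau> \<in> G. \<tau> P2 = R}"
  shows "\<exists>\<alpha>\<in>PGL. \<alpha> ` C = C \<and> (\<forall>R\<in>X. \<alpha> (\<phi> R) = \<phi> (\<sigma> R))"
proof -
  interpret B: galois_pair X \<phi> d F e2 e1 e3 l2 l1 l3 P2 P1 by (rule swap)
  have sB: "\<sigma> \<in> B.G" using \<sigma> by (simp add: B.G_def)
  have sa: "\<sigma> \<in> curve_aut X" by (rule B.G_aut[OF sB])
  have Byy: "B.xx R = yy R" for R by (simp add: B.x_def y_def)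
  have ys: "\<forall>\<^sub>F R in genf X. yy (\<sigma> R) = yy R" using B.G_xx[OF sB] by (simp add: Byy)
  define P3 where "P3 = \<sigma> P2"
  have P3X: "P3 \<in> X" unfolding P3_def by (rule aut_in[OF X_irr sa P2(1)])
  have P31: "P3 \<noteq> P1" using aut_inj[OF X_irr sa P2(1) P1(1)] fixed_P1 phi_neq by (auto simp: P3_def)
  \<comment> \<open>As y is invariant under \<sigma> and has a pole at \<open>P2\<close>, it has one
    at \<open>P3\<close>; so the images of all three points are collinear.\<close>
  have l3q: "dotp l3 (hc P3) = 0"
    unfolding P3_def by (rule B.pole_l3[OF B.locv_invariant[OF sB B.pole_P1]])
  have l2q: "dotp l2 (hc P3) \<noteq> 0" using eq_P1[OF P3X _ l3q] P31 by blast
  \<comment> \<open>The position of \<open>P3\<close> on the line through the two Galois points.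
    Shearing \<open>e2\<close> by s \<open>e1\<close> gives a frame centred at \<open>P3\<close>
    with the same y and with x replaced by x - s y.\<close>
  define s where "s = dotp l1 (hc P3) / dotp l2 (hc P3)"
  have q: "hc P3 = dotp l2 (hc P3) *s (e2 + s *s e1)"
    by (subst expand) (use l2q in \<open>simp add: l3q s_def vector_smult_assoc add.commute\<close>)
  have fr: "frame e1 (e2 + s *s e1) e3 (l1 - s *s l2) l2 l3"
  proof
    fix v
    show "v = dotp (l1 - s *s l2) v *s e1 + dotp l2 v *s (e2 + s *s e1) + dotp l3 v *s e3"
      by (subst expand[of v]) (simp add: vec_eq_iff algebra_simps)
  qed simp_all
  have e2': "e2 + s *s e1 \<noteq> 0" using frame.dual(5)[OF fr] by (metis dotp_0(1) zero_neq_one)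
  have "abs_proj (hc P3) = abs_proj (e2 + s *s e1)" by (subst q) (rule abs_proj_scale[OF l2q e2'])
  then have phi3: "\<phi> P3 = abs_proj (e2 + s *s e1)" by (simp add: abs_rep_proj)
  interpret A3: galois_pair X \<phi> d F e1 "e2 + s *s e1" e3 "l1 - s *s l2" l2 l3 P1 P3
    using fr plane_model_axioms P1 P3X P3 phi3
    by (simp add: galois_pair_def galois_pair_axioms_def P3_def)
  have x3: "A3.xx R = dotp (l1 - s *s l2) (hc R) / dotp l3 (hc R)" for R by (simp add: A3.x_def)
  define lam where "lam = dotp (grad F e2) e1"
  define mu where "mu = dotp (grad F (e2 + s *s e1)) e1"
  have lm: "lam \<noteq> 0" "mu \<noteq> 0" using transversal A3.transversal by (simp_all add: lam_def mu_def)
  obtain lam0 where L: "lead_coeff f = [:lam0, lam:]" using lead_f by (simp add: lam_def)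
  obtain mu0 where L3: "lead_coeff A3.f = [:mu0, mu:]" using A3.lead_f by (simp add: mu_def)
  define u where "u R = poly (lead_coeff A3.f) (A3.xx (\<sigma> R)) / poly (lead_coeff f) (xx R)" for R
  have xs: "\<forall>\<^sub>F R in genf X. A3.xx (\<sigma> R) \<noteq> 0" by (rule aut_gen[OF X_irr sa A3.gen_xx])
  \<comment> \<open>Where x at Q and the sheared coordinate at \<sigma>(Q) are both finite, the
    orders of the two leading coefficients are orbit counts, equal by hypothesis. Elsewhere Q lies
    on the line at infinity and the linear polynomials are compared by their growth.\<close>
  have reg: "\<exists>a. locv X Q u a" if Q: "Q \<in> X" for Q
  proof (cases "(\<exists>c. locv X Q xx c) \<and> (\<exists>c. locv X (\<sigma> Q) A3.xx c)")
    case True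
    then obtain c c' where c: "locv X Q xx c" "locv X (\<sigma> Q) A3.xx c'" by blast
    have sQ: "\<sigma> Q \<in> X" by (rule aut_in[OF X_irr sa Q])
    obtain t where t: "unif X (\<sigma> Q) t" using unif_X_exists[OF sQ] by blast
    have ts: "unif X Q (\<lambda>R. t (\<sigma> R))" by (rule aut_unif[OF X_irr sa Q t])
    obtain v a where v: "locv X Q v a" "a \<noteq> 0"
      "\<forall>\<^sub>F R in genf X. poly (lead_coeff f) (xx R) = v R * t (\<sigma> R) ^ card {\<tau> \<in> G. \<tau> Q = P2}"
      by (rule lead_coeff_order[OF c(1) ts]) (rule that)
    obtain v' a' where v': "locv X (\<sigma> Q) v' a'" "a' \<noteq> 0"
      "\<forall>\<^sub>F R in genf X. poly (lead_coeff A3.f) (A3.xx R) = v' R * t R ^ card {\<tau> \<in> A3.G. \<tau> (\<sigma> Q) = P3}"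
      by (rule A3.lead_coeff_order[OF c(2) t]) (rule that)
    \<comment> \<open>The hypothesis counts maps starting at \<open>P2\<close> and
      \<open>P3\<close>, the orders count maps ending there.\<close>
    have n: "card {\<tau> \<in> A3.G. \<tau> (\<sigma> Q) = P3} = card {\<tau> \<in> G. \<tau> Q = P2}"
      using cards[OF Q] A3.card_transporter_swap[OF sQ P3X] card_transporter_swap[OF Q P2(1)]
      by (simp add: A3.G_def phi3[symmetric] P3_def)
    have "\<forall>\<^sub>F R in genf X. t (\<sigma> R) \<noteq> 0" using ts by (simp add: unif_def)
    with v(3) aut_gen[OF X_irr sa v'(3)] have "\<forall>\<^sub>F R in genf X. v' (\<sigma> R) / v R = u R"
      by eventually_elim (simp add: u_def n)
    from locv_cong[OF locv_divide[OF X_irr aut_locv[OF X_irr sa Q v'(1)] v(1,2)] this] show ?thesis by blast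
  next
    case False
    have P2f: "(\<exists>c. locv X P2 xx c) \<and> (\<exists>c. locv X (\<sigma> P2) A3.xx c)"
      using finite_P2 A3.finite_P2 by (simp add: P3_def)
    then have QP2: "Q \<noteq> P2" using False by blast
    have sQ: "\<sigma> Q \<in> X" "\<sigma> Q \<noteq> P3"
      using aut_in[OF X_irr sa Q] aut_inj[OF X_irr sa Q P2(1)] QP2 by (auto simp: P3_def)
    \<comment> \<open>Off the line at infinity y is finite at Q, hence by invariance at \<sigma>(Q)
      as well; as \<sigma>(Q) is not \<open>P1\<close>, both points would be affine and both
      coordinates finite.\<close>
    have l3Q: "dotp l3 (hc Q) = 0"
    proof (rule ccontr)
      assume nz: "dotp l3 (hc Q) \<noteq> 0"
      have "Q \<noteq> P1" using nz hc_P1 by auto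
      then have "\<sigma> Q \<noteq> P1" using aut_inj[OF X_irr sa Q P1(1)] fixed_P1 by simp
      moreover have "locv X Q B.xx (dotp l2 (hc Q) / dotp l3 (hc Q))"
        using locv_lin[OF Q nz, of l2] by (simp add: B.x_def[abs_def])
      from B.locv_invariant[OF sB, of Q "\<lambda>a. a", OF this]
      have "locv X (\<sigma> Q) B.xx (dotp l2 (hc Q) / dotp l3 (hc Q))" .
      ultimately have "dotp l3 (hc (\<sigma> Q)) \<noteq> 0" using B.finite_l3 by blast
      then show False
        using False locv_lin[OF Q nz, of l1] locv_lin[OF sQ(1), of l3 "l1 - s *s l2"]
        by (auto simp: x_def[abs_def] A3.x_def[abs_def])
    qed
    \<comment> \<open>At \<open>P1\<close> both inverse coordinates are uniformizers, so their
      quotient is a unit. At other points y\<circ>\<sigma> = y eliminates \<open>l3\<close> from the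
      quotient, leaving ratios of linear forms with nonzero denominators.\<close>
    have ratio: "\<exists>b. locv X Q (\<lambda>R. A3.xx (\<sigma> R) / xx R) b \<and> dotp l3 (hc (\<sigma> Q)) = 0"
    proof (cases "Q = P1")
      case True
      have "unif X (\<sigma> P1) (\<lambda>R. 1 / A3.xx R)" using A3.unif_pole_P1 by (simp add: fixed_P1)
      from aut_unif[OF X_irr sa P1(1) this] obtain v b where v: "locv X P1 v b"
        "\<forall>\<^sub>F R in genf X. 1 / xx R = v R * (1 / A3.xx (\<sigma> R))"
        by (rule unif_quotient[OF X_irr _ unif_pole_P1]) (rule that)
      have "\<forall>\<^sub>F R in genf X. v R = A3.xx (\<sigma> R) / xx R"
        using v(2) xs gen_xx by eventually_elim (simp add: field_simps)
      from locv_cong[OF v(1) this] show ?thesis using True fixed_P1 hc_P1 by auto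
    next
      case QP1: False
      have "dotp l3 (hc (\<sigma> Q)) = 0"
        by (rule B.pole_l3[OF B.locv_invariant[OF sB B.l3_pole[OF Q QP1 l3Q]]])
      moreover have "\<sigma> Q \<noteq> P1" using aut_inj[OF X_irr sa Q P1(1)] fixed_P1 QP1 by simp
      ultimately have l2: "dotp l2 (hc (\<sigma> Q)) \<noteq> 0" and l3: "dotp l3 (hc (\<sigma> Q)) = 0"
        using eq_P1[OF sQ(1)] by auto
      have l1: "dotp l1 (hc Q) \<noteq> 0" using eq_P2[OF Q _ l3Q] QP2 by blast
      have "\<forall>\<^sub>F R in genf X. dotp (l1 - s *s l2) (hc (\<sigma> R)) / dotp l2 (hc (\<sigma> R)) * (dotp l2 (hc R) / dotp l1 (hc R)) =
          A3.xx (\<sigma> R) / xx R"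
        using ys gen_l(1,2) gen_l(3) aut_gen[OF X_irr sa gen_l(2)] aut_gen[OF X_irr sa gen_l(3)]
      proof eventually_elim
        case (elim R)
        then have "dotp l3 (hc (\<sigma> R)) = dotp l2 (hc (\<sigma> R)) * dotp l3 (hc R) / dotp l2 (hc R)"
          by (simp add: y_def field_simps)
        then show ?case using elim by (simp add: x3 x_def)
      qed
      from locv_cong[OF locv_mult[OF X_irr aut_locv[OF X_irr sa Q locv_lin[OF sQ(1) l2]] locv_lin[OF Q l1]] this]
      show ?thesis using l3 by blast
    qed
    then obtain b where b: "locv X Q (\<lambda>R. A3.xx (\<sigma> R) / xx R) b" and l3s: "dotp l3 (hc (\<sigma> Q)) = 0" by blast
    have p3: "locv X Q (\<lambda>R. 1 / A3.xx (\<sigma> R)) 0" by (rule aut_locv[OF X_irr sa Q A3.l3_pole[OF sQ l3s]])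
    \<comment> \<open>Each leading coefficient is divided by its own coordinate. At the common pole
      only the slopes lam and mu remain, and lam is nonzero by transversality.\<close>
    have "locv X Q (\<lambda>R. (mu0 * (1 / A3.xx (\<sigma> R)) + mu) / (lam0 * (1 / xx R) + lam) * (A3.xx (\<sigma> R) / xx R))
        ((mu0 * 0 + mu) / (lam0 * 0 + lam) * b)"
      using lm by (intro locv_mult locv_divide locv_add locv_const X_irr Q p3 b l3_pole QP2 l3Q) auto
    moreover have "\<forall>\<^sub>F R in genf X.
        (mu0 * (1 / A3.xx (\<sigma> R)) + mu) / (lam0 * (1 / xx R) + lam) * (A3.xx (\<sigma> R) / xx R) = u R"
      using xs gen_xx
    proof eventually_elim
      case (elim R)
      have "(mu0 * (1 / A3.xx (\<sigma> R)) + mu) * A3.xx (\<sigma> R) = poly (lead_coeff A3.f) (A3.xx (\<sigma> R))"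
        "(lam0 * (1 / xx R) + lam) * xx R = poly (lead_coeff f) (xx R)"
        using elim unfolding L L3 by (simp_all add: algebra_simps)
      then show ?case unfolding u_def by (simp only: times_divide_times_eq)
    qed
    ultimately have "locv X Q u ((mu0 * 0 + mu) / (lam0 * 0 + lam) * b)" by (rule locv_cong)
    then show ?thesis ..
  qed
  obtain c where c: "\<forall>\<^sub>F R in genf X. u R = c" by (rule regular_constant[of u, OF reg]) (assumption, rule that)
  have nzL: "\<forall>\<^sub>F R in genf X. poly (lead_coeff f) (xx R) \<noteq> 0"
    by (rule phi_gen[OF gen_poly_x_nonzero]) (use L lm in simp)
  have nzL3: "\<forall>\<^sub>F R in genf X. poly (lead_coeff A3.f) (A3.xx (\<sigma> R)) \<noteq> 0"
    by (rule aut_gen[OF X_irr sa phi_gen[OF A3.gen_poly_x_nonzero]]) (use L3 lm in simp)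
  have "\<forall>\<^sub>F R in genf X. c \<noteq> 0" using c nzL nzL3 by eventually_elim (auto simp: u_def)
  then have c0: "c \<noteq> 0" using eventually_genf_ex[OF X_irr] by blast
  \<comment> \<open>Obtained by solving mu0 + mu x3\<circ>\<sigma> = c (lam0 + lam x) for
    x\<circ>\<sigma>, where x3 = x - s y and y\<circ>\<sigma> = y.\<close>
  define a k where "a = c * lam / mu" and "k = (c * lam0 - mu0) / mu"
  have a0: "a \<noteq> 0" using c0 lm by (simp add: a_def)
  let ?M = "homology a s k"
  have inv: "invertible ?M" using homology_inverse[OF a0] unfolding invertible_def by blast
  have Mnz: "?M *v v \<noteq> 0" if "v \<noteq> 0" for v using invertible_mult_eq_0[OF inv] that by simp
  have gen: "\<forall>\<^sub>F R in genf X. linear_proj_map ?M (\<phi> R) = \<phi> (\<sigma> R)"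
    using c nzL ys gen_l(3) aut_gen[OF X_irr sa gen_l(3)]
  proof eventually_elim
    case (elim R)
    have "mu * (a * xx R + k) = c * lam * xx R + (c * lam0 - mu0)"
      using lm by (simp add: a_def k_def distrib_left)
    moreover have "mu0 + mu * A3.xx (\<sigma> R) = c * (lam0 + lam * xx R)"
      using elim(1,2) unfolding u_def L L3 by (simp add: field_simps)
    ultimately have "mu0 + mu * A3.xx (\<sigma> R) = mu0 + mu * (a * xx R + k)" by (simp add: algebra_simps)
    then have "mu * A3.xx (\<sigma> R) = mu * (a * xx R + k)" unfolding add_left_cancel .
    then have "A3.xx (\<sigma> R) = a * xx R + k" using lm by simp
    moreover have "A3.xx (\<sigma> R) = xx (\<sigma> R) - s * yy (\<sigma> R)" by (simp add: x3 x_def y_def diff_divide_distrib)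
    ultimately have xs: "xx (\<sigma> R) = a * xx R + s * yy R + k" using elim(3) by (simp add: algebra_simps)
    let ?w = "xx (\<sigma> R) *s e1 + yy (\<sigma> R) *s e2 + e3"
    have "?M *v hc R = dotp l3 (hc R) *s ?w"
      by (subst rep_affine[OF elim(4)])
        (simp add: homology_mult xs elim(3) vec_eq_iff algebra_simps)
    then have "linear_proj_map ?M (\<phi> R) = abs_proj ?w"
      unfolding linear_proj_map_def using abs_proj_scale[OF elim(4) affine_nonzero] by simp
    moreover have "abs_proj (hc (\<sigma> R)) = abs_proj ?w"
      by (subst rep_affine[OF elim(5)]) (rule abs_proj_scale[OF elim(5) affine_nonzero])
    ultimately show ?case by (simp add: abs_rep_proj)
  qed
  have m: "morphism UNIV UNIV (linear_proj_map ?M)" by (rule linear_proj_map_morphism) (rule Mnz[OF rep_proj_nonzero])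
  \<comment> \<open>Both sides are morphisms on X, so the generic identity holds at every point,
    including those on the line at infinity.\<close>
  have eq: "linear_proj_map ?M (\<phi> R) = \<phi> (\<sigma> R)" if "R \<in> X" for R
    by (rule morphism_eqI[OF X_irr morphism_compose[OF mor m] morphism_compose[OF aut_morphism[OF X_irr sa] mor] gen that])
  have "linear_proj_map ?M ` C = \<phi> ` (\<sigma> ` X)" by (simp add: image_image eq)
  also have "\<sigma> ` X = X" using aut_bij[OF X_irr sa] by (simp add: bij_betw_def)
  finally have "linear_proj_map ?M ` C = C" .
  then show ?thesis using inv eq unfolding PGL_def by blast
qed

end

theorem proposition2:
  fixes X :: "('a::alg_closed_field, 'n::finite) proj set"
    and \<phi> :: "('a, 'n) proj \<Rightarrow> ('a, 3) proj"
    and \<sigma> :: "('a, 'n) proj \<Rightarrow> ('a, 'n) proj"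
    and P1 P2 P3 :: "('a, 'n) proj"
    and d :: nat
  assumes "smooth_projective_curve X"
    and "morphism X UNIV \<phi>"
    and "birational_onto_image X \<phi>"
    and "plane_curve_of_degree (\<phi> ` X) d" and "d \<ge> 4"
    and "P1 \<in> X" and "P2 \<in> X"
    and "\<phi> P1 \<noteq> \<phi> P2"
    and "inner_galois_point (\<phi> ` X) (\<phi> P1)"
    and "inner_galois_point (\<phi> ` X) (\<phi> P2)"
    and "\<sigma> \<in> galois_point_group X \<phi> (\<phi> P1)"
    and "P3 = \<sigma> P2"
  shows "(\<exists>\<sigma>'\<in>PGL. \<sigma>' ` (\<phi> ` X) = \<phi> ` X \<and> (\<forall>x\<in>X. \<sigma>' (\<phi> x) = \<phi> (\<sigma> x))) \<longleftrightarrow>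
    \<sigma> P1 = P1 \<and>
    inner_galois_point (\<phi> ` X) (\<phi> P3) \<and>
    div_pullback X X \<sigma> (galois_divisor X \<phi> P3) = galois_divisor X \<phi> P2"
    (is "?lin \<longleftrightarrow> ?cond")
proof -
  obtain F where F: "Factorial_Ring.irreducible F" "is_form d F" "\<phi> ` X = {x. form_at F x = 0}"
    using assms(4) unfolding plane_curve_of_degree_def by blast
  interpret plane_model X \<phi> d F
    by unfold_locales (use assms F in auto)
  obtain e3 l1 l2 l3 where "galois_pair X \<phi> d F (hc P1) (hc P2) e3 l1 l2 l3 P1 P2"
    by (rule galois_pairI[OF assms(6-10)]) (rule that)
  then interpret galois_pair X \<phi> d F "hc P1" "hc P2" e3 l1 l2 l3 P1 P2 .
  have \<sigma>: "\<sigma> \<in> galois_point_group X \<phi> (abs_proj (hc P1))" using assms(11) by (simp add: abs_rep_proj)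
  have sa: "\<sigma> \<in> curve_aut X" using assms(11) by (simp add: galois_point_group_def)
  have G: "G = galois_point_group X \<phi> (\<phi> P2)" by (simp add: G_def abs_rep_proj)
  have P3X: "P3 \<in> X" using aut_in[OF X_irr sa assms(7)] assms(12) by simp
  have divisors: "div_pullback X X \<sigma> (galois_divisor X \<phi> P3) = galois_divisor X \<phi> P2 \<longleftrightarrow>
      (\<forall>R\<in>X. card {\<gamma> \<in> galois_point_group X \<phi> (\<phi> P3). \<gamma> P3 = \<sigma> R} = card {\<tau> \<in> G. \<tau> P2 = R})"
    and fin3: "finite (galois_point_group X \<phi> (\<phi> P3))"
    if "\<sigma> P1 = P1" "inner_galois_point C (\<phi> P3)"
  proof -
    \<comment> \<open>Since \<sigma> fixes \<open>P1\<close>, the points \<open>P1\<close> and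
      \<open>P3\<close> form a pair of distinct Galois points. This makes the group of
      \<open>P3\<close> finite, without which the sum in its divisor would not count the
      orbit.\<close>
    have "P3 \<noteq> P1" using aut_inj[OF X_irr sa assms(7,6)] that(1) assms(8,12) by auto
    then have "\<phi> P1 \<noteq> \<phi> P3" using fibre_unique[OF valring_P(1) assms(6) P3X] by auto
    then show fin3: "finite (galois_point_group X \<phi> (\<phi> P3))"
      by (rule finite_galois_point_group[OF assms(6) P3X _ assms(9) that(2)])
    show "div_pullback X X \<sigma> (galois_divisor X \<phi> P3) = galois_divisor X \<phi> P2 \<longleftrightarrow>
        (\<forall>R\<in>X. card {\<gamma> \<in> galois_point_group X \<phi> (\<phi> P3). \<gamma> P3 = \<sigma> R} = card {\<tau> \<in> G. \<tau> P2 = R})"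
      using pullback_galois_divisor_iff[OF sa unif_X_exists assms(7)] finite_G fin3 unfolding G assms(12) by blast
  qed
  show ?thesis
  proof
    assume ?lin
    then obtain M where M: "invertible M" "linear_proj_map M ` C = C" "\<And>R. R \<in> X \<Longrightarrow> linear_proj_map M (\<phi> R) = \<phi> (\<sigma> R)"
      unfolding PGL_def by blast
    then obtain N where "M ** N = mat 1" "N ** M = mat 1" by (auto simp: invertible_def)
    then interpret S: linear_symmetry X \<phi> d F M N \<sigma>
      by unfold_locales (use M sa in auto)
    have a: "\<sigma> P1 = P1" by (rule symmetry_fixes_P1[OF \<sigma> S.linear_symmetry_axioms])
    have eq: "S.\<alpha> (\<phi> P2) = \<phi> P3" using M(3)[OF assms(7)] assms(12) by simp
    have b: "inner_galois_point C (\<phi> P3)" using S.inner_galois_image[OF assms(10,8)] unfolding eq .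
    have "card {\<gamma> \<in> galois_point_group X \<phi> (\<phi> P3). \<gamma> P3 = \<sigma> R} = card {\<tau> \<in> G. \<tau> P2 = R}" if "R \<in> X" for R
      using S.card_conjugate[OF assms(10,8) _ _ assms(7) that] finite_G fin3[OF a b]
      unfolding eq G assms(12)[symmetric] by blast
    then show ?cond using a b divisors[OF a b] by blast
  next
    assume c: ?cond
    then have "card {\<gamma> \<in> galois_point_group X \<phi> (\<phi> (\<sigma> P2)). \<gamma> (\<sigma> P2) = \<sigma> R} = card {\<tau> \<in> G. \<tau> P2 = R}" if "R \<in> X" for R
      using divisors that unfolding assms(12) by blast
    then show ?lin using linear_extension_exists[OF \<sigma>] c unfolding assms(12) by blast
  qed
qed

end
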